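(* Let $\varepsilon>0$ and $\delta>0$ satisfy \[ 2\varepsilon T\sqrt d\{1+T\sqrt d(1+\varepsilon)\}e^{T(\sqrt d+2\varepsilon+\varepsilon^2)}<1,\qquad \varepsilon T\{1+T\sqrt d K_0(1+\varepsilon)e^{T(\sqrt d+2\varepsilon+\varepsilon^2)}\}<1, \] \[ \delta T\,(2\sqrt d\vee K_0)\{1+T(\sqrt d+\delta)e^{T(\sqrt d+\delta)}\}<1 . \] (i) Let $\sigma\in C([0,T];\mathbb R^{d\times d})$ with $\|\sigma\|_\infty<\varepsilon$. Then (a) there exists $S\in C^1([0,T];\mathbb R^{d\times d})$ solving $S'=-S^2-\sigma^\dagger S-S\sigma-\sigma^\dagger\sigma$, $S(T)=0$; (b) $\chi=S+\sigma$ satisfies $T\|\chi\|_\infty<1$ and $\sigma(t)=\chi(t)-\int_t^T\chi(u)^\dagger\chi(u)du$ for $t\in[0,T]$, $(\iota+F_\chi)^{-1}$ exists as a continuous linear operator on $\mathcal W$, and \[ \int_{\mathcal W}e^{\mathfrak p_\sigma}f\,d\mu=e^{\frac12\int_0^T\mathrm{tr}\,S(t)\,dt}\int_{\mathcal W}f\circ(\iota+F_\chi)^{-1}d\mu,\qquad f\in C_b(\mathcal W). \] (ii) Let $\sigma\in C^1([0,T];\mathbb R^{d\times d})$ with $|\sigma(T)|+\|\sigma'\|_\infty+2\|\sigma_A\|_\infty<\delta$. Then (a) the solution $A\in C^2([0,T];\mathbb R^{d\times d})$ of $A''-2\sigma_AA'-\sigma'A=0$, $A(T)=I_d$, $A'(T)=\sigma(T)$,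 satisfies $\det A(t)\ne0$ for all $t\in[0,T]$; (b) $\chi=A'A^{-1}$ satisfies $T\|\chi\|_\infty<1$ and $\sigma(t)=\chi(t)-\int_t^T\chi(u)^\dagger\chi(u)du$ for $t\in[0,T]$, $(\iota+F_\chi)^{-1}$ exists as a continuous linear operator on $\mathcal W$, and \[ \int_{\mathcal W}e^{\mathfrak p_\sigma}f\,d\mu=\frac{e^{-\frac12\int_0^T\mathrm{tr}\,\sigma_S(t)\,dt}}{\sqrt{\det A(0)}}\int_{\mathcal W}f\circ(\iota+F_\chi)^{-1}d\mu,\qquad f\in C_b(\mathcal W). \]
   Context: Standing setting: $T>0$, $d\in\mathbb N$. $\mathcal W$ is the Banach space (sup norm) of continuous $w:[0,T]\to\mathbb R^d$ with $w(0)=0$, $\mu$ the Wiener measure, $\theta(t)(w)=w(t)$ the coordinate process, $d\theta$ Itô integration; $\iota$ is the identity of $\mathcal W$ and $C_b(\mathcal W)$ the bounded continuous real functions on $\mathcal W$. $|M|$ is the Frobenius norm and $M^\dagger$ the transpose of $M\in\mathbb R^{d\times d}$; $\|\sigma\|_\infty=\sup_t|\sigma(t)|$; $I_d$ is the identity matrix; $a\vee b=\max\{a,b\}$; $'$ is differentiation in $t$; $\sigma_A=\frac12(\sigma-\sigma^\dagger)$, $\sigma_S=\frac12(\sigma+\sigma^\dagger)$; $K_0=\sup\{|M^{-1}|: M\in\mathbb R^{d\times d},\ |M-I_d|<\frac12\}$. For $\chi,\sigma\in C([0,T];\mathbb R^{d\times d})$: $[F_\chi(w)](t)=-\int_0^t\chi(s)w(s)ds$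 and $\mathfrak p_\sigma=\int_0^T\langle\sigma(t)\theta(t),d\theta(t)\rangle$. *)

theory Defs
  imports "HOL-Analysis.Analysis" "HOL-Probability.Probability"
begin

text \<open>Sup norm over [0,T] (Frobenius norm for matrices, Euclidean norm for vectors).\<close>
definition supn :: "real \<Rightarrow> (real \<Rightarrow> 'a::real_normed_vector) \<Rightarrow> real" where
  "supn T f = (SUP t\<in>{0..T}. norm (f t))"

definition Wsp :: "real \<Rightarrow> (real \<Rightarrow> real^'d::finite) set" where
  "Wsp T = {w. continuous_on {0..T} w \<and> w 0 = 0 \<and> (\<forall>t. t \<notin> {0..T} \<longrightarrow> w t = 0)}"

definition Wopen :: "real \<Rightarrow> (real \<Rightarrow> real^'d::finite) set set" where
  "Wopen T = {U. U \<subseteq> Wsp T \<and> (\<forall>w\<in>U. \<exists>r>0. \<forall>v\<in>Wsp T. supn T (\<lambda>t. v t - w t) < r \<longrightarrow> v \<in> U)}"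

definition Wborel :: "real \<Rightarrow> (real \<Rightarrow> real^'d::finite) set set" where
  "Wborel T = sigma_sets (Wsp T) (Wopen T)"

text \<open>Wiener measure: the probability measure on (W, Borel) whose finite dimensional
  characteristic functions are those of d-dimensional Brownian motion.\<close>
definition is_wiener :: "real \<Rightarrow> (real \<Rightarrow> real^'d::finite) measure \<Rightarrow> bool" where
  "is_wiener T M \<longleftrightarrow> space M = Wsp T \<and> sets M = Wborel T \<and> prob_space M \<and>
     (\<forall>(n::nat) (ts::nat \<Rightarrow> real) (xs::nat \<Rightarrow> real^'d). (\<forall>j<n. ts j \<in> {0..T}) \<longrightarrow>
        integral\<^sup>L M (\<lambda>w. cis (\<Sum>j<n. xs j \<bullet> w (ts j)))
        = complex_of_real (exp (- (1/2) * (\<Sum>i<n. \<Sum>j<n. min (ts i) (ts j) * (xs i \<bullet> xs j)))))"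

definition wiener :: "real \<Rightarrow> (real \<Rightarrow> real^'d::finite) measure" where
  "wiener T = (THE M. is_wiener T M)"

definition ito_sum :: "real \<Rightarrow> (real \<Rightarrow> real^'d^'d) \<Rightarrow> nat \<Rightarrow> (real \<Rightarrow> real^'d::finite) \<Rightarrow> real" where
  "ito_sum T \<sigma> n w = (\<Sum>k<n. (\<sigma> (real k * T / real n) *v w (real k * T / real n))
       \<bullet> (w (real (Suc k) * T / real n) - w (real k * T / real n)))"

definition ito_p :: "real \<Rightarrow> (real \<Rightarrow> real^'d^'d) \<Rightarrow> (real \<Rightarrow> real^'d::finite) \<Rightarrow> real" where
  "ito_p T \<sigma> = (SOME p. p \<in> borel_measurable (wiener T) \<and>
      (\<forall>e>0. (\<lambda>n. measure (wiener T) {w \<in> space (wiener T). \<bar>ito_sum T \<sigma> n w - p w\<bar> > e})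
             \<longlonglongrightarrow> 0))"

definition Fop :: "real \<Rightarrow> (real \<Rightarrow> real^'d^'d) \<Rightarrow> (real \<Rightarrow> real^'d::finite) \<Rightarrow> (real \<Rightarrow> real^'d)" where
  "Fop T chi w = (\<lambda>t. if t \<in> {0..T} then - integral {0..t} (\<lambda>s. chi s *v w s) else 0)"

definition cont_lin_inverse :: "real \<Rightarrow> (real \<Rightarrow> real^'d^'d) \<Rightarrow>
    ((real \<Rightarrow> real^'d::finite) \<Rightarrow> (real \<Rightarrow> real^'d)) \<Rightarrow> bool" where
  "cont_lin_inverse T chi G \<longleftrightarrow>
     (\<forall>w\<in>Wsp T. G w \<in> Wsp T) \<and>
     (\<forall>v\<in>Wsp T. \<forall>w\<in>Wsp T. \<forall>a b. G (\<lambda>t. a *\<^sub>R v t + b *\<^sub>R w t) = (\<lambda>t. a *\<^sub>R G v t + b *\<^sub>R G w t)) \<and>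
     (\<exists>C. \<forall>w\<in>Wsp T. supn T (G w) \<le> C * supn T w) \<and>
     (\<forall>w\<in>Wsp T. G (\<lambda>t. w t + Fop T chi w t) = w) \<and>
     (\<forall>w\<in>Wsp T. (\<lambda>t. G w t + Fop T chi (G w) t) = w)"

definition Cb :: "real \<Rightarrow> ((real \<Rightarrow> real^'d::finite) \<Rightarrow> real) set" where
  "Cb T = {f. (\<exists>B. \<forall>w\<in>Wsp T. \<bar>f w\<bar> \<le> B) \<and>
      (\<forall>w\<in>Wsp T. \<forall>e>0. \<exists>r>0. \<forall>v\<in>Wsp T. supn T (\<lambda>t. v t - w t) < r \<longrightarrow> \<bar>f v - f w\<bar> < e)}"

definition K0 :: "'d::finite itself \<Rightarrow> real" where
  "K0 _ = (SUP M\<in>{M :: real^'d^'d. norm (M - mat 1) < 1/2}. norm (matrix_inv M))"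

definition C1_with :: "real \<Rightarrow> (real \<Rightarrow> 'a::real_normed_vector) \<Rightarrow> (real \<Rightarrow> 'a) \<Rightarrow> bool" where
  "C1_with T f f' \<longleftrightarrow> continuous_on {0..T} f' \<and>
     (\<forall>t\<in>{0..T}. (f has_vector_derivative f' t) (at t within {0..T}))"

end

theory Submission
  imports Defs
begin

text \<open>
  Put \<open>S = \<chi> - \<sigma>\<close>, so that \<open>S' = - \<chi>\<^sup>\<dagger>\<chi>\<close> and \<open>S(T) = 0\<close>. The process \<open>X = (\<iota> + F\<^sub>\<chi>)\<^sup>-\<^sup>1 w\<close> solves
  \<open>dX = dw + \<chi> X dt\<close>, so by Girsanov its law has density
  \<open>exp (\<integral>\<langle>\<chi>\<theta>, d\<theta>\<rangle> - \<onehalf> \<integral>|\<chi>\<theta>|\<^sup>2 dt)\<close> with respect to Wiener measure, and Ito's formula for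
  \<open>\<langle>S\<theta>, \<theta>\<rangle>\<close> turns the exponent into \<open>\<pp>\<^sub>\<sigma> - \<onehalf> \<integral> tr S dt\<close>.

  Both steps are carried out on the uniform grid with \<open>n\<close> steps. There Girsanov is the triangular
  change of variables of the Euler scheme applied to the independent Gaussian increments, and Ito's
  formula is summation by parts. As \<open>n \<rightarrow> \<infinity>\<close> the Euler scheme converges pathwise because
  \<open>T\<parallel>\<chi>\<parallel> < 1\<close>, and the densities, cut off outside a ball of the path space, are bounded in
  \<open>L\<^sup>2\<close> because \<open>D(\<chi>)\<^sup>2 = D(2\<chi>) exp (h \<Sum>|\<chi> w|\<^sup>2)\<close> and \<open>D(2\<chi>)\<close> has mean one.

  Wiener measure itself is obtained from the Levy--Ciesielski series. In part (i) the Riccati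
  equation is solved by Picard iteration below the scalar majorant; in part (ii) a Gronwall estimate
  keeps \<open>A\<close> near the identity, and \<open>det A(0) = exp (- \<integral> tr \<chi>)\<close> is Liouville's formula.
\<close>

section \<open>Matrices and Volterra equations\<close>

text \<open>Wiener measure is known only through its characteristic function, and
  \<open>ito_p\<close> is just some limit in probability of left-point sums; every probabilistic
  fact is therefore reduced to the exact Gaussian law of finitely many increments. In the limit of
  the discrete identity the image side is dominated, since f is bounded. The density side is not:
  there the \<open>L\<^sup>2\<close> bound supplies uniform integrability, and the radius of the
  ball is removed afterwards by monotone convergence, for f \<ge> 0 and then for f plus a constant.
  Symmetry of S, an integral of Gram matrices, is what lets the summation by parts close up. In part
  (ii) chi = A' A^-1 is never differentiated: the defect D of its integral equation, multiplied by
  A, satisfies (D A)' = D^T A' with D(T) = 0, hence vanishes by Gronwall. As for constants, the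
  first condition on \<epsilon> gives 2 \<epsilon> T < 1, which is what the scalar majorant asks
  for; in the condition on \<delta> the entry 2 sqrt d bounds |A^-1| and the braces come from
  Gronwall's bound for |A'|.\<close>

lemma norm_matrix_vector_mult_le:
  fixes A :: "real^'n^'m"
  shows "norm (A *v x) \<le> norm A * norm x"
proof -
  have "norm (A *v x) = L2_set (\<lambda>i. \<bar>A $ i \<bullet> x\<bar>) UNIV"
    by (simp add: norm_vec_def matrix_vector_mul_component)
  also have "\<dots> \<le> L2_set (\<lambda>i. norm (A $ i) * norm x) UNIV"
    by (intro L2_set_mono) (auto simp: Cauchy_Schwarz_ineq2)
  also have "\<dots> = norm A * norm x"
    by (simp add: norm_vec_def[of A] L2_set_left_distrib)
  finally show ?thesis .
qed

lemma norm_transpose: "norm (transpose A) = norm (A :: real^'n^'m)"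
proof -
  have "(\<Sum>i\<in>UNIV. \<Sum>j\<in>UNIV. transpose A $ i $ j * transpose A $ i $ j)
      = (\<Sum>j\<in>UNIV. \<Sum>i\<in>UNIV. A $ j $ i * A $ j $ i)"
    unfolding transpose_def by (simp, rule sum.swap)
  then show ?thesis
    by (simp add: norm_eq_sqrt_inner inner_vec_def)
qed

lemma norm_matrix_mult_le:
  fixes A :: "real^'n^'m" and B :: "real^'k^'n"
  shows "norm (A ** B) \<le> norm A * norm B"
proof -
  have row: "(A ** B) $ i = transpose B *v (A $ i)" for i
    by (simp add: vec_eq_iff matrix_matrix_mult_def matrix_vector_mult_def transpose_def mult.commute)
  have "norm (A ** B) = L2_set (\<lambda>i. norm (transpose B *v (A $ i))) UNIV"
    by (simp add: norm_vec_def[of "A ** B"] row)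
  also have "\<dots> \<le> L2_set (\<lambda>i. norm (A $ i) * norm B) UNIV"
  proof (rule L2_set_mono)
    fix i show "norm (transpose B *v A $ i) \<le> norm (A $ i) * norm B"
      using norm_matrix_vector_mult_le[of "transpose B" "A $ i"] by (simp add: norm_transpose mult.commute)
  qed auto
  also have "\<dots> = norm A * norm B"
    by (simp add: norm_vec_def[of A] L2_set_left_distrib)
  finally show ?thesis .
qed

lemma bounded_bilinear_matrix_mult:
  "bounded_bilinear ((**) :: real^'n^'m \<Rightarrow> real^'k^'n \<Rightarrow> real^'k^'m)"
proof
  show "\<exists>K. \<forall>(a::real^'n^'m) (b::real^'k^'n). norm (a ** b) \<le> norm a * norm b * K"
    by (rule exI[of _ 1]) (simp add: norm_matrix_mult_le)
qed (simp_all add: vec_eq_iff matrix_matrix_mult_def sum.distrib sum_distrib_left algebra_simps)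

lemma bounded_bilinear_matrix_vector_mult:
  "bounded_bilinear ((*v) :: real^'n^'m \<Rightarrow> real^'n \<Rightarrow> real^'m)"
proof
  show "\<exists>K. \<forall>(a::real^'n^'m) (b::real^'n). norm (a *v b) \<le> norm a * norm b * K"
    by (rule exI[of _ 1]) (simp add: norm_matrix_vector_mult_le)
qed (simp_all add: vec_eq_iff matrix_vector_mult_def sum.distrib sum_distrib_left algebra_simps)

lemma bounded_linear_transpose: "bounded_linear (transpose :: real^'n^'m \<Rightarrow> real^'m^'n)"
proof
  show "\<exists>K. \<forall>x::real^'n^'m. norm (transpose x) \<le> norm x * K"
    by (rule exI[of _ 1]) (simp add: norm_transpose)
qed (simp_all add: vec_eq_iff transpose_def)

lemma bounded_linear_trace: "bounded_linear (trace :: real^'n^'n \<Rightarrow> real)"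
proof -
  have "linear (trace :: real^'n^'n \<Rightarrow> real)"
    by (rule linearI) (simp_all add: trace_def sum.distrib sum_distrib_left)
  then show ?thesis by (rule linear_conv_bounded_linear[THEN iffD1])
qed

lemmas continuous_on_matrix_mult [continuous_intros] =
  bounded_bilinear.continuous_on[OF bounded_bilinear_matrix_mult]
lemmas continuous_on_matrix_vector_mult [continuous_intros] =
  bounded_bilinear.continuous_on[OF bounded_bilinear_matrix_vector_mult]
lemmas continuous_on_transpose [continuous_intros] =
  bounded_linear.continuous_on[OF bounded_linear_transpose]
lemmas continuous_on_trace [continuous_intros] =
  bounded_linear.continuous_on[OF bounded_linear_trace]

lemma norm_mat_1: "norm (mat 1 :: real^'n^'n) = sqrt (real CARD('n))"
proof -
  have "(\<Sum>i\<in>UNIV. \<Sum>j\<in>UNIV. (mat 1 :: real^'n^'n) $ i $ j * (mat 1 :: real^'n^'n) $ i $ j) = (\<Sum>i::'n\<in>UNIV. 1)"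
    by (rule sum.cong) (auto simp: mat_def if_distrib cong: if_cong)
  then show ?thesis by (simp add: norm_eq_sqrt_inner inner_vec_def)
qed

section \<open>Sup norms and integrals on [0,T]\<close>

lemma norm_le_supn:
  assumes "continuous_on {0..T} f" "t \<in> {0..T}"
  shows "norm (f t) \<le> supn T f"
proof -
  have "compact ((\<lambda>t. norm (f t)) ` {0..T})"
    by (intro compact_continuous_image continuous_on_norm assms) auto
  then have "bdd_above ((\<lambda>t. norm (f t)) ` {0..T})"
    by (intro bounded_imp_bdd_above compact_imp_bounded)
  then show ?thesis unfolding supn_def by (rule cSUP_upper[OF assms(2)])
qed

lemma supn_le: "0 \<le> T \<Longrightarrow> (\<And>t. t \<in> {0..T} \<Longrightarrow> norm (f t) \<le> B) \<Longrightarrow> supn T f \<le> B"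
  unfolding supn_def by (rule cSUP_least) auto

lemma supn_nonneg: "0 \<le> T \<Longrightarrow> continuous_on {0..T} f \<Longrightarrow> 0 \<le> supn T f"
  using norm_le_supn[of T f 0] order_trans[OF norm_ge_zero[of "f 0"]] by auto

lemma norm_integral_le_const:
  fixes f :: "real \<Rightarrow> 'a::euclidean_space"
  assumes "continuous_on {a..b} f" "a \<le> b" "\<And>t. t \<in> {a..b} \<Longrightarrow> norm (f t) \<le> B"
  shows "norm (integral {a..b} f) \<le> B * (b - a)"
  using integral_bound[of a b f B] assms by auto

section \<open>Volterra equations and Gronwall's inequality\<close>

lemma integral_power_Icc:
  fixes t :: real assumes "0 \<le> t"
  shows "((\<lambda>s. s ^ n) has_integral t ^ Suc n / Suc n) {0..t}"
proof -
  have "((\<lambda>s. s ^ n) has_integral (t ^ Suc n / Suc n - 0 ^ Suc n / Suc n)) {0..t}"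
  proof (rule fundamental_theorem_of_calculus[OF assms])
    fix x assume "x \<in> {0..t}"
    show "((\<lambda>s. s ^ Suc n / real (Suc n)) has_vector_derivative x ^ n) (at x within {0..t})"
      unfolding has_real_derivative_iff_has_vector_derivative[symmetric]
      by (rule DERIV_cong[OF DERIV_cdivide[OF DERIV_pow]]) (simp del: of_nat_Suc)
  qed
  then show ?thesis by simp
qed

text \<open>Picard iteration confined to closed sets \<open>K t\<close>. The Lipschitz bound is
  asked for only inside them, so a locally Lipschitz F such as the quadratic one of the Riccati
  equation is covered once the iteration maps these sets into themselves. Linear equations take
  \<open>UNIV\<close>.\<close>

lemma volterra_exists:
  fixes F :: "real \<Rightarrow> 'a::euclidean_space \<Rightarrow> 'a"
  assumes T: "0 \<le> T" and L: "0 \<le> L"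
    and g: "continuous_on {0..T} g"
    and K: "\<And>t. t \<in> {0..T} \<Longrightarrow> closed (K t)"
    and x0: "continuous_on {0..T} x0" "\<And>t. t \<in> {0..T} \<Longrightarrow> x0 t \<in> K t"
    and inv: "\<And>x t. continuous_on {0..T} x \<Longrightarrow> (\<forall>t\<in>{0..T}. x t \<in> K t) \<Longrightarrow> t \<in> {0..T} \<Longrightarrow>
        g t + integral {0..t} (\<lambda>s. F s (x s)) \<in> K t"
    and cont: "\<And>x. continuous_on {0..T} x \<Longrightarrow> continuous_on {0..T} (\<lambda>s. F s (x s))"
    and lip: "\<And>s x y. s \<in> {0..T} \<Longrightarrow> x \<in> K s \<Longrightarrow> y \<in> K s \<Longrightarrow> norm (F s x - F s y) \<le> L * norm (x - y)"
  shows "\<exists>x. continuous_on {0..T} x \<and>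
    (\<forall>t\<in>{0..T}. x t \<in> K t \<and> x t = g t + integral {0..t} (\<lambda>s. F s (x s)))"
proof -
  define X where "X = rec_nat x0 (\<lambda>_ x t. g t + integral {0..t} (\<lambda>s. F s (x s)))"
  have X0: "X 0 = x0" and XS: "X (Suc n) = (\<lambda>t. g t + integral {0..t} (\<lambda>s. F s (X n s)))" for n
    by (simp_all add: X_def)
  have XC: "continuous_on {0..T} (X n) \<and> (\<forall>t\<in>{0..T}. X n t \<in> K t)" for n
  proof (induction n)
    case 0 then show ?case using x0 by (simp add: X0)
  next
    case (Suc n)
    have "(\<lambda>s. F s (X n s)) integrable_on {0..T}"
      using Suc cont by (intro integrable_continuous_real) auto
    then have "continuous_on {0..T} (\<lambda>t. integral {0..t} (\<lambda>s. F s (X n s)))"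
      by (rule indefinite_integral_continuous_1)
    then show ?case using Suc inv g by (auto simp: XS intro!: continuous_intros)
  qed
  have intF: "(\<lambda>s. F s (x s)) integrable_on {0..t}" if "continuous_on {0..T} x" "t \<in> {0..T}" for x t
    using that cont[OF that(1)] by (intro integrable_continuous_real) (auto elim: continuous_on_subset)
  obtain B where B: "0 \<le> B" "\<And>t. t \<in> {0..T} \<Longrightarrow> norm (X 1 t - X 0 t) \<le> B"
  proof -
    have "continuous_on {0..T} (\<lambda>t. X 1 t - X 0 t)" using XC by (intro continuous_intros) auto
    from norm_le_supn[OF this] supn_nonneg[OF T this] show ?thesis by (intro that) auto
  qed
  \<comment> \<open>Each step integrates a power of s, which produces the factorial and makes the
    series of differences converge whatever the size of L T.\<close>
  have step: "norm (X (Suc n) t - X n t) \<le> B * L ^ n * t ^ n / fact n" if "t \<in> {0..T}" for n t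
    using that
  proof (induction n arbitrary: t)
    case 0 then show ?case using B(2) by simp
  next
    case (Suc n)
    have "X (Suc (Suc n)) t - X (Suc n) t = integral {0..t} (\<lambda>s. F s (X (Suc n) s) - F s (X n s))"
      unfolding XS[of "Suc n"] XS[of n]
      using intF[OF conjunct1[OF XC[of "Suc n"]] Suc.prems] intF[OF conjunct1[OF XC[of n]] Suc.prems]
      by (simp add: XS[of n] integral_diff)
    also have "norm \<dots> \<le> integral {0..t} (\<lambda>s. L * (B * L ^ n * s ^ n / fact n))"
    proof (rule integral_norm_bound_integral)
      show "(\<lambda>s. F s (X (Suc n) s) - F s (X n s)) integrable_on {0..t}"
        using intF XC Suc.prems by (intro integrable_diff) auto
      show "(\<lambda>s. L * (B * L ^ n * s ^ n / fact n)) integrable_on {0..t}"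
        by (intro integrable_continuous_real continuous_intros)  auto
      fix s assume "s \<in> {0..t}"
      then have s: "s \<in> {0..T}" using Suc.prems by auto
      have "norm (F s (X (Suc n) s) - F s (X n s)) \<le> L * norm (X (Suc n) s - X n s)"
        using lip s XC by blast
      also have "\<dots> \<le> L * (B * L ^ n * s ^ n / fact n)"
        using Suc.IH[OF s] L by (intro mult_left_mono) auto
      finally show "norm (F s (X (Suc n) s) - F s (X n s)) \<le> L * (B * L ^ n * s ^ n / fact n)" .
    qed
    also have "\<dots> = L * (B * L ^ n / fact n) * (t ^ Suc n / Suc n)"
    proof -
      have "0 \<le> t" using Suc.prems by simp
      from has_integral_mult_right[OF integral_power_Icc[OF this, of n], of "L * (B * L ^ n / fact n)"]
      have "integral {0..t} (\<lambda>s. L * (B * L ^ n / fact n) * s ^ n) = L * (B * L ^ n / fact n) * (t ^ Suc n / Suc n)"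
        by (rule integral_unique)
      then show ?thesis by (simp add: mult_ac)
    qed
    also have "\<dots> = B * L ^ Suc n * t ^ Suc n / fact (Suc n)"
      by (simp add: fact_Suc field_simps del: of_nat_Suc)
    finally show ?case .
  qed
  define x where "x = (\<lambda>t. X 0 t + (\<Sum>n. X (Suc n) t - X n t))"
  have ul: "uniform_limit {0..T} X x sequentially"
  proof -
    have "summable (\<lambda>n. B * ((L * T) ^ n / fact n))"
      using summable_exp[of "L * T"] by (intro summable_mult) (simp add: divide_inverse mult.commute)
    then have sm: "summable (\<lambda>n. B * L ^ n * T ^ n / fact n)" by (simp add: power_mult_distrib mult_ac)
    have "uniform_limit {0..T} (\<lambda>n t. \<Sum>i<n. X (Suc i) t - X i t) (\<lambda>t. \<Sum>n. X (Suc n) t - X n t) sequentially"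
    proof (rule Weierstrass_m_test[OF _ sm])
      fix n t assume t: "t \<in> {0..T}"
      have "B * L ^ n * t ^ n / fact n \<le> B * L ^ n * T ^ n / fact n"
        using t B(1) L by (intro divide_right_mono mult_left_mono power_mono) auto
      with step[OF t, of n] show "norm (X (Suc n) t - X n t) \<le> B * L ^ n * T ^ n / fact n" by simp
    qed
    then have "uniform_limit {0..T} (\<lambda>n t. X 0 t + (\<Sum>i<n. X (Suc i) t - X i t)) x sequentially"
      unfolding x_def by (intro uniform_limit_intros)
    moreover have "X 0 t + (\<Sum>i<n. X (Suc i) t - X i t) = X n t" for n t
      using sum_lessThan_telescope[of "\<lambda>i. X i t" n] by simp
    ultimately show ?thesis by simp
  qed
  have xc: "continuous_on {0..T} x"
    by (rule uniform_limit_theorem[OF _ ul]) (use XC in auto)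
  have ptw: "(\<lambda>n. X n t) \<longlonglongrightarrow> x t" if "t \<in> {0..T}" for t
    using ul that by (rule tendsto_uniform_limitI)
  have xK: "x t \<in> K t" if "t \<in> {0..T}" for t
    using closed_sequentially[OF K[OF that] _ ptw[OF that]] XC that by auto
  have eq: "x t = g t + integral {0..t} (\<lambda>s. F s (x s))" if t: "t \<in> {0..T}" for t
  proof -
    have "(\<lambda>n. X (Suc n) t) \<longlonglongrightarrow> g t + integral {0..t} (\<lambda>s. F s (x s))"
    proof (rule LIMSEQ_I)
      fix e :: real assume e: "0 < e"
      \<comment> \<open>The summand 1 covers L T = 0 and makes the last estimate strict.\<close>
      define e' where "e' = e / (L * T + 1)"
      have e': "0 < e'" using e T L by (simp add: e'_def add_nonneg_pos)
      from uniform_limitD[OF ul this] obtain N where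
        N: "\<And>n s. n \<ge> N \<Longrightarrow> s \<in> {0..T} \<Longrightarrow> norm (X n s - x s) < e'"
        unfolding eventually_sequentially dist_norm by blast
      show "\<exists>N. \<forall>n\<ge>N. norm (X (Suc n) t - (g t + integral {0..t} (\<lambda>s. F s (x s)))) < e"
      proof (intro exI allI impI)
        fix n assume n: "N \<le> n"
        have "X (Suc n) t - (g t + integral {0..t} (\<lambda>s. F s (x s)))
            = integral {0..t} (\<lambda>s. F s (X n s) - F s (x s))"
          using intF[OF conjunct1[OF XC] t] intF[OF xc t] by (simp add: XS integral_diff)
        also have "norm \<dots> \<le> (L * e') * (t - 0)"
        proof (rule norm_integral_le_const)
          show "continuous_on {0..t} (\<lambda>s. F s (X n s) - F s (x s))"
            using cont[OF conjunct1[OF XC[of n]]] cont[OF xc] t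
            by (intro continuous_intros) (auto elim: continuous_on_subset)
          fix s assume "s \<in> {0..t}"
          then have s: "s \<in> {0..T}" using t by auto
          have "norm (F s (X n s) - F s (x s)) \<le> L * norm (X n s - x s)"
            using lip s XC xK by blast
          also have "\<dots> \<le> L * e'" using N[OF n s] L by (intro mult_left_mono) auto
          finally show "norm (F s (X n s) - F s (x s)) \<le> L * e'" .
        qed (use t in auto)
        also have "\<dots> \<le> (L * e') * T" using t L e' by (intro mult_left_mono) auto
        also have "\<dots> = e * (L * T / (L * T + 1))" by (simp add: e'_def)
        also have "\<dots> < e * 1" using e T L by (intro mult_strict_left_mono) (auto simp: divide_simps add_nonneg_pos)
        finally show "norm (X (Suc n) t - (g t + integral {0..t} (\<lambda>s. F s (x s)))) < e" by simp
      qed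
    qed
    with LIMSEQ_Suc[OF ptw[OF t]] show ?thesis by (rule LIMSEQ_unique)
  qed
  from xc xK eq show ?thesis by blast
qed

lemma integral_reverse_time:
  fixes f :: "real \<Rightarrow> 'a::euclidean_space"
  assumes f: "continuous_on {0..T} f" and t: "t \<in> {0..T}"
  shows "integral {0..t} (\<lambda>s. f (T - s)) = integral {T - t..T} f"
proof -
  have "f integrable_on {T - t..T}"
    using t by (intro integrable_continuous_real continuous_on_subset[OF f]) auto
  then have "(f has_integral integral {T - t..T} f) (cbox (T - t) T)"
    by (simp add: integrable_integral)
  from has_integral_affinity[OF this, of "-1" T]
  have "((\<lambda>s. f (T - s)) has_integral integral {T - t..T} f) ((\<lambda>x. T - x) ` {T - t..T})"
    by (simp add: algebra_simps)
  moreover have "(\<lambda>x. T - x) ` {T - t..T} = {0..t}"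
    by simp
  ultimately show ?thesis by (auto intro: integral_unique)
qed

text \<open>Time reversal by T - t. The Riccati and the Jacobi equation both carry their data at
  T.\<close>

lemma volterra_backward_exists:
  fixes F :: "real \<Rightarrow> 'a::euclidean_space \<Rightarrow> 'a"
  assumes T: "0 \<le> T" and L: "0 \<le> L"
    and g: "continuous_on {0..T} g"
    and K: "\<And>t. t \<in> {0..T} \<Longrightarrow> closed (K t)"
    and x0: "continuous_on {0..T} x0" "\<And>t. t \<in> {0..T} \<Longrightarrow> x0 t \<in> K t"
    and inv: "\<And>x t. continuous_on {0..T} x \<Longrightarrow> (\<forall>t\<in>{0..T}. x t \<in> K t) \<Longrightarrow> t \<in> {0..T} \<Longrightarrow>
        g t + integral {t..T} (\<lambda>s. F s (x s)) \<in> K t"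
    and cont: "\<And>x. continuous_on {0..T} x \<Longrightarrow> continuous_on {0..T} (\<lambda>s. F s (x s))"
    and lip: "\<And>s x y. s \<in> {0..T} \<Longrightarrow> x \<in> K s \<Longrightarrow> y \<in> K s \<Longrightarrow> norm (F s x - F s y) \<le> L * norm (x - y)"
  shows "\<exists>x. continuous_on {0..T} x \<and>
    (\<forall>t\<in>{0..T}. x t \<in> K t \<and> x t = g t + integral {t..T} (\<lambda>s. F s (x s)))"
proof -
  have rev: "continuous_on {0..T} (\<lambda>t. x (T - t))" if "continuous_on {0..T} x" for x :: "real \<Rightarrow> 'a"
    by (rule continuous_on_compose2[OF that]) (auto intro!: continuous_intros)
  have I: "integral {0..t} (\<lambda>s. F (T - s) (x s)) = integral {T - t..T} (\<lambda>s. F s (x (T - s)))"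
    if "continuous_on {0..T} x" "t \<in> {0..T}" for x t
    using integral_reverse_time[OF cont[OF rev[OF that(1)]] that(2)] by simp
  have "\<exists>y. continuous_on {0..T} y \<and>
    (\<forall>t\<in>{0..T}. y t \<in> K (T - t) \<and> y t = g (T - t) + integral {0..t} (\<lambda>s. F (T - s) (y s)))"
  proof (rule volterra_exists[OF T L, where ?x0.0 = "\<lambda>t. x0 (T - t)"])
    fix x t assume x: "continuous_on {0..T} x" "\<forall>t\<in>{0..T}. x t \<in> K (T - t)" and t: "t \<in> {0..T}"
    have "\<forall>t\<in>{0..T}. x (T - t) \<in> K t"
    proof
      fix t assume "t \<in> {0..T}"
      then have "T - t \<in> {0..T}" by simp
      with x(2) have "x (T - t) \<in> K (T - (T - t))" by blast
      then show "x (T - t) \<in> K t" by simp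
    qed
    from inv[OF rev[OF x(1)] this, of "T - t"] t
    show "g (T - t) + integral {0..t} (\<lambda>s. F (T - s) (x s)) \<in> K (T - t)"
      by (simp add: I[OF x(1) t])
  next
    fix x :: "real \<Rightarrow> 'a" assume "continuous_on {0..T} x"
    from rev[of "\<lambda>s. F s (x (T - s))", OF cont[OF rev[OF this]]]
    show "continuous_on {0..T} (\<lambda>s. F (T - s) (x s))" by simp
  next
    fix s x y assume "s \<in> {0..T}" "x \<in> K (T - s)" "y \<in> K (T - s)"
    then show "norm (F (T - s) x - F (T - s) y) \<le> L * norm (x - y)" using lip[of "T - s" x y] by simp
  qed (use K x0 rev g in auto)
  then obtain y where y: "continuous_on {0..T} y" "\<And>t. t\<in>{0..T} \<Longrightarrow> y t \<in> K (T - t)"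
    "\<And>t. t\<in>{0..T} \<Longrightarrow> y t = g (T - t) + integral {0..t} (\<lambda>s. F (T - s) (y s))" by blast
  show ?thesis
  proof (intro exI[of _ "\<lambda>t. y (T - t)"] conjI ballI)
    fix t assume t: "t \<in> {0..T}"
    then have t': "T - t \<in> {0..T}" by simp
    from y(2)[OF t'] show "y (T - t) \<in> K t" by simp
    from y(3)[OF t'] show "y (T - t) = g t + integral {t..T} (\<lambda>s. F s (y (T - s)))"
      by (simp add: I[OF y(1) t'])
  qed (rule rev[OF y(1)])
qed

lemma has_vector_derivative_integral_left:
  fixes f :: "real \<Rightarrow> 'a::euclidean_space"
  assumes f: "continuous_on {0..T} f" and t: "t \<in> {0..T}"
  shows "((\<lambda>t. integral {t..T} f) has_vector_derivative - f t) (at t within {0..T})"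
proof -
  have fi: "f integrable_on {0..T}" using f by (rule integrable_continuous_real)
  have eq: "integral {s..T} f = integral {0..T} f - integral {0..s} f" if "s \<in> {0..T}" for s
    using Henstock_Kurzweil_Integration.integral_combine[of 0 s T f] that fi by (auto simp: algebra_simps)
  have "((\<lambda>s. integral {0..T} f - integral {0..s} f) has_vector_derivative - f t) (at t within {0..T})"
    using has_vector_derivative_diff[OF has_vector_derivative_const integral_has_vector_derivative[OF f t]] by simp
  then show ?thesis
    by (rule has_vector_derivative_transform[OF t eq, rotated])
qed

lemma integral_derivative_backward:
  fixes f :: "real \<Rightarrow> 'a::euclidean_space"
  assumes "\<And>t. t \<in> {0..T} \<Longrightarrow> (f has_vector_derivative f' t) (at t within {0..T})" "t \<in> {0..T}"
  shows "(f' has_integral f T - f t) {t..T}"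
  using assms by (intro fundamental_theorem_of_calculus)
    (auto intro: has_vector_derivative_within_subset[of _ _ _ "{0..T}"])

text \<open>If U denotes the right-hand side of the assumed bound, then U exp(L t) has derivative L
  (U - u) exp(L t) \<ge> 0, so it stays below its value a exp(L T) at the right end.\<close>

lemma gronwall_backward:
  fixes u :: "real \<Rightarrow> real"
  assumes u: "continuous_on {0..T} u" and L: "0 \<le> L"
    and le: "\<And>t. t \<in> {0..T} \<Longrightarrow> u t \<le> a + L * integral {t..T} u" and t: "t \<in> {0..T}"
  shows "u t \<le> a * exp (L * (T - t))"
proof -
  define U where "U = (\<lambda>t. a + L * integral {t..T} u)"
  have dI: "((\<lambda>t. integral {t..T} u) has_real_derivative - u s) (at s within {0..T})" if "s \<in> {0..T}" for s
    using has_vector_derivative_integral_left[OF u that]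
    unfolding has_real_derivative_iff_has_vector_derivative .
  have d: "((\<lambda>t. U t * exp (L * t)) has_vector_derivative (L * (U s - u s)) * exp (L * s)) (at s within {0..T})"
    if "s \<in> {0..T}" for s
    unfolding U_def has_real_derivative_iff_has_vector_derivative[symmetric]
    by (auto intro!: derivative_eq_intros dI[OF that] simp: algebra_simps)
  from integral_derivative_backward[OF d t]
  have "((\<lambda>s. (L * (U s - u s)) * exp (L * s)) has_integral U T * exp (L * T) - U t * exp (L * t)) {t..T}"
    by simp
  moreover have "0 \<le> (L * (U s - u s)) * exp (L * s)" if "s \<in> {t..T}" for s
    using le[of s] t that L by (auto simp: U_def)
  ultimately have "0 \<le> U T * exp (L * T) - U t * exp (L * t)"
    by (rule has_integral_nonneg)
  then have "U t * exp (L * t) \<le> a * exp (L * T)" by (simp add: U_def)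
  then have "U t * exp (L * t) * exp (- (L * t)) \<le> a * exp (L * T) * exp (- (L * t))"
    by (rule mult_right_mono) simp
  then have "U t \<le> a * exp (L * (T - t))"
    by (simp add: mult.assoc exp_add[symmetric] algebra_simps)
  with le[OF t] show ?thesis by (simp add: U_def)
qed

section \<open>The Riccati equation in integral form\<close>

lemma transpose_integral:
  fixes f :: "real \<Rightarrow> real^'n^'m"
  assumes "f integrable_on S"
  shows "transpose (integral S f) = integral S (\<lambda>t. transpose (f t))"
  using integral_linear[OF assms bounded_linear_transpose] by (simp add: o_def)

lemma matrix_diff_mult_right: "(A - B) ** C = A ** C - B ** (C :: real^'k^'n)" for A B :: "real^'n^'m"
  by (rule bounded_bilinear.diff_left[OF bounded_bilinear_matrix_mult])
lemma matrix_diff_mult_left: "A ** (B - C) = A ** B - A ** (C :: real^'k^'n)" for A :: "real^'n^'m"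
  by (rule bounded_bilinear.diff_right[OF bounded_bilinear_matrix_mult])
lemma transpose_diff: "transpose (A - B) = transpose A - transpose (B :: real^'n^'m)"
  by (simp add: vec_eq_iff transpose_def)
lemma transpose_add: "transpose (A + B) = transpose A + transpose (B :: real^'n^'m)"
  by (simp add: vec_eq_iff transpose_def)

text \<open>Gram matrices are symmetric pointwise. This is the source of the symmetry of S = chi -
  \<sigma>, which enters the Riccati equation, the Jacobi equation and the summation by
  parts.\<close>

lemma gram_integral_symmetric:
  fixes chi :: "real \<Rightarrow> real^'n^'n"
  assumes "continuous_on {a..b} chi"
  shows "transpose (integral {a..b} (\<lambda>u. transpose (chi u) ** chi u)) = integral {a..b} (\<lambda>u. transpose (chi u) ** chi u)"
proof -
  have "(\<lambda>u. transpose (chi u) ** chi u) integrable_on {a..b}"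
    by (intro integrable_continuous_real continuous_intros assms)
  from transpose_integral[OF this] show ?thesis by (simp add: matrix_transpose_mul)
qed

text \<open>The majorant solves \<open>y' = - y\<^sup>2\<close>, \<open>y(T) = s\<close>, and stays below \<open>1 / T\<close> exactly when \<open>2 s T < 1\<close>.\<close>

lemma riccati_exists:
  fixes \<sigma> :: "real \<Rightarrow> real^'n^'n"
  assumes T: "0 < T" and c: "continuous_on {0..T} \<sigma>" and s2: "2 * supn T \<sigma> * T < 1"
  shows "\<exists>chi. continuous_on {0..T} chi \<and> T * supn T chi < 1 \<and>
     (\<forall>t\<in>{0..T}. chi t = \<sigma> t + integral {t..T} (\<lambda>u. transpose (chi u) ** chi u))"
proof -
  define s where "s = supn T \<sigma>"
  have s0: "0 \<le> s" using supn_nonneg[OF _ c] T by (simp add: s_def)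
  define y where "y = (\<lambda>t. s / (1 - s * (T - t)))"
  have st: "s * (T - t) \<le> s * T" if "t \<in> {0..T}" for t using that s0 by (intro mult_left_mono) auto
  have sT: "s * T < 1 / 2" using s2 by (simp add: s_def)
  have pos: "0 < 1 - s * (T - t)" if "t \<in> {0..T}" for t using st[OF that] sT by simp
  define Y where "Y = s / (1 - s * T)"
  have Y0: "0 \<le> Y" and YT: "T * Y < 1" using s0 sT by (auto simp: Y_def field_simps)
  have yY: "y t \<le> Y" if "t \<in> {0..T}" for t
    unfolding y_def Y_def using st[OF that] pos[OF that] sT s0
    by (intro divide_left_mono mult_pos_pos) auto
  have y0: "0 \<le> y t" if "t \<in> {0..T}" for t using pos[OF that] s0 by (simp add: y_def)
  have yc: "continuous_on {0..T} y"
    unfolding y_def by (intro continuous_intros) (use pos in force)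
  have yd: "(y has_vector_derivative (- ((y t)^2))) (at t within {0..T})" if "t \<in> {0..T}" for t
    unfolding y_def has_real_derivative_iff_has_vector_derivative[symmetric]
    using pos[OF that] by (auto intro!: derivative_eq_intros simp: power2_eq_square)
  have yI: "integral {t..T} (\<lambda>t. (y t)^2) = y t - s" if "t \<in> {0..T}" for t
    using integral_unique[OF integral_derivative_backward[OF yd that]] by (simp add: y_def)
  \<comment> \<open>The balls of radius \<open>y t\<close> are invariant because s plus the integral
    of y^2 over [t,T] is exactly y(t). Inside them the quadratic map has Lipschitz constant 2 Y,
    where Y = y(0) is the largest radius.\<close>
  have "\<exists>chi. continuous_on {0..T} chi \<and>
     (\<forall>t\<in>{0..T}. chi t \<in> cball 0 (y t) \<and> chi t = \<sigma> t + integral {t..T} (\<lambda>u. transpose (chi u) ** chi u))"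
  proof (rule volterra_backward_exists[where ?x0.0 = "\<lambda>_. 0" and L = "2 * Y" and F = "\<lambda>_ x. transpose x ** x"])
    fix x :: "real \<Rightarrow> real^'n^'n" and t
    assume x: "continuous_on {0..T} x" "\<forall>t\<in>{0..T}. x t \<in> cball 0 (y t)" and t: "t \<in> {0..T}"
    have sub: "{t..T} \<subseteq> {0..T}" using t by auto
    have xc: "continuous_on {t..T} x" using x(1) sub by (rule continuous_on_subset)
    have "norm (integral {t..T} (\<lambda>s. transpose (x s) ** x s)) \<le> integral {t..T} (\<lambda>t. (y t)^2)"
    proof (rule integral_norm_bound_integral)
      show "(\<lambda>s. transpose (x s) ** x s) integrable_on {t..T}"
        by (intro integrable_continuous_real continuous_intros xc)
      show "(\<lambda>t. (y t)^2) integrable_on {t..T}"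
        by (intro integrable_continuous_real continuous_intros continuous_on_subset[OF yc sub])
      fix r assume "r \<in> {t..T}"
      then have r: "r \<in> {0..T}" using sub by auto
      have "norm (transpose (x r) ** x r) \<le> norm (x r) * norm (x r)"
        using norm_matrix_mult_le[of "transpose (x r)" "x r"] by (simp add: norm_transpose)
      also have "\<dots> \<le> y r * y r" using x(2) r y0[OF r] by (intro mult_mono) (auto simp: dist_norm)
      finally show "norm (transpose (x r) ** x r) \<le> (y r)^2" by (simp add: power2_eq_square)
    qed
    moreover have "norm (\<sigma> t) \<le> s" unfolding s_def by (rule norm_le_supn[OF c t])
    ultimately show "\<sigma> t + integral {t..T} (\<lambda>s. transpose (x s) ** x s) \<in> cball 0 (y t)"
      using yI[OF t] norm_triangle_ineq[of "\<sigma> t" "integral {t..T} (\<lambda>s. transpose (x s) ** x s)"]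
      by simp
  next
    fix r and x z :: "real^'n^'n" assume r: "r \<in> {0..T}" and "x \<in> cball 0 (y r)" "z \<in> cball 0 (y r)"
    then have xz: "norm x \<le> Y" "norm z \<le> Y" using yY[OF r] by (auto simp: dist_norm)
    have "transpose x ** x - transpose z ** z = transpose x ** (x - z) + transpose (x - z) ** z"
      by (simp add: matrix_diff_mult_left matrix_diff_mult_right transpose_diff)
    also have "norm \<dots> \<le> norm x * norm (x - z) + norm (x - z) * norm z"
      using norm_matrix_mult_le[of "transpose x" "x - z"] norm_matrix_mult_le[of "transpose (x - z)" z]
      unfolding norm_transpose by (rule norm_triangle_le[OF add_mono])
    also have "\<dots> \<le> Y * norm (x - z) + norm (x - z) * Y"
      using xz Y0 by (intro add_mono mult_mono) auto
    finally show "norm (transpose x ** x - transpose z ** z) \<le> 2 * Y * norm (x - z)" by simp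
  qed (use T c Y0 y0 in \<open>auto intro!: continuous_intros\<close>)
  then obtain chi where chi: "continuous_on {0..T} chi" "\<And>t. t\<in>{0..T} \<Longrightarrow> chi t \<in> cball 0 (y t)"
     "\<And>t. t\<in>{0..T} \<Longrightarrow> chi t = \<sigma> t + integral {t..T} (\<lambda>u. transpose (chi u) ** chi u)" by blast
  have "supn T chi \<le> Y"
    using T chi(2) yY by (intro supn_le) (force simp: dist_norm)+
  then have "T * supn T chi < 1"
    using YT T by (smt (verit) mult_left_mono)
  with chi show ?thesis by blast
qed

section \<open>Inverses, determinants and Liouville's formula\<close>

lemma matrix_inv_mult:
  fixes A :: "real^'n^'n"
  assumes "invertible A"
  shows "A ** matrix_inv A = mat 1" "matrix_inv A ** A = mat 1"
  using someI_ex[OF assms[unfolded invertible_def]] by (simp_all add: matrix_inv_def)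

text \<open>If A x = 0 then |x| = |(A - 1) x| \<le> r |x|, so A is injective. The bound comes from B
  = 1 - B (A - 1) for the inverse B, where sqrt d is the Frobenius norm of the identity.\<close>

lemma matrix_near_identity:
  fixes A :: "real^'n^'n"
  assumes r: "norm (A - mat 1) \<le> r" "r < 1"
  shows "invertible A" "norm (matrix_inv A) * (1 - r) \<le> sqrt (real CARD('n))"
proof -
  show inv: "invertible A"
  proof -
    have "x = 0" if "A *v x = 0" for x
    proof -
      have "norm x = norm ((A - mat 1) *v x)"
        using that by (simp add: bounded_bilinear.diff_left[OF bounded_bilinear_matrix_vector_mult])
      also have "\<dots> \<le> r * norm x"
        by (rule order_trans[OF norm_matrix_vector_mult_le]) (intro mult_right_mono r, simp)
      finally have "(1 - r) * norm x \<le> 0" by (simp add: algebra_simps)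
      then show "x = 0" using r by (simp add: mult_le_0_iff)
    qed
    then show ?thesis
      using matrix_left_invertible_ker invertible_left_inverse by blast
  qed
  define B where "B = matrix_inv A"
  have "B ** A = mat 1" using matrix_inv_mult[OF inv] by (simp add: B_def)
  then have "B = mat 1 - B ** (A - mat 1)"
    by (simp add: matrix_diff_mult_left)
  then have "norm B \<le> norm (mat 1 :: real^'n^'n) + norm (B ** (A - mat 1))"
    by (metis norm_triangle_ineq4)
  also have "\<dots> \<le> sqrt (real CARD('n)) + norm B * r"
    using order_trans[OF norm_matrix_mult_le mult_left_mono[OF r(1)], of B] by (simp add: norm_mat_1)
  finally show "norm (matrix_inv A) * (1 - r) \<le> sqrt (real CARD('n))"
    by (simp add: B_def algebra_simps)
qed

text \<open>Row i of C A is a combination of the rows of A; expanding the determinant linearly in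
  that row leaves only the multiple of row i itself, all other terms having two equal rows.\<close>

lemma det_row_combination:
  fixes A C :: "real^'n^'n"
  shows "det (\<chi> j. if j = i then (C ** A) $ i else A $ j) = C $ i $ i * det A"
proof -
  have "(C ** A) $ i = (\<Sum>k\<in>UNIV. C $ i $ k *s A $ k)"
    by (simp add: vec_eq_iff matrix_matrix_mult_def)
  then have "det (\<chi> j. if j = i then (C ** A) $ i else A $ j)
      = det (\<chi> j. if j = i then (\<Sum>k\<in>UNIV. C $ i $ k *s A $ k) else A $ j)" by (simp only:)
  also have "\<dots> = (\<Sum>k\<in>UNIV. C $ i $ k * det (\<chi> j. if j = i then A $ k else A $ j))"
    by (simp add: det_linear_row_sum det_row_mul)
  also have "\<dots> = (\<Sum>k\<in>UNIV. if k = i then C $ i $ i * det A else 0)"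
  proof (rule sum.cong[OF refl])
    fix k
    show "C $ i $ k * det (\<chi> j. if j = i then A $ k else A $ j) = (if k = i then C $ i $ i * det A else 0)"
    proof (cases "k = i")
      case True
      then have "(\<chi> j. if j = i then A $ k else A $ j) = A" by (simp add: vec_eq_iff)
      then show ?thesis using True by simp
    next
      case False
      then have "det (\<chi> j. if j = i then A $ k else A $ j) = 0"
        by (intro det_identical_rows[of i k]) (auto simp: row_def vec_eq_iff)
      then show ?thesis using False by simp
    qed
  qed
  finally show ?thesis by simp
qed

text \<open>Jacobi's formula. Differentiating the Leibniz expansion replaces one row at a time by
  its derivative; with A' = C A each replacement contributes a diagonal entry of C times det A, and
  these add up to the trace.\<close>

lemma has_vector_derivative_det:
  fixes A :: "real \<Rightarrow> real^'n^'n"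
  assumes "(A has_vector_derivative C ** A t) (at t within S)"
  shows "((\<lambda>t. det (A t)) has_vector_derivative trace C * det (A t)) (at t within S)"
proof -
  define D where "D = C ** A t"
  have bl: "bounded_linear (\<lambda>M :: real^'n^'n. M $ i $ j)" for i j
    by (intro bounded_linear_compose[OF bounded_linear_vec_nth bounded_linear_vec_nth])
  have comp: "((\<lambda>t. A t $ i $ j) has_derivative (\<lambda>h. h * D $ i $ j)) (at t within S)" for i j
    using bounded_linear.has_vector_derivative[OF bl assms] by (simp add: has_vector_derivative_def D_def)
  have "((\<lambda>t. det (A t)) has_derivative (\<lambda>h. \<Sum>p | p permutes UNIV. of_int (sign p) *
      (\<Sum>i\<in>UNIV. (h * D $ i $ p i) * (\<Prod>j\<in>UNIV - {i}. A t $ j $ p j)))) (at t within S)"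
    unfolding det_def
    by (intro has_derivative_sum has_derivative_mult_right has_derivative_prod comp)
  also have "(\<lambda>h. \<Sum>p | p permutes UNIV. of_int (sign p) *
      (\<Sum>i\<in>UNIV. (h * D $ i $ p i) * (\<Prod>j\<in>UNIV - {i}. A t $ j $ p j)))
    = (\<lambda>h. h * (\<Sum>i\<in>UNIV. det (\<chi> j. if j = i then D $ i else A t $ j)))"
  proof (rule ext)
    fix h
    have "(\<Sum>i\<in>UNIV. det (\<chi> j. if j = i then D $ i else A t $ j))
        = (\<Sum>i\<in>UNIV. \<Sum>p | p permutes UNIV. of_int (sign p) * (D $ i $ p i * (\<Prod>j\<in>UNIV - {i}. A t $ j $ p j)))"
      unfolding det_def
    proof (intro sum.cong refl arg_cong2[where f = "(*)"])
      fix i and p :: "'n \<Rightarrow> 'n"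
      have "(\<Prod>j\<in>UNIV. (\<chi> j. if j = i then D $ i else A t $ j) $ j $ p j)
        = D $ i $ p i * (\<Prod>j\<in>UNIV - {i}. (\<chi> j. if j = i then D $ i else A t $ j) $ j $ p j)"
        by (subst prod.remove[of UNIV i]) auto
      also have "(\<Prod>j\<in>UNIV - {i}. (\<chi> j. if j = i then D $ i else A t $ j) $ j $ p j)
        = (\<Prod>j\<in>UNIV - {i}. A t $ j $ p j)" by (rule prod.cong) auto
      finally show "(\<Prod>j\<in>UNIV. (\<chi> j. if j = i then D $ i else A t $ j) $ j $ p j)
        = D $ i $ p i * (\<Prod>j\<in>UNIV - {i}. A t $ j $ p j)" .
    qed
    also have "\<dots> = (\<Sum>p | p permutes UNIV. of_int (sign p) *
      (\<Sum>i\<in>UNIV. D $ i $ p i * (\<Prod>j\<in>UNIV - {i}. A t $ j $ p j)))"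
      by (subst sum.swap) (simp add: sum_distrib_left)
    finally show "(\<Sum>p | p permutes UNIV. of_int (sign p) *
      (\<Sum>i\<in>UNIV. (h * D $ i $ p i) * (\<Prod>j\<in>UNIV - {i}. A t $ j $ p j)))
      = h * (\<Sum>i\<in>UNIV. det (\<chi> j. if j = i then D $ i else A t $ j))"
      by (simp add: sum_distrib_left mult_ac)
  qed
  finally show ?thesis
    unfolding has_vector_derivative_def D_def det_row_combination
    by (simp add: trace_def sum_distrib_right)
qed

text \<open>The product of det A(t) with the exponential of the integral of tr chi over [t,T] has
  derivative zero and equals 1 at T.\<close>

lemma det_liouville:
  fixes A chi :: "real \<Rightarrow> real^'n^'n"
  assumes T: "0 \<le> T" and A: "\<And>t. t \<in> {0..T} \<Longrightarrow> (A has_vector_derivative chi t ** A t) (at t within {0..T})"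
    and chi: "continuous_on {0..T} chi" and AT: "A T = mat 1"
  shows "det (A 0) = exp (- integral {0..T} (\<lambda>t. trace (chi t)))"
proof -
  define I where "I = (\<lambda>t. integral {t..T} (\<lambda>t. trace (chi t)))"
  have tc: "continuous_on {0..T} (\<lambda>t. trace (chi t))" using chi by (intro continuous_intros)
  have "((\<lambda>t. det (A t) * exp (I t)) has_vector_derivative 0) (at t within {0..T})" if t: "t \<in> {0..T}" for t
  proof -
    have 1: "((\<lambda>t. det (A t)) has_real_derivative trace (chi t) * det (A t)) (at t within {0..T})"
      using has_vector_derivative_det[OF A[OF t]] by (simp add: has_real_derivative_iff_has_vector_derivative)
    have 2: "(I has_real_derivative - trace (chi t)) (at t within {0..T})"
      using has_vector_derivative_integral_left[OF tc t]
      unfolding I_def has_real_derivative_iff_has_vector_derivative .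
    show ?thesis unfolding has_real_derivative_iff_has_vector_derivative[symmetric]
      by (auto intro!: derivative_eq_intros 1 2)
  qed
  from integral_unique[OF integral_derivative_backward[OF this, of 0]] T
  have "det (A 0) * exp (I 0) = 1" by (simp add: AT I_def)
  then show ?thesis by (simp add: I_def exp_minus field_simps)
qed

section \<open>The second-order equation for A and the logarithmic derivative of its
  solution\<close>

lemma second_order_linear_ode_exists:
  fixes P Q :: "real \<Rightarrow> real^'n^'n" and A0 A1 :: "real^'n^'n"
  assumes T: "0 < T" and P: "continuous_on {0..T} P" and Q: "continuous_on {0..T} Q"
  shows "\<exists>A B C. C1_with T A B \<and> C1_with T B C \<and> (\<forall>t\<in>{0..T}. C t = P t ** B t + Q t ** A t)
     \<and> A T = A0 \<and> B T = A1"
proof -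
  \<comment> \<open>First-order system for the pair (A, A'). The minus sign is there because x(t) =
    x(T) + integral of F over [t,T] means x' = -F.\<close>
  define F where "F = (\<lambda>s (x :: (real^'n^'n) \<times> (real^'n^'n)). - (snd x, P s ** snd x + Q s ** fst x))"
  define L where "L = 1 + supn T P + supn T Q"
  have L0: "0 \<le> L" using supn_nonneg[OF _ P] supn_nonneg[OF _ Q] T by (simp add: L_def)
  have cF: "continuous_on {0..T} (\<lambda>s. F s (x s))" if "continuous_on {0..T} x" for x
    unfolding F_def using that P Q by (intro continuous_intros) auto
  have "\<exists>x. continuous_on {0..T} x \<and>
    (\<forall>t\<in>{0..T}. x t \<in> UNIV \<and> x t = (A0, A1) + integral {t..T} (\<lambda>s. F s (x s)))"
  proof (rule volterra_backward_exists[where ?x0.0 = "\<lambda>_. 0" and L = L])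
    fix s and x y :: "(real^'n^'n) \<times> (real^'n^'n)" assume s: "s \<in> {0..T}"
    define u v where "u = fst x - fst y" and "v = snd x - snd y"
    have xy: "x - y = (u, v)" by (simp add: u_def v_def prod_eq_iff)
    have uv: "norm u \<le> norm (x - y)" "norm v \<le> norm (x - y)"
      unfolding xy by (auto simp: norm_fst_le norm_snd_le)
    have "F s x - F s y = - (v, P s ** v + Q s ** u)"
      by (simp add: F_def u_def v_def matrix_diff_mult_left prod_eq_iff)
    also have "norm \<dots> \<le> norm v + norm (P s ** v + Q s ** u)"
      by (simp only: norm_minus_cancel) (rule norm_Pair_le)
    also have "norm (P s ** v + Q s ** u) \<le> norm (P s) * norm v + norm (Q s) * norm u"
      by (rule norm_triangle_le[OF add_mono]) (rule norm_matrix_mult_le)+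
    also have "norm v + (norm (P s) * norm v + norm (Q s) * norm u)
        \<le> norm (x - y) + (supn T P * norm (x - y) + supn T Q * norm (x - y))"
      using norm_le_supn[OF P s] norm_le_supn[OF Q s] uv supn_nonneg[OF _ P] supn_nonneg[OF _ Q] T
      by (intro add_mono mult_mono) auto
    finally show "norm (F s x - F s y) \<le> L * norm (x - y)" by (simp add: L_def algebra_simps)
  qed (use T L0 cF in auto)
  then obtain x where x: "continuous_on {0..T} x"
    "\<And>t. t\<in>{0..T} \<Longrightarrow> x t = (A0, A1) + integral {t..T} (\<lambda>s. F s (x s))" by blast
  have xd: "(x has_vector_derivative - F t (x t)) (at t within {0..T})" if t: "t \<in> {0..T}" for t
  proof -
    have "((\<lambda>t. (A0, A1) + integral {t..T} (\<lambda>s. F s (x s))) has_vector_derivative - F t (x t)) (at t within {0..T})"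
      using has_vector_derivative_add[OF has_vector_derivative_const has_vector_derivative_integral_left[OF cF[OF x(1)] t]]
      by simp
    then show ?thesis by (rule has_vector_derivative_transform[OF t x(2), rotated])
  qed
  show ?thesis
  proof (rule exI[of _ "\<lambda>t. fst (x t)"], rule exI[of _ "\<lambda>t. snd (x t)"],
      rule exI[of _ "\<lambda>t. P t ** snd (x t) + Q t ** fst (x t)"], intro conjI ballI)
    show "C1_with T (\<lambda>t. fst (x t)) (\<lambda>t. snd (x t))"
      unfolding C1_with_def
    proof (intro conjI ballI)
      fix t assume "t \<in> {0..T}"
      from bounded_linear.has_vector_derivative[OF bounded_linear_fst xd[OF this]]
      show "((\<lambda>t. fst (x t)) has_vector_derivative snd (x t)) (at t within {0..T})" by (simp add: F_def)
    qed (intro continuous_intros x(1))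
    show "C1_with T (\<lambda>t. snd (x t)) (\<lambda>t. P t ** snd (x t) + Q t ** fst (x t))"
      unfolding C1_with_def
    proof (intro conjI ballI)
      fix t assume "t \<in> {0..T}"
      from bounded_linear.has_vector_derivative[OF bounded_linear_snd xd[OF this]]
      show "((\<lambda>t. snd (x t)) has_vector_derivative P t ** snd (x t) + Q t ** fst (x t)) (at t within {0..T})"
        by (simp add: F_def add.commute)
    qed (intro continuous_intros x(1) P Q)
  qed (use x(2)[of T] T in auto)
qed

lemma C1_with_continuous: "C1_with T f f' \<Longrightarrow> continuous_on {0..T} f"
  unfolding C1_with_def by (metis continuous_on_eq_continuous_within has_vector_derivative_continuous)

text \<open>Gronwall is applied to |A| + |B|, and the result is fed back into the bound for B alone.
  There the integral carries the factor p + q \<le> \<delta>, so the whole estimate is proportional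
  to \<delta>; this is the expression in braces of the smallness condition on \<delta>.\<close>

lemma second_order_linear_ode_bound:
  fixes A B C P Q :: "real \<Rightarrow> real^'n^'n"
  assumes T: "0 < T" and AB: "C1_with T A B" and BC: "C1_with T B C"
    and eq: "\<And>t. t\<in>{0..T} \<Longrightarrow> C t = P t ** B t + Q t ** A t"
    and p: "\<And>t. t\<in>{0..T} \<Longrightarrow> norm (P t) \<le> p" and q: "\<And>t. t\<in>{0..T} \<Longrightarrow> norm (Q t) \<le> q"
    and AT: "A T = mat 1" and sum: "norm (B T) + p + q \<le> \<delta>" and t: "t \<in> {0..T}"
  defines "r \<equiv> sqrt (real CARD('n))"
  shows "norm (B t) \<le> \<delta> * (1 + T * (r + \<delta>) * exp (T * (r + \<delta>)))"
proof -
  \<comment> \<open>Used to replace the coefficient 1 + p + q of the integral by r + \<delta>, so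
    that the additive constant and the rate in Gronwall's inequality coincide.\<close>
  have r1: "1 \<le> r" using zero_less_card_finite[where 'a='n] by (simp add: r_def Suc_leI)
  have p0: "0 \<le> p" "0 \<le> q" using p[of 0] q[of 0] T order_trans[OF norm_ge_zero] by auto
  have d0: "0 \<le> \<delta>" using sum p0 order_trans[OF norm_ge_zero, of "B T"] by (smt (verit) norm_ge_zero)
  have cA: "continuous_on {0..T} A" and cB: "continuous_on {0..T} B"
    using AB BC by (auto dest: C1_with_continuous)
  have pq: "p + q \<le> \<delta>" using sum norm_ge_zero[of "B T"] by linarith
  define u where "u = (\<lambda>t. norm (A t) + norm (B t))"
  have cu: "continuous_on {0..T} u" unfolding u_def by (intro continuous_intros cA cB)
  have sub: "{s..T} \<subseteq> {0..T}" if "s \<in> {0..T}" for s using that by auto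
  have iu: "u integrable_on {s..T}" if "s \<in> {0..T}" for s
    using continuous_on_subset[OF cu sub[OF that]] by (rule integrable_continuous_real)
  have HA: "(B has_integral A T - A s) {s..T}" if "s \<in> {0..T}" for s
    using AB that by (intro integral_derivative_backward) (auto simp: C1_with_def)
  have HB: "(C has_integral B T - B s) {s..T}" if "s \<in> {0..T}" for s
    using BC that by (intro integral_derivative_backward) (auto simp: C1_with_def)
  have Ale: "norm (A s) \<le> r + integral {s..T} u" if s: "s \<in> {0..T}" for s
  proof -
    have "norm (integral {s..T} B) \<le> integral {s..T} u"
      using HA[OF s] iu[OF s] by (intro integral_norm_bound_integral) (auto simp: u_def)
    then show ?thesis
      using integral_unique[OF HA[OF s]] norm_triangle_ineq4[of "A T" "A T - A s"] AT by (simp add: norm_mat_1 r_def)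
  qed
  have Ble: "norm (B s) \<le> norm (B T) + (p + q) * integral {s..T} u" if s: "s \<in> {0..T}" for s
  proof -
    have "norm (integral {s..T} C) \<le> integral {s..T} (\<lambda>t. (p + q) * u t)"
    proof (intro integral_norm_bound_integral)
      fix x assume "x \<in> {s..T}"
      then have x: "x \<in> {0..T}" using sub[OF s] by auto
      have "norm (C x) \<le> norm (P x) * norm (B x) + norm (Q x) * norm (A x)"
        unfolding eq[OF x] by (rule norm_triangle_le[OF add_mono]) (rule norm_matrix_mult_le)+
      also have "\<dots> \<le> p * u x + q * u x"
        using p[OF x] q[OF x] p0 by (intro add_mono mult_mono) (auto simp: u_def)
      finally show "norm (C x) \<le> (p + q) * u x" by (simp add: algebra_simps)
    qed (use HB[OF s] iu[OF s] in \<open>auto intro: integrable_on_mult_right\<close>)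
    then have "norm (integral {s..T} C) \<le> (p + q) * integral {s..T} u" by simp
    then show ?thesis
      using integral_unique[OF HB[OF s]] norm_triangle_ineq4[of "B T" "B T - B s"] by simp
  qed
  have ule: "u s \<le> (r + \<delta>) + (r + \<delta>) * integral {s..T} u" if s: "s \<in> {0..T}" for s
  proof -
    have I0: "0 \<le> integral {s..T} u"
      using iu[OF s] by (intro integral_nonneg) (auto simp: u_def)
    have "u s \<le> (r + norm (B T)) + (1 + (p + q)) * integral {s..T} u"
      using Ale[OF s] Ble[OF s] by (simp add: u_def algebra_simps)
    also have "\<dots> \<le> (r + \<delta>) + (r + \<delta>) * integral {s..T} u"
      using sum p0 pq r1 I0 by (intro add_mono mult_right_mono) auto
    finally show ?thesis .
  qed
  have ub: "u s \<le> (r + \<delta>) * exp ((r + \<delta>) * T)" if s: "s \<in> {0..T}" for s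
  proof -
    have "u s \<le> (r + \<delta>) * exp ((r + \<delta>) * (T - s))"
      by (rule gronwall_backward[OF cu _ ule s]) (use r1 d0 in auto)
    also have "\<dots> \<le> (r + \<delta>) * exp ((r + \<delta>) * T)"
      using s r1 d0 by (intro mult_left_mono) (auto intro!: mult_left_mono)
    finally show ?thesis .
  qed
  have "norm (integral {t..T} u) \<le> ((r + \<delta>) * exp ((r + \<delta>) * T)) * (T - t)"
    using ub sub[OF t] t continuous_on_subset[OF cu sub[OF t]]
    by (intro norm_integral_le_const) (auto simp: u_def)
  also have "\<dots> \<le> ((r + \<delta>) * exp ((r + \<delta>) * T)) * T"
    using t r1 d0 by (intro mult_left_mono) auto
  finally have "(p + q) * integral {t..T} u \<le> \<delta> * (((r + \<delta>) * exp ((r + \<delta>) * T)) * T)"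
    using p0 pq d0 r1 T
    by (intro mult_mono) (auto intro!: integral_nonneg iu[OF t], simp add: u_def)
  moreover have "norm (B T) \<le> \<delta>" using sum p0 by simp
  ultimately have "norm (B t) \<le> \<delta> + \<delta> * (((r + \<delta>) * exp ((r + \<delta>) * T)) * T)" using Ble[OF t] by linarith
  then show ?thesis by (simp add: algebra_simps)
qed

text \<open>By the resolvent identity the difference of two inverses is the product of one inverse,
  the difference of the matrices and the other inverse; the uniform bound b controls both outer
  factors.\<close>

lemma continuous_on_matrix_inv:
  fixes A :: "real \<Rightarrow> real^'n^'n"
  assumes A: "continuous_on S A" and inv: "\<And>t. t \<in> S \<Longrightarrow> invertible (A t)"
    and b: "\<And>t. t \<in> S \<Longrightarrow> norm (matrix_inv (A t)) \<le> b"
  shows "continuous_on S (\<lambda>t. matrix_inv (A t))"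
  unfolding continuous_on
proof
  fix t assume t: "t \<in> S"
  have At: "((\<lambda>s. A t - A s) \<longlongrightarrow> 0) (at t within S)"
    using A t tendsto_diff[OF tendsto_const, of A "A t" "at t within S" "A t"] by (auto simp: continuous_on)
  have "((\<lambda>s. matrix_inv (A s) - matrix_inv (A t)) \<longlongrightarrow> 0) (at t within S)"
  proof (rule tendsto_0_le[OF At, of _ "b * b"])
    show "\<forall>\<^sub>F s in at t within S. norm (matrix_inv (A s) - matrix_inv (A t)) \<le> norm (A t - A s) * (b * b)"
      unfolding eventually_at_filter
    proof (intro always_eventually allI impI)
      fix s assume s: "s \<in> S"
      have "matrix_inv (A s) - matrix_inv (A t) = matrix_inv (A s) ** (A t - A s) ** matrix_inv (A t)"
        by (simp add: matrix_diff_mult_left matrix_diff_mult_right matrix_mul_assoc[symmetric]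
            matrix_inv_mult[OF inv[OF s]] matrix_inv_mult[OF inv[OF t]])
      also have "norm \<dots> \<le> (norm (matrix_inv (A s)) * norm (A t - A s)) * norm (matrix_inv (A t))"
        by (rule order_trans[OF norm_matrix_mult_le mult_right_mono[OF norm_matrix_mult_le]]) simp
      also have "\<dots> \<le> (b * norm (A t - A s)) * b"
        using b[OF s] b[OF t] order_trans[OF norm_ge_zero b[OF s]] by (intro mult_mono) auto
      finally show "norm (matrix_inv (A s) - matrix_inv (A t)) \<le> norm (A t - A s) * (b * b)"
        by (simp add: mult_ac)
    qed
  qed
  then show "((\<lambda>s. matrix_inv (A s)) \<longlongrightarrow> matrix_inv (A t)) (at t within S)"
    by (simp add: LIM_zero_iff)
qed

text \<open>The estimate for B = A' keeps A within 1/2 of the identity, which gives the bound for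
  chi. The integral equation is a uniqueness statement: its defect, multiplied by A, solves a
  homogeneous linear equation with zero terminal value.\<close>

lemma jacobi_equation_chi:
  fixes \<sigma> \<sigma>' A B C :: "real \<Rightarrow> real^'n^'n"
  assumes T: "0 < T" and sg: "C1_with T \<sigma> \<sigma>'"
    and small: "norm (\<sigma> T) + supn T \<sigma>' + 2 * supn T (\<lambda>t. (1/2) *\<^sub>R (\<sigma> t - transpose (\<sigma> t))) < \<delta>"
    and cond: "\<delta> * T * (2 * sqrt (real CARD('n))) *
      (1 + T * (sqrt (real CARD('n)) + \<delta>) * exp (T * (sqrt (real CARD('n)) + \<delta>))) < 1"
    and AB: "C1_with T A B" and BC: "C1_with T B C"
    and eq: "\<And>t. t\<in>{0..T} \<Longrightarrow> C t = 2 *\<^sub>R (((1/2) *\<^sub>R (\<sigma> t - transpose (\<sigma> t))) ** B t) + \<sigma>' t ** A t"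
    and AT: "A T = mat 1" and BT: "B T = \<sigma> T"
  defines "chi \<equiv> \<lambda>t. B t ** matrix_inv (A t)"
  shows "\<And>t. t \<in> {0..T} \<Longrightarrow> det (A t) \<noteq> 0" "continuous_on {0..T} chi" "T * supn T chi < 1"
    "\<And>t. t \<in> {0..T} \<Longrightarrow> \<sigma> t = chi t - integral {t..T} (\<lambda>u. transpose (chi u) ** chi u)"
    "det (A 0) = exp (- integral {0..T} (\<lambda>t. trace (chi t)))"
proof -
  define r where "r = sqrt (real CARD('n))"
  have r1: "1 \<le> r" using zero_less_card_finite[where 'a='n] by (simp add: r_def Suc_leI)
  have cs: "continuous_on {0..T} \<sigma>" and cs': "continuous_on {0..T} \<sigma>'"
    using C1_with_continuous[OF sg] sg by (auto simp: C1_with_def)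
  have csA: "continuous_on {0..T} (\<lambda>t. (1/2) *\<^sub>R (\<sigma> t - transpose (\<sigma> t)))"
    by (intro continuous_intros cs)
  have cA: "continuous_on {0..T} A" and cB: "continuous_on {0..T} B"
    using AB BC by (auto dest: C1_with_continuous)
  \<comment> \<open>Gronwall's bound for |A'|. The coefficient of A' being 2 \<sigma>_A explains the
    term with factor 2 in the hypothesis on \<sigma>.\<close>
  define V where "V = \<delta> * (1 + T * (r + \<delta>) * exp (T * (r + \<delta>)))"
  have Bb: "norm (B t) \<le> V" if t: "t \<in> {0..T}" for t
    unfolding V_def r_def
  proof (rule second_order_linear_ode_bound[OF T AB BC])
    fix t assume t: "t \<in> {0..T}"
    show "C t = (2 *\<^sub>R ((1/2) *\<^sub>R (\<sigma> t - transpose (\<sigma> t)))) ** B t + \<sigma>' t ** A t"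
      using eq[OF t] by (simp add: bounded_bilinear.scaleR_left[OF bounded_bilinear_matrix_mult])
    show "norm (2 *\<^sub>R ((1/2) *\<^sub>R (\<sigma> t - transpose (\<sigma> t)))) \<le> 2 * supn T (\<lambda>t. (1/2) *\<^sub>R (\<sigma> t - transpose (\<sigma> t)))"
      using norm_le_supn[OF csA t] by simp
    show "norm (\<sigma>' t) \<le> supn T \<sigma>'" by (rule norm_le_supn[OF cs' t])
  qed (use small BT AT t in auto)
  have V0: "0 \<le> V" using order_trans[OF norm_ge_zero Bb[of 0]] T by simp
  have TV: "T * V * (2 * r) < 1" using cond by (simp add: V_def r_def mult_ac)
  \<comment> \<open>Half the distance to singularity: since 1 - T V > 1/2, the inverse of A is
    bounded by 2 r, and then T |chi| \<le> T V 2 r < 1.\<close>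
  have TV': "T * V < 1 / 2"
  proof -
    have "T * V * 2 \<le> T * V * (2 * r)" using r1 T V0 by (intro mult_left_mono) auto
    then show ?thesis using TV by simp
  qed
  have near: "norm (A t - mat 1) \<le> T * V" if t: "t \<in> {0..T}" for t
  proof -
    have "(B has_integral A T - A t) {t..T}"
      using AB t by (intro integral_derivative_backward) (auto simp: C1_with_def)
    then have "norm (A T - A t) \<le> V * (T - t)"
      using norm_integral_le_const[of t T B V] Bb t continuous_on_subset[OF cB, of "{t..T}"]
      by (auto dest: integral_unique)
    also have "\<dots> \<le> V * T" using V0 t by (intro mult_left_mono) auto
    finally show ?thesis by (simp add: AT norm_minus_commute mult.commute)
  qed
  have inv: "invertible (A t)" if "t \<in> {0..T}" for t
    using matrix_near_identity(1)[OF near[OF that]] TV' by simp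
  show "det (A t) \<noteq> 0" if "t \<in> {0..T}" for t using inv[OF that] by (simp add: invertible_det_nz)
  have invb: "norm (matrix_inv (A t)) \<le> 2 * r" if "t \<in> {0..T}" for t
  proof -
    have "norm (matrix_inv (A t)) * (1/2) \<le> norm (matrix_inv (A t)) * (1 - T * V)"
      using TV' by (intro mult_left_mono) auto
    also have "\<dots> \<le> r" using matrix_near_identity(2)[OF near[OF that]] TV' by (simp add: r_def)
    finally show ?thesis by simp
  qed
  have cinv: "continuous_on {0..T} (\<lambda>t. matrix_inv (A t))"
    by (rule continuous_on_matrix_inv[OF cA inv invb])
  show cchi: "continuous_on {0..T} chi"
    unfolding chi_def by (intro continuous_intros cB cinv)
  have "supn T chi \<le> V * (2 * r)"
  proof (rule supn_le)
    fix t assume t: "t \<in> {0..T}"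
    show "norm (chi t) \<le> V * (2 * r)"
      unfolding chi_def
      by (rule order_trans[OF norm_matrix_mult_le]) (intro mult_mono Bb invb t V0 norm_ge_zero)
  qed (use T in simp)
  then have "T * supn T chi \<le> T * (V * (2 * r))" using T by (intro mult_left_mono) auto
  then show "T * supn T chi < 1" using TV by (simp add: mult.assoc)
  have chiA: "chi t ** A t = B t" if "t \<in> {0..T}" for t
    by (simp add: chi_def matrix_mul_assoc[symmetric] matrix_inv_mult[OF inv[OF that]])
  show "det (A 0) = exp (- integral {0..T} (\<lambda>t. trace (chi t)))"
    by (rule det_liouville[where chi = chi]) (use T AB chiA cchi AT in \<open>auto simp: C1_with_def\<close>)
  define J where "J = (\<lambda>t. integral {t..T} (\<lambda>u. transpose (chi u) ** chi u))"
  have sub: "{s..T} \<subseteq> {0..T}" if "s \<in> {0..T}" for s using that by auto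
  have cg: "continuous_on {0..T} (\<lambda>u. transpose (chi u) ** chi u)" by (intro continuous_intros cchi)
  have Jd: "(J has_vector_derivative - (transpose (chi t) ** chi t)) (at t within {0..T})" if "t \<in> {0..T}" for t
    unfolding J_def by (rule has_vector_derivative_integral_left[OF cg that])
  have Jsym: "transpose (J t) = J t" if "t \<in> {0..T}" for t
    unfolding J_def by (rule gram_integral_symmetric[OF continuous_on_subset[OF cchi sub[OF that]]])
  have cJ: "continuous_on {0..T} J"
    by (metis Jd continuous_on_eq_continuous_within has_vector_derivative_continuous)
  \<comment> \<open>D is the defect of the integral equation for chi and E = D A. Since chi A = B,
    the inverse of A disappears from E, which can be differentiated directly.\<close>
  define D where "D = (\<lambda>t. \<sigma> t - chi t + J t)"
  define E where "E = (\<lambda>t. (\<sigma> t + J t) ** A t - B t)"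
  have cD: "continuous_on {0..T} D" unfolding D_def by (intro continuous_intros cs cchi cJ)
  have cE: "continuous_on {0..T} E" unfolding E_def by (intro continuous_intros cs cA cB cJ)
  have EDA: "E t = D t ** A t" if "t \<in> {0..T}" for t
    by (simp add: E_def D_def matrix_diff_mult_right bounded_bilinear.add_left[OF bounded_bilinear_matrix_mult] chiA[OF that])
  have DE: "D t = E t ** matrix_inv (A t)" if "t \<in> {0..T}" for t
    by (simp add: EDA[OF that] matrix_mul_assoc[symmetric] matrix_inv_mult[OF inv[OF that]])
  \<comment> \<open>The terms with \<sigma>' A cancel, chi^T chi A becomes chi^T B, and \<sigma> B -
    (\<sigma> - \<sigma>^T) B leaves \<sigma>^T B. What remains is (\<sigma>^T - chi^T + J) B, the
    transpose of D times B because J is symmetric.\<close>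
  have Ed: "(E has_vector_derivative (transpose (D t) ** B t)) (at t within {0..T})" if t: "t \<in> {0..T}" for t
  proof -
    have "((\<lambda>t. \<sigma> t + J t) has_vector_derivative (\<sigma>' t - transpose (chi t) ** chi t)) (at t within {0..T})"
      using has_vector_derivative_add[OF _ Jd[OF t], of \<sigma> "\<sigma>' t"] sg t by (simp add: C1_with_def)
    from bounded_bilinear.has_vector_derivative[OF bounded_bilinear_matrix_mult this, of A "B t"]
    have "((\<lambda>t. (\<sigma> t + J t) ** A t) has_vector_derivative
        ((\<sigma> t + J t) ** B t + (\<sigma>' t - transpose (chi t) ** chi t) ** A t)) (at t within {0..T})"
      using AB t by (simp add: C1_with_def)
    from has_vector_derivative_diff[OF this, of B "C t"] BC t
    have "(E has_vector_derivative
        ((\<sigma> t + J t) ** B t + (\<sigma>' t - transpose (chi t) ** chi t) ** A t - C t)) (at t within {0..T})"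
      by (simp add: C1_with_def E_def)
    also have "(\<sigma> t + J t) ** B t + (\<sigma>' t - transpose (chi t) ** chi t) ** A t - C t = transpose (D t) ** B t"
      unfolding eq[OF t]
      by (simp add: matrix_diff_mult_right bounded_bilinear.add_left[OF bounded_bilinear_matrix_mult] matrix_mul_assoc[symmetric] chiA[OF t] D_def
          transpose_diff transpose_add Jsym[OF t] bounded_bilinear.scaleR_left[OF bounded_bilinear_matrix_mult])
    finally show ?thesis .
  qed
  have ET: "E T = 0" by (simp add: E_def J_def AT BT)
  have "norm (E t) \<le> 0 + (2 * r * V) * integral {t..T} (\<lambda>s. norm (E s))" if t: "t \<in> {0..T}" for t
  proof -
    have HE: "((\<lambda>t. transpose (D t) ** B t) has_integral E T - E t) {t..T}"
      by (rule integral_derivative_backward[OF Ed t])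
    have "norm (integral {t..T} (\<lambda>t. transpose (D t) ** B t)) \<le> integral {t..T} (\<lambda>s. (2 * r * V) * norm (E s))"
    proof (intro integral_norm_bound_integral)
      fix s assume "s \<in> {t..T}"
      then have s: "s \<in> {0..T}" using sub[OF t] by auto
      have "norm (transpose (D s) ** B s) \<le> norm (D s) * norm (B s)"
        using norm_matrix_mult_le[of "transpose (D s)" "B s"] by (simp add: norm_transpose)
      also have "\<dots> \<le> (norm (E s) * norm (matrix_inv (A s))) * norm (B s)"
        unfolding DE[OF s] by (intro mult_right_mono norm_matrix_mult_le) auto
      also have "\<dots> \<le> (norm (E s) * (2 * r)) * V"
        using r1 by (intro mult_mono invb[OF s] Bb[OF s]) auto
      finally show "norm (transpose (D s) ** B s) \<le> (2 * r * V) * norm (E s)" by (simp add: mult_ac)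
    next
      show "(\<lambda>s. (2 * r * V) * norm (E s)) integrable_on {t..T}"
        by (intro integrable_continuous_real continuous_intros continuous_on_subset[OF cE sub[OF t]])
    qed (use HE in auto)
    then show ?thesis using integral_unique[OF HE] by (simp add: ET)
  qed
  then have "norm (E t) \<le> 0 * exp ((2 * r * V) * (T - t))" if "t \<in> {0..T}" for t
    by (intro gronwall_backward[OF _ _ _ that]) (use r1 V0 cE in \<open>auto intro!: continuous_intros\<close>)
  then have "D t = 0" if "t \<in> {0..T}" for t using that by (simp add: DE)
  then show "\<sigma> t = chi t - integral {t..T} (\<lambda>u. transpose (chi u) ** chi u)" if "t \<in> {0..T}" for t
    using that by (simp add: D_def J_def algebra_simps eq_neg_iff_add_eq_0)
qed

section \<open>Path space and the inverse of the identity plus the Volterra operator\<close>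

lemma Wsp_cont: "w \<in> Wsp T \<Longrightarrow> continuous_on {0..T} w"
  and Wsp_0: "w \<in> Wsp T \<Longrightarrow> w 0 = 0"
  and Wsp_out: "w \<in> Wsp T \<Longrightarrow> t \<notin> {0..T} \<Longrightarrow> w t = 0"
  by (auto simp: Wsp_def)

lemma Wsp_lin:
  assumes "v \<in> Wsp T" "w \<in> Wsp T"
  shows "(\<lambda>t. a *\<^sub>R v t + b *\<^sub>R w t) \<in> Wsp T"
  using assms by (auto simp: Wsp_def intro!: continuous_intros)

lemma Wsp_eqI:
  assumes "v \<in> Wsp T" "w \<in> Wsp T" "\<And>t. t \<in> {0..T} \<Longrightarrow> v t = w t" shows "v = w"
  using assms by (auto simp: fun_eq_iff Wsp_def) (metis)

lemma Fop_Wsp: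
  assumes w: "w \<in> Wsp T" and chi: "continuous_on {0..T} chi"
  shows "Fop T chi w \<in> Wsp T"
proof -
  have "(\<lambda>s. chi s *v w s) integrable_on {0..T}"
    by (intro integrable_continuous_real continuous_intros chi Wsp_cont[OF w])
  then have "continuous_on {0..T} (\<lambda>t. - integral {0..t} (\<lambda>s. chi s *v w s))"
    by (intro continuous_intros indefinite_integral_continuous_1)
  then have "continuous_on {0..T} (Fop T chi w)"
    by (rule continuous_on_eq) (simp add: Fop_def)
  then show ?thesis by (auto simp: Wsp_def Fop_def)
qed

lemma Fop_lin:
  assumes v: "v \<in> Wsp T" and w: "w \<in> Wsp T" and chi: "continuous_on {0..T} chi"
  shows "Fop T chi (\<lambda>t. a *\<^sub>R v t + b *\<^sub>R w t) t = a *\<^sub>R Fop T chi v t + b *\<^sub>R Fop T chi w t"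
proof (cases "t \<in> {0..T}")
  case True
  have int: "(\<lambda>s. chi s *v w s) integrable_on {0..t}" if "w \<in> Wsp T" for w :: "real \<Rightarrow> real^'a"
    using True by (intro integrable_continuous_real continuous_intros continuous_on_subset[OF chi]
      continuous_on_subset[OF Wsp_cont[OF that]]) auto
  have "integral {0..t} (\<lambda>s. chi s *v (a *\<^sub>R v s + b *\<^sub>R w s))
    = integral {0..t} (\<lambda>s. a *\<^sub>R (chi s *v v s) + b *\<^sub>R (chi s *v w s))"
    by (simp add: matrix_vector_right_distrib bounded_bilinear.scaleR_right[OF bounded_bilinear_matrix_vector_mult])
  also have "\<dots> = a *\<^sub>R integral {0..t} (\<lambda>s. chi s *v v s) + b *\<^sub>R integral {0..t} (\<lambda>s. chi s *v w s)"
    by (simp add: integral_add integrable_cmul int[OF v] int[OF w])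
  finally show ?thesis using True by (simp add: Fop_def)
qed (auto simp: Fop_def)

lemma norm_Fop_le:
  assumes w: "w \<in> Wsp T" and chi: "continuous_on {0..T} chi" and t: "t \<in> {0..T}"
  shows "norm (Fop T chi w t) \<le> T * supn T chi * supn T w"
proof -
  have T: "0 \<le> T" using t by simp
  have nn: "0 \<le> supn T chi" "0 \<le> supn T w" using supn_nonneg[OF T chi] supn_nonneg[OF T Wsp_cont[OF w]] by auto
  have "norm (integral {0..t} (\<lambda>s. chi s *v w s)) \<le> (supn T chi * supn T w) * (t - 0)"
  proof (rule norm_integral_le_const)
    show "continuous_on {0..t} (\<lambda>s. chi s *v w s)"
      using t by (intro continuous_intros continuous_on_subset[OF chi] continuous_on_subset[OF Wsp_cont[OF w]]) auto
    fix s assume "s \<in> {0..t}"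
    then have s: "s \<in> {0..T}" using t by auto
    show "norm (chi s *v w s) \<le> supn T chi * supn T w"
      by (rule order_trans[OF norm_matrix_vector_mult_le])
        (intro mult_mono norm_le_supn chi s Wsp_cont[OF w] nn norm_ge_zero)
  qed (use t in auto)
  also have "\<dots> \<le> (supn T chi * supn T w) * T" using t nn by (intro mult_left_mono) auto
  finally show ?thesis using t by (simp add: Fop_def mult_ac)
qed

text \<open>The operator has norm at most T |chi| < 1, so its contribution can be absorbed on the
  left. The estimate yields both uniqueness and boundedness of the inverse.\<close>

lemma supn_le_of_Fop_eq:
  assumes x: "x \<in> Wsp T" and w: "w \<in> Wsp T" and T: "0 \<le> T" and chi: "continuous_on {0..T} chi"
    and q: "T * supn T chi < 1" and eq: "\<And>t. x t + Fop T chi x t = w t"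
  shows "supn T x \<le> 1 / (1 - T * supn T chi) * supn T w"
proof -
  have "supn T x \<le> supn T w + T * supn T chi * supn T x"
  proof (rule supn_le[OF T])
    fix t assume t: "t \<in> {0..T}"
    have "norm (x t) \<le> norm (w t) + norm (Fop T chi x t)"
      using norm_triangle_ineq4[of "w t" "Fop T chi x t"] unfolding eq[of t, symmetric] by simp
    then show "norm (x t) \<le> supn T w + T * supn T chi * supn T x"
      using norm_Fop_le[OF x chi t] norm_le_supn[OF Wsp_cont[OF w] t] by linarith
  qed
  then have "(1 - T * supn T chi) * supn T x \<le> supn T w" by (simp add: algebra_simps)
  then show ?thesis using q by (simp add: field_simps)
qed

text \<open>The inverse image of w solves the linear Volterra equation X = w + integral of chi X.
  Linearity and the left-inverse property follow from uniqueness of the solution.\<close>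

lemma cont_lin_inverse_exists:
  fixes chi :: "real \<Rightarrow> real^'d^'d"
  assumes T: "0 < T" and chi: "continuous_on {0..T} chi" and q: "T * supn T chi < 1"
  shows "\<exists>G. cont_lin_inverse T chi G"
proof -
  have T0: "0 \<le> T" using T by simp
  define sol where "sol = (\<lambda>(w :: real \<Rightarrow> real^'d) x. x \<in> Wsp T \<and> (\<forall>t. x t + Fop T chi x t = w t))"
  have ex: "\<exists>x. sol w x" if w: "w \<in> Wsp T" for w
  proof -
    have "\<exists>x. continuous_on {0..T} x \<and>
      (\<forall>t\<in>{0..T}. x t \<in> UNIV \<and> x t = w t + integral {0..t} (\<lambda>s. chi s *v x s))"
    proof (rule volterra_exists[where ?x0.0 = "\<lambda>_. 0" and L = "supn T chi"])
      fix s and x y :: "real^'d" assume s: "s \<in> {0..T}"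
      have "norm (chi s *v (x - y)) \<le> supn T chi * norm (x - y)"
        by (rule order_trans[OF norm_matrix_vector_mult_le mult_right_mono[OF norm_le_supn[OF chi s]]]) simp
      then show "norm (chi s *v x - chi s *v y) \<le> supn T chi * norm (x - y)"
        by (simp add: matrix_vector_mult_diff_distrib)
    qed (use T0 chi supn_nonneg[OF T0 chi] Wsp_cont[OF w] in \<open>auto intro!: continuous_intros\<close>)
    then obtain x where x: "continuous_on {0..T} x"
      "\<And>t. t\<in>{0..T} \<Longrightarrow> x t = w t + integral {0..t} (\<lambda>s. chi s *v x s)" by blast
    \<comment> \<open>\<open>Wsp T\<close> prescribes the value 0 off [0,T], while the Volterra
      solution is controlled only on the interval.\<close>
    define y where "y = (\<lambda>t. if t \<in> {0..T} then x t else 0)"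
    have "continuous_on {0..T} y" by (rule continuous_on_eq[OF x(1)]) (simp add: y_def)
    moreover have "x 0 = 0" using x(2)[of 0] T Wsp_0[OF w] by simp
    ultimately have y: "y \<in> Wsp T" using T by (auto simp: Wsp_def y_def)
    have "y t + Fop T chi y t = w t" for t
    proof (cases "t \<in> {0..T}")
      case True
      have "integral {0..t} (\<lambda>s. chi s *v y s) = integral {0..t} (\<lambda>s. chi s *v x s)"
        by (rule integral_cong) (use True in \<open>auto simp: y_def\<close>)
      then show ?thesis using x(2)[OF True] True by (simp add: y_def Fop_def)
    next
      case False then show ?thesis using Wsp_out[OF w False] unfolding y_def Fop_def by (simp only: if_False add_0_left)
    qed
    with y show ?thesis by (auto simp: sol_def)
  qed
  have uniq: "x = y" if "sol w x" "sol w y" for w x y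
  proof -
    define z where "z = (\<lambda>t. 1 *\<^sub>R x t + (-1) *\<^sub>R y t)"
    have xy: "x \<in> Wsp T" "y \<in> Wsp T" using that by (auto simp: sol_def)
    have z: "z \<in> Wsp T" unfolding z_def by (rule Wsp_lin[OF xy])
    have z0: "(\<lambda>t. 0) \<in> Wsp T" by (simp add: Wsp_def)
    have Fz: "Fop T chi z t = 1 *\<^sub>R Fop T chi x t + (-1) *\<^sub>R Fop T chi y t" for t
      unfolding z_def by (rule Fop_lin[OF xy chi])
    have xy_eq: "x t + Fop T chi x t = y t + Fop T chi y t" for t using that by (simp add: sol_def)
    have "z t + Fop T chi z t = (x t + Fop T chi x t) - (y t + Fop T chi y t)" for t
      unfolding Fz by (simp add: z_def)
    then have "z t + Fop T chi z t = 0" for t by (simp add: xy_eq)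
    from supn_le_of_Fop_eq[OF z z0 T0 chi q this]
    have "supn T z \<le> 0" using T by (simp add: supn_def)
    then have "norm (z t) \<le> 0" if "t \<in> {0..T}" for t
      using norm_le_supn[OF Wsp_cont[OF z] that] by linarith
    then show "x = y" by (intro Wsp_eqI[OF xy]) (auto simp: z_def)
  qed
  define G where "G = (\<lambda>w. SOME x. sol w x)"
  have G: "sol w (G w)" if "w \<in> Wsp T" for w
    unfolding G_def by (rule someI_ex[OF ex[OF that]])
  have Geq: "G w = x" if "w \<in> Wsp T" "sol w x" for w x
    using uniq[OF G[OF that(1)] that(2)] .
  have "cont_lin_inverse T chi G"
    unfolding cont_lin_inverse_def
  proof (intro conjI ballI allI)
    fix w :: "real \<Rightarrow> real^'d" assume w: "w \<in> Wsp T"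
    show "G w \<in> Wsp T" using G[OF w] by (simp add: sol_def)
    show "(\<lambda>t. G w t + Fop T chi (G w) t) = w" using G[OF w] by (auto simp: sol_def)
    have "(\<lambda>t. 1 *\<^sub>R w t + 1 *\<^sub>R Fop T chi w t) \<in> Wsp T" by (rule Wsp_lin[OF w Fop_Wsp[OF w chi]])
    then show "G (\<lambda>t. w t + Fop T chi w t) = w" by (intro Geq) (auto simp: sol_def w)
    fix v :: "real \<Rightarrow> real^'d" and a b assume v: "v \<in> Wsp T"
    show "G (\<lambda>t. a *\<^sub>R v t + b *\<^sub>R w t) = (\<lambda>t. a *\<^sub>R G v t + b *\<^sub>R G w t)"
    proof (rule Geq[OF Wsp_lin[OF v w]])
      have *: "G v \<in> Wsp T" "G w \<in> Wsp T" "\<And>t. v t = G v t + Fop T chi (G v) t" "\<And>t. w t = G w t + Fop T chi (G w) t"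
        using G[OF v] G[OF w] by (auto simp: sol_def)
      show "sol (\<lambda>t. a *\<^sub>R v t + b *\<^sub>R w t) (\<lambda>t. a *\<^sub>R G v t + b *\<^sub>R G w t)"
        unfolding sol_def
      proof (intro conjI allI Wsp_lin *(1,2))
        fix t
        show "a *\<^sub>R G v t + b *\<^sub>R G w t + Fop T chi (\<lambda>t. a *\<^sub>R G v t + b *\<^sub>R G w t) t = a *\<^sub>R v t + b *\<^sub>R w t"
          by (simp add: Fop_lin[OF *(1,2) chi] *(3)[of t] *(4)[of t] scaleR_add_right)
      qed
    qed
  next
    show "\<exists>C. \<forall>w\<in>Wsp T. supn T (G w) \<le> C * supn T w"
      using supn_le_of_Fop_eq[OF _ _ T0 chi q] G by (intro exI[of _ "1 / (1 - T * supn T chi)"]) (auto simp: sol_def)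
  qed
  then show ?thesis by blast
qed

section \<open>Characteristic functions determine a probability measure\<close>

text \<open>The real functions whose integrals can be read off from the characteristic function:
  real and imaginary parts of characters, and their linear combinations.\<close>

inductive_set trig_span :: "('a \<Rightarrow> real) set \<Rightarrow> ('a \<Rightarrow> real) set" for L where
  cos: "\<phi> \<in> L \<Longrightarrow> (\<lambda>x. cos (\<phi> x)) \<in> trig_span L"
| sin: "\<phi> \<in> L \<Longrightarrow> (\<lambda>x. sin (\<phi> x)) \<in> trig_span L"
| add: "f \<in> trig_span L \<Longrightarrow> g \<in> trig_span L \<Longrightarrow> (\<lambda>x. f x + g x) \<in> trig_span L"
| scale: "f \<in> trig_span L \<Longrightarrow> (\<lambda>x. c * f x) \<in> trig_span L"

lemma trig_span_combine:
  assumes "f \<in> trig_span L" "g \<in> trig_span L" "\<And>x. h x = a * f x + b * g x"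
  shows "h \<in> trig_span L"
proof -
  have "h = (\<lambda>x. a * f x + b * g x)" using assms(3) by auto
  then show ?thesis using assms(1,2) by (auto intro: trig_span.intros)
qed

text \<open>The product-to-sum formulas. They need sums and differences of phases, hence the closure
  conditions on L.\<close>

lemma trig_span_mult:
  assumes add: "\<And>\<phi> \<psi>. \<phi> \<in> L \<Longrightarrow> \<psi> \<in> L \<Longrightarrow> (\<lambda>x. \<phi> x + \<psi> x) \<in> L"
    and diff: "\<And>\<phi> \<psi>. \<phi> \<in> L \<Longrightarrow> \<psi> \<in> L \<Longrightarrow> (\<lambda>x. \<phi> x - \<psi> x) \<in> L"
    and f: "f \<in> trig_span L" and g: "g \<in> trig_span L"
  shows "(\<lambda>x. f x * g x) \<in> trig_span L"
  using f
proof induction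
  case (cos \<phi>)
  from g show ?case
  proof induction
    case (cos \<psi>)
    show ?case
      by (rule trig_span_combine[OF trig_span.cos[OF diff] trig_span.cos[OF add], of \<phi> \<psi> \<phi> \<psi> _ "1/2" "1/2"])
        (use cos \<open>\<phi> \<in> L\<close> in \<open>auto simp: cos_add cos_diff field_simps\<close>)
  next
    case (sin \<psi>)
    show ?case
      by (rule trig_span_combine[OF trig_span.sin[OF add] trig_span.sin[OF diff], of \<phi> \<psi> \<phi> \<psi> _ "1/2" "-1/2"])
        (use sin \<open>\<phi> \<in> L\<close> in \<open>auto simp: sin_add sin_diff field_simps\<close>)
  next
    case (add f g) then show ?case by (simp add: distrib_left trig_span.add)
  next
    case (scale f c) then show ?case using trig_span.scale[OF scale.IH, of c] by (simp add: mult_ac)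
  qed
next
  case (sin \<phi>)
  from g show ?case
  proof induction
    case (cos \<psi>)
    show ?case
      by (rule trig_span_combine[OF trig_span.sin[OF add] trig_span.sin[OF diff], of \<phi> \<psi> \<phi> \<psi> _ "1/2" "1/2"])
        (use cos \<open>\<phi> \<in> L\<close> in \<open>auto simp: sin_add sin_diff field_simps\<close>)
  next
    case (sin \<psi>)
    show ?case
      by (rule trig_span_combine[OF trig_span.cos[OF diff] trig_span.cos[OF add], of \<phi> \<psi> \<phi> \<psi> _ "1/2" "-1/2"])
        (use sin \<open>\<phi> \<in> L\<close> in \<open>auto simp: cos_add cos_diff field_simps\<close>)
  next
    case (add f g) then show ?case by (simp add: distrib_left trig_span.add)
  next
    case (scale f c) then show ?case using trig_span.scale[OF scale.IH, of c] by (simp add: mult_ac)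
  qed
next
  case (add f g) then show ?case by (simp add: distrib_right trig_span.add)
next
  case (scale f c) then show ?case using trig_span.scale[OF scale.IH, of c] by (simp add: mult_ac)
qed

lemma trig_span_bounded: "f \<in> trig_span L \<Longrightarrow> \<exists>B. \<forall>x. \<bar>f x\<bar> \<le> B"
proof (induction rule: trig_span.induct)
  case (add f g)
  then obtain B C where "\<And>x. \<bar>f x\<bar> \<le> B" "\<And>x. \<bar>g x\<bar> \<le> C" by auto
  then show ?case by (intro exI[of _ "B + C"]) (auto intro: order_trans[OF abs_triangle_ineq add_mono])
next
  case (scale f c)
  then obtain B where "\<And>x. \<bar>f x\<bar> \<le> B" by auto
  then show ?case by (intro exI[of _ "\<bar>c\<bar> * B"]) (auto simp: abs_mult intro: mult_left_mono)
qed (auto intro: exI[of _ 1])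

section \<open>Uniform closure of an algebra of bounded functions\<close>

definition unif_closure :: "'a set \<Rightarrow> ('a \<Rightarrow> real) set \<Rightarrow> ('a \<Rightarrow> real) set" where
  "unif_closure \<Omega> A = {g. \<forall>e>0. \<exists>a\<in>A. \<forall>x\<in>\<Omega>. \<bar>g x - a x\<bar> < e}"

lemma unif_closureI: "(\<And>e. e > 0 \<Longrightarrow> \<exists>a\<in>A. \<forall>x\<in>\<Omega>. \<bar>g x - a x\<bar> < e) \<Longrightarrow> g \<in> unif_closure \<Omega> A"
  by (simp add: unif_closure_def)

lemma unif_closureE: "g \<in> unif_closure \<Omega> A \<Longrightarrow> e > 0 \<Longrightarrow> \<exists>a\<in>A. \<forall>x\<in>\<Omega>. \<bar>g x - a x\<bar> < e"
  by (simp add: unif_closure_def)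

lemma unif_closure_idem:
  assumes "\<And>e. e > 0 \<Longrightarrow> \<exists>a\<in>unif_closure \<Omega> A. \<forall>x\<in>\<Omega>. \<bar>g x - a x\<bar> < e"
  shows "g \<in> unif_closure \<Omega> A"
proof (rule unif_closureI)
  fix e :: real assume e: "e > 0"
  obtain a where a: "a \<in> unif_closure \<Omega> A" "\<forall>x\<in>\<Omega>. \<bar>g x - a x\<bar> < e/2" using assms[of "e/2"] e by auto
  obtain b where b: "b \<in> A" "\<forall>x\<in>\<Omega>. \<bar>a x - b x\<bar> < e/2" using unif_closureE[OF a(1), of "e/2"] e by auto
  show "\<exists>a\<in>A. \<forall>x\<in>\<Omega>. \<bar>g x - a x\<bar> < e"
  proof (intro bexI[OF _ b(1)] ballI)
    fix x assume "x \<in> \<Omega>"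
    with a(2) b(2) have "\<bar>g x - a x\<bar> < e/2" "\<bar>a x - b x\<bar> < e/2" by auto
    then show "\<bar>g x - b x\<bar> < e" by linarith
  qed
qed

text \<open>The setting of the Weierstrass argument: the closure B is again an algebra and is stable
  under composition with continuous functions of one variable. Positive parts and minima thus become
  available, which the algebra itself does not contain in general.\<close>

locale bounded_function_algebra =
  fixes \<Omega> :: "'a set" and A :: "('a \<Rightarrow> real) set"
  assumes bdd: "f \<in> A \<Longrightarrow> \<exists>B. \<forall>x\<in>\<Omega>. \<bar>f x\<bar> \<le> B"
    and one: "(\<lambda>_. 1) \<in> A"
    and add: "f \<in> A \<Longrightarrow> g \<in> A \<Longrightarrow> (\<lambda>x. f x + g x) \<in> A"
    and mult: "f \<in> A \<Longrightarrow> g \<in> A \<Longrightarrow> (\<lambda>x. f x * g x) \<in> A"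
    and scale: "f \<in> A \<Longrightarrow> (\<lambda>x. c * f x) \<in> A"
begin

abbreviation "B \<equiv> unif_closure \<Omega> A"

lemma sub: "A \<subseteq> B" by (auto simp: unif_closure_def intro!: bexI)

lemma B_bdd: assumes "f \<in> B" shows "\<exists>K. \<forall>x\<in>\<Omega>. \<bar>f x\<bar> \<le> K"
proof -
  obtain a where a: "a \<in> A" "\<forall>x\<in>\<Omega>. \<bar>f x - a x\<bar> < 1" using unif_closureE[OF assms, of 1] by auto
  obtain K where "\<forall>x\<in>\<Omega>. \<bar>a x\<bar> \<le> K" using bdd[OF a(1)] by auto
  with a(2) have "\<forall>x\<in>\<Omega>. \<bar>f x\<bar> \<le> K + 1" by (auto, smt (verit))
  then show ?thesis ..
qed

lemma B_const: "(\<lambda>_. c) \<in> B"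
  using scale[OF one, of c] sub by auto

lemma B_add: assumes "f \<in> B" "g \<in> B" shows "(\<lambda>x. f x + g x) \<in> B"
proof (rule unif_closureI)
  fix e :: real assume e: "e > 0"
  obtain a b where "a \<in> A" "\<forall>x\<in>\<Omega>. \<bar>f x - a x\<bar> < e/2" "b \<in> A" "\<forall>x\<in>\<Omega>. \<bar>g x - b x\<bar> < e/2"
    using unif_closureE[OF assms(1), of "e/2"] unif_closureE[OF assms(2), of "e/2"] e by auto
  then show "\<exists>a\<in>A. \<forall>x\<in>\<Omega>. \<bar>f x + g x - a x\<bar> < e"
    by (intro bexI[OF _ add[of a b]]) (auto, smt (verit) field_sum_of_halves)
qed

lemma B_mult: assumes f: "f \<in> B" and g: "g \<in> B" shows "(\<lambda>x. f x * g x) \<in> B"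
proof (rule unif_closureI)
  fix e :: real assume e: "e > 0"
  obtain K where K: "\<And>x. x \<in> \<Omega> \<Longrightarrow> \<bar>f x\<bar> \<le> K" using B_bdd[OF f] by auto
  define e1 where "e1 = e / 2 / (\<bar>K\<bar> + 1)"
  have e1: "e1 > 0" using e by (simp add: e1_def add_nonneg_pos)
  obtain b where b: "b \<in> A" "\<And>x. x\<in>\<Omega> \<Longrightarrow> \<bar>g x - b x\<bar> < e1" using unif_closureE[OF g e1] by auto
  obtain K' where K': "\<And>x. x \<in> \<Omega> \<Longrightarrow> \<bar>b x\<bar> \<le> K'" using bdd[OF b(1)] by auto
  define e2 where "e2 = e / 2 / (\<bar>K'\<bar> + 1)"
  have e2: "e2 > 0" using e by (simp add: e2_def add_nonneg_pos)
  obtain a where a: "a \<in> A" "\<And>x. x\<in>\<Omega> \<Longrightarrow> \<bar>f x - a x\<bar> < e2" using unif_closureE[OF f e2] by auto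
  have "\<bar>f x * g x - a x * b x\<bar> < e" if x: "x \<in> \<Omega>" for x
  proof -
    have "f x * g x - a x * b x = f x * (g x - b x) + (f x - a x) * b x" by (simp add: algebra_simps)
    then have "\<bar>f x * g x - a x * b x\<bar> \<le> \<bar>f x\<bar> * \<bar>g x - b x\<bar> + \<bar>f x - a x\<bar> * \<bar>b x\<bar>"
      by (metis abs_mult abs_triangle_ineq)
    also have "\<dots> \<le> \<bar>K\<bar> * e1 + e2 * \<bar>K'\<bar>"
      using K[OF x] K'[OF x] b(2)[OF x] a(2)[OF x] by (intro add_mono mult_mono) auto
    also have "\<dots> < (\<bar>K\<bar> + 1) * e1 + e2 * (\<bar>K'\<bar> + 1)" using e1 e2 by (simp add: algebra_simps)
    also have "\<dots> = e"
    proof -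
      have "\<bar>K\<bar> + 1 \<noteq> 0" "\<bar>K'\<bar> + 1 \<noteq> 0" by linarith+
      moreover have "c * (d / c) = d" "d / c * c = d" if "c \<noteq> 0" for c d :: real using that by simp_all
      ultimately have "(\<bar>K\<bar> + 1) * e1 = e / 2" "e2 * (\<bar>K'\<bar> + 1) = e / 2" unfolding e1_def e2_def by blast+
      then show ?thesis by simp
    qed
    finally show ?thesis .
  qed
  then show "\<exists>a\<in>A. \<forall>x\<in>\<Omega>. \<bar>f x * g x - a x\<bar> < e" using mult[OF a(1) b(1)] by (intro bexI) auto
qed

lemma B_polynomial:
  assumes "real_polynomial_function p" and f: "f \<in> B"
  shows "(\<lambda>x. p (f x)) \<in> B"
  using assms(1)
proof (induction rule: real_polynomial_function.induct)
  case (linear p)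
  interpret bounded_linear p by fact
  have "(\<lambda>x. p 1 * f x) = (\<lambda>x. p (f x))"
  proof
    fix x show "p 1 * f x = p (f x)" using scaleR[of "f x" 1] by (simp add: mult.commute)
  qed
  then show ?case using B_mult[OF B_const[of "p 1"] f] by metis
next
  case (const c) show ?case by (rule B_const)
next
  case (add f g) then show ?case by (intro B_add)
next
  case (mult f g) then show ?case by (intro B_mult)
qed

text \<open>The function f takes values in some [-K,K], where a polynomial approximates the
  continuous function uniformly.\<close>

lemma B_continuous:
  fixes \<phi> :: "real \<Rightarrow> real"
  assumes f: "f \<in> B" and \<phi>: "continuous_on UNIV \<phi>" shows "(\<lambda>x. \<phi> (f x)) \<in> B"
proof (rule unif_closure_idem)
  fix e :: real assume e: "e > 0"
  obtain K where K: "\<And>x. x \<in> \<Omega> \<Longrightarrow> \<bar>f x\<bar> \<le> K" using B_bdd[OF f] by auto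
  obtain p where p: "real_polynomial_function p" "\<And>x. x \<in> {-K..K} \<Longrightarrow> \<bar>\<phi> x - p x\<bar> < e"
    using Stone_Weierstrass_real_polynomial_function[of "{-K..K}" \<phi> e] e continuous_on_subset[OF \<phi>] by auto
  show "\<exists>a\<in>B. \<forall>x\<in>\<Omega>. \<bar>\<phi> (f x) - a x\<bar> < e"
    by (intro bexI[OF _ B_polynomial[OF p(1) f]]) (use p(2) K in \<open>force simp: abs_le_iff\<close>)
qed

end

text \<open>Recovers an unbounded linear functional as a pointwise limit of bounded trigonometric
  functions of its multiples.\<close>

lemma n_sin_over_n_tendsto: "(\<lambda>n. real n * sin (x / real n)) \<longlonglongrightarrow> x"
proof -
  have "((\<lambda>y. sin (x * y)) has_real_derivative x) (at 0)"
    by (auto intro!: derivative_eq_intros)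
  then have *: "((\<lambda>y. sin (x * y) / y) \<longlongrightarrow> x) (at 0)" by (simp add: DERIV_def)
  have "filterlim (\<lambda>n. inverse (real n)) (at 0) sequentially"
    unfolding filterlim_at using LIMSEQ_inverse_real_of_nat[THEN LIMSEQ_imp_Suc]
    by (auto intro: eventually_mono[OF eventually_gt_at_top[of 0]])
  from filterlim_compose[OF * this] show ?thesis by (simp add: field_simps)
qed

text \<open>Equality of integrals passes from the trigonometric functions to their uniform closure,
  then to the sets where a function of the closure is positive. These form an intersection-stable
  generator. Nothing is assumed about dimension, so the same result serves for path space and for
  finite products of increments; \<open>gen\<close> says that L generates the sigma-algebra.\<close>

theorem prob_measure_eq_of_char_eq:
  fixes M N :: "'a measure"
  assumes M: "prob_space M" and N: "prob_space N" and sets: "sets N = sets M"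
    and L0: "(\<lambda>_. 0) \<in> L"
    and Ladd: "\<And>\<phi> \<psi>. \<phi> \<in> L \<Longrightarrow> \<psi> \<in> L \<Longrightarrow> (\<lambda>x. \<phi> x + \<psi> x) \<in> L"
    and Lscale: "\<And>\<phi> c. \<phi> \<in> L \<Longrightarrow> (\<lambda>x. c * \<phi> x) \<in> L"
    and meas: "\<And>\<phi>. \<phi> \<in> L \<Longrightarrow> \<phi> \<in> borel_measurable M"
    and gen: "\<And>N'. space N' = space M \<Longrightarrow> (\<And>\<phi>. \<phi> \<in> L \<Longrightarrow> \<phi> \<in> borel_measurable N') \<Longrightarrow> sets M \<subseteq> sets N'"
    and char: "\<And>\<phi>. \<phi> \<in> L \<Longrightarrow> integral\<^sup>L M (\<lambda>x. cis (\<phi> x)) = integral\<^sup>L N (\<lambda>x. cis (\<phi> x))"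
  shows "M = N"
proof -
  interpret M: prob_space M by fact
  interpret N: prob_space N by fact
  have space: "space N = space M" using sets by (rule sets_eq_imp_space_eq)
  have Ldiff: "(\<lambda>x. \<phi> x - \<psi> x) \<in> L" if "\<phi> \<in> L" "\<psi> \<in> L" for \<phi> \<psi>
    using Ladd[OF that(1) Lscale[OF that(2), of "-1"]] by simp
  have measN: "\<phi> \<in> borel_measurable N" if "\<phi> \<in> borel_measurable M" for \<phi> :: "'a \<Rightarrow> real"
    using that by (simp add: measurable_def sets space)
  have bi: "integrable M f \<and> integrable N f"
    if "f \<in> borel_measurable M" "\<And>x. x \<in> space M \<Longrightarrow> \<bar>f x\<bar> \<le> K" for f :: "'a \<Rightarrow> real" and K
    using that measN[OF that(1)] space
    by (intro conjI M.integrable_const_bound[where B = K] N.integrable_const_bound[where B = K]) auto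
  have cis: "integrable M (\<lambda>x. cis (\<phi> x)) \<and> integrable N (\<lambda>x. cis (\<phi> x))" if "\<phi> \<in> L" for \<phi>
  proof -
    have [measurable]: "\<phi> \<in> borel_measurable M" "\<phi> \<in> borel_measurable N" using meas[OF that] measN[OF meas[OF that]] .
    have [measurable]: "cis \<in> borel_measurable borel" by (intro borel_measurable_continuous_onI continuous_intros)
    show ?thesis
      by (intro conjI M.integrable_const_bound[where B = 1] N.integrable_const_bound[where B = 1]) auto
  qed
  have trig: "f \<in> borel_measurable M \<and> integral\<^sup>L M f = integral\<^sup>L N f" if "f \<in> trig_span L" for f
    using that
  proof induction
    case (cos \<phi>)
    have "integral\<^sup>L K (\<lambda>x. cos (\<phi> x)) = Re (integral\<^sup>L K (\<lambda>x. cis (\<phi> x)))" if "integrable K (\<lambda>x. cis (\<phi> x))" for K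
      using integral_bounded_linear[OF bounded_linear_Re that] by simp
    then show ?case using cis[OF cos] char[OF cos] meas[OF cos] by auto
  next
    case (sin \<phi>)
    have "integral\<^sup>L K (\<lambda>x. sin (\<phi> x)) = Im (integral\<^sup>L K (\<lambda>x. cis (\<phi> x)))" if "integrable K (\<lambda>x. cis (\<phi> x))" for K
      using integral_bounded_linear[OF bounded_linear_Im that] by simp
    then show ?case using cis[OF sin] char[OF sin] meas[OF sin] by auto
  next
    case (add f g)
    obtain K K' where K: "\<And>x. \<bar>f x\<bar> \<le> K" "\<And>x. \<bar>g x\<bar> \<le> K'"
      using trig_span_bounded[OF add.hyps(1)] trig_span_bounded[OF add.hyps(2)] by blast
    have "integrable M f" "integrable M g" "integrable N f" "integrable N g"
      using bi[OF conjunct1[OF add.IH(1)] K(1)] bi[OF conjunct1[OF add.IH(2)] K(2)] by auto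
    then show ?case using add.IH by simp
  next
    case (scale f c) then show ?case by (auto intro: borel_measurable_times)
  qed
  interpret A: bounded_function_algebra "space M" "trig_span L"
  proof
    show "\<exists>B. \<forall>x\<in>space M. \<bar>f x\<bar> \<le> B" if "f \<in> trig_span L" for f using trig_span_bounded[OF that] by auto
    show "(\<lambda>_. 1) \<in> trig_span L" using trig_span.cos[OF L0] by simp
  qed (auto intro: trig_span.intros trig_span_mult Ladd Ldiff)
  have Bmeas: "f \<in> borel_measurable M" if f: "f \<in> A.B" for f
  proof -
    have "\<forall>n. \<exists>a\<in>trig_span L. \<forall>x\<in>space M. \<bar>f x - a x\<bar> < 1 / Suc n"
      using unif_closureE[OF f] by simp
    then obtain a where a: "\<And>n. a n \<in> trig_span L" "\<And>n x. x \<in> space M \<Longrightarrow> \<bar>f x - a n x\<bar> < 1 / Suc n" by metis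
    show ?thesis
    proof (rule borel_measurable_LIMSEQ_real)
      show "a n \<in> borel_measurable M" for n using trig[OF a(1)] by simp
      fix x assume "x \<in> space M"
      then have "\<forall>n. norm (a n x - f x) \<le> 1 / Suc n" using a(2)[of x] by (auto simp: abs_minus_commute less_imp_le)
      then have "(\<lambda>n. a n x - f x) \<longlonglongrightarrow> 0"
        by (intro Lim_null_comparison[OF _ LIMSEQ_Suc[OF lim_1_over_n]] always_eventually) auto
      then show "(\<lambda>n. a n x) \<longlonglongrightarrow> f x" by (simp add: LIM_zero_iff)
    qed
  qed
  have Bint: "integral\<^sup>L M f = integral\<^sup>L N f" if f: "f \<in> A.B" for f
  proof -
    have fm: "f \<in> borel_measurable M" "f \<in> borel_measurable N" using Bmeas[OF f] measN[OF Bmeas[OF f]] .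
    obtain K where K: "\<And>x. x \<in> space M \<Longrightarrow> \<bar>f x\<bar> \<le> K" using A.B_bdd[OF f] by auto
    have fi: "integrable M f" "integrable N f"
      using bi[OF fm(1) K] by auto
    have "\<bar>integral\<^sup>L M f - integral\<^sup>L N f\<bar> \<le> 0 + e" if e: "e > 0" for e
    proof -
      obtain a where a: "a \<in> trig_span L" "\<And>x. x\<in>space M \<Longrightarrow> \<bar>f x - a x\<bar> < e/2"
        using unif_closureE[OF f, of "e/2"] e by auto
      have am: "a \<in> borel_measurable M" "a \<in> borel_measurable N" using conjunct1[OF trig[OF a(1)]] measN[OF conjunct1[OF trig[OF a(1)]]] .
      obtain K where K: "\<And>x. \<bar>a x\<bar> \<le> K" using trig_span_bounded[OF a(1)] by auto
      have ai: "integrable M a" "integrable N a"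
        using bi[OF am(1) K] by auto
      have close: "\<bar>integral\<^sup>L K f - integral\<^sup>L K a\<bar> \<le> e/2"
        if K: "prob_space K" "space K = space M" and i: "integrable K f" "integrable K a" for K
      proof -
        interpret K: prob_space K by fact
        have *: "- (e/2) \<le> f x - a x" "f x - a x \<le> e/2" if "x \<in> space K" for x
        proof -
          have "\<bar>f x - a x\<bar> < e/2" using a(2)[of x] that K(2) by simp
          then show "- (e/2) \<le> f x - a x" "f x - a x \<le> e/2" by linarith+
        qed
        have "integral\<^sup>L K (\<lambda>x. f x - a x) \<le> e/2"
          by (rule K.integral_le_const[OF Bochner_Integration.integrable_diff[OF i] AE_I2[OF *(2)]])
        moreover have "- (e/2) \<le> integral\<^sup>L K (\<lambda>x. f x - a x)"
          by (rule K.integral_ge_const[OF Bochner_Integration.integrable_diff[OF i] AE_I2[OF *(1)]])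
        ultimately show ?thesis unfolding Bochner_Integration.integral_diff[OF i] by linarith
      qed
      have "\<bar>integral\<^sup>L M f - integral\<^sup>L M a\<bar> \<le> e/2" by (rule close[OF M refl fi(1) ai(1)])
      moreover have "\<bar>integral\<^sup>L N f - integral\<^sup>L N a\<bar> \<le> e/2" by (rule close[OF N space fi(2) ai(2)])
      ultimately show ?thesis using trig[OF a(1)] by linarith
    qed
    then show ?thesis using field_le_epsilon[of "\<bar>integral\<^sup>L M f - integral\<^sup>L N f\<bar>" 0] by auto
  qed
  define P where "P = (\<lambda>g :: 'a \<Rightarrow> real. {x \<in> space M. 0 < g x})"
  define E where "E = P ` A.B"
  have PE: "emeasure M (P g) = emeasure N (P g)" if g: "g \<in> A.B" for g
  proof -
    \<comment> \<open>A continuous function of g, hence in the closure, that tends pointwise to the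
      indicator of g > 0 and is bounded by 1.\<close>
    define f where "f = (\<lambda>n x. min 1 (real n * max (g x) 0))"
    have fB: "f n \<in> A.B" for n
      unfolding f_def by (rule A.B_continuous[OF g]) (intro continuous_intros)
    have Pm: "P g \<in> sets M" "P g \<in> sets N" using Bmeas[OF g] by (auto simp: P_def sets)
    have conv: "(\<lambda>n. f n x) \<longlonglongrightarrow> indicator (P g) x" if "x \<in> space M" for x
    proof (cases "0 < g x")
      case True
      then obtain n0 where n0: "1 < real n0 * g x" using reals_Archimedean3[of "g x"] by auto
      have "f n x = 1" if "n \<ge> n0" for n
      proof -
        have "real n0 * g x \<le> real n * g x" using that True by (intro mult_right_mono) auto
        then have "1 \<le> real n * g x" using n0 by linarith
        then show ?thesis using True by (simp add: f_def)
      qed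
      then show ?thesis using True that by (intro tendsto_eventually) (auto simp: P_def eventually_sequentially)
    next
      case False
      then show ?thesis by (simp add: f_def P_def)
    qed
    have f1: "\<bar>f n x\<bar> \<le> 1" for n x by (simp add: f_def)
    have "(\<lambda>n. integral\<^sup>L M (f n)) \<longlonglongrightarrow> integral\<^sup>L M (indicator (P g))"
      by (rule integral_dominated_convergence[where w = "\<lambda>_. 1"])
        (use Pm Bmeas[OF fB] conv f1 in \<open>auto intro!: AE_I2 simp: borel_measurable_indicator\<close>)
    moreover have "(\<lambda>n. integral\<^sup>L N (f n)) \<longlonglongrightarrow> integral\<^sup>L N (indicator (P g))"
      by (rule integral_dominated_convergence[where w = "\<lambda>_. 1"])
        (use Pm measN[OF Bmeas[OF fB]] conv f1 space in \<open>auto intro!: AE_I2 simp: borel_measurable_indicator\<close>)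
    ultimately have "integral\<^sup>L M (indicator (P g)) = (integral\<^sup>L N (indicator (P g)) :: real)"
      using Bint[OF fB] by (simp add: LIMSEQ_unique)
    then have "measure M (P g) = measure N (P g)" using Pm by (simp add: space P_def)
    then show ?thesis by (simp add: M.emeasure_eq_measure N.emeasure_eq_measure)
  qed
  have genE: "sets M = sigma_sets (space M) E"
  proof
    show "sigma_sets (space M) E \<subseteq> sets M"
      using Bmeas by (intro sets.sigma_sets_subset) (auto simp: E_def P_def)
    have EP: "E \<subseteq> Pow (space M)" by (auto simp: E_def P_def)
    define S where "S = sigma (space M) E"
    have S: "space S = space M" "sets S = sigma_sets (space M) E" using EP by (simp_all add: S_def)
    have BS: "g \<in> borel_measurable S" if g: "g \<in> A.B" for g
      unfolding borel_measurable_iff_greater S(1)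
    proof
      fix c
      have "{w \<in> space M. c < g w} = P (\<lambda>x. g x + (- c))" by (auto simp: P_def)
      also have "\<dots> \<in> sets S" using A.B_add[OF g A.B_const[of "-c"]] by (auto simp: S(2) E_def)
      finally show "{w \<in> space M. c < g w} \<in> sets S" .
    qed
    \<comment> \<open>The positivity sets generate a sigma-algebra for which all trigonometric
      functions are measurable; the limit of n sin(\<phi>/n) carries this over to \<phi>
      itself.\<close>
    have "\<phi> \<in> borel_measurable S" if \<phi>: "\<phi> \<in> L" for \<phi>
    proof (rule borel_measurable_LIMSEQ_real)
      show "(\<lambda>n. real n * sin (\<phi> x / real n)) \<longlonglongrightarrow> \<phi> x" for x by (rule n_sin_over_n_tendsto)
      show "(\<lambda>x. real n * sin (\<phi> x / real n)) \<in> borel_measurable S" for n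
        using BS[OF subsetD[OF A.sub trig_span.scale[OF trig_span.sin[OF Lscale[OF \<phi>, of "1 / real n"]], of "real n"]]]
        by simp
    qed
    from gen[OF S(1) this] show "sets M \<subseteq> sigma_sets (space M) E" by (simp add: S(2))
  qed
  show ?thesis
  proof (rule measure_eqI_generator_eq[of E "space M" _ _ "\<lambda>_. space M"])
    show "Int_stable E"
    proof (rule Int_stableI)
      fix a b assume "a \<in> E" "b \<in> E"
      then obtain f g where fg: "f \<in> A.B" "g \<in> A.B" "a = P f" "b = P g" by (auto simp: E_def)
      \<comment> \<open>Positive parts prevent a product of two negative values from counting as
        positive.\<close>
      have "a \<inter> b = P (\<lambda>x. max (f x) 0 * max (g x) 0)"
        unfolding fg P_def by (auto simp: max_def zero_less_mult_iff)
      moreover have "(\<lambda>x. max (f x) 0 * max (g x) 0) \<in> A.B"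
        by (intro A.B_mult A.B_continuous[where \<phi> = "\<lambda>x. max x 0"] fg continuous_intros)
      ultimately show "a \<inter> b \<in> E" by (auto simp: E_def)
    qed
    have "space M = P (\<lambda>_. 1)" by (auto simp: P_def)
    then show "range (\<lambda>_. space M) \<subseteq> E" using A.B_const[of 1] by (auto simp: E_def)
  qed (use PE genE sets in \<open>auto simp: E_def P_def\<close>)
qed

section \<open>Borel sets of the path space\<close>

definition hat :: "real \<Rightarrow> real" where "hat u = max 0 (1 - \<bar>u\<bar>)"

lemma hat_nonneg: "0 \<le> hat u" by (simp add: hat_def)

lemma hat_eq_0: "1 \<le> \<bar>u\<bar> \<Longrightarrow> hat u = 0" by (simp add: hat_def)

text \<open>Each hat is the difference of two consecutive translates of a ramp clamped to [0,1], so
  the sum telescopes.\<close>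

lemma hat_partition_unity:
  assumes "0 \<le> s" "s \<le> real n"
  shows "(\<Sum>k\<le>n. hat (s - real k)) = 1"
proof -
  define c where "c = (\<lambda>u::real. max 0 (min 1 u))"
  have "hat (s - real k) = c (s + 1 - real k) - c (s + 1 - real (Suc k))" for k
    by (auto simp: hat_def c_def max_def min_def abs_if)
  then have "(\<Sum>k\<le>n. hat (s - real k)) = (\<Sum>k<Suc n. c (s + 1 - real k) - c (s + 1 - real (Suc k)))"
    by (simp only: lessThan_Suc_atMost)
  also have "\<dots> = c (s + 1 - real 0) - c (s + 1 - real (Suc n))"
    by (rule sum_lessThan_telescope')
  also have "\<dots> = 1" using assms by (simp add: c_def)
  finally show ?thesis .
qed

text \<open>Piecewise linear interpolation at the nodes k T / n, written in the hat basis so that it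
  is visibly continuous in t and linear, hence measurable, in the nodes. It is zero off [0,T] as
  \<open>Wsp\<close> demands.\<close>

definition pwl :: "real \<Rightarrow> nat \<Rightarrow> (nat \<Rightarrow> 'a::real_normed_vector) \<Rightarrow> real \<Rightarrow> 'a" where
  "pwl T n x t = (if t \<in> {0..T} then \<Sum>k\<le>n. hat (t * real n / T - real k) *\<^sub>R x k else 0)"

lemma continuous_hat: "continuous_on UNIV hat"
  unfolding hat_def by (intro continuous_intros)

lemma pwl_Wsp:
  fixes x :: "nat \<Rightarrow> real^'d"
  assumes "x 0 = 0"
  shows "pwl T n x \<in> Wsp T"
proof -
  have "continuous_on {0..T} (\<lambda>t. \<Sum>k\<le>n. hat (t * real n / T - real k) *\<^sub>R x k)"
    unfolding divide_inverse by (intro continuous_intros continuous_on_compose2[OF continuous_hat]) auto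
  then have "continuous_on {0..T} (pwl T n x)"
    by (rule continuous_on_eq) (simp add: pwl_def)
  moreover have "pwl T n x 0 = 0"
  proof -
    have "hat (0 * real n / T - real k) *\<^sub>R x k = 0" for k
      using assms by (cases k) (auto simp: hat_eq_0)
    then show ?thesis by (simp only: pwl_def sum.neutral_const if_cancel)
  qed
  ultimately show ?thesis by (auto simp: Wsp_def pwl_def)
qed

text \<open>A value of the interpolant is a convex combination of the nodes within one mesh width.\<close>

lemma norm_pwl_diff_le:
  fixes x :: "nat \<Rightarrow> 'a::real_normed_vector"
  assumes T: "0 < T" and n: "0 < n" and t: "t \<in> {0..T}"
    and e: "\<And>k. k \<le> n \<Longrightarrow> \<bar>t - real k * T / real n\<bar> < T / real n \<Longrightarrow> norm (x k - v) \<le> e"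
  shows "norm (pwl T n x t - v) \<le> e"
proof -
  define s where "s = t * real n / T"
  have s: "0 \<le> s" "s \<le> real n" using t T n by (auto simp: s_def field_simps)
  have w1: "(\<Sum>k\<le>n. hat (s - real k)) = 1" by (rule hat_partition_unity[OF s])
  have "pwl T n x t - v = (\<Sum>k\<le>n. hat (s - real k) *\<^sub>R x k) - (\<Sum>k\<le>n. hat (s - real k)) *\<^sub>R v"
    using t by (simp add: pwl_def s_def[symmetric] w1)
  also have "\<dots> = (\<Sum>k\<le>n. hat (s - real k) *\<^sub>R (x k - v))"
    by (simp add: scaleR_sum_left sum_subtractf scaleR_diff_right)
  also have "norm \<dots> \<le> (\<Sum>k\<le>n. hat (s - real k) * e)"
  proof (rule sum_norm_le)
    fix k assume "k \<in> {..n}"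
    show "norm (hat (s - real k) *\<^sub>R (x k - v)) \<le> hat (s - real k) * e"
    proof (cases "1 \<le> \<bar>s - real k\<bar>")
      case True then show ?thesis by (simp add: hat_eq_0)
    next
      case False
      have "\<bar>t - real k * T / real n\<bar> = \<bar>s - real k\<bar> * (T / real n)"
        using T n by (simp add: s_def abs_mult[symmetric] field_simps)
      also have "\<dots> < 1 * (T / real n)" using False T n by (intro mult_strict_right_mono) auto
      finally have "norm (x k - v) \<le> e" using e[of k] \<open>k \<in> {..n}\<close> by simp
      then show ?thesis by (simp add: hat_nonneg mult_left_mono)
    qed
  qed
  also have "\<dots> = e" by (simp add: sum_distrib_right[symmetric] w1)
  finally show ?thesis .
qed

lemma grid_mem: "0 \<le> T \<Longrightarrow> k \<le> n \<Longrightarrow> real k * T / real n \<in> {0..T}"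
  by (cases "n = 0") (auto simp: field_simps mult_left_mono)

lemma continuous_modulus:
  fixes w :: "real \<Rightarrow> 'a::real_normed_vector"
  assumes "continuous_on {0..T} w" "0 < e"
  shows "\<forall>\<^sub>F n in sequentially. \<forall>s\<in>{0..T}. \<forall>t\<in>{0..T}. \<bar>t - s\<bar> \<le> T / real n \<longrightarrow> norm (w t - w s) < e"
proof -
  have "uniformly_continuous_on {0..T} w"
    by (rule compact_uniformly_continuous[OF assms(1)]) simp
  then obtain d where d: "d > 0" "\<And>s t. s\<in>{0..T} \<Longrightarrow> t\<in>{0..T} \<Longrightarrow> \<bar>t - s\<bar> < d \<Longrightarrow> norm (w t - w s) < e"
    unfolding uniformly_continuous_on_def dist_norm real_norm_def using assms(2) by blast
  have "(\<lambda>n. T / real n) \<longlonglongrightarrow> 0" by (rule lim_const_over_n)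
  then have "\<forall>\<^sub>F n in sequentially. T / real n < d" using d(1) by (rule order_tendstoD)
  then show ?thesis by (rule eventually_mono) (auto intro!: d(2))
qed

text \<open>The threshold for n is independent of the node values x. The same statement therefore
  serves for interpolating w exactly, for rounding nodes to a countable set and for nodes of an
  Euler scheme. Node error and modulus of continuity give 2 e, and 3 e makes the bound
  strict.\<close>

lemma pwl_approx:
  fixes w :: "real \<Rightarrow> 'a::real_normed_vector"
  assumes T: "0 < T" and w: "continuous_on {0..T} w" and e: "0 < e"
  shows "\<forall>\<^sub>F n in sequentially. \<forall>x. (\<forall>k\<le>n. norm (x k - w (real k * T / real n)) \<le> e)
     \<longrightarrow> (\<forall>t\<in>{0..T}. norm (pwl T n x t - w t) < 3 * e)"
  using continuous_modulus[OF w e] eventually_gt_at_top[of 0]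
proof eventually_elim
  case (elim n)
  show ?case
  proof (intro allI impI ballI)
    fix x t assume x: "\<forall>k\<le>n. norm (x k - w (real k * T / real n)) \<le> e" and t: "t \<in> {0..T}"
    have "norm (pwl T n x t - w t) \<le> 2 * e"
    proof (rule norm_pwl_diff_le[OF T elim(2) t])
      fix k assume k: "k \<le> n" "\<bar>t - real k * T / real n\<bar> < T / real n"
      have "norm (w (real k * T / real n) - w t) < e"
        using elim(1) t grid_mem[of T k n] T k by (simp add: abs_minus_commute)
      moreover have "norm (x k - w (real k * T / real n)) \<le> e" using x k by simp
      ultimately show "norm (x k - w t) \<le> 2 * e"
        using norm_triangle_ineq[of "x k - w (real k * T / real n)" "w (real k * T / real n) - w t"] by simp
    qed
    then show "norm (pwl T n x t - w t) < 3 * e" using e by simp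
  qed
qed

section \<open>Separability of path space and measurability of evaluations\<close>

lemma supn_less: "0 \<le> T \<Longrightarrow> continuous_on {0..T} f \<Longrightarrow> (\<And>t. t \<in> {0..T} \<Longrightarrow> norm (f t) < B) \<Longrightarrow> supn T f < B"
proof -
  assume T: "0 \<le> T" and f: "continuous_on {0..T} f" and B: "\<And>t. t \<in> {0..T} \<Longrightarrow> norm (f t) < B"
  obtain t where t: "t \<in> {0..T}" "\<And>s. s \<in> {0..T} \<Longrightarrow> norm (f s) \<le> norm (f t)"
    using continuous_attains_sup[OF _ _ continuous_on_norm[OF f]] T by (metis atLeastAtMost_iff compact_Icc empty_iff order_refl)
  have "supn T f \<le> norm (f t)" by (rule supn_le[OF T t(2)])
  then show ?thesis using B[OF t(1)] by simp
qed

lemma Wsp_diff_cont: "v \<in> Wsp T \<Longrightarrow> w \<in> Wsp T \<Longrightarrow> continuous_on {0..T} (\<lambda>t. v t - w t)"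
  by (intro continuous_intros Wsp_cont)

lemma supn_triangle:
  assumes "0 \<le> T" "u \<in> Wsp T" "v \<in> Wsp T" "w \<in> Wsp T"
  shows "supn T (\<lambda>t. u t - w t) \<le> supn T (\<lambda>t. u t - v t) + supn T (\<lambda>t. v t - w t)"
proof (rule supn_le[OF assms(1)])
  fix t assume t: "t \<in> {0..T}"
  show "norm (u t - w t) \<le> supn T (\<lambda>t. u t - v t) + supn T (\<lambda>t. v t - w t)"
    using norm_le_supn[OF Wsp_diff_cont[OF assms(2,3)] t] norm_le_supn[OF Wsp_diff_cont[OF assms(3,4)] t]
      norm_triangle_ineq[of "u t - v t" "v t - w t"] by simp
qed

lemma supn_minus_commute: "supn T (\<lambda>t. u t - w t) = supn T (\<lambda>t. w t - u t)"
  by (simp add: supn_def norm_minus_commute)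

text \<open>Interpolants with nodes in a countable dense set. Finite lists keep the family
  countable, and node 0 is overwritten by 0 so that every member starts at the origin.\<close>

definition Wdense :: "real \<Rightarrow> (real \<Rightarrow> real^'d::finite) set" where
  "Wdense T = (\<lambda>(n, l). pwl T n (\<lambda>k. if k = 0 then 0 else l ! k)) `
     (UNIV \<times> lists (SOME D. countable D \<and> (\<forall>X. open X \<longrightarrow> X \<noteq> {} \<longrightarrow> (\<exists>d\<in>D. d \<in> X))))"

lemma Wdense_props:
  fixes w :: "real \<Rightarrow> real^'d"
  shows "countable (Wdense T :: (real \<Rightarrow> real^'d) set)" "(Wdense T :: (real \<Rightarrow> real^'d) set) \<subseteq> Wsp T"
    "0 < T \<Longrightarrow> w \<in> Wsp T \<Longrightarrow> 0 < e \<Longrightarrow> \<exists>v\<in>Wdense T. supn T (\<lambda>t. v t - w t) < e"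
proof -
  define D :: "(real^'d) set" where "D = (SOME D. countable D \<and> (\<forall>X. open X \<longrightarrow> X \<noteq> {} \<longrightarrow> (\<exists>d\<in>D. d \<in> X)))"
  have "\<exists>D::(real^'d) set. countable D \<and> (\<forall>X. open X \<longrightarrow> X \<noteq> {} \<longrightarrow> (\<exists>d\<in>D. d \<in> X))"
    by (rule countable_dense_exists)
  from someI_ex[OF this] have D: "countable D" "\<And>X. open X \<Longrightarrow> X \<noteq> {} \<Longrightarrow> \<exists>d\<in>D. d \<in> X" unfolding D_def by blast+
  have WD: "Wdense T = (\<lambda>(n, l). pwl T n (\<lambda>k. if k = 0 then 0 else l ! k)) ` (UNIV \<times> lists D)"
    by (simp add: Wdense_def D_def)
  show "countable (Wdense T :: (real \<Rightarrow> real^'d) set)"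
    unfolding WD by (intro countable_image countable_SIGMA) (auto simp: D(1))
  show "(Wdense T :: (real \<Rightarrow> real^'d) set) \<subseteq> Wsp T"
    unfolding WD by (auto intro!: pwl_Wsp)
  assume T: "0 < T" and w: "w \<in> Wsp T" and e: "0 < e"
  define e' where "e' = e / 3"
  have e': "e' > 0" using e by (simp add: e'_def)
  from pwl_approx[OF T Wsp_cont[OF w] e'] obtain n where
    n: "\<And>x. (\<forall>k\<le>n. norm (x k - w (real k * T / real n)) \<le> e') \<Longrightarrow> (\<forall>t\<in>{0..T}. norm (pwl T n x t - w t) < 3 * e')"
    unfolding eventually_sequentially by blast
  have "\<forall>k. \<exists>d\<in>D. d \<in> ball (w (real k * T / real n)) e'" using e' by (intro allI D(2)) auto
  then obtain d where d: "\<And>k. d k \<in> D" "\<And>k. norm (d k - w (real k * T / real n)) < e'"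
    by (metis dist_norm mem_ball norm_minus_commute)
  define l where "l = map d [0..<Suc n]"
  have lD: "l \<in> lists D" using d(1) by (auto simp: l_def)
  define v where "v = pwl T n (\<lambda>k. if k = 0 then 0 else l ! k)"
  have "v \<in> Wdense T" unfolding WD v_def using lD by (intro image_eqI[of _ _ "(n, l)"]) auto
  moreover have "\<forall>t\<in>{0..T}. norm (v t - w t) < 3 * e'"
    unfolding v_def
  proof (rule n, intro allI impI)
    fix k assume "k \<le> n"
    then show "norm ((if k = 0 then 0 else l ! k) - w (real k * T / real n)) \<le> e'"
      using d(2)[of k] e' Wsp_0[OF w] by (auto simp: l_def less_imp_le simp del: upt_Suc)
  qed
  ultimately show "\<exists>v\<in>Wdense T. supn T (\<lambda>t. v t - w t) < e"
    using T w \<open>Wdense T \<subseteq> Wsp T\<close>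
    by (intro bexI[of _ v] supn_less Wsp_diff_cont) (auto simp: e'_def)
qed

text \<open>By continuity the sup norm is decided at rational times, which turns a closed ball into
  a countable intersection of conditions on single evaluations.\<close>

lemma measurable_supn_ball:
  fixes c :: "real \<Rightarrow> real^'d" and N :: "(real \<Rightarrow> real^'d) measure"
  assumes T: "0 < T" and c: "c \<in> Wsp T" and N: "space N = Wsp T"
    and ev: "\<And>t. t \<in> {0..T} \<Longrightarrow> (\<lambda>w. w t) \<in> borel_measurable N"
  shows "{w \<in> Wsp T. supn T (\<lambda>t. c t - w t) \<le> r} \<in> sets N"
proof -
  have "{w \<in> Wsp T. supn T (\<lambda>t. c t - w t) \<le> r}
      = {w \<in> space N. \<forall>q\<in>\<rat> \<inter> {0..T}. norm (c q - w q) \<le> r}"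
  proof (intro Collect_cong conj_cong)
    fix w assume "w \<in> space N"
    then have w: "w \<in> Wsp T" by (simp add: N)
    have cw: "continuous_on {0..T} (\<lambda>t. c t - w t)" by (rule Wsp_diff_cont[OF c w])
    show "(supn T (\<lambda>t. c t - w t) \<le> r) = (\<forall>q\<in>\<rat> \<inter> {0..T}. norm (c q - w q) \<le> r)"
    proof
      assume "supn T (\<lambda>t. c t - w t) \<le> r"
      then show "\<forall>q\<in>\<rat> \<inter> {0..T}. norm (c q - w q) \<le> r"
        using order_trans[OF norm_le_supn[OF cw]] by blast
    next
      assume q: "\<forall>q\<in>\<rat> \<inter> {0..T}. norm (c q - w q) \<le> r"
      show "supn T (\<lambda>t. c t - w t) \<le> r"
      proof (rule supn_le)
        fix t assume t: "t \<in> {0..T}"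
        \<comment> \<open>The endpoint T may be irrational, so density is shown in the open interval
          and extended to its closure.\<close>
        have "{0..T} \<subseteq> closure (\<rat> \<inter> {0..T})"
        proof -
          have "{0<..<T} \<subseteq> closure (\<rat> \<inter> {0<..<T})"
          proof
            fix x assume x: "x \<in> {0<..<T}"
            show "x \<in> closure (\<rat> \<inter> {0<..<T})"
              unfolding closure_approachable
            proof (intro allI impI)
              fix d :: real assume "0 < d"
              then have "max 0 (x - d) < min T x" using x by auto
              then obtain q where "q \<in> \<rat>" "max 0 (x - d) < q" "q < min T x" using Rats_dense_in_real by blast
              then show "\<exists>y\<in>\<rat> \<inter> {0<..<T}. dist y x < d"
                by (intro bexI[of _ q]) (auto simp: dist_real_def)
            qed
          qed
          also have "\<dots> \<subseteq> closure (\<rat> \<inter> {0..T})" by (rule closure_mono) auto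
          finally have "closure {0<..<T} \<subseteq> closure (\<rat> \<inter> {0..T})" by (rule closure_minimal) simp
          then show ?thesis using T by simp
        qed
        then have "t \<in> closure (\<rat> \<inter> {0..T})" using t by auto
        then obtain x where x: "\<And>n. x n \<in> \<rat> \<inter> {0..T}" "x \<longlonglongrightarrow> t" unfolding closure_sequential by blast
        have "(\<lambda>n. norm (c (x n) - w (x n))) \<longlonglongrightarrow> norm (c t - w t)"
          by (intro tendsto_norm continuous_on_tendsto_compose[OF cw x(2) t] always_eventually)
            (use x(1) in auto)
        then show "norm (c t - w t) \<le> r"
          by (rule LIMSEQ_le_const2) (use q x(1) in auto)
      qed (use T in simp)
    qed
  qed (simp add: N)
  also have "\<dots> \<in> sets N"
  proof (rule sets.sets_Collect_countable_All')
    fix q assume "q \<in> \<rat> \<inter> {0..T}"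
    then have [measurable]: "(\<lambda>w. w q) \<in> borel_measurable N" using ev by auto
    show "{x \<in> space N. norm (c q - x q) \<le> r} \<in> sets N" by measurable
  qed (simp add: countable_rat)
  finally show ?thesis .
qed

text \<open>By separability an open set is the countable union of those closed balls, with centre in
  \<open>Wdense\<close> and radius 1/(m+1), that it contains. Hence evaluations generate the Borel
  sets.\<close>

lemma Wborel_subset_if_evaluations_measurable:
  fixes N :: "(real \<Rightarrow> real^'d) measure"
  assumes T: "0 < T" and N: "space N = Wsp T"
    and ev: "\<And>t. t \<in> {0..T} \<Longrightarrow> (\<lambda>w. w t) \<in> borel_measurable N"
  shows "Wborel T \<subseteq> sets N"
proof -
  have "U \<in> sets N" if U: "U \<in> Wopen T" for U
  proof -
    define b where "b = (\<lambda>(c :: real \<Rightarrow> real^'d) m. {w \<in> Wsp T. supn T (\<lambda>t. c t - w t) \<le> 1 / real (Suc m)})"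
    have "U = (\<Union>p \<in> {p \<in> Wdense T \<times> UNIV. b (fst p) (snd p) \<subseteq> U}. b (fst p) (snd p))"
    proof
      show "U \<subseteq> (\<Union>p \<in> {p \<in> Wdense T \<times> UNIV. b (fst p) (snd p) \<subseteq> U}. b (fst p) (snd p))"
      proof
        fix w assume wU: "w \<in> U"
        then have w: "w \<in> Wsp T" using U by (auto simp: Wopen_def)
        obtain r where r: "r > 0" "\<And>v. v\<in>Wsp T \<Longrightarrow> supn T (\<lambda>t. v t - w t) < r \<Longrightarrow> v \<in> U"
          using U wU by (auto simp: Wopen_def)
        obtain m where m: "1 / real (Suc m) < r / 2" using nat_approx_posE[of "r/2"] r by auto
        obtain c where c: "c \<in> Wdense T" "supn T (\<lambda>t. c t - w t) < 1 / real (Suc m)"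
          using Wdense_props(3)[OF T w, of "1 / real (Suc m)"] by auto
        have cW: "c \<in> Wsp T" using c Wdense_props(2) by auto
        have "b c m \<subseteq> U"
        proof
          fix v assume v: "v \<in> b c m"
          then have vW: "v \<in> Wsp T" "supn T (\<lambda>t. v t - c t) \<le> 1 / real (Suc m)"
            by (auto simp: b_def supn_minus_commute[of T c v])
          from supn_triangle[OF _ vW(1) cW w] T have "supn T (\<lambda>t. v t - w t) < r"
            using vW(2) c(2) m by simp
          then show "v \<in> U" using r(2) vW by blast
        qed
        moreover have "w \<in> b c m" using w c(2) by (simp add: b_def)
        ultimately show "w \<in> (\<Union>p \<in> {p \<in> Wdense T \<times> UNIV. b (fst p) (snd p) \<subseteq> U}. b (fst p) (snd p))"
          using c(1) by (intro UN_I[of "(c, m)"]) auto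
      qed
    qed auto
    also have "\<dots> \<in> sets N"
    proof (rule sets.countable_UN'')
      show "countable {p \<in> Wdense T \<times> (UNIV::nat set). b (fst p) (snd p) \<subseteq> U}"
        by (rule countable_subset[of _ "Wdense T \<times> UNIV"]) (auto intro!: countable_SIGMA Wdense_props(1))
      fix p assume "p \<in> {p \<in> Wdense T \<times> (UNIV::nat set). b (fst p) (snd p) \<subseteq> U}"
      then have "fst p \<in> Wsp T" using subsetD[OF Wdense_props(2)] by auto
      then show "b (fst p) (snd p) \<in> sets N"
        unfolding b_def by (rule measurable_supn_ball[OF T _ N ev])
    qed
    finally show ?thesis .
  qed
  then show ?thesis unfolding Wborel_def N[symmetric] by (intro sets.sigma_sets_subset) auto
qed

lemma Wopen_measurable_continuous:
  fixes N :: "(real \<Rightarrow> real^'d) measure" and f :: "(real \<Rightarrow> real^'d) \<Rightarrow> 'b::metric_space"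
  assumes N: "space N = Wsp T" "sets N = Wborel T"
    and f: "\<And>w e. w \<in> Wsp T \<Longrightarrow> 0 < e \<Longrightarrow> \<exists>r>0. \<forall>v\<in>Wsp T. supn T (\<lambda>t. v t - w t) < r \<longrightarrow> dist (f v) (f w) < e"
  shows "f \<in> borel_measurable N"
proof (rule borel_measurableI)
  fix S :: "'b set" assume S: "open S"
  have "f -` S \<inter> Wsp T \<in> Wopen T"
    unfolding Wopen_def
  proof (intro CollectI conjI ballI)
    fix w assume w: "w \<in> f -` S \<inter> Wsp T"
    then obtain e where e: "0 < e" "\<And>y. dist y (f w) < e \<Longrightarrow> y \<in> S" using S unfolding open_dist by auto
    from f[of w e] w e(1) obtain r where "r > 0" "\<forall>v\<in>Wsp T. supn T (\<lambda>t. v t - w t) < r \<longrightarrow> dist (f v) (f w) < e" by auto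
    then show "\<exists>r>0. \<forall>v\<in>Wsp T. supn T (\<lambda>t. v t - w t) < r \<longrightarrow> v \<in> f -` S \<inter> Wsp T" using e(2) by auto
  qed auto
  then show "f -` S \<inter> space N \<in> sets N" unfolding N Wborel_def by (rule sigma_sets.Basic)
qed

lemma Wborel_evaluation_measurable:
  fixes N :: "(real \<Rightarrow> real^'d) measure"
  assumes "space N = Wsp T" "sets N = Wborel T" "t \<in> {0..T}"
  shows "(\<lambda>w. w t) \<in> borel_measurable N"
proof (rule Wopen_measurable_continuous[OF assms(1,2)])
  fix w :: "real \<Rightarrow> real^'d" and e :: real assume w: "w \<in> Wsp T" "0 < e"
  then show "\<exists>r>0. \<forall>v\<in>Wsp T. supn T (\<lambda>t. v t - w t) < r \<longrightarrow> dist (v t) (w t) < e"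
    using norm_le_supn[OF Wsp_diff_cont assms(3)] by (intro exI[of _ e]) (auto simp: dist_norm intro: le_less_trans)
qed

lemma Cb_measurable:
  assumes "space N = Wsp T" "sets N = Wborel T" "f \<in> Cb T"
  shows "f \<in> borel_measurable N"
  using assms(3) by (intro Wopen_measurable_continuous[OF assms(1,2)]) (auto simp: Cb_def dist_real_def)

text \<open>Reduces measurability of a random path to that of its values at fixed times; random
  series, interpolants and Euler paths all enter path space this way.\<close>

lemma measurable_Wborel:
  fixes N :: "(real \<Rightarrow> real^'d) measure" and X :: "'a \<Rightarrow> real \<Rightarrow> real^'d"
  assumes T: "0 < T" and N: "space N = Wsp T" "sets N = Wborel T"
    and X: "\<And>x. x \<in> space M \<Longrightarrow> X x \<in> Wsp T" and Xt: "\<And>t. t \<in> {0..T} \<Longrightarrow> (\<lambda>x. X x t) \<in> borel_measurable M"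
  shows "X \<in> measurable M N"
proof -
  \<comment> \<open>The sigma-algebra generated by evaluations, realised as a pull-back of the
    product sigma-algebra over [0,T]; it contains the Borel sets by separability.\<close>
  define V where "V = vimage_algebra (Wsp T) (\<lambda>w. restrict w {0..T}) (PiM {0..T} (\<lambda>_. borel :: (real^'d) measure))"
  have sV: "space V = Wsp T" by (simp add: V_def)
  have r: "(\<lambda>w. restrict w {0..T}) \<in> measurable V (PiM {0..T} (\<lambda>_. borel :: (real^'d) measure))"
    unfolding V_def by (rule measurable_vimage_algebra1) (auto simp: space_PiM)
  have "(\<lambda>w. w t) \<in> borel_measurable V" if "t \<in> {0..T}" for t
    using measurable_compose[OF r measurable_component_singleton[OF that]] that by (simp add: cong: measurable_cong)
  from Wborel_subset_if_evaluations_measurable[OF T sV this] have sub: "sets N \<subseteq> sets V" by (simp add: N)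
  have "X \<in> measurable M V"
    unfolding V_def
  proof (rule measurable_vimage_algebra2)
    show "(\<lambda>x. restrict (X x) {0..T}) \<in> measurable M (PiM {0..T} (\<lambda>_. borel))"
      using Xt by (intro measurable_restrict) auto
  qed (use X in auto)
  then show ?thesis using sub N sV by (auto simp: measurable_def)
qed

lemma sum_lessThan_add:
  fixes f :: "nat \<Rightarrow> 'a::comm_monoid_add"
  shows "(\<Sum>j<n + m. f j) = (\<Sum>j<n. f j) + (\<Sum>j<m. f (n + j))"
  by (induction m) (simp_all add: add.assoc)

text \<open>The phases are the finite linear functionals of evaluations. Their characteristic
  functions are prescribed by \<open>is_wiener\<close>, and they generate the Borel sets.\<close>

theorem is_wiener_unique:
  assumes T: "0 < T" and M: "is_wiener T M" and N: "is_wiener T N"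
  shows "M = (N :: (real \<Rightarrow> real^'d) measure)"
proof -
  define lf where "lf = (\<lambda>(n::nat) ts xs (w :: real \<Rightarrow> real^'d). \<Sum>j<n. xs j \<bullet> w (ts j))"
  define L where "L = {\<phi>. \<exists>n ts xs. (\<forall>j<n. ts j \<in> {0..T}) \<and> \<phi> = lf n ts xs}"
  note Md = M[unfolded is_wiener_def] and Nd = N[unfolded is_wiener_def]
  have MW: "space M = Wsp T" "sets M = Wborel T" and NW: "space N = Wsp T" "sets N = Wborel T"
    using Md Nd by auto
  have lfm: "lf n ts xs \<in> borel_measurable M" if "\<forall>j<n. ts j \<in> {0..T}" for n ts xs
    unfolding lf_def
    using Wborel_evaluation_measurable[OF MW] that by (intro borel_measurable_sum borel_measurable_inner) auto
  show ?thesis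
  proof (rule prob_measure_eq_of_char_eq[where L = L])
    show "(\<lambda>_. 0) \<in> L" by (auto simp: L_def lf_def fun_eq_iff intro!: exI[of _ 0])
    fix \<phi> assume "\<phi> \<in> L"
    then obtain n ts xs where \<phi>: "\<forall>j<n. ts j \<in> {0..T}" "\<phi> = lf n ts xs" by (auto simp: L_def)
    show "\<phi> \<in> borel_measurable M" using lfm \<phi> by simp
    show "integral\<^sup>L M (\<lambda>x. cis (\<phi> x)) = integral\<^sup>L N (\<lambda>x. cis (\<phi> x))"
      unfolding \<phi>(2) lf_def using Md Nd \<phi>(1) by simp
    show "(\<lambda>x. c * \<phi> x) \<in> L" for c
    proof -
      have "(\<lambda>x. c * \<phi> x) = lf n ts (\<lambda>j. c *\<^sub>R xs j)" by (simp add: \<phi>(2) lf_def sum_distrib_left)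
      then show ?thesis using \<phi>(1) by (auto simp: L_def)
    qed
    fix \<psi> assume "\<psi> \<in> L"
    then obtain m us ys where \<psi>: "\<forall>j<m. us j \<in> {0..T}" "\<psi> = lf m us ys" by (auto simp: L_def)
    \<comment> \<open>A sum of two functionals is again of the required form after concatenating the
      lists of times and vectors.\<close>
    define ts' xs' where "ts' = (\<lambda>j. if j < n then ts j else us (j - n))" and "xs' = (\<lambda>j. if j < n then xs j else ys (j - n))"
    have "(\<lambda>x. \<phi> x + \<psi> x) = lf (n + m) ts' xs'"
    proof
      fix w
      have "lf (n + m) ts' xs' w = (\<Sum>j<n. xs' j \<bullet> w (ts' j)) + (\<Sum>j<m. xs' (n + j) \<bullet> w (ts' (n + j)))"
        unfolding lf_def by (rule sum_lessThan_add)
      also have "\<dots> = \<phi> w + \<psi> w" unfolding \<phi> \<psi> lf_def ts'_def xs'_def by simp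
      finally show "\<phi> w + \<psi> w = lf (n + m) ts' xs' w" by simp
    qed
    then show "(\<lambda>x. \<phi> x + \<psi> x) \<in> L" using \<phi>(1) \<psi>(1)
      by (auto simp: L_def ts'_def intro!: exI[of _ "n + m"] exI[of _ ts'] exI[of _ xs'])
  next
    fix N' :: "(real \<Rightarrow> real^'d) measure" assume N': "space N' = space M" "\<And>\<phi>. \<phi> \<in> L \<Longrightarrow> \<phi> \<in> borel_measurable N'"
    have "(\<lambda>w. w t) \<in> borel_measurable N'" if t: "t \<in> {0..T}" for t
    proof (rule borel_measurable_euclidean_space[THEN iffD2], rule)
      fix i :: "real^'d"
      have "(\<lambda>w. w t \<bullet> i) = lf 1 (\<lambda>_. t) (\<lambda>_. i)" by (simp add: lf_def inner_commute)
      then show "(\<lambda>w. w t \<bullet> i) \<in> borel_measurable N'" using t by (intro N'(2)) (auto simp: L_def intro!: exI[of _ "1::nat"] exI[of _ "\<lambda>_. t"] exI[of _ "\<lambda>_. i"])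
    qed
    then show "sets M \<subseteq> sets N'"
      using Wborel_subset_if_evaluations_measurable[OF T, of N'] N'(1) MW by simp
  qed (use Md Nd in auto)
qed

section \<open>Existence of Wiener measure\<close>

definition tent :: "real \<Rightarrow> real" where "tent x = max 0 (min x (1 - x))"

lemma tent_bounds: "0 \<le> tent x" "tent x \<le> 1" by (auto simp: tent_def)

lemma continuous_tent: "continuous_on UNIV tent"
  unfolding tent_def by (intro continuous_intros)

text \<open>Integer translates of the tent have disjoint supports, up to endpoints where they
  vanish.\<close>

lemma tent_shift: "tent (x - of_int k) = (if \<lfloor>x\<rfloor> = k then tent (frac x) else 0)"
proof (cases "\<lfloor>x\<rfloor> = k")
  case True then show ?thesis by (simp add: frac_def)
next
  case False
  then have "x - of_int k < 0 \<or> 1 \<le> x - of_int k" by linarith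
  then show ?thesis using False by (auto simp: tent_def)
qed

text \<open>Covariance of a process made of independent standard Brownian bridges, one on each
  interval [k,k+1]; \<open>min u v - u * v\<close> is the covariance of a single bridge.\<close>

definition bridge_cov :: "real \<Rightarrow> real \<Rightarrow> real" where
  "bridge_cov x y = (if \<lfloor>x\<rfloor> = \<lfloor>y\<rfloor> then min (frac x) (frac y) - frac x * frac y else 0)"

lemma bridge_cov_bounds: "\<bar>bridge_cov x y\<bar> \<le> 1"
proof -
  define u v where "u = frac x" and "v = frac y"
  have uv: "0 \<le> u" "u < 1" "0 \<le> v" "v < 1" by (auto simp: u_def v_def frac_lt_1)
  have "u * v \<le> u * 1" "u * v \<le> 1 * v" "0 \<le> u * v"
    using uv mult_left_le_one_le[of v u] mult_right_le_one_le[of u v] by auto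
  then have "\<bar>min u v - u * v\<bar> \<le> 1" using uv by linarith
  then show ?thesis by (simp add: bridge_cov_def u_def v_def)
qed

text \<open>Conditioning the bridge on its midpoint splits off one tent function and leaves two
  independent bridges at half the scale.\<close>

lemma bridge_cov_split:
  "bridge_cov x y = (if \<lfloor>x\<rfloor> = \<lfloor>y\<rfloor> then tent (frac x) * tent (frac y) else 0) + bridge_cov (2 * x) (2 * y) / 2"
proof -
  have fl: "\<lfloor>2 * z\<rfloor> = 2 * \<lfloor>z\<rfloor> + (if frac z < 1/2 then 0 else 1) \<and>
      frac (2 * z) = 2 * frac z - (if frac z < 1/2 then 0 else 1)" for z :: real
  proof -
    have z: "z = of_int \<lfloor>z\<rfloor> + frac z" "0 \<le> frac z" "frac z < 1" by (auto simp: frac_def) linarith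
    have "\<lfloor>2 * z\<rfloor> = 2 * \<lfloor>z\<rfloor> + (if frac z < 1/2 then 0 else 1)"
      by (rule floor_unique) (use z in \<open>auto simp: frac_def split: if_splits\<close>)
    then show ?thesis by (simp add: frac_def)
  qed
  show ?thesis
  proof (cases "\<lfloor>x\<rfloor> = \<lfloor>y\<rfloor>")
    case False
    then have "\<lfloor>2 * x\<rfloor> \<noteq> \<lfloor>2 * y\<rfloor>" using fl[of x] fl[of y] by (auto split: if_splits)
    then show ?thesis using False by (simp add: bridge_cov_def)
  next
    case True
    define u v where "u = frac x" and "v = frac y"
    have uv: "0 \<le> u" "u < 1" "0 \<le> v" "v < 1" by (auto simp: u_def v_def frac_lt_1)
    show ?thesis
      unfolding bridge_cov_def conjunct1[OF fl] conjunct2[OF fl]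
      using True uv unfolding u_def[symmetric] v_def[symmetric]
      by (auto simp: tent_def min_def max_def field_simps)
  qed
qed

text \<open>The index is (level, shift). Level 0 has only the shift 0, so the pair (0,1) is free to
  encode the linear function, the part of Brownian motion complementary to the bridge. The factor
  2^(-n/2) is the square root of the factor 1/2 gained at each halving of the bridge.\<close>

definition schauder :: "nat \<times> nat \<Rightarrow> real \<Rightarrow> real" where
  "schauder p s = (if p = (0, 1) then s else sqrt (1/2) ^ fst p * tent (2 ^ fst p * s - real (snd p)))"

lemma continuous_on_schauder: "continuous_on S (schauder p)"
proof (cases "p = (0, 1)")
  case True
  then have "schauder p = (\<lambda>s. s)" by (auto simp: schauder_def)
  then show ?thesis by simp
next
  case False
  then have "schauder p = (\<lambda>s. sqrt (1/2) ^ fst p * tent (2 ^ fst p * s - real (snd p)))" by (auto simp: schauder_def)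
  then show ?thesis by (auto intro!: continuous_intros continuous_on_compose2[OF continuous_tent])
qed

definition schauder_ind :: "nat \<Rightarrow> (nat \<times> nat) set" where
  "schauder_ind N = insert (0, 1) (SIGMA n:{..<N}. {..<2 ^ n})"

lemma finite_schauder_ind [simp]: "finite (schauder_ind N)" by (simp add: schauder_ind_def)

lemma sum_schauder_ind:
  "(\<Sum>p\<in>schauder_ind N. f p) = f (0, 1) + (\<Sum>n<N. \<Sum>k<2 ^ n. f (n, k :: nat))" for f :: "_ \<Rightarrow> real"
  unfolding schauder_ind_def by (subst sum.insert) (auto simp: sum.Sigma)

text \<open>At given s and t at most one shift contributes, and only when both points lie in the
  same dyadic cell.\<close>

lemma schauder_level:
  assumes "0 \<le> s" "s < 1" "0 \<le> t" "t < 1"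
  shows "(\<Sum>k<2 ^ n. schauder (n, k) s * schauder (n, k) t)
    = (1/2) ^ n * (if \<lfloor>2 ^ n * s\<rfloor> = \<lfloor>2 ^ n * t\<rfloor> then tent (frac (2 ^ n * s)) * tent (frac (2 ^ n * t)) else 0)"
proof -
  define x y where "x = 2 ^ n * s" and "y = 2 ^ n * t"
  define m where "m = nat \<lfloor>x\<rfloor>"
  have m: "0 \<le> x" "x < 2 ^ n" using assms by (auto simp: x_def)
  then have mi: "int m = \<lfloor>x\<rfloor>" by (simp add: m_def)
  have "real m < 2 ^ n" using m mi by linarith
  then have mn: "m < 2 ^ n" by (metis of_nat_less_iff of_nat_numeral of_nat_power)
  have sq: "sqrt (1/2) ^ n * sqrt (1/2) ^ n = (1/2 :: real) ^ n"
    by (simp add: power_mult_distrib[symmetric] real_sqrt_mult[symmetric])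
  have ne: "(n, k) \<noteq> (0, 1)" if "k < 2 ^ n" for k :: nat using that by auto
  have "(\<Sum>k<2 ^ n. schauder (n, k) s * schauder (n, k) t)
      = (\<Sum>k<2 ^ n. (1/2) ^ n * (tent (x - of_int (int k)) * tent (y - of_int (int k))))"
  proof (rule sum.cong[OF refl])
    fix k assume "k \<in> {..<2 ^ n :: nat}"
    then have *: "schauder (n, k) r = sqrt (1/2) ^ n * tent (2 ^ n * r - real k)" for r
      using ne[of k] by (auto simp: schauder_def)
    have "c * a * (c * b) = c * c * (a * b)" for a b c :: real by simp
    then show "schauder (n, k) s * schauder (n, k) t = (1/2) ^ n * (tent (x - of_int (int k)) * tent (y - of_int (int k)))"
      unfolding * sq[symmetric] x_def y_def by simp
  qed
  also have "\<dots> = (\<Sum>k<2 ^ n. if k = m then (1/2) ^ n * (if \<lfloor>x\<rfloor> = \<lfloor>y\<rfloor> then tent (frac x) * tent (frac y) else 0) else 0)"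
    unfolding tent_shift using mi by (intro sum.cong refl) auto
  also have "\<dots> = (1/2) ^ n * (if \<lfloor>x\<rfloor> = \<lfloor>y\<rfloor> then tent (frac x) * tent (frac y) else 0)"
    using mn by simp
  finally show ?thesis by (simp add: x_def y_def)
qed

text \<open>Repeated halving: after N levels the missing covariance is that of the bridges on the
  dyadic cells of length 2^-N, scaled by 2^-N. The linear function supplies s t, which completes the
  bridge covariance to the minimum.\<close>

lemma schauder_cov:
  assumes st: "0 \<le> s" "s < 1" "0 \<le> t" "t < 1"
  shows "(\<Sum>p\<in>schauder_ind N. schauder p s * schauder p t) = min s t - (1/2) ^ N * bridge_cov (2 ^ N * s) (2 ^ N * t)"
proof (induction N)
  case 0
  have "\<lfloor>s\<rfloor> = 0" "\<lfloor>t\<rfloor> = 0" "frac s = s" "frac t = t" using st by (auto simp: floor_eq_iff frac_eq)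
  then show ?case by (simp add: sum_schauder_ind bridge_cov_def schauder_def)
next
  case (Suc N)
  have "(\<Sum>p\<in>schauder_ind (Suc N). schauder p s * schauder p t)
      = (\<Sum>p\<in>schauder_ind N. schauder p s * schauder p t) + (\<Sum>k<2 ^ N. schauder (N, k) s * schauder (N, k) t)"
    by (simp add: sum_schauder_ind)
  then show ?case
    unfolding Suc schauder_level[OF st] using bridge_cov_split[of "2 ^ N * s" "2 ^ N * t"]
    by (simp add: algebra_simps)
qed

lemma schauder_cov_tendsto:
  assumes "0 \<le> s" "s < 1" "0 \<le> t" "t < 1"
  shows "(\<lambda>N. \<Sum>p\<in>schauder_ind N. schauder p s * schauder p t) \<longlonglongrightarrow> min s t"
proof -
  have "(\<lambda>N. (1/2) ^ N * bridge_cov (2 ^ N * s) (2 ^ N * t)) \<longlonglongrightarrow> 0"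
  proof (rule Lim_null_comparison)
    show "\<forall>\<^sub>F N in sequentially. norm ((1/2) ^ N * bridge_cov (2 ^ N * s) (2 ^ N * t)) \<le> (1/2) ^ N"
      using bridge_cov_bounds by (intro always_eventually allI) (simp add: abs_mult mult_left_le)
    show "(\<lambda>N. (1/2) ^ N) \<longlonglongrightarrow> (0::real)" by (rule LIMSEQ_power_zero) simp
  qed
  then show ?thesis unfolding schauder_cov[OF assms] using tendsto_diff[OF tendsto_const] by force
qed

text \<open>Only one tent is nonzero at s; bounding its coefficient by the sum over the level
  removes the dependence on s. Fourth powers are taken because (1/4)^n beats the 2^n terms of a
  level, whereas second powers would give (1/2)^n and only balance them.\<close>

lemma schauder_level_bound:
  assumes s: "0 \<le> s" "s < 1"
  shows "\<bar>\<Sum>k<2 ^ n. z k * schauder (n, k) s\<bar> ^ 4 \<le> (\<Sum>k<2 ^ n. z k ^ 4) * (1/4) ^ n"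
proof -
  define x where "x = 2 ^ n * s"
  define m where "m = nat \<lfloor>x\<rfloor>"
  have m: "0 \<le> x" "x < 2 ^ n" using assms by (auto simp: x_def)
  then have mi: "int m = \<lfloor>x\<rfloor>" by (simp add: m_def)
  have "real m < 2 ^ n" using m mi by linarith
  then have mn: "m < 2 ^ n" by (metis of_nat_less_iff of_nat_numeral of_nat_power)
  have "(\<Sum>k<2 ^ n. z k * schauder (n, k) s) = (\<Sum>k<2 ^ n. z k * (sqrt (1/2) ^ n * tent (x - of_int (int k))))"
    by (intro sum.cong refl) (auto simp: schauder_def x_def)
  also have "\<dots> = (\<Sum>k<2 ^ n. if k = m then z m * (sqrt (1/2) ^ n * tent (frac x)) else 0)"
    unfolding tent_shift using mi by (intro sum.cong refl) auto
  also have "\<dots> = z m * (sqrt (1/2) ^ n * tent (frac x))" using mn by simp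
  finally have eq: "(\<Sum>k<2 ^ n. z k * schauder (n, k) s) = z m * (sqrt (1/2) ^ n * tent (frac x))" .
  have q: "(sqrt (1/2) ^ n) ^ 4 = (1/4 :: real) ^ n"
  proof -
    have "sqrt (1/2) ^ 4 = (sqrt (1/2) * sqrt (1/2)) * (sqrt (1/2) * sqrt (1/2))"
      by (simp only: power4_eq_xxxx mult.assoc)
    then have "sqrt (1/2) ^ 4 = (1/4 :: real)" by simp
    then show ?thesis by (metis mult.commute power_mult)
  qed
  have "\<bar>\<Sum>k<2 ^ n. z k * schauder (n, k) s\<bar> ^ 4 = z m ^ 4 * ((1/4) ^ n * tent (frac x) ^ 4)"
    unfolding eq by (simp add: power_mult_distrib q)
  also have "\<dots> \<le> z m ^ 4 * ((1/4) ^ n * 1)"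
    using tent_bounds[of "frac x"] by (intro mult_left_mono power_le_one) auto
  also have "\<dots> \<le> (\<Sum>k<2 ^ n. z k ^ 4) * (1/4) ^ n"
    using mn by (simp, intro mult_right_mono member_le_sum) auto
  finally show ?thesis .
qed

section \<open>The random series and its paths\<close>

definition gauss_space :: "(nat \<times> nat \<times> 'd \<Rightarrow> real) measure" where
  "gauss_space = PiM UNIV (\<lambda>_. std_normal_distribution)"

lemma prob_space_std_normal: "prob_space std_normal_distribution"
  by (rule prob_space_normal_density) simp

lemma gauss_space_prob: "prob_space (gauss_space :: (nat \<times> nat \<times> 'd \<Rightarrow> real) measure)"
  unfolding gauss_space_def by (intro prob_space_PiM prob_space_std_normal)

lemma gauss_space_measurable [measurable]: "(\<lambda>\<omega>. \<omega> j) \<in> borel_measurable gauss_space"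
  unfolding gauss_space_def
  using measurable_component_singleton[of j UNIV "\<lambda>_. std_normal_distribution"] by simp

lemma space_gauss_space [simp]: "space gauss_space = UNIV"
  by (simp add: gauss_space_def space_PiM)

lemma gauss_space_fourth_moment:
  "(\<integral>\<^sup>+\<omega>. ennreal (\<omega> j ^ 4) \<partial>gauss_space) = (\<integral>\<^sup>+x. ennreal (x ^ 4) \<partial>std_normal_distribution)"
proof -
  have "(\<integral>\<^sup>+x. ennreal (x ^ 4) \<partial>std_normal_distribution)
      = (\<integral>\<^sup>+x. ennreal (x ^ 4) \<partial>distr gauss_space std_normal_distribution (\<lambda>\<omega>. \<omega> j))"
    unfolding gauss_space_def by (subst distr_PiM_component) (auto intro: prob_space_std_normal)
  also have "\<dots> = (\<integral>\<^sup>+\<omega>. ennreal (\<omega> j ^ 4) \<partial>gauss_space)"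
    by (subst nn_integral_distr) auto
  finally show ?thesis ..
qed

lemma std_normal_fourth_moment_finite: "(\<integral>\<^sup>+x. ennreal (x ^ 4) \<partial>std_normal_distribution) < \<infinity>"
proof -
  have "integrable std_normal_distribution (\<lambda>x. x ^ 4)" by (rule integrable_std_normal_distribution_moment)
  then show ?thesis by (subst nn_integral_eq_integral) auto
qed

lemma gauss_space_linear_char:
  assumes J: "finite J"
  shows "integral\<^sup>L gauss_space (\<lambda>\<omega>. cis (\<Sum>j\<in>J. a j * \<omega> j)) = complex_of_real (exp (- (1/2) * (\<Sum>j\<in>J. (a j)\<^sup>2)))"
proof -
  interpret GP: product_prob_space "\<lambda>_ :: nat \<times> nat \<times> 'a. std_normal_distribution" UNIV
    by (rule product_prob_spaceI) (rule prob_space_std_normal)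
  have m: "(\<lambda>\<omega>. restrict \<omega> J) \<in> measurable gauss_space (PiM J (\<lambda>_. std_normal_distribution))"
    unfolding gauss_space_def by (rule measurable_restrict_subset) simp
  have "integral\<^sup>L gauss_space (\<lambda>\<omega>. cis (\<Sum>j\<in>J. a j * \<omega> j)) = integral\<^sup>L gauss_space (\<lambda>\<omega>. \<Prod>j\<in>J. iexp (a j * restrict \<omega> J j))"
    by (intro Bochner_Integration.integral_cong refl) (simp add: cis_conv_exp sum_distrib_left exp_sum J)
  also have "\<dots> = integral\<^sup>L (distr gauss_space (PiM J (\<lambda>_. std_normal_distribution)) (\<lambda>\<omega>. restrict \<omega> J))
      (\<lambda>\<omega>. \<Prod>j\<in>J. iexp (a j * \<omega> j))"
  proof (rule integral_distr[OF m, symmetric], rule borel_measurable_prod)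
    fix j assume j: "j \<in> J"
    have "(\<lambda>x. iexp (a j * x)) \<in> borel_measurable std_normal_distribution" by simp
    from measurable_compose[OF measurable_component_singleton[OF j] this]
    show "(\<lambda>\<omega>. iexp (a j * \<omega> j)) \<in> borel_measurable (PiM J (\<lambda>_. std_normal_distribution))" .
  qed
  also have "distr gauss_space (PiM J (\<lambda>_. std_normal_distribution)) (\<lambda>\<omega>. restrict \<omega> J) = PiM J (\<lambda>_. std_normal_distribution)"
    unfolding gauss_space_def by (rule GP.distr_PiM_restrict_finite[OF J]) simp
  also have "integral\<^sup>L \<dots> (\<lambda>\<omega>. \<Prod>j\<in>J. iexp (a j * \<omega> j)) = (\<Prod>j\<in>J. CLINT x|std_normal_distribution. iexp (a j * x))"
  proof (rule GP.product_integral_prod[OF J])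
    fix j assume "j \<in> J"
    show "integrable std_normal_distribution (\<lambda>x. iexp (a j * x))"
      by (intro finite_measure.integrable_const_bound[OF prob_space.finite_measure[OF prob_space_std_normal], where B = 1]) auto
  qed
  also have "\<dots> = (\<Prod>j\<in>J. complex_of_real (exp (- (1/2) * (a j)\<^sup>2)))"
    using char_std_normal_distribution by (simp add: char_def fun_eq_iff)
  also have "\<dots> = complex_of_real (exp (\<Sum>j\<in>J. - (1/2) * (a j)\<^sup>2))"
    by (simp add: exp_sum J)
  finally show ?thesis by (simp add: sum_distrib_left)
qed

definition bm_approx :: "nat \<Rightarrow> (nat \<times> nat \<times> 'd \<Rightarrow> real) \<Rightarrow> 'd \<Rightarrow> real \<Rightarrow> real" where
  "bm_approx N \<omega> i s = (\<Sum>p\<in>schauder_ind N. \<omega> (fst p, snd p, i) * schauder p s)"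

text \<open>The rate 1/3 lies strictly between 1/4 and 1/2. Below 1/2, the expectation is a
  convergent geometric series of ratio 2/3; above 1/4, finiteness makes the levels of the series
  decay geometrically.\<close>

definition bm_weight :: "(nat \<times> nat \<times> 'd::finite \<Rightarrow> real) \<Rightarrow> ennreal" where
  "bm_weight \<omega> = (\<Sum>i\<in>UNIV. \<Sum>n. ennreal ((\<Sum>k<2 ^ n. \<omega> (n, k, i) ^ 4) * (1/3) ^ n))"

lemma bm_weight_measurable [measurable]: "bm_weight \<in> borel_measurable gauss_space"
  unfolding bm_weight_def by measurable

lemma AE_bm_weight:
  "AE \<omega> in (gauss_space :: (nat \<times> nat \<times> 'd::finite \<Rightarrow> real) measure). bm_weight \<omega> < \<infinity>"
proof -
  obtain K where K: "(\<integral>\<^sup>+x. ennreal (x ^ 4) \<partial>std_normal_distribution) = ennreal K" "0 \<le> K"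
    using std_normal_fourth_moment_finite by (metis ennreal_cases infinity_ennreal_def less_irrefl)
  have "(\<integral>\<^sup>+\<omega>. ennreal ((\<Sum>k<2 ^ n. \<omega> (n, k, i) ^ 4) * (1/3) ^ n) \<partial>gauss_space) = ennreal (K * (2/3) ^ n)" for n and i :: 'd
  proof -
    have "(\<integral>\<^sup>+\<omega>. ennreal ((\<Sum>k<2 ^ n. \<omega> (n, k, i) ^ 4) * (1/3) ^ n) \<partial>gauss_space)
      = (\<integral>\<^sup>+\<omega>. (\<Sum>k<2 ^ n. ennreal (\<omega> (n, k, i) ^ 4)) * ennreal ((1/3) ^ n) \<partial>gauss_space)"
      by (intro nn_integral_cong) (simp add: ennreal_mult'' sum_ennreal)
    also have "\<dots> = (\<Sum>k<(2::nat) ^ n. ennreal K) * ennreal ((1/3) ^ n)"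
      by (subst nn_integral_multc, measurable, subst nn_integral_sum)
        (auto simp: gauss_space_fourth_moment K)
    also have "\<dots> = ennreal ((2 ^ n * K) * (1/3) ^ n)"
    proof -
      have "(\<Sum>k<(2::nat) ^ n. ennreal K) = ennreal (\<Sum>k<(2::nat) ^ n. K)" using K(2) by (intro sum_ennreal) auto
      also have "(\<Sum>k<(2::nat) ^ n. K) = 2 ^ n * K" by simp
      finally have *: "(\<Sum>k<(2::nat) ^ n. ennreal K) = ennreal (2 ^ n * K)" .
      show ?thesis unfolding * by (rule ennreal_mult''[symmetric]) simp
    qed
    also have "(2 ^ n * K) * (1/3) ^ n = K * (2/3 :: real) ^ n"
      by (simp add: power_divide)
    finally show ?thesis .
  qed
  then have eq: "integral\<^sup>N (gauss_space :: (nat \<times> nat \<times> 'd \<Rightarrow> real) measure) bm_weight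
      = (\<Sum>i::'d\<in>UNIV. \<Sum>n. ennreal (K * (2/3) ^ n))"
    unfolding bm_weight_def by (subst nn_integral_sum, measurable) (subst nn_integral_suminf, auto)
  have "(\<Sum>i::'d\<in>UNIV. \<Sum>n. ennreal (K * (2/3) ^ n)) < \<infinity>"
  proof -
    have "summable (\<lambda>n. K * (2/3 :: real) ^ n)" by (intro summable_mult summable_geometric) simp
    then have "(\<Sum>n. ennreal (K * (2/3) ^ n)) = ennreal (\<Sum>n. K * (2/3) ^ n)"
      using K(2) by (intro suminf_ennreal2) auto
    then show ?thesis by (simp add: ennreal_mult_less_top of_nat_less_top)
  qed
  then have "integral\<^sup>N (gauss_space :: (nat \<times> nat \<times> 'd \<Rightarrow> real) measure) bm_weight \<noteq> \<infinity>"
    unfolding eq by simp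
  from nn_integral_PInf_AE[OF bm_weight_measurable this] show ?thesis
    by eventually_elim (simp add: less_top)
qed

text \<open>Finiteness of the weight bounds the fourth moments of level n by K 3^n, so its fourth
  power is at most K (3/4)^n uniformly in s, and Weierstrass's test applies.\<close>

lemma bm_approx_uniform_limit:
  fixes \<omega> :: "nat \<times> nat \<times> 'd::finite \<Rightarrow> real"
  assumes "bm_weight \<omega> < \<infinity>"
  shows "\<exists>g. uniform_limit {0..1/2} (\<lambda>N. bm_approx N \<omega> i) g sequentially"
proof -
  define m where "m = (\<lambda>n. \<Sum>k<2 ^ n. \<omega> (n, k, i) ^ 4)"
  have "(\<Sum>n. ennreal (m n * (1/3) ^ n)) \<le> bm_weight \<omega>"
    unfolding bm_weight_def m_def by (rule member_le_sum) auto
  then obtain K where K: "(\<Sum>n. ennreal (m n * (1/3) ^ n)) = ennreal K" "0 \<le> K"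
    using assms by (metis ennreal_cases infinity_ennreal_def less_irrefl order.strict_trans1 top.not_eq_extremum)
  have mK: "m n \<le> K * 3 ^ n" for n
  proof -
    have "(\<Sum>n\<in>{n}. ennreal (m n * (1/3) ^ n)) \<le> (\<Sum>n. ennreal (m n * (1/3) ^ n))"
      by (rule sum_le_suminf) auto
    then have "m n * (1/3) ^ n \<le> K" using K by simp
    then show ?thesis by (simp add: power_divide field_simps)
  qed
  define q :: real where "q = root 4 (3/4)"
  have q: "0 \<le> q" "q < 1" "q ^ 4 = 3/4" by (auto simp: q_def real_root_lt_1_iff)
  define b where "b = root 4 K"
  have b: "0 \<le> b" "b ^ 4 = K" using K(2) by (auto simp: b_def)
  define lev where "lev = (\<lambda>n s. \<Sum>k<2 ^ n. \<omega> (n, k, i) * schauder (n, k) s)"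
  have "uniform_limit {0..1/2} (\<lambda>N s. \<Sum>n<N. lev n s) (\<lambda>s. \<Sum>n. lev n s) sequentially"
  proof (rule Weierstrass_m_test[where M = "\<lambda>n. b * q ^ n"])
    show "summable (\<lambda>n. b * q ^ n)" using q by (intro summable_mult summable_geometric) auto
    fix n s assume s: "s \<in> {0..1/2::real}"
    have "\<bar>lev n s\<bar> ^ 4 \<le> m n * (1/4) ^ n"
      unfolding lev_def m_def by (rule schauder_level_bound) (use s in auto)
    also have "\<dots> \<le> K * 3 ^ n * (1/4) ^ n" by (intro mult_right_mono mK) auto
    also have "\<dots> = K * (3/4) ^ n" by (simp add: power_divide)
    also have "\<dots> = (b * q ^ n) ^ 4" by (simp add: power_mult_distrib b q(3)[symmetric] power_mult[symmetric] mult.commute)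
    finally have "\<bar>lev n s\<bar> ^ Suc 3 \<le> (b * q ^ n) ^ Suc 3" by simp
    then show "norm (lev n s) \<le> b * q ^ n"
      unfolding real_norm_def by (rule power_le_imp_le_base) (use b q in auto)
  qed
  then have "uniform_limit {0..1/2} (\<lambda>N s. \<omega> (0, 1, i) * s + (\<Sum>n<N. lev n s)) (\<lambda>s. \<omega> (0, 1, i) * s + (\<Sum>n. lev n s)) sequentially"
    by (intro uniform_limit_intros)
  moreover have "(\<lambda>N. bm_approx N \<omega> i) = (\<lambda>N s. \<omega> (0, 1, i) * s + (\<Sum>n<N. lev n s))"
    by (intro ext, simp add: bm_approx_def sum_schauder_ind lev_def) (simp add: schauder_def)
  ultimately show ?thesis by metis
qed

lemma bm_approx_measurable [measurable]: "(\<lambda>\<omega>. bm_approx N \<omega> i s) \<in> borel_measurable gauss_space"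
  unfolding bm_approx_def by measurable

text \<open>Brownian scaling: [0,T] is mapped into [0,1/2], where the series is controlled, and the
  factor sqrt(2 T) restores the variance. On the null set of infinite weight the path is set to 0,
  so that every sample lies in \<open>Wsp T\<close>.\<close>

definition bm_path :: "real \<Rightarrow> (nat \<times> nat \<times> 'd \<Rightarrow> real) \<Rightarrow> real \<Rightarrow> real^'d::finite" where
  "bm_path T \<omega> t = (if t \<in> {0..T} \<and> bm_weight \<omega> < \<infinity>
     then \<chi> i. sqrt (2 * T) * lim (\<lambda>N. bm_approx N \<omega> i (t / (2 * T))) else 0)"

lemma bm_approx_tendsto:
  assumes "bm_weight \<omega> < \<infinity>" "0 < T" "t \<in> {0..T}"
  shows "(\<lambda>N. sqrt (2 * T) * bm_approx N \<omega> i (t / (2 * T))) \<longlonglongrightarrow> bm_path T \<omega> t $ i"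
proof -
  obtain g where "uniform_limit {0..1/2} (\<lambda>N. bm_approx N \<omega> i) g sequentially"
    using bm_approx_uniform_limit[OF assms(1)] by blast
  moreover have "t / (2 * T) \<in> {0..1/2}" using assms by (auto simp: field_simps)
  ultimately have "(\<lambda>N. bm_approx N \<omega> i (t / (2 * T))) \<longlonglongrightarrow> g (t / (2 * T))"
    by (rule tendsto_uniform_limitI)
  then show ?thesis using assms by (auto simp: bm_path_def limI intro!: tendsto_mult)
qed

lemma bm_path_Wsp:
  assumes T: "0 < T"
  shows "bm_path T \<omega> \<in> Wsp T"
proof (cases "bm_weight \<omega> < \<infinity>")
  case True
  have "continuous_on {0..T} (\<lambda>t. \<chi> i. bm_path T \<omega> t $ i)"
  proof (rule continuous_on_vec_lambda)
    fix i
    obtain g where g: "uniform_limit {0..1/2} (\<lambda>N. bm_approx N \<omega> i) g sequentially"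
      using bm_approx_uniform_limit[OF True] by blast
    have "continuous_on {0..1/2} (bm_approx N \<omega> i)" for N
      unfolding bm_approx_def by (intro continuous_intros continuous_on_schauder)
    then have cg: "continuous_on {0..1/2} g" by (intro uniform_limit_theorem[OF _ g]) auto
    have "continuous_on {0..T} (\<lambda>t. sqrt (2 * T) * g (t / (2 * T)))"
      using T by (intro continuous_intros continuous_on_compose2[OF cg]) (auto simp: field_simps)
    then show "continuous_on {0..T} (\<lambda>t. bm_path T \<omega> t $ i)"
    proof (rule continuous_on_eq)
      fix t assume t: "t \<in> {0..T}"
      then have "t / (2 * T) \<in> {0..1/2}" using T by (auto simp: field_simps)
      from tendsto_mult[OF tendsto_const[of "sqrt (2 * T)"] tendsto_uniform_limitI[OF g this]]
      show "sqrt (2 * T) * g (t / (2 * T)) = bm_path T \<omega> t $ i"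
        using bm_approx_tendsto[OF True T t] by (rule LIMSEQ_unique)
    qed
  qed
  moreover have "bm_path T \<omega> 0 = 0"
  proof -
    have "bm_approx N \<omega> i 0 = 0" for N i
      unfolding bm_approx_def by (rule sum.neutral) (auto simp: schauder_def tent_def)
    then show ?thesis by (simp add: bm_path_def vec_eq_iff)
  qed
  ultimately show ?thesis by (auto simp: Wsp_def bm_path_def vec_lambda_eta)
qed (auto simp: Wsp_def bm_path_def[abs_def])

lemma bm_path_measurable:
  assumes T: "0 < T" and t: "t \<in> {0..T}"
  shows "(\<lambda>\<omega>. bm_path T \<omega> t) \<in> borel_measurable (gauss_space :: (nat \<times> nat \<times> 'd::finite \<Rightarrow> real) measure)"
proof (rule borel_measurable_euclidean_space[THEN iffD2], rule)
  fix b :: "real^'d" assume "b \<in> Basis"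
  then obtain i where i: "b = axis i 1" by (auto simp: Basis_vec_def)
  have "(\<lambda>\<omega>. bm_path T \<omega> t $ i) \<in> borel_measurable gauss_space"
  proof (rule borel_measurable_LIMSEQ_real)
    fix N
    show "(\<lambda>\<omega>. if bm_weight \<omega> < \<infinity> then sqrt (2 * T) * bm_approx N \<omega> i (t / (2 * T)) else 0) \<in> borel_measurable gauss_space"
      by measurable
  next
    fix \<omega> :: "nat \<times> nat \<times> 'd \<Rightarrow> real"
    show "(\<lambda>N. if bm_weight \<omega> < \<infinity> then sqrt (2 * T) * bm_approx N \<omega> i (t / (2 * T)) else 0) \<longlonglongrightarrow> bm_path T \<omega> t $ i"
    proof (cases "bm_weight \<omega> < \<infinity>")
      case True then show ?thesis using bm_approx_tendsto[OF True T t] by (simp only: if_True)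
    next
      case False then show ?thesis by (simp add: bm_path_def)
    qed
  qed
  then show "(\<lambda>\<omega>. bm_path T \<omega> t \<bullet> b) \<in> borel_measurable gauss_space" by (simp add: i inner_axis)
qed

lemma sum_swap3: "(\<Sum>p\<in>P. \<Sum>i\<in>I. \<Sum>j\<in>J. g p i j) = (\<Sum>j\<in>J. \<Sum>p\<in>P. \<Sum>i\<in>I. g p i j)"
  by (rule trans[OF sum.cong[OF refl sum.swap] sum.swap])

text \<open>Partial sums are finite linear combinations of independent normals, with an explicit
  characteristic function. Dominated convergence handles one side, convergence of the Schauder
  covariance the other.\<close>

lemma bm_path_char:
  fixes xs :: "nat \<Rightarrow> real^'d" and n :: nat
  assumes T: "0 < T" and ts: "\<And>j. j < n \<Longrightarrow> ts j \<in> {0..T}"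
  shows "integral\<^sup>L gauss_space (\<lambda>\<omega>. cis (\<Sum>j<n. xs j \<bullet> bm_path T \<omega> (ts j)))
    = complex_of_real (exp (- (1/2) * (\<Sum>i<n. \<Sum>j<n. min (ts i) (ts j) * (xs i \<bullet> xs j))))"
proof -
  interpret prob_space "gauss_space :: (nat \<times> nat \<times> 'd \<Rightarrow> real) measure" by (rule gauss_space_prob)
  define s where "s = (\<lambda>j. ts j / (2 * T))"
  have s: "0 \<le> s j" "s j < 1" if "j < n" for j using ts[OF that] T by (auto simp: s_def field_simps)
  define XN :: "nat \<Rightarrow> (nat \<times> nat \<times> 'd \<Rightarrow> real) \<Rightarrow> nat \<Rightarrow> real^'d"
    where "XN = (\<lambda>N \<omega> j. \<chi> i. sqrt (2 * T) * bm_approx N \<omega> i (s j))"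
  \<comment> \<open>Coefficient of the Gaussian variable with index p and coordinate i once the sums
    over times and over the series are interchanged.\<close>
  define a where "a = (\<lambda>p (i :: 'd). sqrt (2 * T) * (\<Sum>j<n. xs j $ i * schauder p (s j)))"
  have cm [measurable]: "cis \<in> borel_measurable borel"
    by (intro borel_measurable_continuous_onI continuous_intros)
  have pm: "(\<lambda>\<omega>. bm_path T \<omega> (ts j)) \<in> borel_measurable gauss_space" if "j < n" for j
    by (rule bm_path_measurable[OF T ts[OF that]])
  have XNeq: "(\<Sum>j<n. xs j \<bullet> XN N \<omega> j) = (\<Sum>j<n. \<Sum>i\<in>UNIV. xs j $ i * (sqrt (2 * T) * bm_approx N \<omega> i (s j)))" for N \<omega>
    by (simp add: XN_def inner_vec_def)
  have lim1: "(\<lambda>N. integral\<^sup>L gauss_space (\<lambda>\<omega>. cis (\<Sum>j<n. xs j \<bullet> XN N \<omega> j)))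
      \<longlonglongrightarrow> integral\<^sup>L gauss_space (\<lambda>\<omega>. cis (\<Sum>j<n. xs j \<bullet> bm_path T \<omega> (ts j)))"
  proof (rule integral_dominated_convergence[where w = "\<lambda>_. 1"])
    show "(\<lambda>\<omega>. cis (\<Sum>j<n. xs j \<bullet> XN N \<omega> j)) \<in> borel_measurable gauss_space" for N
      unfolding XNeq by measurable
    show "(\<lambda>\<omega>. cis (\<Sum>j<n. xs j \<bullet> bm_path T \<omega> (ts j))) \<in> borel_measurable gauss_space"
      by (rule measurable_compose[OF _ cm]) (intro borel_measurable_sum borel_measurable_inner pm, auto)
    show "AE \<omega> in gauss_space. (\<lambda>N. cis (\<Sum>j<n. xs j \<bullet> XN N \<omega> j)) \<longlonglongrightarrow> cis (\<Sum>j<n. xs j \<bullet> bm_path T \<omega> (ts j))"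
      using AE_bm_weight
    proof eventually_elim
      case (elim \<omega>)
      have "(\<lambda>N. \<Sum>j<n. xs j \<bullet> XN N \<omega> j) \<longlonglongrightarrow> (\<Sum>j<n. xs j \<bullet> bm_path T \<omega> (ts j))"
        unfolding XN_def s_def
        by (intro tendsto_sum tendsto_inner tendsto_const vec_tendstoI) (use bm_approx_tendsto[OF elim T ts] in simp)
      moreover have "isCont cis x" for x
        using continuous_on_eq_continuous_at[of UNIV cis] continuous_on_cis[OF continuous_on_id] by simp
      ultimately show ?case by (rule isCont_tendsto_compose[rotated])
    qed
  qed auto
  have "integral\<^sup>L gauss_space (\<lambda>\<omega>. cis (\<Sum>j<n. xs j \<bullet> XN N \<omega> j))
      = complex_of_real (exp (- (1/2) * (\<Sum>i<n. \<Sum>j<n. 2 * T * (xs i \<bullet> xs j) * (\<Sum>p\<in>schauder_ind N. schauder p (s i) * schauder p (s j)))))" for N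
  proof -
    define \<iota> where "\<iota> = (\<lambda>(p :: nat \<times> nat, i :: 'd). (fst p, snd p, i))"
    have inj: "inj \<iota>" by (auto simp: inj_def \<iota>_def)
    define J where "J = \<iota> ` (schauder_ind N \<times> UNIV)"
    define A where "A = (\<lambda>(k, l, i). a (k, l) i)"
    have "(\<Sum>j<n. xs j \<bullet> XN N \<omega> j) = (\<Sum>q\<in>J. A q * \<omega> q)" for \<omega>
    proof -
      have "(\<Sum>q\<in>J. A q * \<omega> q) = (\<Sum>p\<in>schauder_ind N. \<Sum>i\<in>UNIV. a p i * \<omega> (fst p, snd p, i))"
        unfolding J_def by (subst sum.reindex[OF inj_on_subset[OF inj]])
          (auto simp: sum.cartesian_product \<iota>_def A_def intro!: sum.cong)
      also have "\<dots> = (\<Sum>p\<in>schauder_ind N. \<Sum>i\<in>UNIV. \<Sum>j<n. xs j $ i * (sqrt (2 * T) * (\<omega> (fst p, snd p, i) * schauder p (s j))))"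
        unfolding a_def by (intro sum.cong refl) (simp add: sum_distrib_left sum_distrib_right mult_ac)
      also have "\<dots> = (\<Sum>j<n. \<Sum>i\<in>UNIV. \<Sum>p\<in>schauder_ind N. xs j $ i * (sqrt (2 * T) * (\<omega> (fst p, snd p, i) * schauder p (s j))))"
        by (rule trans[OF sum_swap3], intro sum.cong refl sum.swap)
      also have "\<dots> = (\<Sum>j<n. xs j \<bullet> XN N \<omega> j)"
        unfolding XNeq bm_approx_def by (simp add: sum_distrib_left)
      finally show ?thesis ..
    qed
    then have "integral\<^sup>L gauss_space (\<lambda>\<omega>. cis (\<Sum>j<n. xs j \<bullet> XN N \<omega> j))
        = complex_of_real (exp (- (1/2) * (\<Sum>q\<in>J. (A q)\<^sup>2)))"
      by (simp add: gauss_space_linear_char J_def)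
    also have "(\<Sum>q\<in>J. (A q)\<^sup>2) = (\<Sum>p\<in>schauder_ind N. \<Sum>i\<in>UNIV. (a p i)\<^sup>2)"
      unfolding J_def by (subst sum.reindex[OF inj_on_subset[OF inj]])
          (auto simp: sum.cartesian_product \<iota>_def A_def intro!: sum.cong)
    also have "\<dots> = (\<Sum>p\<in>schauder_ind N. \<Sum>i\<in>UNIV. \<Sum>j<n. \<Sum>l<n. 2 * T * ((xs j $ i * xs l $ i) * (schauder p (s j) * schauder p (s l))))"
    proof (intro sum.cong refl)
      fix p i
      have "(a p i)\<^sup>2 = 2 * T * ((\<Sum>j<n. xs j $ i * schauder p (s j)) * (\<Sum>j<n. xs j $ i * schauder p (s j)))"
        using T by (simp add: a_def power_mult_distrib power2_eq_square)
      then show "(a p i)\<^sup>2 = (\<Sum>j<n. \<Sum>l<n. 2 * T * ((xs j $ i * xs l $ i) * (schauder p (s j) * schauder p (s l))))"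
        by (simp add: sum_product sum_distrib_left mult_ac)
    qed
    also have "\<dots> = (\<Sum>j<n. \<Sum>l<n. \<Sum>p\<in>schauder_ind N. \<Sum>i\<in>UNIV. 2 * T * ((xs j $ i * xs l $ i) * (schauder p (s j) * schauder p (s l))))"
      by (rule trans[OF sum_swap3], intro sum.cong refl sum_swap3)
    also have "\<dots> = (\<Sum>j<n. \<Sum>l<n. 2 * T * (xs j \<bullet> xs l) * (\<Sum>p\<in>schauder_ind N. schauder p (s j) * schauder p (s l)))"
      by (intro sum.cong refl, subst sum.swap)
        (simp add: inner_vec_def sum_distrib_left sum_distrib_right mult_ac)
    finally show ?thesis .
  qed
  moreover have "(\<lambda>N. complex_of_real (exp (- (1/2) * (\<Sum>i<n. \<Sum>j<n. 2 * T * (xs i \<bullet> xs j) * (\<Sum>p\<in>schauder_ind N. schauder p (s i) * schauder p (s j))))))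
     \<longlonglongrightarrow> complex_of_real (exp (- (1/2) * (\<Sum>i<n. \<Sum>j<n. 2 * T * (xs i \<bullet> xs j) * min (s i) (s j))))"
    using s by (intro tendsto_of_real tendsto_exp tendsto_mult tendsto_sum tendsto_const schauder_cov_tendsto) auto
  moreover have "2 * T * (xs i \<bullet> xs j) * min (s i) (s j) = min (ts i) (ts j) * (xs i \<bullet> xs j)" for i j
    using T by (auto simp: s_def min_def field_simps)
  ultimately show ?thesis using LIMSEQ_unique[OF lim1] by simp
qed

theorem is_wiener_exists:
  assumes T: "0 < T"
  shows "\<exists>M :: (real \<Rightarrow> real^'d) measure. is_wiener T M"
proof -
  \<comment> \<open>The zero measure only carries the Borel sigma-algebra, to serve as target of the
    image measure.\<close>
  define W :: "(real \<Rightarrow> real^'d) measure" where "W = measure_of (Wsp T) (Wborel T) (\<lambda>_. 0)"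
  have Wo: "Wopen T \<subseteq> Pow (Wsp T :: (real \<Rightarrow> real^'d) set)" by (auto simp: Wopen_def)
  have Wsub: "Wborel T \<subseteq> Pow (Wsp T :: (real \<Rightarrow> real^'d) set)"
    unfolding Wborel_def using sigma_sets_into_sp[OF Wo] by auto
  have W: "space W = Wsp T" "sets W = Wborel T"
    using Wsub sigma_sets_sigma_sets_eq[OF Wo] by (simp_all add: W_def Wborel_def)
  interpret G: prob_space "gauss_space :: (nat \<times> nat \<times> 'd \<Rightarrow> real) measure" by (rule gauss_space_prob)
  have m: "bm_path T \<in> measurable (gauss_space :: (nat \<times> nat \<times> 'd \<Rightarrow> real) measure) W"
    by (rule measurable_Wborel[OF T W bm_path_Wsp[OF T] bm_path_measurable[OF T]])
  define M where "M = distr gauss_space W (bm_path T)"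
  have "is_wiener T M"
    unfolding is_wiener_def
  proof (intro conjI allI impI)
    show "space M = Wsp T" "sets M = Wborel T" by (simp_all add: M_def W)
    show "prob_space M" unfolding M_def by (rule G.prob_space_distr[OF m])
    fix n :: nat and ts and xs :: "nat \<Rightarrow> real^'d" assume ts: "\<forall>j<n. ts j \<in> {0..T}"
    have cm: "cis \<in> borel_measurable borel"
      by (intro borel_measurable_continuous_onI continuous_intros)
    have "(\<lambda>w. cis (\<Sum>j<n. xs j \<bullet> w (ts j))) \<in> borel_measurable W"
      using Wborel_evaluation_measurable[OF W] ts
      by (intro measurable_compose[OF _ cm] borel_measurable_sum borel_measurable_inner) auto
    then have "integral\<^sup>L M (\<lambda>w. cis (\<Sum>j<n. xs j \<bullet> w (ts j)))
        = integral\<^sup>L gauss_space (\<lambda>\<omega>. cis (\<Sum>j<n. xs j \<bullet> bm_path T \<omega> (ts j)))"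
      unfolding M_def by (rule integral_distr[OF m])
    also have "\<dots> = complex_of_real (exp (- (1/2) * (\<Sum>i<n. \<Sum>j<n. min (ts i) (ts j) * (xs i \<bullet> xs j))))"
      using ts by (intro bm_path_char[OF T]) auto
    finally show "integral\<^sup>L M (\<lambda>w. cis (\<Sum>j<n. xs j \<bullet> w (ts j)))
        = complex_of_real (exp (- (1/2) * (\<Sum>i<n. \<Sum>j<n. min (ts i) (ts j) * (xs i \<bullet> xs j))))" .
  qed
  then show ?thesis by blast
qed

theorem wiener_is_wiener: "0 < T \<Longrightarrow> is_wiener T (wiener T :: (real \<Rightarrow> real^'d) measure)"
  unfolding wiener_def using is_wiener_exists is_wiener_unique by (metis theI)

section \<open>Discrete Girsanov transform\<close>

definition gauss_density :: "real \<Rightarrow> 'a::euclidean_space \<Rightarrow> real" where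
  "gauss_density h x = (\<Prod>b\<in>Basis. normal_density 0 (sqrt h) (x \<bullet> b))"

definition gauss :: "real \<Rightarrow> 'a::euclidean_space measure" where
  "gauss h = density lborel (\<lambda>x. ennreal (gauss_density h x))"

lemma gauss_density_measurable [measurable]: "gauss_density h \<in> borel_measurable borel"
  unfolding gauss_density_def by measurable

lemma gauss_density_nonneg: "0 \<le> gauss_density h x"
  unfolding gauss_density_def by (intro prod_nonneg) auto

lemma sets_gauss [simp, measurable_cong]: "sets (gauss h) = sets borel"
  and space_gauss [simp]: "space (gauss h) = UNIV"
  by (simp_all add: gauss_def)

lemma prob_space_gauss:
  assumes h: "0 < h" shows "prob_space (gauss h :: 'a::euclidean_space measure)"
proof
  have "emeasure (gauss h :: 'a measure) (space (gauss h)) = (\<integral>\<^sup>+x. (\<Prod>b\<in>Basis. ennreal (normal_density 0 (sqrt h) (x \<bullet> b))) \<partial>(lborel :: 'a measure))"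
    by (simp add: gauss_def emeasure_density gauss_density_def prod_ennreal)
  also have "\<dots> = (\<Prod>b\<in>(Basis :: 'a set). \<integral>\<^sup>+x. ennreal (normal_density 0 (sqrt h) x) \<partial>lborel)"
    by (rule nn_integral_lborel_prod) auto
  also have "(\<integral>\<^sup>+x. ennreal (normal_density 0 (sqrt h) x) \<partial>lborel) = 1"
    using integral_normal_density[of "sqrt h" 0] integrable_normal_density[of "sqrt h" 0] h
    by (subst nn_integral_eq_integral) auto
  finally show "emeasure (gauss h :: 'a measure) (space (gauss h)) = 1" by simp
qed

text \<open>Completing the square in each coordinate; \<open>h\<close> is the variance per
  coordinate.\<close>

lemma gauss_density_shift:
  assumes h: "0 < h"
  shows "gauss_density h (x - a) = gauss_density h x * exp ((x \<bullet> a) / h - (norm a)\<^sup>2 / (2 * h))"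
proof -
  have "normal_density 0 (sqrt h) ((x - a) \<bullet> b)
      = normal_density 0 (sqrt h) (x \<bullet> b) * exp ((x \<bullet> b) * (a \<bullet> b) / h - (a \<bullet> b)\<^sup>2 / (2 * h))" for b
  proof -
    have "- ((x - a) \<bullet> b)\<^sup>2 / (2 * h) = - (x \<bullet> b)\<^sup>2 / (2 * h) + ((x \<bullet> b) * (a \<bullet> b) / h - (a \<bullet> b)\<^sup>2 / (2 * h))"
      using h by (simp add: inner_diff_left power2_eq_square field_simps)
    then show ?thesis using h by (simp add: normal_density_def exp_add[symmetric])
  qed
  then have "gauss_density h (x - a) = gauss_density h x * (\<Prod>b\<in>Basis. exp ((x \<bullet> b) * (a \<bullet> b) / h - (a \<bullet> b)\<^sup>2 / (2 * h)))"
    unfolding gauss_density_def by (simp add: prod.distrib)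
  also have "(\<Prod>b\<in>Basis. exp ((x \<bullet> b) * (a \<bullet> b) / h - (a \<bullet> b)\<^sup>2 / (2 * h)))
      = exp ((x \<bullet> a) / h - (norm a)\<^sup>2 / (2 * h))"
  proof -
    have "(norm a)\<^sup>2 = (\<Sum>b\<in>Basis. (a \<bullet> b)\<^sup>2)"
      unfolding power2_norm_eq_inner by (simp only: euclidean_inner[of a a] power2_eq_square)
    then show ?thesis
      by (simp add: exp_sum[symmetric] sum_subtractf sum_divide_distrib[symmetric] euclidean_inner[of x a])
  qed
  finally show ?thesis .
qed

text \<open>One-step Cameron-Martin formula: translation invariance of Lebesgue measure moves the
  shift onto the density.\<close>

lemma nn_integral_gauss_shift:
  fixes g :: "'a::euclidean_space \<Rightarrow> ennreal"
  assumes h: "0 < h" and g [measurable]: "g \<in> borel_measurable borel"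
  shows "(\<integral>\<^sup>+x. g (x + a) \<partial>gauss h) = (\<integral>\<^sup>+x. g x * ennreal (exp ((x \<bullet> a) / h - (norm a)\<^sup>2 / (2 * h))) \<partial>gauss h)"
proof -
  have "(\<integral>\<^sup>+x. g (x + a) \<partial>gauss h) = (\<integral>\<^sup>+x. ennreal (gauss_density h ((a + x) - a)) * g (a + x) \<partial>lborel)"
    unfolding gauss_def by (subst nn_integral_density) (auto simp: add.commute)
  also have "\<dots> = (\<integral>\<^sup>+x. ennreal (gauss_density h (x - a)) * g x \<partial>distr lborel borel ((+) a))"
    by (subst nn_integral_distr) auto
  also have "\<dots> = (\<integral>\<^sup>+x. ennreal (gauss_density h x) * (g x * ennreal (exp ((x \<bullet> a) / h - (norm a)\<^sup>2 / (2 * h)))) \<partial>lborel)"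
    unfolding lborel_distr_plus gauss_density_shift[OF h]
    by (simp add: ennreal_mult'' mult_ac)
  also have "\<dots> = (\<integral>\<^sup>+x. g x * ennreal (exp ((x \<bullet> a) / h - (norm a)\<^sup>2 / (2 * h))) \<partial>gauss h)"
    unfolding gauss_def by (subst nn_integral_density) auto
  finally show ?thesis .
qed

lemma normal_char_integral:
  assumes s: "0 < s"
  shows "(LINT x|lborel. normal_density 0 s x *\<^sub>R iexp (c * x)) = complex_of_real (exp (- (1/2) * (s * c)\<^sup>2))"
proof -
  have "(LINT x|lborel. normal_density 0 s x *\<^sub>R iexp (c * x))
      = \<bar>s\<bar> *\<^sub>R (LINT x|lborel. normal_density 0 s (0 + s * x) *\<^sub>R iexp (c * (0 + s * x)))"
    using s by (intro lborel_integral_real_affine) auto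
  also have "\<dots> = (LINT x|lborel. std_normal_density x *\<^sub>R iexp ((s * c) * x))"
  proof -
    have "\<bar>s\<bar> * normal_density 0 s (s * x) = std_normal_density x" for x
      using s by (simp add: normal_density_def real_sqrt_mult power_mult_distrib field_simps)
    then have "\<bar>s\<bar> *\<^sub>R (normal_density 0 s (0 + s * x) *\<^sub>R iexp (c * (0 + s * x))) = std_normal_density x *\<^sub>R iexp ((s * c) * x)" for x
    proof -
      have "c * (0 + s * x) = (s * c) * x" by simp
      then show ?thesis using \<open>\<And>x. \<bar>s\<bar> * normal_density 0 s (s * x) = std_normal_density x\<close>
        by (simp only: scaleR_scaleR add_0_left)
    qed
    then show ?thesis by (simp only: integral_scaleR_right[symmetric])
  qed
  also have "\<dots> = (CLINT x|std_normal_distribution. iexp ((s * c) * x))"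
    by (subst integral_density) auto
  also have "\<dots> = complex_of_real (exp (- (1/2) * (s * c)\<^sup>2))"
    using fun_cong[OF char_std_normal_distribution, of "s * c"] by (simp add: char_def)
  finally show ?thesis .
qed

lemma gauss_char:
  fixes u :: "'a::euclidean_space"
  assumes h: "0 < h"
  shows "integral\<^sup>L (gauss h) (\<lambda>x. cis (u \<bullet> x)) = complex_of_real (exp (- (1/2) * (h * (norm u)\<^sup>2)))"
proof -
  have cm [measurable]: "cis \<in> borel_measurable borel"
    by (intro borel_measurable_continuous_onI continuous_intros)
  interpret P: product_sigma_finite "\<lambda>_ :: 'a. lborel :: real measure" by unfold_locales
  have "integral\<^sup>L (gauss h) (\<lambda>x. cis (u \<bullet> x)) = (LINT x|lborel. gauss_density h x *\<^sub>R cis (u \<bullet> x))"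
    unfolding gauss_def by (rule integral_density) (auto simp: gauss_density_nonneg)
  also have "\<dots> = (LINT x|distr (PiM Basis (\<lambda>b. lborel)) borel (\<lambda>f. \<Sum>b\<in>Basis. f b *\<^sub>R b). gauss_density h x *\<^sub>R cis (u \<bullet> x))"
    by (subst lborel_eq) simp
  also have "\<dots> = (LINT f|PiM Basis (\<lambda>b. lborel). gauss_density h (\<Sum>b\<in>Basis. f b *\<^sub>R b) *\<^sub>R cis (u \<bullet> (\<Sum>b\<in>Basis. f b *\<^sub>R b)))"
  proof (rule integral_distr)
    have "(\<lambda>f. f b) \<in> borel_measurable (PiM Basis (\<lambda>b. lborel :: real measure))" if "b \<in> Basis" for b :: 'a
      using measurable_component_singleton[OF that, of "\<lambda>_. lborel :: real measure"] by simp
    then show "(\<lambda>f. \<Sum>b\<in>Basis. f b *\<^sub>R b) \<in> measurable (PiM Basis (\<lambda>b. lborel :: real measure)) (borel :: 'a measure)"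
      by (intro borel_measurable_sum borel_measurable_scaleR) auto
  qed auto
  also have "\<dots> = (LINT f|PiM Basis (\<lambda>b. lborel). (\<Prod>b\<in>Basis. normal_density 0 (sqrt h) (f b) *\<^sub>R iexp ((u \<bullet> b) * f b)))"
  proof (rule Bochner_Integration.integral_cong[OF refl])
    fix f :: "'a \<Rightarrow> real"
    have 1: "gauss_density h (\<Sum>b\<in>Basis. f b *\<^sub>R b) = (\<Prod>b\<in>Basis. normal_density 0 (sqrt h) (f b))"
      unfolding gauss_density_def by (rule prod.cong) auto
    have 2: "cis (u \<bullet> (\<Sum>b\<in>Basis. f b *\<^sub>R b)) = (\<Prod>b\<in>Basis. iexp ((u \<bullet> b) * f b))"
      by (simp add: cis_conv_exp inner_sum_right exp_sum[symmetric] sum_distrib_left mult_ac)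
    show "gauss_density h (\<Sum>b\<in>Basis. f b *\<^sub>R b) *\<^sub>R cis (u \<bullet> (\<Sum>b\<in>Basis. f b *\<^sub>R b))
        = (\<Prod>b\<in>Basis. normal_density 0 (sqrt h) (f b) *\<^sub>R iexp ((u \<bullet> b) * f b))"
      unfolding 1 2 by (simp add: scaleR_conv_of_real prod.distrib)
  qed
  also have "\<dots> = (\<Prod>b\<in>Basis. LINT x|lborel. normal_density 0 (sqrt h) x *\<^sub>R iexp ((u \<bullet> b) * x))"
  proof (rule P.product_integral_prod)
    fix b :: 'a
    show "integrable lborel (\<lambda>x. normal_density 0 (sqrt h) x *\<^sub>R iexp ((u \<bullet> b) * x))"
      using h by (intro Bochner_Integration.integrable_bound[OF integrable_normal_density[of "sqrt h" 0]]) auto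
  qed simp
  also have "\<dots> = (\<Prod>b\<in>Basis. complex_of_real (exp (- (1/2) * (h * (u \<bullet> b)\<^sup>2))))"
    using h by (simp only: normal_char_integral real_sqrt_gt_0_iff) (simp add: power_mult_distrib)
  also have "\<dots> = complex_of_real (exp (\<Sum>b\<in>Basis. - (1/2) * (h * (u \<bullet> b)\<^sup>2)))"
    by (simp add: exp_sum)
  also have "(\<Sum>b\<in>Basis. - (1/2) * (h * (u \<bullet> b)\<^sup>2)) = - (1/2) * (h * (norm u)\<^sup>2)"
    unfolding power2_norm_eq_inner by (simp only: euclidean_inner[of u u] sum_distrib_left power2_eq_square)
  finally show ?thesis .
qed

section \<open>The Euler scheme as a triangular map of increments\<close>

fun euler :: "real \<Rightarrow> (nat \<Rightarrow> real^'d^'d) \<Rightarrow> (nat \<Rightarrow> real^'d) \<Rightarrow> nat \<Rightarrow> real^'d" where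
  "euler h c \<xi> 0 = 0"
| "euler h c \<xi> (Suc k) = euler h c \<xi> k + (\<xi> k + h *\<^sub>R (c k *v euler h c \<xi> k))"

text \<open>The increments of the scheme as a function of the driving increments, restricted to the
  first n indices so as to stay in the product space. Entry k depends only on entries 0 to k, which
  makes the map triangular.\<close>

definition euler_incr :: "real \<Rightarrow> (nat \<Rightarrow> real^'d^'d) \<Rightarrow> nat \<Rightarrow> (nat \<Rightarrow> real^'d) \<Rightarrow> nat \<Rightarrow> real^'d" where
  "euler_incr h c n \<xi> = (\<lambda>k\<in>{..<n}. \<xi> k + h *\<^sub>R (c k *v euler h c \<xi> k))"

definition psum :: "(nat \<Rightarrow> real^'d) \<Rightarrow> nat \<Rightarrow> real^'d" where
  "psum \<xi> k = (\<Sum>j<k. \<xi> j)"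

text \<open>Left-point version, on steps of length h, of the integral of <chi \<theta>, d\<theta>>
  minus half the integral of |chi \<theta>|^2 dt; \<open>psum\<close> is the path with increments
  \<xi>.\<close>

definition log_density :: "real \<Rightarrow> (nat \<Rightarrow> real^'d^'d) \<Rightarrow> nat \<Rightarrow> (nat \<Rightarrow> real^'d) \<Rightarrow> real" where
  "log_density h c n \<xi> = (\<Sum>k<n. (c k *v psum \<xi> k) \<bullet> \<xi> k - h / 2 * (norm (c k *v psum \<xi> k))\<^sup>2)"

lemma euler_cong: "(\<And>j. j < k \<Longrightarrow> \<xi> j = \<zeta> j) \<Longrightarrow> euler h c \<xi> k = euler h c \<zeta> k"
  by (induction k) auto

lemma psum_cong: "(\<And>j. j < k \<Longrightarrow> \<xi> j = \<zeta> j) \<Longrightarrow> psum \<xi> k = psum \<zeta> k"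
  by (simp add: psum_def)

lemma log_density_cong: "(\<And>j. j < n \<Longrightarrow> \<xi> j = \<zeta> j) \<Longrightarrow> log_density h c n \<xi> = log_density h c n \<zeta>"
  unfolding log_density_def by (intro sum.cong refl) (simp cong: psum_cong)

text \<open>Summing the transformed increments gives back the scheme. The drift is thereby a
  function of the transformed path, and this is why the density has a closed form in the new
  variables.\<close>

lemma psum_euler_incr: "k \<le> n \<Longrightarrow> psum (euler_incr h c n \<xi>) k = euler h c \<xi> k"
  by (induction k) (auto simp: psum_def euler_incr_def)

lemma matrix_vector_measurable [measurable (raw)]:
  "f \<in> borel_measurable M \<Longrightarrow> (\<lambda>x. A *v f x) \<in> borel_measurable M" for A :: "real^'n^'m"
  by (rule borel_measurable_continuous_on[OF linear_continuous_on[OF matrix_vector_mul_bounded_linear]])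

lemma PiM_component_measurable: "j < n \<Longrightarrow> (\<lambda>\<xi>. \<xi> j) \<in> borel_measurable (PiM {..<n} (\<lambda>_. borel))"
  by (rule measurable_component_singleton) simp

lemma euler_measurable: "k \<le> n \<Longrightarrow> (\<lambda>\<xi>. euler h c \<xi> k) \<in> borel_measurable (PiM {..<n} (\<lambda>_. borel))"
proof (induction k)
  case (Suc k)
  then have [measurable]: "(\<lambda>\<xi>. euler h c \<xi> k) \<in> borel_measurable (PiM {..<n} (\<lambda>_. borel))"
    "(\<lambda>\<xi>. \<xi> k) \<in> borel_measurable (PiM {..<n} (\<lambda>_. borel))" by (auto intro: PiM_component_measurable)
  show ?case by simp
qed simp

lemma psum_measurable: "k \<le> n \<Longrightarrow> (\<lambda>\<xi>. psum \<xi> k) \<in> borel_measurable (PiM {..<n} (\<lambda>_. borel))"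
  unfolding psum_def by (intro borel_measurable_sum PiM_component_measurable) auto

lemma euler_incr_measurable: "euler_incr h c n \<in> measurable (PiM {..<n} (\<lambda>_. borel)) (PiM {..<n} (\<lambda>_. borel))"
  unfolding euler_incr_def[abs_def]
proof (rule measurable_restrict)
  fix k assume "k \<in> {..<n}"
  then have [measurable]: "(\<lambda>\<xi>. euler h c \<xi> k) \<in> borel_measurable (PiM {..<n} (\<lambda>_. borel))"
    "(\<lambda>\<xi>. \<xi> k) \<in> borel_measurable (PiM {..<n} (\<lambda>_. borel))" by (auto intro: PiM_component_measurable euler_measurable)
  show "(\<lambda>\<xi>. \<xi> k + h *\<^sub>R (c k *v euler h c \<xi> k)) \<in> borel_measurable (PiM {..<n} (\<lambda>_. borel))" by measurable
qed

lemma log_density_measurable: "log_density h c n \<in> borel_measurable (PiM {..<n} (\<lambda>_. borel))"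
  unfolding log_density_def[abs_def]
proof (rule borel_measurable_sum)
  fix k assume "k \<in> {..<n}"
  then have [measurable]: "(\<lambda>\<xi>. psum \<xi> k) \<in> borel_measurable (PiM {..<n} (\<lambda>_. borel))"
    "(\<lambda>\<xi>. \<xi> k) \<in> borel_measurable (PiM {..<n} (\<lambda>_. borel))" by (auto intro: PiM_component_measurable psum_measurable)
  show "(\<lambda>\<xi>. (c k *v psum \<xi> k) \<bullet> \<xi> k - h / 2 * (norm (c k *v psum \<xi> k))\<^sup>2) \<in> borel_measurable (PiM {..<n} (\<lambda>_. borel))"
    by measurable
qed

text \<open>One coordinate at a time: conditionally on the past, the step is a Gaussian translation.\<close>

theorem discrete_girsanov:
  fixes c :: "nat \<Rightarrow> real^'d^'d"
  assumes h: "0 < h" and g: "g \<in> borel_measurable (PiM {..<n} (\<lambda>_. borel))"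
  shows "(\<integral>\<^sup>+\<xi>. g (euler_incr h c n \<xi>) \<partial>PiM {..<n} (\<lambda>_. gauss h))
    = (\<integral>\<^sup>+\<xi>. g \<xi> * ennreal (exp (log_density h c n \<xi>)) \<partial>PiM {..<n} (\<lambda>_. gauss h))"
  using g
proof (induction n arbitrary: g)
  case 0
  show ?case
  proof (rule nn_integral_cong)
    fix \<xi> :: "nat \<Rightarrow> real^'d" assume "\<xi> \<in> space (PiM {..<0} (\<lambda>_. gauss h))"
    then have "\<xi> = euler_incr h c 0 \<xi>" by (simp add: space_PiM euler_incr_def restrict_def)
    then show "g (euler_incr h c 0 \<xi>) = g \<xi> * ennreal (exp (log_density h c 0 \<xi>))"
      by (simp add: log_density_def)
  qed
next
  case (Suc n)
  interpret P: product_sigma_finite "\<lambda>_ :: nat. gauss h :: (real^'d) measure"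
    by (intro product_sigma_finite.intro prob_space_imp_sigma_finite prob_space_gauss h)
  have sPn: "sets (PiM I (\<lambda>_. gauss h :: (real^'d) measure)) = sets (PiM I (\<lambda>_. borel))" for I :: "nat set"
    by (rule sets_PiM_cong) auto
  have ms: "measurable (PiM I (\<lambda>_. gauss h :: (real^'d) measure)) N = measurable (PiM I (\<lambda>_. borel)) N" for I :: "nat set" and N :: "'z measure"
    by (rule measurable_cong_sets[OF sPn refl])
  have Sn: "{..<Suc n} = insert n {..<n}" by auto
  \<comment> \<open>E is the density factor of the last step given the past \<zeta>, and G' the test
    function with the last coordinate integrated out against it.\<close>
  define E where "E = (\<lambda>\<zeta> (y :: real^'d). exp ((c n *v psum \<zeta> n) \<bullet> y - h / 2 * (norm (c n *v psum \<zeta> n))\<^sup>2))"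
  define G' where "G' = (\<lambda>\<zeta>. \<integral>\<^sup>+y. g (\<zeta>(n := y)) * ennreal (E \<zeta> y) \<partial>gauss h)"
  have upd: "(\<lambda>(\<zeta>, y). \<zeta>(n := y)) \<in> measurable (PiM {..<n} (\<lambda>_. borel) \<Otimes>\<^sub>M gauss h) (PiM {..<Suc n} (\<lambda>_. borel :: (real^'d) measure))"
    unfolding Sn using measurable_add_dim[of n "{..<n}" "\<lambda>_. borel :: (real^'d) measure"]
    by (simp add: measurable_def sets_pair_measure space_pair_measure)
  have gm: "(\<lambda>(\<zeta>, y). g (\<zeta>(n := y))) \<in> borel_measurable (PiM {..<n} (\<lambda>_. borel) \<Otimes>\<^sub>M gauss h)"
    using measurable_compose[OF upd Suc.prems] by (simp add: case_prod_unfold fun_upd_def)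
  have pm [measurable]: "(\<lambda>\<zeta>. psum \<zeta> n) \<in> borel_measurable (PiM {..<n} (\<lambda>_. borel :: (real^'d) measure))"
    by (rule psum_measurable) simp
  have Em: "(\<lambda>(\<zeta>, y). ennreal (E \<zeta> y)) \<in> borel_measurable (PiM {..<n} (\<lambda>_. borel) \<Otimes>\<^sub>M gauss h)"
    unfolding E_def by measurable
  have G'm: "G' \<in> borel_measurable (PiM {..<n} (\<lambda>_. borel))"
    unfolding G'_def using gm Em by (intro sigma_finite_measure.borel_measurable_nn_integral
        prob_space_imp_sigma_finite prob_space_gauss h) (simp add: case_prod_unfold)
  have gy: "(\<lambda>y. g (\<zeta>(n := y))) \<in> borel_measurable borel" if "\<zeta> \<in> space (PiM {..<n} (\<lambda>_. borel))" for \<zeta>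
    using measurable_compose[OF measurable_Pair1'[OF that] gm] by (simp add: measurable_def)
  have ps: "\<xi> \<in> space (PiM {..<n} (\<lambda>_. gauss h)) \<Longrightarrow> \<xi> \<in> space (PiM {..<n} (\<lambda>_. borel))" for \<xi> :: "nat \<Rightarrow> real^'d"
    by (simp add: space_PiM)
  \<comment> \<open>For a fixed past the last coordinate is merely translated, by a vector that
    depends only on the already transformed increments.\<close>
  have einc: "euler_incr h c (Suc n) (\<xi>(n := y)) = (euler_incr h c n \<xi>)(n := y + h *\<^sub>R (c n *v psum (euler_incr h c n \<xi>) n))" for \<xi> y
  proof
    fix k
    have "euler h c (\<xi>(n := y)) k = euler h c \<xi> k" if "k \<le> n" for k using that by (intro euler_cong) auto
    then show "euler_incr h c (Suc n) (\<xi>(n := y)) k = ((euler_incr h c n \<xi>)(n := y + h *\<^sub>R (c n *v psum (euler_incr h c n \<xi>) n))) k"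
      by (auto simp: euler_incr_def[of _ _ "Suc n"] psum_euler_incr) (auto simp: euler_incr_def)
  qed
  have "(\<integral>\<^sup>+\<xi>. g (euler_incr h c (Suc n) \<xi>) \<partial>PiM {..<Suc n} (\<lambda>_. gauss h))
      = (\<integral>\<^sup>+\<xi>. \<integral>\<^sup>+y. g (euler_incr h c (Suc n) (\<xi>(n := y))) \<partial>gauss h \<partial>PiM {..<n} (\<lambda>_. gauss h))"
    unfolding Sn
    by (rule P.product_nn_integral_insert)
      (use measurable_compose[OF euler_incr_measurable Suc.prems] in \<open>auto simp: ms Sn\<close>)
  also have "\<dots> = (\<integral>\<^sup>+\<xi>. G' (euler_incr h c n \<xi>) \<partial>PiM {..<n} (\<lambda>_. gauss h))"
  proof (rule nn_integral_cong)
    fix \<xi> :: "nat \<Rightarrow> real^'d" assume "\<xi> \<in> space (PiM {..<n} (\<lambda>_. gauss h))"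
    define \<zeta> where "\<zeta> = euler_incr h c n \<xi>"
    have \<zeta>: "\<zeta> \<in> space (PiM {..<n} (\<lambda>_. borel))"
      using measurable_space[OF euler_incr_measurable ps] \<open>\<xi> \<in> _\<close> by (simp add: \<zeta>_def)
    have "(\<integral>\<^sup>+y. g (euler_incr h c (Suc n) (\<xi>(n := y))) \<partial>gauss h)
        = (\<integral>\<^sup>+y. (\<lambda>y. g (\<zeta>(n := y))) (y + h *\<^sub>R (c n *v psum \<zeta> n)) \<partial>gauss h)"
      by (simp add: einc \<zeta>_def)
    \<comment> \<open>With a = h c x the exponent y.a/h - |a|^2/(2h) becomes (c x).y - (h/2)|c x|^2,
      the last term of the log density.\<close>
    also have "\<dots> = G' \<zeta>"
      unfolding nn_integral_gauss_shift[OF h gy[OF \<zeta>]] G'_def E_def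
      using h by (simp add: inner_commute power_mult_distrib power2_eq_square field_simps)
    finally show "(\<integral>\<^sup>+y. g (euler_incr h c (Suc n) (\<xi>(n := y))) \<partial>gauss h) = G' (euler_incr h c n \<xi>)"
      by (simp add: \<zeta>_def)
  qed
  also have "\<dots> = (\<integral>\<^sup>+\<xi>. G' \<xi> * ennreal (exp (log_density h c n \<xi>)) \<partial>PiM {..<n} (\<lambda>_. gauss h))"
    by (rule Suc.IH[OF G'm])
  also have "\<dots> = (\<integral>\<^sup>+\<xi>. \<integral>\<^sup>+y. g (\<xi>(n := y)) * ennreal (exp (log_density h c (Suc n) (\<xi>(n := y)))) \<partial>gauss h \<partial>PiM {..<n} (\<lambda>_. gauss h))"
  proof (rule nn_integral_cong)
    fix \<xi> :: "nat \<Rightarrow> real^'d" assume "\<xi> \<in> space (PiM {..<n} (\<lambda>_. gauss h))"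
    note \<xi> = ps[OF this]
    have ld: "log_density h c (Suc n) (\<xi>(n := y)) = log_density h c n \<xi> + ((c n *v psum \<xi> n) \<bullet> y - h / 2 * (norm (c n *v psum \<xi> n))\<^sup>2)" for y
    proof -
      have "log_density h c n (\<xi>(n := y)) = log_density h c n \<xi>" by (rule log_density_cong) simp
      moreover have "psum (\<xi>(n := y)) n = psum \<xi> n" by (rule psum_cong) simp
      ultimately show ?thesis by (simp add: log_density_def)
    qed
    have [measurable]: "(\<lambda>y. g (\<xi>(n := y))) \<in> borel_measurable borel" by (rule gy[OF \<xi>])
    have "G' \<xi> * ennreal (exp (log_density h c n \<xi>))
        = (\<integral>\<^sup>+y. g (\<xi>(n := y)) * ennreal (E \<xi> y) * ennreal (exp (log_density h c n \<xi>)) \<partial>gauss h)"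
      unfolding G'_def by (rule nn_integral_multc[symmetric]) (unfold E_def, measurable)
    also have "\<dots> = (\<integral>\<^sup>+y. g (\<xi>(n := y)) * ennreal (exp (log_density h c (Suc n) (\<xi>(n := y)))) \<partial>gauss h)"
      unfolding ld exp_add E_def by (simp add: ennreal_mult'' mult_ac)
    finally show "G' \<xi> * ennreal (exp (log_density h c n \<xi>))
        = (\<integral>\<^sup>+y. g (\<xi>(n := y)) * ennreal (exp (log_density h c (Suc n) (\<xi>(n := y)))) \<partial>gauss h)" .
  qed
  also have "\<dots> = (\<integral>\<^sup>+\<xi>. g \<xi> * ennreal (exp (log_density h c (Suc n) \<xi>)) \<partial>PiM {..<Suc n} (\<lambda>_. gauss h))"
    unfolding Sn
    by (rule P.product_nn_integral_insert[symmetric])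
      (use Suc.prems log_density_measurable[of h c "Suc n"] in \<open>auto simp: ms Sn\<close>)
  finally show ?case .
qed

section \<open>Increments of Brownian motion\<close>

lemma cis_measurable [measurable]: "cis \<in> borel_measurable borel"
  by (intro borel_measurable_continuous_onI continuous_intros)

definition incr :: "real \<Rightarrow> nat \<Rightarrow> (real \<Rightarrow> real^'d) \<Rightarrow> nat \<Rightarrow> real^'d" where
  "incr T n w k = w (real (Suc k) * T / real n) - w (real k * T / real n)"

lemma psum_incr: "w 0 = 0 \<Longrightarrow> psum (incr T n w) k = w (real k * T / real n)"
  unfolding psum_def incr_def by (subst sum_lessThan_telescope) simp

text \<open>The minimum counts the grid steps lying before both indices. In this form the covariance
  min(s,t) is a sum of products, from which independence of increments can be read off.\<close>

lemma min_eq_sum: "i \<le> n \<Longrightarrow> j \<le> n \<Longrightarrow> real (min i j) = (\<Sum>k<n. of_bool (k < i) * of_bool (k < j))"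
proof -
  assume "i \<le> n" "j \<le> n"
  then have "{..<n} \<inter> {k. k < i \<and> k < j} = {..<min i j}" by auto
  moreover have "(\<Sum>k<n. of_bool (k < i) * of_bool (k < j)) = (\<Sum>k<n. if k < i \<and> k < j then 1 else (0::real))"
    by (intro sum.cong refl) auto
  ultimately show ?thesis by (simp add: sum.If_cases)
qed

lemma integrable_mult_of_squares:
  fixes f g :: "'a \<Rightarrow> real"
  assumes [measurable]: "f \<in> borel_measurable M" "g \<in> borel_measurable M"
    and "integrable M (\<lambda>x. (f x)\<^sup>2)" "integrable M (\<lambda>x. (g x)\<^sup>2)"
  shows "integrable M (\<lambda>x. f x * g x)"
proof (rule Bochner_Integration.integrable_bound)
  show "integrable M (\<lambda>x. (f x)\<^sup>2 + (g x)\<^sup>2)" using assms by simp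
  show "AE x in M. norm (f x * g x) \<le> norm ((f x)\<^sup>2 + (g x)\<^sup>2)"
  proof (intro AE_I2)
    fix x
    have "0 \<le> (\<bar>f x\<bar> - \<bar>g x\<bar>)\<^sup>2" by simp
    then have "2 * (\<bar>f x\<bar> * \<bar>g x\<bar>) \<le> (f x)\<^sup>2 + (g x)\<^sup>2" by (simp add: power2_diff)
    moreover have "0 \<le> \<bar>f x\<bar> * \<bar>g x\<bar>" by simp
    ultimately have "\<bar>f x\<bar> * \<bar>g x\<bar> \<le> (f x)\<^sup>2 + (g x)\<^sup>2" by linarith
    then show "norm (f x * g x) \<le> norm ((f x)\<^sup>2 + (g x)\<^sup>2)" by (simp add: abs_mult)
  qed
qed simp

lemma integrable_square_sum:
  fixes f :: "'i \<Rightarrow> 'a \<Rightarrow> real"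
  assumes "finite I" "\<And>i. i \<in> I \<Longrightarrow> f i \<in> borel_measurable M" "\<And>i. i \<in> I \<Longrightarrow> integrable M (\<lambda>x. (f i x)\<^sup>2)"
  shows "integrable M (\<lambda>x. (\<Sum>i\<in>I. f i x)\<^sup>2)"
  unfolding power2_eq_square sum_product
  using assms by (intro Bochner_Integration.integrable_sum integrable_mult_of_squares) auto

lemma orthogonal_sum_square:
  fixes D :: "nat \<Rightarrow> 'a \<Rightarrow> real"
  assumes m: "\<And>k. k < n \<Longrightarrow> D k \<in> borel_measurable M" and i: "\<And>k. k < n \<Longrightarrow> integrable M (\<lambda>x. (D k x)\<^sup>2)"
    and o: "\<And>j k. j < k \<Longrightarrow> k < n \<Longrightarrow> integral\<^sup>L M (\<lambda>x. D j x * D k x) = 0"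
  shows "integral\<^sup>L M (\<lambda>x. (\<Sum>k<n. D k x)\<^sup>2) = (\<Sum>k<n. integral\<^sup>L M (\<lambda>x. (D k x)\<^sup>2))"
  using assms
proof (induction n)
  case (Suc n)
  have c: "integrable M (\<lambda>x. D j x * D n x)" if "j < n" for j
    using Suc.prems that by (intro integrable_mult_of_squares) auto
  have "integral\<^sup>L M (\<lambda>x. (\<Sum>k<Suc n. D k x)\<^sup>2)
      = integral\<^sup>L M (\<lambda>x. (\<Sum>k<n. D k x)\<^sup>2 + 2 * (\<Sum>j<n. D j x * D n x) + (D n x)\<^sup>2)"
    by (intro Bochner_Integration.integral_cong refl) (simp add: power2_sum sum_distrib_right)
  also have "\<dots> = integral\<^sup>L M (\<lambda>x. (\<Sum>k<n. D k x)\<^sup>2) + 2 * (\<Sum>j<n. integral\<^sup>L M (\<lambda>x. D j x * D n x)) + integral\<^sup>L M (\<lambda>x. (D n x)\<^sup>2)"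
  proof -
    have "integrable M (\<lambda>x. (\<Sum>k<n. D k x)\<^sup>2)" using Suc.prems(1,2) by (intro integrable_square_sum) auto
    moreover have "integrable M (\<lambda>x. \<Sum>j<n. D j x * D n x)" using c by (intro Bochner_Integration.integrable_sum) auto
    moreover have "integrable M (\<lambda>x. (D n x)\<^sup>2)" using Suc.prems(2) by simp
    ultimately show ?thesis using c by (simp add: Bochner_Integration.integral_sum)
  qed
  also have "(\<Sum>j<n. integral\<^sup>L M (\<lambda>x. D j x * D n x)) = 0" using Suc.prems(3) by simp
  finally show ?case using Suc by simp
qed simp

section \<open>Law, independence and moments of Brownian increments\<close>

locale brownian =
  fixes T :: real and W :: "(real \<Rightarrow> real^'d::finite) measure"
  assumes T: "0 < T" and W: "is_wiener T W"
begin

lemma space_W: "space W = Wsp T" and sets_W: "sets W = Wborel T"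
  using W by (auto simp: is_wiener_def)

sublocale prob_space W using W by (simp add: is_wiener_def)

lemma ev: "t \<in> {0..T} \<Longrightarrow> (\<lambda>w. w t) \<in> borel_measurable W"
  by (rule Wborel_evaluation_measurable[OF space_W sets_W])

lemma grid [simp]: "k \<le> n \<Longrightarrow> real k * T / real n \<in> {0..T}" "k < n \<Longrightarrow> real (Suc k) * T / real n \<in> {0..T}"
  using T grid_mem[of T k n] grid_mem[of T "Suc k" n] by auto

lemma incr_measurable: "k < n \<Longrightarrow> (\<lambda>w. incr T n w k) \<in> borel_measurable W"
  unfolding incr_def by (intro borel_measurable_diff ev grid) auto

lemma incr_restrict_measurable: "m \<le> n \<Longrightarrow> (\<lambda>w. restrict (incr T n w) {..<m}) \<in> measurable W (PiM {..<m} (\<lambda>_. borel))"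
  by (intro measurable_restrict) (auto intro: incr_measurable)

lemma char_W: "(\<And>j. j < n \<Longrightarrow> ts j \<in> {0..T}) \<Longrightarrow> integral\<^sup>L W (\<lambda>w. cis (\<Sum>j<n. xs j \<bullet> w (ts j)))
  = complex_of_real (exp (- (1/2) * (\<Sum>i<n. \<Sum>j<n. min (ts i) (ts j) * (xs i \<bullet> xs j))))" for n :: nat
  using W by (simp add: is_wiener_def)

text \<open>Written out in evaluations, the covariance form becomes a sum over grid steps of h times
  a squared norm; on step k exactly the vector u_k survives.\<close>

lemma incr_char:
  assumes n: "0 < n"
  shows "integral\<^sup>L W (\<lambda>w. cis (\<Sum>k<n. u k \<bullet> incr T n w k)) = complex_of_real (exp (- (1/2) * (\<Sum>k<n. T / real n * (norm (u k))\<^sup>2)))"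
proof -
  \<comment> \<open>Two evaluations per increment: the first n indices are the right endpoints with
    coefficient u, the next n the left endpoints with coefficient -u.\<close>
  define m where "m = (\<lambda>j. if j < n then Suc j else j - n)"
  define ts where "ts = (\<lambda>j. real (m j) * T / real n)"
  define xs where "xs = (\<lambda>j. if j < n then u j else - u (j - n))"
  have mn: "m j \<le> n" if "j < n + n" for j using that by (auto simp: m_def)
  have eq: "(\<Sum>k<n. u k \<bullet> incr T n w k) = (\<Sum>j<n + n. xs j \<bullet> w (ts j))" for w
    unfolding sum_lessThan_add by (simp add: xs_def ts_def m_def incr_def inner_diff_right sum_subtractf sum_negf)
  have "integral\<^sup>L W (\<lambda>w. cis (\<Sum>k<n. u k \<bullet> incr T n w k))
      = complex_of_real (exp (- (1/2) * (\<Sum>i<n + n. \<Sum>j<n + n. min (ts i) (ts j) * (xs i \<bullet> xs j))))"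
    unfolding eq by (rule char_W) (use mn grid(1) in \<open>auto simp only: ts_def\<close>)
  also have "(\<Sum>i<n + n. \<Sum>j<n + n. min (ts i) (ts j) * (xs i \<bullet> xs j))
      = (\<Sum>i<n + n. \<Sum>j<n + n. \<Sum>k<n. (T / real n) * ((of_bool (k < m i) *\<^sub>R xs i) \<bullet> (of_bool (k < m j) *\<^sub>R xs j)))"
  proof (intro sum.cong refl)
    fix i j assume ij: "i \<in> {..<n + n}" "j \<in> {..<n + n}"
    have "min (ts i) (ts j) = T / real n * real (min (m i) (m j))"
    proof -
      have "ts i = T / real n * real (m i)" "ts j = T / real n * real (m j)" by (simp_all add: ts_def)
      moreover have "0 \<le> T / real n" using T by simp
      ultimately show ?thesis by (simp add: min_mult_distrib_left of_nat_min)
    qed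
    also have "real (min (m i) (m j)) = (\<Sum>k<n. of_bool (k < m i) * of_bool (k < m j))"
      using ij by (intro min_eq_sum mn) auto
    finally have *: "min (ts i) (ts j) = T / real n * (\<Sum>k<n. of_bool (k < m i) * of_bool (k < m j))" .
    show "min (ts i) (ts j) * (xs i \<bullet> xs j) = (\<Sum>k<n. (T / real n) * ((of_bool (k < m i) *\<^sub>R xs i) \<bullet> (of_bool (k < m j) *\<^sub>R xs j)))"
      unfolding * sum_distrib_left sum_distrib_right by (intro sum.cong refl) simp
  qed
  also have "\<dots> = (\<Sum>k<n. \<Sum>i<n + n. \<Sum>j<n + n. (T / real n) * ((of_bool (k < m i) *\<^sub>R xs i) \<bullet> (of_bool (k < m j) *\<^sub>R xs j)))"
    by (rule sum_swap3)
  also have "\<dots> = (\<Sum>k<n. T / real n * (norm (u k))\<^sup>2)"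
  proof (rule sum.cong[OF refl])
    fix k assume k: "k \<in> {..<n}"
    \<comment> \<open>The indicators of k < i + 1 and k < i differ only for i = k.\<close>
    have "(\<Sum>i<n + n. of_bool (k < m i) *\<^sub>R xs i) = (\<Sum>i<n. (of_bool (k < Suc i) - of_bool (k < i)) *\<^sub>R u i)"
      unfolding sum_lessThan_add by (simp add: m_def xs_def scaleR_diff_left sum_subtractf sum_negf)
    also have "\<dots> = (\<Sum>i<n. if i = k then u k else 0)" by (intro sum.cong refl) (auto simp: less_Suc_eq)
    also have "\<dots> = u k" using k by simp
    finally have "u k = (\<Sum>i<n + n. of_bool (k < m i) *\<^sub>R xs i)" ..
    then have "(norm (u k))\<^sup>2 = (\<Sum>i<n + n. \<Sum>j<n + n. (of_bool (k < m i) *\<^sub>R xs i) \<bullet> (of_bool (k < m j) *\<^sub>R xs j))"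
      unfolding power2_norm_eq_inner by (simp only: inner_sum_left inner_sum_right) (rule sum.swap)
    then show "(\<Sum>i<n + n. \<Sum>j<n + n. (T / real n) * ((of_bool (k < m i) *\<^sub>R xs i) \<bullet> (of_bool (k < m j) *\<^sub>R xs j))) = T / real n * (norm (u k))\<^sup>2"
      by (simp only: sum_distrib_left)
  qed
  finally show ?thesis .
qed

text \<open>The characteristic function of the increments factorises into Gaussian ones, and a
  finite product law is determined by the characteristic functions of linear functionals. This
  carries the discrete Girsanov theorem over to Wiener measure.\<close>

theorem incr_distr:
  assumes n: "0 < n"
  shows "distr W (PiM {..<n} (\<lambda>_. borel)) (\<lambda>w. restrict (incr T n w) {..<n}) = PiM {..<n} (\<lambda>_. gauss (T / real n))"
proof -
  have h: "0 < T / real n" using T n by simp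
  define lf where "lf = (\<lambda>(u :: nat \<Rightarrow> real^'d) \<xi>. \<Sum>k<n. u k \<bullet> \<xi> k)"
  define L where "L = range lf"
  define M where "M = distr W (PiM {..<n} (\<lambda>_. borel)) (\<lambda>w. restrict (incr T n w) {..<n})"
  define N where "N = PiM {..<n} (\<lambda>_. gauss (T / real n) :: (real^'d) measure)"
  have sN: "sets N = sets (PiM {..<n} (\<lambda>_. borel))" unfolding N_def by (rule sets_PiM_cong) auto
  have lfm: "lf u \<in> borel_measurable (PiM {..<n} (\<lambda>_. borel))" for u
    unfolding lf_def by (intro borel_measurable_sum borel_measurable_inner PiM_component_measurable) auto
  interpret P: product_prob_space "\<lambda>_ :: nat. gauss (T / real n) :: (real^'d) measure" "{..<n}"
    by (rule product_prob_spaceI) (rule prob_space_gauss[OF h])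
  have "M = N"
  proof (rule prob_measure_eq_of_char_eq[where L = L])
    show "prob_space M" unfolding M_def by (rule prob_space_distr[OF incr_restrict_measurable]) simp
    show "prob_space N" unfolding N_def by (rule prob_space_PiM) (rule prob_space_gauss[OF h])
    show "sets N = sets M" by (simp add: M_def sN)
    have "lf (\<lambda>_. 0) = (\<lambda>_. 0)" by (simp add: lf_def)
    then show "(\<lambda>_. 0) \<in> L" unfolding L_def by (metis rangeI)
    fix \<phi> assume "\<phi> \<in> L"
    then obtain u where u: "\<phi> = lf u" by (auto simp: L_def)
    show "\<phi> \<in> borel_measurable M" unfolding u M_def using lfm by simp
    have "(\<lambda>x. c * \<phi> x) = lf (\<lambda>k. c *\<^sub>R u k)" for c by (simp add: u lf_def sum_distrib_left)
    then show "(\<lambda>x. c * \<phi> x) \<in> L" for c by (simp add: L_def)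
    show "integral\<^sup>L M (\<lambda>x. cis (\<phi> x)) = integral\<^sup>L N (\<lambda>x. cis (\<phi> x))"
    proof -
      have "integral\<^sup>L M (\<lambda>x. cis (\<phi> x)) = integral\<^sup>L W (\<lambda>w. cis (lf u (restrict (incr T n w) {..<n})))"
        unfolding M_def u by (rule integral_distr) (auto intro!: incr_restrict_measurable measurable_compose[OF lfm])
      also have "\<dots> = complex_of_real (exp (- (1/2) * (\<Sum>k<n. T / real n * (norm (u k))\<^sup>2)))"
        using incr_char[OF n, of u] by (simp add: lf_def)
      also have "\<dots> = (\<Prod>k<n. complex_of_real (exp (- (1/2) * (T / real n * (norm (u k))\<^sup>2))))"
        by (simp add: sum_distrib_left exp_sum)
      also have "\<dots> = (\<Prod>k<n. integral\<^sup>L (gauss (T / real n)) (\<lambda>x. cis (u k \<bullet> x)))"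
        by (simp only: gauss_char[OF h])
      also have "\<dots> = integral\<^sup>L N (\<lambda>\<xi>. \<Prod>k<n. cis (u k \<bullet> \<xi> k))"
        unfolding N_def
        by (rule P.product_integral_prod[symmetric])
          (auto intro!: finite_measure.integrable_const_bound[OF prob_space.finite_measure[OF prob_space_gauss[OF h]], where B = 1])
      also have "\<dots> = integral\<^sup>L N (\<lambda>x. cis (\<phi> x))"
        by (simp add: u lf_def cis_conv_exp exp_sum sum_distrib_left)
      finally show ?thesis .
    qed
    fix \<psi> assume "\<psi> \<in> L"
    then obtain v where v: "\<psi> = lf v" by (auto simp: L_def)
    have "(\<lambda>x. \<phi> x + \<psi> x) = lf (\<lambda>k. u k + v k)" by (simp add: u v lf_def inner_add_left sum.distrib)
    then show "(\<lambda>x. \<phi> x + \<psi> x) \<in> L" by (simp add: L_def)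
  next
    fix N' :: "(nat \<Rightarrow> real^'d) measure" assume N': "space N' = space M" "\<And>\<phi>. \<phi> \<in> L \<Longrightarrow> \<phi> \<in> borel_measurable N'"
    have c: "(\<lambda>\<xi>. \<xi> k) \<in> borel_measurable N'" if k: "k < n" for k
    proof (rule borel_measurable_euclidean_space[THEN iffD2], rule)
      fix b :: "real^'d"
      have "lf (\<lambda>j. if j = k then b else 0) \<xi> = \<xi> k \<bullet> b" for \<xi>
      proof -
        have "lf (\<lambda>j. if j = k then b else 0) \<xi> = (\<Sum>j<n. if j = k then b \<bullet> \<xi> k else 0)"
          unfolding lf_def by (intro sum.cong) auto
        then show ?thesis using k by (simp add: inner_commute)
      qed
      then have "lf (\<lambda>j. if j = k then b else 0) = (\<lambda>\<xi>. \<xi> k \<bullet> b)" by auto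
      then show "(\<lambda>\<xi>. \<xi> k \<bullet> b) \<in> borel_measurable N'" using N'(2) by (metis L_def rangeI)
    qed
    have sp: "space N' = space (PiM {..<n} (\<lambda>_. borel :: (real^'d) measure))" using N'(1) by (simp add: M_def)
    have "(\<lambda>\<xi>. \<xi>) \<in> measurable N' (PiM {..<n} (\<lambda>_. borel :: (real^'d) measure))"
      by (rule measurable_PiM_single') (use c sp in \<open>auto simp: space_PiM\<close>)
    from measurable_sets[OF this] show "sets M \<subseteq> sets N'"
      using sp sets.sets_into_space by (fastforce simp: M_def)
  qed
  then show ?thesis by (simp add: M_def N_def)
qed

lemma incr_marginal:
  assumes "k < n" shows "distr W borel (\<lambda>w. incr T n w k) = gauss (T / real n)"
proof -
  have n: "0 < n" and h: "0 < T / real n" using assms T by auto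
  have "distr (PiM {..<n} (\<lambda>_. gauss (T / real n) :: (real^'d) measure)) (gauss (T / real n)) (\<lambda>\<xi>. \<xi> k) = gauss (T / real n)"
    using assms by (intro distr_PiM_component prob_space_gauss h) auto
  then have "gauss (T / real n) = distr (PiM {..<n} (\<lambda>_. gauss (T / real n) :: (real^'d) measure)) borel (\<lambda>\<xi>. \<xi> k)"
    by (metis distr_cong sets_gauss)
  also have "\<dots> = distr W borel ((\<lambda>\<xi>. \<xi> k) \<circ> (\<lambda>w. restrict (incr T n w) {..<n}))"
    unfolding incr_distr[OF n, symmetric]
    by (rule distr_distr) (use assms in \<open>auto intro!: incr_restrict_measurable PiM_component_measurable\<close>)
  also have "\<dots> = distr W borel (\<lambda>w. incr T n w k)" using assms by (intro distr_cong) auto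
  finally show ?thesis ..
qed

lemma incr_indep: "indep_vars (\<lambda>_. borel) (\<lambda>k w. incr T n w k) {..<n}"
proof (cases "n = 0")
  case True then show ?thesis by (simp add: indep_vars_def indep_sets_def)
next
  case False
  have "distr W (PiM {..<n} (\<lambda>_. borel)) (\<lambda>w. \<lambda>k\<in>{..<n}. incr T n w k) = PiM {..<n} (\<lambda>k. distr W borel (\<lambda>w. incr T n w k))"
    using incr_distr[of n] False PiM_cong[of "{..<n}" "{..<n}" "\<lambda>k. distr W borel (\<lambda>w. incr T n w k)" "\<lambda>_. gauss (T / real n)"]
    by (simp add: incr_marginal)
  then show ?thesis
    using False by (subst indep_vars_iff_distr_eq_PiM') (auto intro: incr_measurable)
qed

text \<open>Adaptedness in usable form: F is a function on path space that factors through the first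
  k increments, so it is independent of increment k.\<close>

lemma incr_indep_past:
  fixes f :: "(nat \<Rightarrow> real^'d) \<Rightarrow> real" and g :: "real^'d \<Rightarrow> real"
  assumes k: "k < n" and f: "f \<in> borel_measurable (PiM {..<k} (\<lambda>_. borel))" and g: "g \<in> borel_measurable borel"
    and F: "\<And>w. w \<in> Wsp T \<Longrightarrow> F w = f (restrict (incr T n w) {..<k})"
    and i: "integrable W F" "integrable W (\<lambda>w. g (incr T n w k))"
  shows "integrable W (\<lambda>w. F w * g (incr T n w k))"
    "expectation (\<lambda>w. F w * g (incr T n w k)) = expectation F * expectation (\<lambda>w. g (incr T n w k))"
proof -
  have "indep_var (PiM {..<k} (\<lambda>_. borel)) (\<lambda>w. restrict (\<lambda>j. incr T n w j) {..<k})
      (PiM {k} (\<lambda>_. borel)) (\<lambda>w. restrict (\<lambda>j. incr T n w j) {k})"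
    by (rule indep_var_restrict[OF incr_indep]) (use k in auto)
  moreover have "(\<lambda>\<xi>. g (\<xi> k)) \<in> borel_measurable (PiM {k} (\<lambda>_. borel))"
    by (rule measurable_compose[OF measurable_component_singleton[of k "{k}" "\<lambda>_. borel"] g]) simp
  ultimately have "indep_var borel (f \<circ> (\<lambda>w. restrict (\<lambda>j. incr T n w j) {..<k}))
      borel ((\<lambda>\<xi>. g (\<xi> k)) \<circ> (\<lambda>w. restrict (\<lambda>j. incr T n w j) {k}))"
    by (intro indep_var_compose[OF _ f])
  then have ind: "indep_var borel (\<lambda>w. f (restrict (incr T n w) {..<k})) borel (\<lambda>w. g (incr T n w k))"
    by (simp add: comp_def)
  have eq: "F w = f (restrict (incr T n w) {..<k})" if "w \<in> space W" for w using F that by (simp add: space_W)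
  have i1: "integrable W (\<lambda>w. f (restrict (incr T n w) {..<k}))"
    using i(1) Bochner_Integration.integrable_cong[OF refl, of W F "\<lambda>w. f (restrict (incr T n w) {..<k})"] eq by simp
  show "integrable W (\<lambda>w. F w * g (incr T n w k))"
    using indep_var_integrable[OF ind i1 i(2)] Bochner_Integration.integrable_cong[OF refl, of W "\<lambda>w. F w * g (incr T n w k)" "\<lambda>w. f (restrict (incr T n w) {..<k}) * g (incr T n w k)"] eq
    by simp
  show "expectation (\<lambda>w. F w * g (incr T n w k)) = expectation F * expectation (\<lambda>w. g (incr T n w k))"
    using indep_var_lebesgue_integral[OF ind i1 i(2)]
    by (simp add: eq cong: Bochner_Integration.integral_cong)
qed

text \<open>The two-point characteristic function with vectors r u at t and -r u at s has quadratic
  form r^2 (t - s) |u|^2.\<close>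

lemma increment_law:
  assumes st: "0 \<le> s" "s \<le> t" "t \<le> T"
  shows "distr W borel (\<lambda>w. u \<bullet> (w t - w s)) = distr std_normal_distribution borel (\<lambda>x. sqrt ((t - s) * (u \<bullet> u)) * x)"
proof -
  have [measurable]: "(\<lambda>w. w t) \<in> borel_measurable W" "(\<lambda>w. w s) \<in> borel_measurable W"
    using st by (auto intro!: ev)
  interpret N: real_distribution std_normal_distribution by (rule real_dist_normal_dist)
  show ?thesis
  proof (rule Levy_uniqueness)
    show "real_distribution (distr W borel (\<lambda>w. u \<bullet> (w t - w s)))" by (rule real_distribution_distr) simp
    show "real_distribution (distr std_normal_distribution borel (\<lambda>x. sqrt ((t - s) * (u \<bullet> u)) * x))"
      by (rule N.real_distribution_distr) simp
    show "char (distr W borel (\<lambda>w. u \<bullet> (w t - w s))) = char (distr std_normal_distribution borel (\<lambda>x. sqrt ((t - s) * (u \<bullet> u)) * x))"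
    proof
      fix r :: real
      have "char (distr W borel (\<lambda>w. u \<bullet> (w t - w s))) r = integral\<^sup>L W (\<lambda>w. iexp (r * (u \<bullet> (w t - w s))))"
        unfolding char_def by (rule integral_distr) auto
      also have "\<dots> = integral\<^sup>L W (\<lambda>w. cis (\<Sum>j<2::nat. (if j = 0 then r *\<^sub>R u else - r *\<^sub>R u) \<bullet> w (if j = 0 then t else s)))"
        by (simp add: cis_conv_exp numeral_2_eq_2 inner_diff_right algebra_simps)
      also have "\<dots> = complex_of_real (exp (- (1/2) * (r\<^sup>2 * ((t - s) * (u \<bullet> u)))))"
        using st by (subst char_W) (auto simp: numeral_2_eq_2 power2_eq_square algebra_simps)
      also have "\<dots> = char std_normal_distribution (r * sqrt ((t - s) * (u \<bullet> u)))"
        using st by (simp add: char_std_normal_distribution power_mult_distrib)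
      also have "\<dots> = char (distr std_normal_distribution borel (\<lambda>x. sqrt ((t - s) * (u \<bullet> u)) * x)) r"
        unfolding char_def by (subst integral_distr) (auto simp: mult_ac)
      finally show "char (distr W borel (\<lambda>w. u \<bullet> (w t - w s))) r = char (distr std_normal_distribution borel (\<lambda>x. sqrt ((t - s) * (u \<bullet> u)) * x)) r" .
    qed
  qed
qed

lemma increment_moments:
  assumes st: "0 \<le> s" "s \<le> t" "t \<le> T"
  shows "integrable W (\<lambda>w. (u \<bullet> (w t - w s)) ^ k)"
    "expectation (\<lambda>w. (u \<bullet> (w t - w s))) = 0"
    "expectation (\<lambda>w. (u \<bullet> (w t - w s))\<^sup>2) = (t - s) * (u \<bullet> u)"
    "expectation (\<lambda>w. (u \<bullet> (w t - w s)) ^ 4) = 3 * ((t - s) * (u \<bullet> u))\<^sup>2"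
proof -
  have [measurable]: "(\<lambda>w. w t) \<in> borel_measurable W" "(\<lambda>w. w s) \<in> borel_measurable W"
    using st by (auto intro!: ev)
  define v where "v = (t - s) * (u \<bullet> u)"
  have v: "0 \<le> v" using st by (simp add: v_def)
  have law: "expectation (\<lambda>w. (u \<bullet> (w t - w s)) ^ k) = (LINT x|std_normal_distribution. (sqrt v * x) ^ k)" for k
  proof -
    have "expectation (\<lambda>w. (u \<bullet> (w t - w s)) ^ k) = integral\<^sup>L (distr W borel (\<lambda>w. u \<bullet> (w t - w s))) (\<lambda>x. x ^ k)"
      by (rule integral_distr[symmetric]) auto
    also have "\<dots> = (LINT x|std_normal_distribution. (sqrt v * x) ^ k)"
      unfolding increment_law[OF st] v_def by (rule integral_distr) auto
    finally show ?thesis .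
  qed
  have "integrable (distr std_normal_distribution borel (\<lambda>x. sqrt v * x)) (\<lambda>x. x ^ k)"
    by (subst integrable_distr_eq) (auto simp: power_mult_distrib integrable_std_normal_distribution_moment)
  then have "integrable (distr W borel (\<lambda>w. u \<bullet> (w t - w s))) (\<lambda>x. x ^ k)"
    unfolding increment_law[OF st] v_def .
  then show "integrable W (\<lambda>w. (u \<bullet> (w t - w s)) ^ k)" by (subst (asm) integrable_distr_eq) auto
  show "expectation (\<lambda>w. (u \<bullet> (w t - w s))) = 0"
    using law[of 1] integral_std_normal_distribution_moment_odd[of 1] by simp
  show "expectation (\<lambda>w. (u \<bullet> (w t - w s))\<^sup>2) = (t - s) * (u \<bullet> u)"
    using law[of 2] std_normal_distribution_even_moments(1)[of 1] v by (simp add: power_mult_distrib v_def fact_numeral)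
  have "sqrt v ^ 4 = v\<^sup>2"
    using v by (metis mult_2 numeral_Bit0 power2_eq_square power_add real_sqrt_pow2)
  then show "expectation (\<lambda>w. (u \<bullet> (w t - w s)) ^ 4) = 3 * ((t - s) * (u \<bullet> u))\<^sup>2"
    using law[of 4] std_normal_distribution_even_moments(1)[of 2] by (simp add: power_mult_distrib v_def[symmetric] fact_numeral)
qed

end

text \<open>Riesz-Fischer: a subsequence with summable gaps converges almost everywhere, and Fatou's
  lemma shows that the whole sequence converges to the same limit in L1.\<close>

lemma (in prob_space) L1_complete:
  fixes X :: "nat \<Rightarrow> 'a \<Rightarrow> real"
  assumes X: "\<And>n. integrable M (X n)"
    and cauchy: "\<And>e. e > 0 \<Longrightarrow> \<exists>N. \<forall>n\<ge>N. \<forall>m\<ge>N. expectation (\<lambda>x. \<bar>X n x - X m x\<bar>) \<le> e"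
  shows "\<exists>Y. integrable M Y \<and> (\<lambda>n. expectation (\<lambda>x. \<bar>X n x - Y x\<bar>)) \<longlonglongrightarrow> 0"
proof -
  have [measurable]: "X n \<in> borel_measurable M" for n using X by auto
  have "\<forall>k. \<exists>N. \<forall>n\<ge>N. \<forall>m\<ge>N. expectation (\<lambda>x. \<bar>X n x - X m x\<bar>) \<le> (1/2) ^ k" by (intro allI cauchy) simp
  then obtain N where N: "\<And>k n m. n \<ge> N k \<Longrightarrow> m \<ge> N k \<Longrightarrow> expectation (\<lambda>x. \<bar>X n x - X m x\<bar>) \<le> (1/2) ^ k" by metis
  \<comment> \<open>Chosen so that r k and r (k+1) both lie beyond N k, hence consecutive gaps are
    at most (1/2)^k, and so that r k \<ge> k.\<close>
  define r where "r = (\<lambda>k. (\<Sum>i\<le>k. N i) + k)"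
  have rN: "N k \<le> r k" "N k \<le> r (Suc k)" "k \<le> r k" for k
  proof -
    have "N k \<le> (\<Sum>i\<le>k. N i)" by (rule member_le_sum) auto
    then show "N k \<le> r k" "N k \<le> r (Suc k)" "k \<le> r k" by (auto simp: r_def)
  qed
  have nn: "(\<integral>\<^sup>+x. ennreal \<bar>X n x - X m x\<bar> \<partial>M) = ennreal (expectation (\<lambda>x. \<bar>X n x - X m x\<bar>))" for n m
    using X by (intro nn_integral_eq_integral) auto
  have "(\<integral>\<^sup>+x. (\<Sum>k. ennreal \<bar>X (r (Suc k)) x - X (r k) x\<bar>) \<partial>M) = (\<Sum>k. ennreal (expectation (\<lambda>x. \<bar>X (r (Suc k)) x - X (r k) x\<bar>)))"
    by (subst nn_integral_suminf) (auto simp: nn)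
  also have "\<dots> \<le> (\<Sum>k. ennreal ((1/2) ^ k))"
    by (intro suminf_le ennreal_leI N rN) auto
  also have "\<dots> = ennreal (\<Sum>k. (1/2) ^ k)" by (intro suminf_ennreal2 summable_geometric) auto
  finally have "(\<integral>\<^sup>+x. (\<Sum>k. ennreal \<bar>X (r (Suc k)) x - X (r k) x\<bar>) \<partial>M) \<noteq> \<infinity>"
    by (metis ennreal_neq_top infinity_ennreal_def neq_top_trans)
  then have "AE x in M. (\<Sum>k. ennreal \<bar>X (r (Suc k)) x - X (r k) x\<bar>) \<noteq> \<infinity>"
    by (rule nn_integral_PInf_AE[rotated]) measurable
  then have conv: "AE x in M. (\<lambda>k. X (r k) x) \<longlonglongrightarrow> lim (\<lambda>k. X (r k) x)"
  proof eventually_elim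
    case (elim x)
    then have "summable (\<lambda>k. \<bar>X (r (Suc k)) x - X (r k) x\<bar>)"
      by (intro summable_suminf_not_top) auto
    then have "summable (\<lambda>k. X (r (Suc k)) x - X (r k) x)" by (rule summable_rabs_cancel)
    then have "convergent (\<lambda>k. \<Sum>i<k. X (r (Suc i)) x - X (r i) x)" by (simp add: summable_iff_convergent)
    then have "convergent (\<lambda>k. X (r k) x - X (r 0) x)" by (simp add: sum_lessThan_telescope[of "\<lambda>i. X (r i) x"])
    then show ?case by (simp add: convergent_diff_const_right_iff convergent_LIMSEQ_iff)
  qed
  define Y where "Y = (\<lambda>x. lim (\<lambda>k. X (r k) x))"
  have [measurable]: "Y \<in> borel_measurable M" unfolding Y_def by measurable
  have fatou: "(\<integral>\<^sup>+x. ennreal \<bar>X n x - Y x\<bar> \<partial>M) \<le> ennreal e"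
    if e: "\<And>n m. n \<ge> K \<Longrightarrow> m \<ge> K \<Longrightarrow> expectation (\<lambda>x. \<bar>X n x - X m x\<bar>) \<le> e" and n: "n \<ge> K" for e n K
  proof -
    have "(\<integral>\<^sup>+x. ennreal \<bar>X n x - Y x\<bar> \<partial>M) = (\<integral>\<^sup>+x. liminf (\<lambda>k. ennreal \<bar>X n x - X (r k) x\<bar>) \<partial>M)"
    proof (rule nn_integral_cong_AE, use conv in eventually_elim)
      case (elim x)
      then have "(\<lambda>k. ennreal \<bar>X n x - X (r k) x\<bar>) \<longlonglongrightarrow> ennreal \<bar>X n x - Y x\<bar>"
        unfolding Y_def by (intro tendsto_ennrealI tendsto_intros)
      then show ?case by (intro lim_imp_Liminf[symmetric]) auto
    qed
    also have "\<dots> \<le> liminf (\<lambda>k. \<integral>\<^sup>+x. ennreal \<bar>X n x - X (r k) x\<bar> \<partial>M)"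
      by (rule nn_integral_liminf) measurable
    also have "\<dots> \<le> limsup (\<lambda>k. \<integral>\<^sup>+x. ennreal \<bar>X n x - X (r k) x\<bar> \<partial>M)"
      by (rule Liminf_le_Limsup) simp
    also have "\<dots> \<le> ennreal e"
    proof (rule Limsup_bounded)
      show "\<forall>\<^sub>F k in sequentially. (\<integral>\<^sup>+x. ennreal \<bar>X n x - X (r k) x\<bar> \<partial>M) \<le> ennreal e"
        using eventually_ge_at_top[of K]
      proof eventually_elim
        case (elim k)
        have "K \<le> r k" using elim rN(3)[of k] by simp
        then show ?case unfolding nn by (intro ennreal_leI e n)
      qed
    qed
    finally show ?thesis .
  qed
  have Yi: "integrable M (\<lambda>x. X n x - Y x)" if "n \<ge> N 0" for n
  proof (rule integrableI_bounded)
    have "(\<integral>\<^sup>+x. ennreal \<bar>X n x - Y x\<bar> \<partial>M) \<le> ennreal ((1/2) ^ 0)" by (rule fatou[OF N that])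
    then show "(\<integral>\<^sup>+x. ennreal (norm (X n x - Y x)) \<partial>M) < \<infinity>" by (simp add: le_less_trans)
  qed simp
  have "integrable M (\<lambda>x. X (N 0) x - (X (N 0) x - Y x))"
    by (intro Bochner_Integration.integrable_diff X Yi) simp
  then have "integrable M Y" by simp
  moreover have "(\<lambda>n. expectation (\<lambda>x. \<bar>X n x - Y x\<bar>)) \<longlonglongrightarrow> 0"
  proof (rule LIMSEQ_I)
    fix e :: real assume e: "0 < e"
    obtain K where K: "\<And>n m. n \<ge> K \<Longrightarrow> m \<ge> K \<Longrightarrow> expectation (\<lambda>x. \<bar>X n x - X m x\<bar>) \<le> e / 2"
      using cauchy[of "e/2"] e by auto
    have "norm (expectation (\<lambda>x. \<bar>X n x - Y x\<bar>) - 0) < e" if "n \<ge> max K (N 0)" for n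
    proof -
      have "ennreal (expectation (\<lambda>x. \<bar>X n x - Y x\<bar>)) = (\<integral>\<^sup>+x. ennreal \<bar>X n x - Y x\<bar> \<partial>M)"
        using Yi[of n] that by (intro nn_integral_eq_integral[symmetric]) auto
      also have "\<dots> \<le> ennreal (e / 2)" using that by (intro fatou[OF K]) auto
      finally have "expectation (\<lambda>x. \<bar>X n x - Y x\<bar>) \<le> e / 2" using e by simp
      moreover have "0 \<le> expectation (\<lambda>x. \<bar>X n x - Y x\<bar>)" by simp
      ultimately show ?thesis using e by simp
    qed
    then show "\<exists>no. \<forall>n\<ge>no. norm (expectation (\<lambda>x. \<bar>X n x - Y x\<bar>) - 0) < e" by blast
  qed
  ultimately show ?thesis by blast
qed

section \<open>Moment estimates and Riemann sums\<close>

lemma (in prob_space) expectation_abs_le_sqrt: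
  fixes X :: "'a \<Rightarrow> real"
  assumes "X \<in> borel_measurable M" "integrable M (\<lambda>x. (X x)\<^sup>2)"
  shows "integrable M X" "expectation (\<lambda>x. \<bar>X x\<bar>) \<le> sqrt (expectation (\<lambda>x. (X x)\<^sup>2))"
proof -
  have "integrable M (\<lambda>x. X x * 1)" using assms by (intro integrable_mult_of_squares) auto
  then show i: "integrable M X" by simp
  have "0 \<le> variance (\<lambda>x. \<bar>X x\<bar>)" by (rule variance_positive)
  also have "variance (\<lambda>x. \<bar>X x\<bar>) = expectation (\<lambda>x. \<bar>X x\<bar>\<^sup>2) - (expectation (\<lambda>x. \<bar>X x\<bar>))\<^sup>2"
    using i assms by (intro variance_eq) auto
  finally have "(expectation (\<lambda>x. \<bar>X x\<bar>))\<^sup>2 \<le> expectation (\<lambda>x. (X x)\<^sup>2)" by simp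
  then show "expectation (\<lambda>x. \<bar>X x\<bar>) \<le> sqrt (expectation (\<lambda>x. (X x)\<^sup>2))"
    by (rule real_le_rsqrt)
qed

text \<open>Each cell contributes at most h e. The statement covers partial sums up to every k,
  because the Euler scheme is compared with its limit at all nodes.\<close>

lemma riemann_sum_error:
  fixes f :: "real \<Rightarrow> 'a::euclidean_space"
  assumes T: "0 < T" and f: "continuous_on {0..T} f" and n: "0 < n"
    and mod: "\<And>s t. s \<in> {0..T} \<Longrightarrow> t \<in> {0..T} \<Longrightarrow> \<bar>t - s\<bar> \<le> T / real n \<Longrightarrow> norm (f t - f s) \<le> e" and k: "k \<le> n"
  shows "norm (integral {0..real k * T / real n} f - (\<Sum>j<k. (T / real n) *\<^sub>R f (real j * T / real n))) \<le> real k * (T / real n) * e"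
  using k
proof (induction k)
  case (Suc k)
  define a b where "a = real k * T / real n" and "b = real (Suc k) * T / real n"
  have ab: "0 \<le> a" "a \<le> b" "b \<le> T" "b - a = T / real n"
    using T n Suc.prems grid_mem[of T k n] grid_mem[of T "Suc k" n] by (auto simp: a_def b_def field_simps)
  have fi: "f integrable_on {0..b}" using ab by (intro integrable_continuous_real continuous_on_subset[OF f]) auto
  have fab: "continuous_on {a..b} f" using ab by (intro continuous_on_subset[OF f]) auto
  have I: "integral {0..b} f = integral {0..a} f + integral {a..b} f"
    using Henstock_Kurzweil_Integration.integral_combine[OF ab(1,2) fi] by simp
  have "integral {a..b} f - (T / real n) *\<^sub>R f a = integral {a..b} (\<lambda>t. f t - f a)"
    using ab(2) integrable_continuous_real[OF fab] unfolding ab(4)[symmetric] by (subst integral_diff) auto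
  also have "norm \<dots> \<le> e * (b - a)"
    using ab by (intro norm_integral_le_const mod continuous_intros fab) auto
  finally have "norm (integral {a..b} f - (T / real n) *\<^sub>R f a) \<le> (T / real n) * e" by (simp add: ab(4) mult.commute)
  moreover have "norm (integral {0..a} f - (\<Sum>j<k. (T / real n) *\<^sub>R f (real j * T / real n))) \<le> real k * (T / real n) * e"
    unfolding a_def using Suc by simp
  ultimately have "norm (integral {0..b} f - (\<Sum>j<Suc k. (T / real n) *\<^sub>R f (real j * T / real n)))
      \<le> real k * (T / real n) * e + (T / real n) * e"
    unfolding I using norm_triangle_ineq[of "integral {0..a} f - (\<Sum>j<k. (T / real n) *\<^sub>R f (real j * T / real n))" "integral {a..b} f - (T / real n) *\<^sub>R f a"]
    by (simp add: a_def algebra_simps)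
  then show ?case by (simp add: b_def algebra_simps add_divide_distrib del: sum.lessThan_Suc)
qed simp

lemma riemann_sum_tendsto:
  fixes f :: "real \<Rightarrow> 'a::euclidean_space"
  assumes T: "0 < T" and f: "continuous_on {0..T} f"
  shows "(\<lambda>n. \<Sum>j<n. (T / real n) *\<^sub>R f (real j * T / real n)) \<longlonglongrightarrow> integral {0..T} f"
proof (rule LIMSEQ_I)
  fix e :: real assume e: "0 < e"
  define e' where "e' = e / (2 * T)"
  have e': "0 < e'" using e T by (simp add: e'_def)
  from eventually_conj[OF continuous_modulus[OF f e'] eventually_gt_at_top[of 0]]
  have "\<forall>\<^sub>F n in sequentially. norm ((\<Sum>j<n. (T / real n) *\<^sub>R f (real j * T / real n)) - integral {0..T} f) < e"
  proof eventually_elim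
    case (elim n)
    have "norm (integral {0..real n * T / real n} f - (\<Sum>j<n. (T / real n) *\<^sub>R f (real j * T / real n))) \<le> real n * (T / real n) * e'"
      using elim by (intro riemann_sum_error[OF T f]) (auto simp: less_imp_le)
    also have "\<dots> = e / 2" using elim T by (simp add: e'_def)
    finally show ?case using e elim by (simp add: norm_minus_commute)
  qed
  then show "\<exists>no. \<forall>n\<ge>no. norm ((\<Sum>j<n. (T / real n) *\<^sub>R f (real j * T / real n)) - integral {0..T} f) < e"
    by (simp add: eventually_sequentially)
qed

lemma norm_power2_vec: "(norm (v :: real^'d))\<^sup>2 = (\<Sum>i\<in>UNIV. (axis i 1 \<bullet> v)\<^sup>2)"
  unfolding power2_norm_eq_inner by (simp add: inner_vec_def[of v v] inner_axis' power2_eq_square)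

lemma power2_norm_add_le: "(norm (a + b))\<^sup>2 \<le> 2 * (norm a)\<^sup>2 + 2 * (norm b)\<^sup>2"
proof -
  have "(norm (a + b))\<^sup>2 \<le> (norm a + norm b)\<^sup>2" by (intro power_mono norm_triangle_ineq) auto
  also have "\<dots> \<le> 2 * (norm a)\<^sup>2 + 2 * (norm b)\<^sup>2"
    using zero_le_power2[of "norm a - norm b"] by (simp add: power2_sum power2_diff)
  finally show ?thesis .
qed

section \<open>The discrete Ito isometry\<close>

context brownian
begin

lemma increment_norm2:
  assumes st: "0 \<le> s" "s \<le> t" "t \<le> T"
  shows "integrable W (\<lambda>w. (norm (w t - w s))\<^sup>2)" "expectation (\<lambda>w. (norm (w t - w s))\<^sup>2) = real CARD('d) * (t - s)"
  unfolding norm_power2_vec using increment_moments(1)[OF st, of _ 2] increment_moments(3)[OF st]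
  by (auto simp: Bochner_Integration.integral_sum)

lemma increment_norm4:
  assumes st: "0 \<le> s" "s \<le> t" "t \<le> T"
  shows "integrable W (\<lambda>w. (norm (w t - w s)) ^ 4)" "expectation (\<lambda>w. (norm (w t - w s)) ^ 4) \<le> 3 * (real CARD('d))\<^sup>2 * (t - s)\<^sup>2"
proof -
  have [measurable]: "(\<lambda>w. w t) \<in> borel_measurable W" "(\<lambda>w. w s) \<in> borel_measurable W"
    using st by (auto intro!: ev)
  have n4: "(norm v) ^ 4 = (\<Sum>i\<in>UNIV. (axis i 1 \<bullet> v)\<^sup>2)\<^sup>2" for v :: "real^'d"
    unfolding norm_power2_vec[symmetric] by (simp add: power_mult[symmetric])
  have p4: "((x::real)\<^sup>2)\<^sup>2 = x ^ 4" for x by (simp add: power_mult[symmetric])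
  show i: "integrable W (\<lambda>w. (norm (w t - w s)) ^ 4)"
    unfolding n4 by (rule integrable_square_sum) (use increment_moments(1)[OF st, of _ 4] in \<open>auto simp: p4\<close>)
  have "expectation (\<lambda>w. (norm (w t - w s)) ^ 4) \<le> expectation (\<lambda>w. real CARD('d) * (\<Sum>i\<in>UNIV. (axis i 1 \<bullet> (w t - w s)) ^ 4))"
  proof (rule integral_mono[OF i])
    show "integrable W (\<lambda>w. real CARD('d) * (\<Sum>i\<in>UNIV. (axis i 1 \<bullet> (w t - w s)) ^ 4))"
      using increment_moments(1)[OF st, of _ 4] by auto
    fix w :: "real \<Rightarrow> real^'d"
    show "(norm (w t - w s)) ^ 4 \<le> real CARD('d) * (\<Sum>i\<in>UNIV. (axis i 1 \<bullet> (w t - w s)) ^ 4)"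
      unfolding n4 using sum_squared_le_sum_of_squares[of "\<lambda>i. (axis i 1 \<bullet> (w t - w s))\<^sup>2" "UNIV :: 'd set"]
      by (simp add: p4 mult.commute)
  qed
  also have "\<dots> = 3 * (real CARD('d))\<^sup>2 * (t - s)\<^sup>2"
    using increment_moments(1)[OF st, of _ 4] increment_moments(4)[OF st]
    by (simp add: Bochner_Integration.integral_sum power2_eq_square)
  finally show "expectation (\<lambda>w. (norm (w t - w s)) ^ 4) \<le> 3 * (real CARD('d))\<^sup>2 * (t - s)\<^sup>2" .
qed

lemma grid_step:
  assumes "k < n"
  shows "0 \<le> real k * T / real n" "real k * T / real n \<le> real (Suc k) * T / real n" "real (Suc k) * T / real n \<le> T"
    "real (Suc k) * T / real n - real k * T / real n = T / real n"
proof -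
  show "0 \<le> real k * T / real n" using T by simp
  show "real (Suc k) * T / real n \<le> T" using grid(2)[OF assms] by (simp only: atLeastAtMost_iff)
  show d: "real (Suc k) * T / real n - real k * T / real n = T / real n" by (simp add: field_simps add_divide_distrib)
  have "0 \<le> T / real n" using T by simp
  then show "real k * T / real n \<le> real (Suc k) * T / real n" using d by linarith
qed

lemma incr_norm2:
  assumes "k < n"
  shows "integrable W (\<lambda>w. (norm (incr T n w k))\<^sup>2)" "expectation (\<lambda>w. (norm (incr T n w k))\<^sup>2) = real CARD('d) * (T / real n)"
  unfolding incr_def using increment_norm2[OF grid_step(1-3)[OF assms]] unfolding grid_step(4)[OF assms] by auto

lemma incr_norm4:
  assumes "k < n"
  shows "integrable W (\<lambda>w. (norm (incr T n w k)) ^ 4)" "expectation (\<lambda>w. (norm (incr T n w k)) ^ 4) \<le> 3 * (real CARD('d))\<^sup>2 * (T / real n)\<^sup>2"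
  unfolding incr_def using increment_norm4[OF grid_step(1-3)[OF assms]] unfolding grid_step(4)[OF assms] by auto

lemma incr_component:
  assumes "k < n"
  shows "integrable W (\<lambda>w. u \<bullet> incr T n w k)" "expectation (\<lambda>w. u \<bullet> incr T n w k) = 0"
  unfolding incr_def
  using increment_moments(1)[OF grid_step(1-3)[OF assms], of u 1] increment_moments(2)[OF grid_step(1-3)[OF assms], of u] by auto

text \<open>Martingale differences are orthogonal: V_k depends on values up to time k only, since m
  k \<le> k. The two-term form covers a plain left-point sum (B' = 0) as well as the difference of
  sums on two nested grids, where m k is the last coarse node.\<close>

lemma ito_remainder_square_le:
  fixes B B' :: "nat \<Rightarrow> real^'d^'d"
  assumes n: "0 < n" and m: "\<And>k. k < n \<Longrightarrow> m k \<le> k"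
  defines "V \<equiv> \<lambda>k w. B k *v w (real k * T / real n) - B' k *v w (real (m k) * T / real n)"
  assumes K: "\<And>k. k < n \<Longrightarrow> expectation (\<lambda>w. (norm (V k w))\<^sup>2) \<le> K"
  shows "integrable W (\<lambda>w. (\<Sum>k<n. V k w \<bullet> incr T n w k)\<^sup>2)"
    "expectation (\<lambda>w. (\<Sum>k<n. V k w \<bullet> incr T n w k)\<^sup>2) \<le> T * real CARD('d) * K"
proof -
  define h where "h = T / real n"
  define f where "f = (\<lambda>k \<zeta>. B k *v psum \<zeta> k - B' k *v psum \<zeta> (m k))"
  have w0: "psum (incr T n w) j = w (real j * T / real n)" if "w \<in> Wsp T" for w j
    using psum_incr[of w T n j] Wsp_0[OF that] by simp
  have Vf: "V k w = f k (restrict (incr T n w) {..<l})" if "k < n" "k \<le> l" "w \<in> Wsp T" for k l w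
  proof -
    have "psum (restrict (incr T n w) {..<l}) j = w (real j * T / real n)" if "j \<le> l" for j
      using w0[OF \<open>w \<in> Wsp T\<close>, of j] that psum_cong[of j "restrict (incr T n w) {..<l}" "incr T n w"] by simp
    then show ?thesis using m[OF that(1)] that(2) by (simp add: f_def V_def)
  qed
  have fm: "f k \<in> borel_measurable (PiM {..<l} (\<lambda>_. borel))" if "k < n" "k \<le> l" for k l
    unfolding f_def using m[OF that(1)] that(2)
    by (intro borel_measurable_diff matrix_vector_measurable psum_measurable) auto
  have Vm [measurable]: "V k \<in> borel_measurable W" if "k < n" for k
    unfolding V_def using m[OF that] that by (intro borel_measurable_diff matrix_vector_measurable ev grid) auto
  have Vi: "integrable W (\<lambda>w. (norm (V k w))\<^sup>2)" if k: "k < n" for k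
  proof (rule Bochner_Integration.integrable_bound)
    have a: "0 \<le> real j * T / real n" "real j * T / real n \<le> T" if "j \<le> k" for j
      using grid(1)[of j n] k that by auto
    show "integrable W (\<lambda>w. 2 * (norm (B k))\<^sup>2 * (norm (w (real k * T / real n) - w 0))\<^sup>2
        + 2 * (norm (B' k))\<^sup>2 * (norm (w (real (m k) * T / real n) - w 0))\<^sup>2)"
      using increment_norm2(1)[OF order_refl a, of k] increment_norm2(1)[OF order_refl a, of "m k"] m[OF k] by simp
    show "AE w in W. norm ((norm (V k w))\<^sup>2) \<le> norm (2 * (norm (B k))\<^sup>2 * (norm (w (real k * T / real n) - w 0))\<^sup>2
        + 2 * (norm (B' k))\<^sup>2 * (norm (w (real (m k) * T / real n) - w 0))\<^sup>2)"
    proof (rule AE_I2)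
      fix w assume "w \<in> space W"
      then have w0: "w 0 = 0" by (simp add: space_W Wsp_0)
      have "(norm (V k w))\<^sup>2 \<le> 2 * (norm (B k *v w (real k * T / real n)))\<^sup>2 + 2 * (norm (- (B' k *v w (real (m k) * T / real n))))\<^sup>2"
        unfolding V_def using power2_norm_add_le[of "B k *v w (real k * T / real n)" "- (B' k *v w (real (m k) * T / real n))"] by simp
      also have "\<dots> \<le> 2 * (norm (B k) * norm (w (real k * T / real n)))\<^sup>2 + 2 * (norm (B' k) * norm (w (real (m k) * T / real n)))\<^sup>2"
        unfolding norm_minus_cancel by (intro add_mono mult_left_mono power_mono norm_matrix_vector_mult_le) auto
      finally show "norm ((norm (V k w))\<^sup>2) \<le> norm (2 * (norm (B k))\<^sup>2 * (norm (w (real k * T / real n) - w 0))\<^sup>2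
        + 2 * (norm (B' k))\<^sup>2 * (norm (w (real (m k) * T / real n) - w 0))\<^sup>2)"
        by (simp add: w0 power_mult_distrib)
    qed
  qed (use Vm[OF k] in measurable)
  define D where "D = (\<lambda>k w. V k w \<bullet> incr T n w k)"
  have im [measurable]: "(\<lambda>w. incr T n w k) \<in> borel_measurable W" if "k < n" for k by (rule incr_measurable[OF that])
  have Dm: "D k \<in> borel_measurable W" if "k < n" for k
    unfolding D_def using Vm[OF that] im[OF that] by measurable
  have VX: "integrable W (\<lambda>w. (norm (V k w))\<^sup>2 * (norm (incr T n w k))\<^sup>2)"
    "expectation (\<lambda>w. (norm (V k w))\<^sup>2 * (norm (incr T n w k))\<^sup>2) = expectation (\<lambda>w. (norm (V k w))\<^sup>2) * (real CARD('d) * h)" if k: "k < n" for k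
  proof -
    have *: "(\<lambda>\<zeta>. (norm (f k \<zeta>))\<^sup>2) \<in> borel_measurable (PiM {..<k} (\<lambda>_. borel))"
      using fm[OF k order_refl] by measurable
    \<comment> \<open>The squared norms of V_k and of the increment are independent, so the
      expectation of their product is E|V_k|^2 d h.\<close>
    note ind = incr_indep_past[OF k *, of "\<lambda>x. (norm x)\<^sup>2" "\<lambda>w. (norm (V k w))\<^sup>2"]
    show "integrable W (\<lambda>w. (norm (V k w))\<^sup>2 * (norm (incr T n w k))\<^sup>2)"
      by (rule ind(1)) (use Vf[OF k order_refl] Vi[OF k] incr_norm2[OF k] in auto)
    show "expectation (\<lambda>w. (norm (V k w))\<^sup>2 * (norm (incr T n w k))\<^sup>2) = expectation (\<lambda>w. (norm (V k w))\<^sup>2) * (real CARD('d) * h)"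
      unfolding h_def incr_norm2(2)[OF k, symmetric]
      by (rule ind(2)) (use Vf[OF k order_refl] Vi[OF k] incr_norm2[OF k] in auto)
  qed
  have D2: "(D k w)\<^sup>2 \<le> (norm (V k w))\<^sup>2 * (norm (incr T n w k))\<^sup>2" for k w
    unfolding D_def power_mult_distrib[symmetric]
    using Cauchy_Schwarz_ineq2[of "V k w" "incr T n w k"] by (intro abs_le_square_iff[THEN iffD1]) simp
  have Di: "integrable W (\<lambda>w. (D k w)\<^sup>2)" if k: "k < n" for k
    by (rule Bochner_Integration.integrable_bound[OF VX(1)[OF k]]) (use D2 Dm[OF k] in \<open>auto intro!: AE_I2\<close>)
  have Ci: "integrable W (\<lambda>w. (V k w $ i)\<^sup>2)" "(\<lambda>w. V k w $ i) \<in> borel_measurable W" if k: "k < n" for k i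
  proof -
    show 1: "(\<lambda>w. V k w $ i) \<in> borel_measurable W"
      using borel_measurable_inner[OF Vm[OF k] borel_measurable_const[of "axis i 1"]] by (simp add: inner_axis)
    show "integrable W (\<lambda>w. (V k w $ i)\<^sup>2)"
      by (rule Bochner_Integration.integrable_bound[OF Vi[OF k]])
        (use 1 component_le_norm_cart in \<open>auto intro!: AE_I2 abs_le_square_iff[THEN iffD1]\<close>)
  qed
  have orth: "expectation (\<lambda>w. D j w * D k w) = 0" if jk: "j < k" "k < n" for j k
  proof -
    have j: "j < n" using jk by simp
    \<comment> \<open>Independence is stated for scalar products, so the inner product is split into
      coordinates; each later increment coordinate has mean zero.\<close>
    have F: "integrable W (\<lambda>w. (D j w * V k w $ i) * (axis i 1 \<bullet> incr T n w k))"
      "expectation (\<lambda>w. (D j w * V k w $ i) * (axis i 1 \<bullet> incr T n w k)) = 0" for i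
    proof -
      define g where "g = (\<lambda>\<zeta>. (f j \<zeta> \<bullet> \<zeta> j) * (f k \<zeta> $ i))"
      have "(\<lambda>\<zeta>. f k \<zeta> $ i) \<in> borel_measurable (PiM {..<k} (\<lambda>_. borel))"
        using borel_measurable_inner[OF fm[OF jk(2) order_refl] borel_measurable_const[of "axis i 1"]] by (simp add: inner_axis)
      then have gm: "g \<in> borel_measurable (PiM {..<k} (\<lambda>_. borel))"
        unfolding g_def using fm[OF j, of k] jk
        by (intro borel_measurable_times borel_measurable_inner PiM_component_measurable) auto
      have Fg: "D j w * V k w $ i = g (restrict (incr T n w) {..<k})" if "w \<in> Wsp T" for w
        using Vf[OF j _ that, of k] Vf[OF jk(2) order_refl that] jk by (simp add: g_def D_def)
      have Fi: "integrable W (\<lambda>w. D j w * V k w $ i)"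
        by (rule integrable_mult_of_squares[OF Dm[OF j] Ci(2)[OF jk(2)] Di[OF j] Ci(1)[OF jk(2)]])
      note ind = incr_indep_past[OF jk(2) gm _ Fg Fi incr_component(1)[OF jk(2), of "axis i 1"]]
      show "integrable W (\<lambda>w. (D j w * V k w $ i) * (axis i 1 \<bullet> incr T n w k))" by (rule ind(1)) auto
      have "expectation (\<lambda>w. (D j w * V k w $ i) * (axis i 1 \<bullet> incr T n w k))
        = expectation (\<lambda>w. D j w * V k w $ i) * expectation (\<lambda>w. axis i 1 \<bullet> incr T n w k)" by (rule ind(2)) auto
      then show "expectation (\<lambda>w. (D j w * V k w $ i) * (axis i 1 \<bullet> incr T n w k)) = 0"
        by (simp add: incr_component(2)[OF jk(2)])
    qed
    have "D j w * D k w = (\<Sum>i\<in>UNIV. (D j w * V k w $ i) * (axis i 1 \<bullet> incr T n w k))" for w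
    proof -
      have "D k w = (\<Sum>i\<in>UNIV. V k w $ i * incr T n w k $ i)" by (simp add: D_def inner_vec_def)
      then show ?thesis by (simp add: sum_distrib_left inner_axis' mult_ac)
    qed
    then show ?thesis using F by (simp add: Bochner_Integration.integral_sum)
  qed
  show "integrable W (\<lambda>w. (\<Sum>k<n. V k w \<bullet> incr T n w k)\<^sup>2)"
    using integrable_square_sum[of "{..<n}" D W] Dm Di by (simp add: D_def)
  have "expectation (\<lambda>w. (\<Sum>k<n. V k w \<bullet> incr T n w k)\<^sup>2) = (\<Sum>k<n. expectation (\<lambda>w. (D k w)\<^sup>2))"
    using orthogonal_sum_square[of n D W] Dm Di orth by (simp add: D_def)
  also have "\<dots> \<le> (\<Sum>k<n. K * (real CARD('d) * h))"
  proof (rule sum_mono)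
    fix k assume "k \<in> {..<n}"
    then have k: "k < n" by simp
    have "expectation (\<lambda>w. (D k w)\<^sup>2) \<le> expectation (\<lambda>w. (norm (V k w))\<^sup>2 * (norm (incr T n w k))\<^sup>2)"
      using D2 by (intro integral_mono Di[OF k] VX(1)[OF k])
    also have "\<dots> \<le> K * (real CARD('d) * h)"
      unfolding VX(2)[OF k] using T by (intro mult_right_mono K[OF k]) (auto simp: h_def)
    finally show "expectation (\<lambda>w. (D k w)\<^sup>2) \<le> K * (real CARD('d) * h)" .
  qed
  also have "\<dots> = T * real CARD('d) * K" using n by (simp add: h_def)
  finally show "expectation (\<lambda>w. (\<Sum>k<n. V k w \<bullet> incr T n w k)\<^sup>2) \<le> T * real CARD('d) * K" .
qed

end

section \<open>The stochastic integral\<close>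

lemma ito_sum_incr: "ito_sum T \<sigma> n w = (\<Sum>k<n. (\<sigma> (real k * T / real n) *v w (real k * T / real n)) \<bullet> incr T n w k)"
  by (simp add: ito_sum_def incr_def)

text \<open>A coarse sum rewritten on a p times finer grid: the integrand is frozen at the last
  coarse node \<open>k div p * p\<close> and the fine increments add up to the coarse one.\<close>

lemma ito_sum_refine:
  assumes n: "0 < n" and p: "0 < p"
  shows "ito_sum T \<sigma> n w = (\<Sum>k<n * p. (\<sigma> (real (k div p * p) * T / real (n * p)) *v w (real (k div p * p) * T / real (n * p)))
     \<bullet> incr T (n * p) w k)"
proof -
  define F where "F = (\<lambda>k. (\<sigma> (real (k div p * p) * T / real (n * p)) *v w (real (k div p * p) * T / real (n * p))) \<bullet> incr T (n * p) w k)"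
  have g: "real (q * p) * T / real (n * p) = real q * T / real n" for q using p by simp
  have "(\<Sum>k<n * p. F k) = (\<Sum>q<n. \<Sum>k\<in>{q * p..<q * p + p}. F k)" by (rule sum.nat_group[symmetric])
  also have "\<dots> = (\<Sum>q<n. (\<sigma> (real q * T / real n) *v w (real q * T / real n)) \<bullet> incr T n w q)"
  proof (rule sum.cong[OF refl])
    fix q assume "q \<in> {..<n}"
    have "(\<Sum>k\<in>{q * p..<q * p + p}. F k) = (\<Sum>k\<in>{q * p..<q * p + p}. (\<sigma> (real q * T / real n) *v w (real q * T / real n)) \<bullet> incr T (n * p) w k)"
    proof (rule sum.cong[OF refl])
      fix k assume "k \<in> {q * p..<q * p + p}"
      then have "k div p = q" using p by (intro div_nat_eqI) (auto simp: algebra_simps)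
      then show "F k = (\<sigma> (real q * T / real n) *v w (real q * T / real n)) \<bullet> incr T (n * p) w k"
        unfolding F_def by (simp only: g)
    qed
    also have "\<dots> = (\<sigma> (real q * T / real n) *v w (real q * T / real n)) \<bullet> (\<Sum>k\<in>{q * p..<q * p + p}. incr T (n * p) w k)"
      by (simp add: inner_sum_right)
    also have "(\<Sum>k\<in>{q * p..<q * p + p}. incr T (n * p) w k) = incr T n w q"
    proof -
      have "(\<Sum>k\<in>{q * p..<q * p + p}. incr T (n * p) w k)
          = (\<Sum>k\<in>{q * p..<q * p + p}. w (real (Suc k) * T / real (n * p)) - w (real k * T / real (n * p)))"
        by (simp only: incr_def)
      also have "\<dots> = w (real (q * p + p) * T / real (n * p)) - w (real (q * p) * T / real (n * p))"
        by (rule sum_Suc_diff') simp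
      also have "\<dots> = incr T n w q"
      proof -
        have "q * p + p = Suc q * p" by simp
        then have "real (q * p + p) * T / real (n * p) = real (Suc q) * T / real n" by (simp only: g)
        then show ?thesis by (simp only: g incr_def)
      qed
      finally show ?thesis .
    qed
    finally show "(\<Sum>k\<in>{q * p..<q * p + p}. F k) = (\<sigma> (real q * T / real n) *v w (real q * T / real n)) \<bullet> incr T n w q" .
  qed
  finally show ?thesis by (simp add: F_def ito_sum_incr)
qed

context brownian
begin

lemma ito_sum_measurable: "ito_sum T \<sigma> n \<in> borel_measurable W"
proof -
  have "(\<lambda>w. (\<sigma> (real k * T / real n) *v w (real k * T / real n)) \<bullet> incr T n w k) \<in> borel_measurable W" if "k < n" for k
    using that by (intro borel_measurable_inner matrix_vector_measurable ev grid incr_measurable) auto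
  then show ?thesis unfolding ito_sum_incr[abs_def] by (intro borel_measurable_sum) auto
qed

lemma ito_sum_square_integrable: "integrable W (\<lambda>w. (ito_sum T \<sigma> n w)\<^sup>2)"
proof (cases "n = 0")
  case True then show ?thesis by (simp add: ito_sum_def)
next
  case False
  \<comment> \<open>The case B' = 0. Only integrability is wanted, so the bound is taken to be the
    sum of all second moments.\<close>
  have "integrable W (\<lambda>w. (\<Sum>k<n. (\<sigma> (real k * T / real n) *v w (real k * T / real n) - 0 *v w (real k * T / real n)) \<bullet> incr T n w k)\<^sup>2)"
    using False
  proof (intro ito_remainder_square_le(1)[where m = "\<lambda>k. k"
      and K = "\<Sum>k<n. expectation (\<lambda>w. (norm (\<sigma> (real k * T / real n) *v w (real k * T / real n) - 0 *v w (real k * T / real n)))\<^sup>2)"])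
    fix k assume "k < n"
    then show "expectation (\<lambda>w. (norm (\<sigma> (real k * T / real n) *v w (real k * T / real n) - 0 *v w (real k * T / real n)))\<^sup>2)
      \<le> (\<Sum>k<n. expectation (\<lambda>w. (norm (\<sigma> (real k * T / real n) *v w (real k * T / real n) - 0 *v w (real k * T / real n)))\<^sup>2))"
      by (intro member_le_sum) auto
  qed auto
  then show ?thesis by (simp add: ito_sum_incr)
qed

text \<open>The integrand changes by (\<sigma>(t) - \<sigma>(s)) w(s) + \<sigma>(t) (w(t) - w(s))
  with t - s \<le> T/n. The modulus \<eta> controls the first term, the variance of the increment
  the second.\<close>

lemma ito_sum_refine_close:
  fixes \<sigma> :: "real \<Rightarrow> real^'d^'d"
  assumes c: "continuous_on {0..T} \<sigma>" and n: "0 < n" and p: "0 < p" and \<eta>: "0 \<le> \<eta>"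
    and mod: "\<And>s t. s \<in> {0..T} \<Longrightarrow> t \<in> {0..T} \<Longrightarrow> \<bar>t - s\<bar> \<le> T / real n \<Longrightarrow> norm (\<sigma> t - \<sigma> s) \<le> \<eta>"
  shows "integrable W (\<lambda>w. (ito_sum T \<sigma> (n * p) w - ito_sum T \<sigma> n w)\<^sup>2)"
    "expectation (\<lambda>w. (ito_sum T \<sigma> (n * p) w - ito_sum T \<sigma> n w)\<^sup>2)
      \<le> T * real CARD('d) * (2 * \<eta>\<^sup>2 * (real CARD('d) * T) + 2 * (supn T \<sigma>)\<^sup>2 * (real CARD('d) * (T / real n)))"
proof -
  define N where "N = n * p"
  define m where "m = (\<lambda>k. k div p * p)"
  have N: "0 < N" using n p by (simp add: N_def)
  have mk: "m k \<le> k" for k by (simp add: m_def)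
  define t where "t = (\<lambda>k. real k * T / real N)"
  define V where "V = (\<lambda>k w. \<sigma> (t k) *v w (t k) - \<sigma> (t (m k)) *v w (t (m k)))"
  have diff: "ito_sum T \<sigma> (n * p) w - ito_sum T \<sigma> n w = (\<Sum>k<N. V k w \<bullet> incr T N w k)" for w
    unfolding ito_sum_refine[OF n p] ito_sum_incr[of T \<sigma> "n * p"] V_def t_def N_def m_def
    by (simp add: inner_diff_left sum_subtractf)
  have K: "expectation (\<lambda>w. (norm (V k w))\<^sup>2) \<le> 2 * \<eta>\<^sup>2 * (real CARD('d) * T) + 2 * (supn T \<sigma>)\<^sup>2 * (real CARD('d) * (T / real n))"
    (is "_ \<le> ?K") if k: "k < N" for k
  proof -
    have tk: "t k \<in> {0..T}" "t (m k) \<in> {0..T}" using k mk[of k] unfolding t_def by (auto simp del: atLeastAtMost_iff intro!: grid)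
    have le: "t (m k) \<le> t k" using mk[of k] T unfolding t_def by (intro divide_right_mono mult_right_mono) auto
    have gap: "t k - t (m k) \<le> T / real n"
    proof -
      have "k - m k \<le> p" using p mod_less_divisor[OF p, of k] by (simp add: m_def minus_div_mult_eq_mod less_imp_le)
      then have "real k - real (m k) \<le> real p" using mk[of k] by linarith
      then have "(real k - real (m k)) * (T / real N) \<le> real p * (T / real N)" using T by (intro mult_right_mono) auto
      also have "\<dots> = T / real n" using p by (simp add: N_def)
      finally show ?thesis by (simp add: t_def algebra_simps diff_divide_distrib)
    qed
    have st: "0 \<le> t (m k)" "t (m k) \<le> T" "t k \<le> T" using tk by auto
    have i1: "integrable W (\<lambda>w. (norm (w (t (m k)) - w 0))\<^sup>2)" "expectation (\<lambda>w. (norm (w (t (m k)) - w 0))\<^sup>2) = real CARD('d) * (t (m k) - 0)"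
      using increment_norm2[OF order_refl st(1,2)] by auto
    have i2: "integrable W (\<lambda>w. (norm (w (t k) - w (t (m k))))\<^sup>2)"
      "expectation (\<lambda>w. (norm (w (t k) - w (t (m k))))\<^sup>2) = real CARD('d) * (t k - t (m k))"
      using increment_norm2[OF st(1) le st(3)] by auto
    have "expectation (\<lambda>w. (norm (V k w))\<^sup>2)
        \<le> expectation (\<lambda>w. 2 * \<eta>\<^sup>2 * (norm (w (t (m k)) - w 0))\<^sup>2 + 2 * (supn T \<sigma>)\<^sup>2 * (norm (w (t k) - w (t (m k))))\<^sup>2)"
    proof (rule integral_mono')
      show "integrable W (\<lambda>w. 2 * \<eta>\<^sup>2 * (norm (w (t (m k)) - w 0))\<^sup>2 + 2 * (supn T \<sigma>)\<^sup>2 * (norm (w (t k) - w (t (m k))))\<^sup>2)"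
        using i1 i2 by simp
      fix w assume "w \<in> space W"
      then have w0: "w 0 = 0" by (simp add: space_W Wsp_0)
      have "V k w = (\<sigma> (t k) - \<sigma> (t (m k))) *v w (t (m k)) + \<sigma> (t k) *v (w (t k) - w (t (m k)))"
        by (simp add: V_def matrix_vector_mult_diff_distrib bounded_bilinear.diff_left[OF bounded_bilinear_matrix_vector_mult])
      then have "(norm (V k w))\<^sup>2 \<le> 2 * (norm ((\<sigma> (t k) - \<sigma> (t (m k))) *v w (t (m k))))\<^sup>2 + 2 * (norm (\<sigma> (t k) *v (w (t k) - w (t (m k)))))\<^sup>2"
        using power2_norm_add_le by metis
      also have "\<dots> \<le> 2 * (\<eta> * norm (w (t (m k))))\<^sup>2 + 2 * (supn T \<sigma> * norm (w (t k) - w (t (m k))))\<^sup>2"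
      proof (intro add_mono mult_left_mono power_mono)
        show "norm ((\<sigma> (t k) - \<sigma> (t (m k))) *v w (t (m k))) \<le> \<eta> * norm (w (t (m k)))"
          by (rule order_trans[OF norm_matrix_vector_mult_le mult_right_mono]) (use mod[OF tk(2,1)] gap le in auto)
        show "norm (\<sigma> (t k) *v (w (t k) - w (t (m k)))) \<le> supn T \<sigma> * norm (w (t k) - w (t (m k)))"
          by (rule order_trans[OF norm_matrix_vector_mult_le mult_right_mono]) (use norm_le_supn[OF c tk(1)] in auto)
      qed auto
      finally show "(norm (V k w))\<^sup>2 \<le> 2 * \<eta>\<^sup>2 * (norm (w (t (m k)) - w 0))\<^sup>2 + 2 * (supn T \<sigma>)\<^sup>2 * (norm (w (t k) - w (t (m k))))\<^sup>2"
        by (simp add: w0 power_mult_distrib)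
    qed auto
    also have "\<dots> = 2 * \<eta>\<^sup>2 * (real CARD('d) * t (m k)) + 2 * (supn T \<sigma>)\<^sup>2 * (real CARD('d) * (t k - t (m k)))"
      using i1 i2 by simp
    also have "\<dots> \<le> ?K" using st(2) gap by (intro add_mono mult_left_mono) auto
    finally show ?thesis .
  qed
  show "integrable W (\<lambda>w. (ito_sum T \<sigma> (n * p) w - ito_sum T \<sigma> n w)\<^sup>2)"
    unfolding diff V_def t_def by (rule ito_remainder_square_le(1)[OF N mk K[unfolded V_def t_def]])
  show "expectation (\<lambda>w. (ito_sum T \<sigma> (n * p) w - ito_sum T \<sigma> n w)\<^sup>2)
      \<le> T * real CARD('d) * (2 * \<eta>\<^sup>2 * (real CARD('d) * T) + 2 * (supn T \<sigma>)\<^sup>2 * (real CARD('d) * (T / real n)))"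
    unfolding diff V_def t_def by (rule ito_remainder_square_le(2)[OF N mk K[unfolded V_def t_def]])
qed

text \<open>Uniform grids with n and m steps need not be nested, so both sums are compared with the
  one on the common refinement of n m steps.\<close>

theorem ito_sum_limit:
  fixes \<sigma> :: "real \<Rightarrow> real^'d^'d"
  assumes c: "continuous_on {0..T} \<sigma>"
  shows "\<exists>Y. integrable W Y \<and> (\<lambda>n. expectation (\<lambda>w. \<bar>ito_sum T \<sigma> n w - Y w\<bar>)) \<longlonglongrightarrow> 0"
proof (rule L1_complete)
  show "integrable W (ito_sum T \<sigma> n)" for n
    by (rule expectation_abs_le_sqrt(1)[OF ito_sum_measurable ito_sum_square_integrable])
  fix e :: real assume e: "0 < e"
  define d where "d = real CARD('d)"
  have d: "0 < d" by (simp add: d_def)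
  define b where "b = (e / 2)\<^sup>2"
  have b: "0 < b" using e by (simp add: b_def)
  \<comment> \<open>Makes the first part of the variance bound equal to b/2; the second part falls
    below b/2 for large n. Here b = (e/2)^2, so the mean distance is at most e/2.\<close>
  define \<eta> where "\<eta> = sqrt (b / (4 * T * d * (d * T)))"
  have \<eta>: "0 < \<eta>" using b T d by (simp add: \<eta>_def)
  have \<eta>2: "T * d * (2 * \<eta>\<^sup>2 * (d * T)) = b / 2" using b T d by (simp add: \<eta>_def)
  have "(\<lambda>n. T * d * (2 * (supn T \<sigma>)\<^sup>2 * (d * (T / real n)))) \<longlonglongrightarrow> T * d * (2 * (supn T \<sigma>)\<^sup>2 * (d * 0))"
    by (intro tendsto_mult tendsto_const lim_const_over_n)
  then have "\<forall>\<^sub>F n in sequentially. T * d * (2 * (supn T \<sigma>)\<^sup>2 * (d * (T / real n))) < b / 2"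
    using b by (intro order_tendstoD) auto
  from eventually_conj[OF this eventually_conj[OF continuous_modulus[OF c \<eta>] eventually_gt_at_top[of 0]]]
  obtain N where N: "\<And>n. n \<ge> N \<Longrightarrow> T * d * (2 * (supn T \<sigma>)\<^sup>2 * (d * (T / real n))) < b / 2"
    "\<And>n s t. n \<ge> N \<Longrightarrow> s\<in>{0..T} \<Longrightarrow> t\<in>{0..T} \<Longrightarrow> \<bar>t - s\<bar> \<le> T / real n \<Longrightarrow> norm (\<sigma> t - \<sigma> s) < \<eta>" "\<And>n. n \<ge> N \<Longrightarrow> 0 < n"
    unfolding eventually_sequentially by blast
  have close: "expectation (\<lambda>w. \<bar>ito_sum T \<sigma> (n * p) w - ito_sum T \<sigma> n w\<bar>) \<le> e / 2"
    "integrable W (\<lambda>w. ito_sum T \<sigma> (n * p) w - ito_sum T \<sigma> n w)" if n: "n \<ge> N" and p: "0 < p" for n p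
  proof -
    have mod: "norm (\<sigma> t - \<sigma> s) \<le> \<eta>" if "s \<in> {0..T}" "t \<in> {0..T}" "\<bar>t - s\<bar> \<le> T / real n" for s t
      using N(2)[OF n that] by simp
    note r = ito_sum_refine_close[OF c N(3)[OF n] p less_imp_le[OF \<eta>] mod]
    have m: "(\<lambda>w. ito_sum T \<sigma> (n * p) w - ito_sum T \<sigma> n w) \<in> borel_measurable W"
      by (intro borel_measurable_diff ito_sum_measurable)
    show "integrable W (\<lambda>w. ito_sum T \<sigma> (n * p) w - ito_sum T \<sigma> n w)" by (rule expectation_abs_le_sqrt(1)[OF m r(1)])
    have "expectation (\<lambda>w. \<bar>ito_sum T \<sigma> (n * p) w - ito_sum T \<sigma> n w\<bar>) \<le> sqrt (expectation (\<lambda>w. (ito_sum T \<sigma> (n * p) w - ito_sum T \<sigma> n w)\<^sup>2))"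
      by (rule expectation_abs_le_sqrt(2)[OF m r(1)])
    also have "\<dots> \<le> sqrt b"
    proof (rule real_sqrt_le_mono)
      show "expectation (\<lambda>w. (ito_sum T \<sigma> (n * p) w - ito_sum T \<sigma> n w)\<^sup>2) \<le> b"
        using r(2) N(1)[OF n] \<eta>2 unfolding d_def[symmetric] distrib_left by linarith
    qed
    also have "\<dots> = e / 2" using e by (simp add: b_def)
    finally show "expectation (\<lambda>w. \<bar>ito_sum T \<sigma> (n * p) w - ito_sum T \<sigma> n w\<bar>) \<le> e / 2" .
  qed
  show "\<exists>N. \<forall>n\<ge>N. \<forall>m\<ge>N. expectation (\<lambda>w. \<bar>ito_sum T \<sigma> n w - ito_sum T \<sigma> m w\<bar>) \<le> e"
  proof (intro exI allI impI)
    fix n m assume nm: "N \<le> n" "N \<le> m"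
    have "expectation (\<lambda>w. \<bar>ito_sum T \<sigma> n w - ito_sum T \<sigma> m w\<bar>)
      \<le> expectation (\<lambda>w. \<bar>ito_sum T \<sigma> (n * m) w - ito_sum T \<sigma> n w\<bar> + \<bar>ito_sum T \<sigma> (m * n) w - ito_sum T \<sigma> m w\<bar>)"
      using close(2)[OF nm(1) N(3)[OF nm(2)]] close(2)[OF nm(2) N(3)[OF nm(1)]]
      by (intro integral_mono') (auto simp: mult.commute[of m n])
    also have "\<dots> \<le> e / 2 + e / 2"
      using close[OF nm(1) N(3)[OF nm(2)]] close[OF nm(2) N(3)[OF nm(1)]]
      by (subst Bochner_Integration.integral_add) auto
    finally show "expectation (\<lambda>w. \<bar>ito_sum T \<sigma> n w - ito_sum T \<sigma> m w\<bar>) \<le> e" by simp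
  qed
qed

section \<open>Quadratic variation and identification of the stochastic integral\<close>

lemma incr_quadratic_mean:
  assumes k: "k < n"
  shows "integrable W (\<lambda>w. (A *v incr T n w k) \<bullet> incr T n w k)"
    "expectation (\<lambda>w. (A *v incr T n w k) \<bullet> incr T n w k) = T / real n * trace A"
proof -
  define X :: "(real \<Rightarrow> real^'d) \<Rightarrow> real^'d" where "X = (\<lambda>w. incr T n w k)"
  have m2: "integrable W (\<lambda>w. (u \<bullet> X w)\<^sup>2)" "expectation (\<lambda>w. (u \<bullet> X w)\<^sup>2) = T / real n * (u \<bullet> u)" for u
    using increment_moments(1)[OF grid_step(1-3)[OF k], of u 2] increment_moments(3)[OF grid_step(1-3)[OF k], of u]
    unfolding grid_step(4)[OF k] by (auto simp: X_def incr_def)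
  \<comment> \<open>Polarisation reduces mixed moments to the known variances in the directions of
    sums and differences of basis vectors.\<close>
  have pol: "X w $ i * X w $ j = (1/4) * ((axis i 1 + axis j 1) \<bullet> X w)\<^sup>2 - (1/4) * ((axis i 1 - axis j 1) \<bullet> X w)\<^sup>2" for w i j
    by (simp add: inner_add_left inner_diff_left inner_axis' power2_eq_square algebra_simps)
  have ij: "integrable W (\<lambda>w. X w $ i * X w $ j)" "expectation (\<lambda>w. X w $ i * X w $ j) = (if i = j then T / real n else 0)" for i j
  proof -
    show "integrable W (\<lambda>w. X w $ i * X w $ j)" unfolding pol using m2 by auto
    have "expectation (\<lambda>w. X w $ i * X w $ j) = (1/4) * (T / real n * ((axis i 1 + axis j 1) \<bullet> (axis i 1 + axis j (1::real))))
        - (1/4) * (T / real n * ((axis i 1 - axis j 1) \<bullet> (axis i 1 - axis j (1::real))))"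
      unfolding pol using m2 by simp
    also have "\<dots> = (if i = j then T / real n else 0)"
      by (simp add: inner_add_left inner_add_right inner_diff_left inner_diff_right inner_axis_axis)
    finally show "expectation (\<lambda>w. X w $ i * X w $ j) = (if i = j then T / real n else 0)" .
  qed
  have q: "(A *v X w) \<bullet> X w = (\<Sum>i\<in>UNIV. \<Sum>j\<in>UNIV. A $ i $ j * (X w $ i * X w $ j))" for w
    by (simp add: inner_vec_def matrix_vector_mult_def sum_distrib_right sum_distrib_left mult_ac)
  have i: "integrable W (\<lambda>w. (A *v X w) \<bullet> X w)" unfolding q using ij by auto
  then show "integrable W (\<lambda>w. (A *v incr T n w k) \<bullet> incr T n w k)" by (simp add: X_def)
  have "expectation (\<lambda>w. (A *v X w) \<bullet> X w) = (\<Sum>i\<in>UNIV. \<Sum>j\<in>UNIV. A $ i $ j * (if i = j then T / real n else 0))"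
    unfolding q using ij by (simp add: Bochner_Integration.integral_sum)
  also have "\<dots> = T / real n * trace A"
    by (simp add: trace_def sum_distrib_left if_distrib mult.commute cong: if_cong)
  finally show "expectation (\<lambda>w. (A *v incr T n w k) \<bullet> incr T n w k) = T / real n * trace A" by (simp add: X_def)
qed

text \<open>The centred terms D are orthogonal with second moment of order h^2, so their sum has
  variance of order 1/n. The subtracted means form a Riemann sum for the integral of tr S.\<close>

theorem quadratic_variation_limit:
  fixes S :: "real \<Rightarrow> real^'d^'d"
  assumes S: "continuous_on {0..T} S"
  shows "\<And>n. integrable W (\<lambda>w. \<Sum>k<n. (S (real k * T / real n) *v incr T n w k) \<bullet> incr T n w k)"
    "(\<lambda>n. expectation (\<lambda>w. \<bar>(\<Sum>k<n. (S (real k * T / real n) *v incr T n w k) \<bullet> incr T n w k) - integral {0..T} (\<lambda>t. trace (S t))\<bar>)) \<longlonglongrightarrow> 0"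
proof -
  define d where "d = real CARD('d)"
  define tr where "tr = (\<lambda>t. trace (S t))"
  have ct: "continuous_on {0..T} tr" unfolding tr_def by (intro continuous_intros S)
  define Q where "Q = (\<lambda>n w. \<Sum>k<n. (S (real k * T / real n) *v incr T n w k) \<bullet> incr T n w k)"
  define R where "R = (\<lambda>n. \<Sum>k<n. (T / real n) *\<^sub>R tr (real k * T / real n))"
  \<comment> \<open>From (a - b)^2 \<le> 2 a^2 + 2 b^2 and the bound 3 d^2 h^2 for the fourth moment
    of an increment.\<close>
  define C where "C = 2 * ((supn T S)\<^sup>2 * (3 * d\<^sup>2)) + 2 * (supn T tr)\<^sup>2"
  define D where "D = (\<lambda>n k w. (S (real k * T / real n) *v incr T n w k) \<bullet> incr T n w k - T / real n * tr (real k * T / real n))"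
  have Qi: "integrable W (Q n)" for n
    unfolding Q_def by (intro Bochner_Integration.integrable_sum incr_quadratic_mean(1)) simp
  then show "integrable W (\<lambda>w. \<Sum>k<n. (S (real k * T / real n) *v incr T n w k) \<bullet> incr T n w k)" for n by (simp add: Q_def)
  have Q2: "integrable W (\<lambda>w. (Q n w - R n)\<^sup>2) \<and> expectation (\<lambda>w. (Q n w - R n)\<^sup>2) \<le> T\<^sup>2 * C / real n" if n: "0 < n" for n
  proof -
    define h where "h = T / real n"
    have im [measurable]: "(\<lambda>w. incr T n w k) \<in> borel_measurable W" if "k < n" for k by (rule incr_measurable[OF that])
    have Dm: "D n k \<in> borel_measurable W" if k: "k < n" for k
      unfolding D_def using im[OF k] by measurable
    have Db: "integrable W (\<lambda>w. (D n k w)\<^sup>2)" "expectation (\<lambda>w. (D n k w)\<^sup>2) \<le> h\<^sup>2 * C" if k: "k < n" for k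
    proof -
      have tk: "real k * T / real n \<in> {0..T}" using k by (intro grid) simp
      have le: "(D n k w)\<^sup>2 \<le> 2 * ((supn T S)\<^sup>2 * (norm (incr T n w k)) ^ 4) + 2 * (h\<^sup>2 * (supn T tr)\<^sup>2)" for w
      proof -
        define X where "X = incr T n w k"
        have "\<bar>(S (real k * T / real n) *v X) \<bullet> X\<bar> \<le> norm (S (real k * T / real n) *v X) * norm X" by (rule Cauchy_Schwarz_ineq2)
        also have "\<dots> \<le> (supn T S * norm X) * norm X"
          by (intro mult_right_mono order_trans[OF norm_matrix_vector_mult_le] norm_le_supn[OF S tk]) auto
        finally have "\<bar>(S (real k * T / real n) *v X) \<bullet> X\<bar> \<le> supn T S * (norm X)\<^sup>2" by (simp add: power2_eq_square)
        then have "((S (real k * T / real n) *v X) \<bullet> X)\<^sup>2 \<le> (supn T S * (norm X)\<^sup>2)\<^sup>2"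
          by (metis abs_ge_zero power2_abs power_mono)
        also have "\<dots> = (supn T S)\<^sup>2 * (norm X) ^ 4" by (simp add: power_mult_distrib power_mult[symmetric])
        finally have 1: "((S (real k * T / real n) *v X) \<bullet> X)\<^sup>2 \<le> (supn T S)\<^sup>2 * (norm X) ^ 4" .
        have "(tr (real k * T / real n))\<^sup>2 \<le> (supn T tr)\<^sup>2"
          using norm_le_supn[OF ct tk] by (metis abs_ge_zero power2_abs power_mono real_norm_def)
        then have 2: "(h * tr (real k * T / real n))\<^sup>2 \<le> h\<^sup>2 * (supn T tr)\<^sup>2"
          by (simp add: power_mult_distrib mult_left_mono)
        have "(D n k w)\<^sup>2 \<le> 2 * ((S (real k * T / real n) *v X) \<bullet> X)\<^sup>2 + 2 * (h * tr (real k * T / real n))\<^sup>2"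
        proof -
          have "(a - b)\<^sup>2 \<le> 2 * a\<^sup>2 + 2 * b\<^sup>2" for a b :: real
            using zero_le_power2[of "a + b"] by (simp add: power2_sum power2_diff)
          then show ?thesis unfolding D_def X_def h_def .
        qed
        then show ?thesis using 1 2 unfolding X_def by linarith
      qed
      have bi: "integrable W (\<lambda>w. 2 * ((supn T S)\<^sup>2 * (norm (incr T n w k)) ^ 4) + 2 * (h\<^sup>2 * (supn T tr)\<^sup>2))"
        using incr_norm4(1)[OF k] by simp
      show "integrable W (\<lambda>w. (D n k w)\<^sup>2)"
        by (rule Bochner_Integration.integrable_bound[OF bi]) (use Dm[OF k] le in \<open>auto intro!: AE_I2 order_trans[OF le abs_ge_self]\<close>)
      then have "expectation (\<lambda>w. (D n k w)\<^sup>2) \<le> expectation (\<lambda>w. 2 * ((supn T S)\<^sup>2 * (norm (incr T n w k)) ^ 4) + 2 * (h\<^sup>2 * (supn T tr)\<^sup>2))"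
        by (intro integral_mono bi le)
      also have "\<dots> = 2 * ((supn T S)\<^sup>2 * expectation (\<lambda>w. (norm (incr T n w k)) ^ 4)) + 2 * (h\<^sup>2 * (supn T tr)\<^sup>2)"
        using incr_norm4(1)[OF k] by (simp add: prob_space)
      also have "\<dots> \<le> 2 * ((supn T S)\<^sup>2 * (3 * d\<^sup>2 * h\<^sup>2)) + 2 * (h\<^sup>2 * (supn T tr)\<^sup>2)"
        using incr_norm4(2)[OF k] by (intro add_mono mult_left_mono) (auto simp: d_def h_def)
      also have "\<dots> = h\<^sup>2 * C" by (simp add: C_def algebra_simps)
      finally show "expectation (\<lambda>w. (D n k w)\<^sup>2) \<le> h\<^sup>2 * C" .
    qed
    have D0: "expectation (D n k) = 0" "integrable W (D n k)" if k: "k < n" for k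
      unfolding D_def using incr_quadratic_mean[OF k] by (auto simp: tr_def prob_space)
    have orth: "expectation (\<lambda>w. D n j w * D n k w) = 0" if jk: "j < k" "k < n" for j k
    proof -
      have j: "j < n" using jk by simp
      define q where "q = (\<lambda>l x. (S (real l * T / real n) *v x) \<bullet> x - T / real n * tr (real l * T / real n))"
      have qm: "q l \<in> borel_measurable borel" for l unfolding q_def by measurable
      have "expectation (\<lambda>w. D n j w * q k (incr T n w k)) = expectation (D n j) * expectation (\<lambda>w. q k (incr T n w k))"
      proof (rule incr_indep_past(2)[OF jk(2) _ qm])
        show "(\<lambda>\<zeta>. q j (\<zeta> j)) \<in> borel_measurable (PiM {..<k} (\<lambda>_. borel))"
          using jk by (intro measurable_compose[OF PiM_component_measurable qm])
        show "D n j w = q j (restrict (incr T n w) {..<k} j)" for w using jk by (simp add: D_def q_def)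
        show "integrable W (D n j)" by (rule D0(2)[OF j])
        show "integrable W (\<lambda>w. q k (incr T n w k))" using D0(2)[OF jk(2)] by (simp add: D_def q_def)
      qed
      then show ?thesis using D0(1)[OF j] by (simp add: D_def q_def)
    qed
    have eq: "Q n w - R n = (\<Sum>k<n. D n k w)" for w by (simp add: Q_def R_def D_def sum_subtractf)
    have "expectation (\<lambda>w. (Q n w - R n)\<^sup>2) = (\<Sum>k<n. expectation (\<lambda>w. (D n k w)\<^sup>2))"
      unfolding eq by (rule orthogonal_sum_square[OF Dm Db(1) orth])
    also have "\<dots> \<le> (\<Sum>k<n. h\<^sup>2 * C)" by (intro sum_mono Db(2)) simp
    also have "\<dots> = T\<^sup>2 * C / real n" using n by (simp add: h_def power2_eq_square)
    finally show ?thesis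
      unfolding eq using integrable_square_sum[of "{..<n}" "D n" W] Dm Db(1) by auto
  qed
  have "(\<lambda>n. sqrt (T\<^sup>2 * C / real n) + \<bar>R n - integral {0..T} tr\<bar>) \<longlonglongrightarrow> sqrt 0 + \<bar>integral {0..T} tr - integral {0..T} tr\<bar>"
    unfolding R_def by (intro tendsto_add tendsto_real_sqrt tendsto_rabs tendsto_diff tendsto_const riemann_sum_tendsto[OF T ct] lim_const_over_n)
  then have lim: "(\<lambda>n. sqrt (T\<^sup>2 * C / real n) + \<bar>R n - integral {0..T} tr\<bar>) \<longlonglongrightarrow> 0" by simp
  have "(\<lambda>n. expectation (\<lambda>w. \<bar>Q n w - integral {0..T} tr\<bar>)) \<longlonglongrightarrow> 0"
  proof (rule tendsto_sandwich[OF _ _ tendsto_const lim])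
    show "\<forall>\<^sub>F n in sequentially. expectation (\<lambda>w. \<bar>Q n w - integral {0..T} tr\<bar>) \<le> sqrt (T\<^sup>2 * C / real n) + \<bar>R n - integral {0..T} tr\<bar>"
      using eventually_gt_at_top[of 0]
    proof eventually_elim
      case (elim n)
      have m: "(\<lambda>w. Q n w - R n) \<in> borel_measurable W" using Qi[of n] by auto
      have "expectation (\<lambda>w. \<bar>Q n w - integral {0..T} tr\<bar>) \<le> expectation (\<lambda>w. \<bar>Q n w - R n\<bar> + \<bar>R n - integral {0..T} tr\<bar>)"
        using Qi[of n] by (intro integral_mono) auto
      also have "\<dots> = expectation (\<lambda>w. \<bar>Q n w - R n\<bar>) + \<bar>R n - integral {0..T} tr\<bar>"
        using Qi[of n] by (simp add: prob_space)
      also have "expectation (\<lambda>w. \<bar>Q n w - R n\<bar>) \<le> sqrt (expectation (\<lambda>w. (Q n w - R n)\<^sup>2))"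
        by (rule expectation_abs_le_sqrt(2)[OF m]) (use Q2[OF elim] in simp)
      also have "\<dots> \<le> sqrt (T\<^sup>2 * C / real n)" using Q2[OF elim] by (intro real_sqrt_le_mono) simp
      finally show ?case by simp
    qed
  qed simp
  then show "(\<lambda>n. expectation (\<lambda>w. \<bar>(\<Sum>k<n. (S (real k * T / real n) *v incr T n w k) \<bullet> incr T n w k) - integral {0..T} (\<lambda>t. trace (S t))\<bar>)) \<longlonglongrightarrow> 0"
    unfolding Q_def tr_def .
qed

lemma L1_imp_prob:
  assumes X: "\<And>n. integrable W (X n)" and Y: "integrable W Y"
    and lim: "(\<lambda>n. expectation (\<lambda>w. \<bar>X n w - Y w\<bar>)) \<longlonglongrightarrow> (0::real)" and e: "0 < e"
  shows "(\<lambda>n. measure W {w \<in> space W. \<bar>X n w - Y w\<bar> > e}) \<longlonglongrightarrow> 0"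
proof (rule tendsto_sandwich[OF _ _ tendsto_const])
  show "(\<lambda>n. expectation (\<lambda>w. \<bar>X n w - Y w\<bar>) / e) \<longlonglongrightarrow> 0" using tendsto_divide[OF lim tendsto_const, of e] e by simp
  show "\<forall>\<^sub>F n in sequentially. measure W {w \<in> space W. \<bar>X n w - Y w\<bar> > e} \<le> expectation (\<lambda>w. \<bar>X n w - Y w\<bar>) / e"
  proof (intro always_eventually allI)
    fix n
    have [measurable]: "X n \<in> borel_measurable W" "Y \<in> borel_measurable W" using X Y by auto
    have "measure W {w \<in> space W. \<bar>X n w - Y w\<bar> > e} \<le> measure W {w \<in> space W. \<bar>X n w - Y w\<bar> \<ge> e}"
      by (intro finite_measure_mono) auto
    also have "\<dots> \<le> expectation (\<lambda>w. \<bar>X n w - Y w\<bar>) / e"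
      using X Y e by (intro integral_Markov_inequality_measure[where A = "{}"]) auto
    finally show "measure W {w \<in> space W. \<bar>X n w - Y w\<bar> > e} \<le> expectation (\<lambda>w. \<bar>X n w - Y w\<bar>) / e" .
  qed
qed simp

end

text \<open>\<open>ito_p\<close> is an arbitrary choice among limits in probability. The L1 limit Y
  is one of them, so the choice is meaningful, and two such limits agree almost everywhere; Y may
  therefore stand in for it.\<close>

theorem ito_p_limit:
  fixes \<sigma> :: "real \<Rightarrow> real^'d^'d"
  assumes T: "0 < T" and c: "continuous_on {0..T} \<sigma>"
  shows "\<exists>Y. integrable (wiener T) Y \<and> (\<lambda>n. integral\<^sup>L (wiener T) (\<lambda>w. \<bar>ito_sum T \<sigma> n w - Y w\<bar>)) \<longlonglongrightarrow> 0
     \<and> (AE w in wiener T. ito_p T \<sigma> w = Y w) \<and> ito_p T \<sigma> \<in> borel_measurable (wiener T)"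
proof -
  interpret brownian T "wiener T :: (real \<Rightarrow> real^'d) measure"
    by unfold_locales (use T wiener_is_wiener in auto)
  obtain Y where Y: "integrable (wiener T) Y" "(\<lambda>n. expectation (\<lambda>w. \<bar>ito_sum T \<sigma> n w - Y w\<bar>)) \<longlonglongrightarrow> 0"
    using ito_sum_limit[OF c] by blast
  have Ii: "integrable (wiener T) (ito_sum T \<sigma> n)" for n
    by (rule expectation_abs_le_sqrt(1)[OF ito_sum_measurable ito_sum_square_integrable])
  define P where "P = (\<lambda>p. p \<in> borel_measurable (wiener T) \<and>
      (\<forall>e>0. (\<lambda>n. measure (wiener T) {w \<in> space (wiener T). \<bar>ito_sum T \<sigma> n w - p w\<bar> > e}) \<longlonglongrightarrow> 0))"
  have PY: "P Y" using Y L1_imp_prob[OF Ii Y] by (auto simp: P_def)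
  have PD: "(\<lambda>n. measure (wiener T) {w \<in> space (wiener T). \<bar>ito_sum T \<sigma> n w - q w\<bar> > e}) \<longlonglongrightarrow> 0"
    if "P q" "0 < e" for q e using that unfolding P_def by blast
  define p where "p = ito_p T \<sigma>"
  have Pp: "P p" unfolding p_def ito_p_def P_def[symmetric] by (rule someI[of P, OF PY])
  have [measurable]: "p \<in> borel_measurable (wiener T)" "Y \<in> borel_measurable (wiener T)" "ito_sum T \<sigma> n \<in> borel_measurable (wiener T)" for n
    using Pp PY ito_sum_measurable by (auto simp: P_def)
  have z: "measure (wiener T) {w \<in> space (wiener T). \<bar>p w - Y w\<bar> > e} = 0" if e: "0 < e" for e
  proof -
    have "(\<lambda>n. measure (wiener T) {w \<in> space (wiener T). \<bar>ito_sum T \<sigma> n w - p w\<bar> > e / 2}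
        + measure (wiener T) {w \<in> space (wiener T). \<bar>ito_sum T \<sigma> n w - Y w\<bar> > e / 2}) \<longlonglongrightarrow> 0 + 0"
      using e by (intro tendsto_add PD[OF Pp] PD[OF PY]) auto
    moreover have "measure (wiener T) {w \<in> space (wiener T). \<bar>p w - Y w\<bar> > e}
      \<le> measure (wiener T) {w \<in> space (wiener T). \<bar>ito_sum T \<sigma> n w - p w\<bar> > e / 2}
        + measure (wiener T) {w \<in> space (wiener T). \<bar>ito_sum T \<sigma> n w - Y w\<bar> > e / 2}" for n
    proof -
      have "measure (wiener T) {w \<in> space (wiener T). \<bar>p w - Y w\<bar> > e}
        \<le> measure (wiener T) ({w \<in> space (wiener T). \<bar>ito_sum T \<sigma> n w - p w\<bar> > e / 2} \<union> {w \<in> space (wiener T). \<bar>ito_sum T \<sigma> n w - Y w\<bar> > e / 2})"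
      proof (rule finite_measure_mono)
        show "{w \<in> space (wiener T). \<bar>p w - Y w\<bar> > e} \<subseteq> {w \<in> space (wiener T). \<bar>ito_sum T \<sigma> n w - p w\<bar> > e / 2}
            \<union> {w \<in> space (wiener T). \<bar>ito_sum T \<sigma> n w - Y w\<bar> > e / 2}"
        proof
          fix w assume "w \<in> {w \<in> space (wiener T). \<bar>p w - Y w\<bar> > e}"
          then have "w \<in> space (wiener T)" "\<bar>ito_sum T \<sigma> n w - p w\<bar> > e / 2 \<or> \<bar>ito_sum T \<sigma> n w - Y w\<bar> > e / 2"
            by (simp, simp only: mem_Collect_eq, linarith)
          then show "w \<in> {w \<in> space (wiener T). \<bar>ito_sum T \<sigma> n w - p w\<bar> > e / 2} \<union> {w \<in> space (wiener T). \<bar>ito_sum T \<sigma> n w - Y w\<bar> > e / 2}" by blast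
        qed
      qed measurable
      also have "\<dots> \<le> measure (wiener T) {w \<in> space (wiener T). \<bar>ito_sum T \<sigma> n w - p w\<bar> > e / 2}
        + measure (wiener T) {w \<in> space (wiener T). \<bar>ito_sum T \<sigma> n w - Y w\<bar> > e / 2}"
        by (intro measure_Un_le) auto
      finally show ?thesis .
    qed
    ultimately have "measure (wiener T) {w \<in> space (wiener T). \<bar>p w - Y w\<bar> > e} \<le> 0 + 0"
      by (intro LIMSEQ_le_const) auto
    then show ?thesis using measure_nonneg[of "wiener T"] by (simp add: order_antisym)
  qed
  have "AE w in wiener T. \<forall>k. \<not> \<bar>p w - Y w\<bar> > 1 / real (Suc k)"
    unfolding AE_all_countable
  proof
    fix k
    have "{w \<in> space (wiener T). \<bar>p w - Y w\<bar> > 1 / real (Suc k)} \<in> null_sets (wiener T)"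
      using z[of "1 / real (Suc k)"] by (intro null_setsI) (auto simp: emeasure_eq_measure)
    then show "AE w in wiener T. \<not> \<bar>p w - Y w\<bar> > 1 / real (Suc k)"
      by (rule AE_I') auto
  qed
  then have "AE w in wiener T. p w = Y w"
  proof eventually_elim
    case (elim w)
    show ?case
    proof (rule ccontr)
      assume "p w \<noteq> Y w"
      then obtain k where "1 / real (Suc k) < \<bar>p w - Y w\<bar>" using nat_approx_posE[of "\<bar>p w - Y w\<bar>"] by auto
      with elim show False by blast
    qed
  qed
  then show ?thesis using Y Pp by (intro exI[of _ Y]) (auto simp: p_def P_def)
qed

section \<open>Passage to the limit\<close>

lemma pwl_cong: "(\<And>k. k \<le> n \<Longrightarrow> x k = y k) \<Longrightarrow> pwl T n x = pwl T n y"
  by (auto simp: pwl_def fun_eq_iff intro!: sum.cong)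

lemma pwl_node:
  assumes T: "0 < T" and n: "0 < n" and k: "k \<le> n"
  shows "pwl T n x (real k * T / real n) = x k"
proof -
  have "norm (pwl T n x (real k * T / real n) - x k) \<le> 0"
  proof (rule norm_pwl_diff_le[OF T n])
    show "real k * T / real n \<in> {0..T}" using T k by (intro grid_mem) auto
    fix j assume "\<bar>real k * T / real n - real j * T / real n\<bar> < T / real n"
    moreover have "real k * T / real n - real j * T / real n = (real k - real j) * (T / real n)"
      by (simp add: algebra_simps diff_divide_distrib)
    ultimately have "\<bar>real k - real j\<bar> * (T / real n) < 1 * (T / real n)" using T n by (simp add: abs_mult)
    then have "\<bar>real k - real j\<bar> < 1" using T n by (subst (asm) mult_less_cancel_right_pos) auto
    then have "j = k" by linarith
    then show "norm (x j - x k) \<le> 0" by simp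
  qed
  then show ?thesis by simp
qed

text \<open>Uniform integrability by truncation: for X \<ge> 0 one has X - min(X,a) \<le> X^2/a, so
  truncating costs at most K/a uniformly in n. Fatou's lemma passes the second-moment bound to the
  limit.\<close>

lemma (in prob_space) expectation_limit_of_L2_bounded:
  fixes Y :: "nat \<Rightarrow> 'a \<Rightarrow> real"
  assumes m: "\<And>n. Y n \<in> borel_measurable M" "Z \<in> borel_measurable M" and nn: "\<And>n x. 0 \<le> Y n x"
    and lim: "AE x in M. (\<lambda>n. Y n x) \<longlonglongrightarrow> Z x" and K: "\<And>n. (\<integral>\<^sup>+x. ennreal ((Y n x)\<^sup>2) \<partial>M) \<le> ennreal K" and K0: "0 \<le> K"
  shows "integrable M Z" "(\<lambda>n. expectation (Y n)) \<longlonglongrightarrow> expectation Z"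
proof -
  note [measurable] = m
  have Z0: "AE x in M. 0 \<le> Z x" using lim by eventually_elim (rule LIMSEQ_le_const, auto intro: nn)
  have "(\<integral>\<^sup>+x. ennreal ((Z x)\<^sup>2) \<partial>M) = (\<integral>\<^sup>+x. liminf (\<lambda>n. ennreal ((Y n x)\<^sup>2)) \<partial>M)"
  proof (rule nn_integral_cong_AE, use lim in eventually_elim)
    case (elim x)
    then have "(\<lambda>n. ennreal ((Y n x)\<^sup>2)) \<longlonglongrightarrow> ennreal ((Z x)\<^sup>2)" by (intro tendsto_ennrealI tendsto_power)
    then show ?case by (intro lim_imp_Liminf[symmetric]) auto
  qed
  also have "\<dots> \<le> liminf (\<lambda>n. \<integral>\<^sup>+x. ennreal ((Y n x)\<^sup>2) \<partial>M)" by (rule nn_integral_liminf) measurable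
  also have "\<dots> \<le> limsup (\<lambda>n. \<integral>\<^sup>+x. ennreal ((Y n x)\<^sup>2) \<partial>M)" by (rule Liminf_le_Limsup) simp
  also have "\<dots> \<le> ennreal K" by (rule Limsup_bounded) (simp add: K)
  finally have ZK: "(\<integral>\<^sup>+x. ennreal ((Z x)\<^sup>2) \<partial>M) \<le> ennreal K" .
  have sq: "integrable M (\<lambda>x. (X x)\<^sup>2) \<and> expectation (\<lambda>x. (X x)\<^sup>2) \<le> K"
    if [measurable]: "X \<in> borel_measurable M" and X: "(\<integral>\<^sup>+x. ennreal ((X x)\<^sup>2) \<partial>M) \<le> ennreal K" for X :: "'a \<Rightarrow> real"
  proof
    show i: "integrable M (\<lambda>x. (X x)\<^sup>2)"
      using X by (intro integrableI_bounded) (auto simp: le_less_trans)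
    have "ennreal (expectation (\<lambda>x. (X x)\<^sup>2)) \<le> ennreal K"
      using X by (subst nn_integral_eq_integral[OF i, symmetric]) auto
    then show "expectation (\<lambda>x. (X x)\<^sup>2) \<le> K" using K0 by simp
  qed
  have trunc: "\<bar>expectation X - expectation (\<lambda>x. min (X x) a)\<bar> \<le> K / a"
    if X [measurable]: "X \<in> borel_measurable M" and XK: "(\<integral>\<^sup>+x. ennreal ((X x)\<^sup>2) \<partial>M) \<le> ennreal K"
      and X0: "AE x in M. 0 \<le> X x" and a: "0 < a" for X :: "'a \<Rightarrow> real" and a
  proof -
    have s: "integrable M (\<lambda>x. (X x)\<^sup>2)" "expectation (\<lambda>x. (X x)\<^sup>2) \<le> K" using sq[OF X XK] by auto
    have i: "integrable M X" by (rule expectation_abs_le_sqrt(1)[OF X s(1)])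
    have i': "integrable M (\<lambda>x. min (X x) a)" using i by simp
    have b: "0 \<le> X x - min (X x) a" "X x - min (X x) a \<le> (X x)\<^sup>2 / a" if "0 \<le> X x" for x
    proof -
      show "0 \<le> X x - min (X x) a" by simp
      show "X x - min (X x) a \<le> (X x)\<^sup>2 / a"
      proof (cases "X x \<le> a")
        case True then show ?thesis using a by simp
      next
        case False
        then have "X x * a \<le> X x * X x" using that by (intro mult_left_mono) auto
        then have "X x \<le> (X x)\<^sup>2 / a" using a by (simp add: field_simps power2_eq_square)
        then show ?thesis using a False by simp
      qed
    qed
    have "0 \<le> expectation (\<lambda>x. X x - min (X x) a)" by (rule integral_nonneg_AE) (simp)
    moreover have "expectation (\<lambda>x. X x - min (X x) a) \<le> expectation (\<lambda>x. (X x)\<^sup>2 / a)"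
      using s i i' X0 b(2) by (intro integral_mono_AE) (auto elim!: eventually_mono)
    moreover have "expectation (\<lambda>x. (X x)\<^sup>2 / a) \<le> K / a" using s a by (simp add: divide_right_mono)
    ultimately show ?thesis using i i' by simp
  qed
  show "integrable M Z" using sq[OF m(2) ZK] by (intro expectation_abs_le_sqrt(1)[OF m(2)]) auto
  show "(\<lambda>n. expectation (Y n)) \<longlonglongrightarrow> expectation Z"
  proof (rule LIMSEQ_I)
    fix e :: real assume e: "0 < e"
    \<comment> \<open>Makes the truncation error less than e/3; K + 1 keeps the level positive when
      K = 0.\<close>
    define a where "a = 3 * (K + 1) / e"
    have a: "0 < a" using e K0 by (simp add: a_def)
    have Ka: "K / a < e / 3" using e K0 by (simp add: a_def field_simps)
    have "(\<lambda>n. expectation (\<lambda>x. min (Y n x) a)) \<longlonglongrightarrow> expectation (\<lambda>x. min (Z x) a)"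
    proof (rule integral_dominated_convergence[where w = "\<lambda>_. a"])
      show "AE x in M. (\<lambda>n. min (Y n x) a) \<longlonglongrightarrow> min (Z x) a"
        using lim by eventually_elim (intro tendsto_min tendsto_const)
      show "AE x in M. norm (min (Y n x) a) \<le> a" for n using nn a by (intro AE_I2) (simp add: min_def)
    qed auto
    then obtain N where N: "\<And>n. n \<ge> N \<Longrightarrow> \<bar>expectation (\<lambda>x. min (Y n x) a) - expectation (\<lambda>x. min (Z x) a)\<bar> < e / 3"
      using LIMSEQ_D[of _ _ "e/3"] e by (metis divide_pos_pos real_norm_def zero_less_numeral)
    have "norm (expectation (Y n) - expectation Z) < e" if "n \<ge> N" for n
    proof -
      have "\<bar>expectation (Y n) - expectation (\<lambda>x. min (Y n x) a)\<bar> \<le> K / a"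
        by (rule trunc[OF m(1) K _ a]) (simp add: nn)
      with N[OF that] trunc[OF m(2) ZK Z0 a] Ka show ?thesis unfolding real_norm_def by linarith
    qed
    then show "\<exists>no. \<forall>n\<ge>no. norm (expectation (Y n) - expectation Z) < e" by blast
  qed
qed

section \<open>Pathwise convergence of the Euler scheme\<close>

lemma euler_eq: "euler h c \<xi> k = psum \<xi> k + (\<Sum>j<k. h *\<^sub>R (c j *v euler h c \<xi> j))"
  by (induction k) (auto simp: psum_def)

text \<open>The same bound e propagates to every node: if it holds before node k, the error there is
  at most k h (|chi| e + \<eta>) \<le> T (|chi| e + \<eta>) = e. This is where the contraction
  condition on chi acts.\<close>

lemma euler_converges:
  fixes chi :: "real \<Rightarrow> real^'d^'d"
  assumes T: "0 < T" and chi: "continuous_on {0..T} chi" and q: "T * supn T chi < 1"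
    and w: "w \<in> Wsp T" and X: "X \<in> Wsp T" and eq: "\<And>t. X t + Fop T chi X t = w t" and e: "0 < e"
  shows "\<forall>\<^sub>F n in sequentially. \<forall>k\<le>n. norm (euler (T / real n) (\<lambda>k. chi (real k * T / real n)) (incr T n w) k - X (real k * T / real n)) \<le> e"
proof -
  \<comment> \<open>Solves T (|chi| e + \<eta>) = e; positive because T |chi| < 1.\<close>
  define \<eta> where "\<eta> = e * (1 - T * supn T chi) / T"
  have \<eta>: "0 < \<eta>" using e q T by (simp add: \<eta>_def)
  define Y where "Y = (\<lambda>s. chi s *v X s)"
  have cY: "continuous_on {0..T} Y" unfolding Y_def by (intro continuous_intros chi Wsp_cont[OF X])
  from eventually_conj[OF continuous_modulus[OF cY \<eta>] eventually_gt_at_top[of 0]] show ?thesis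
  proof eventually_elim
    case (elim n)
    define h where "h = T / real n"
    define c where "c = (\<lambda>k. chi (real k * T / real n))"
    define t where "t = (\<lambda>k. real k * T / real n)"
    define E where "E = euler h c (incr T n w)"
    have h: "0 < h" using T elim by (simp add: h_def)
    have "norm (E k - X (t k)) \<le> e" if "k \<le> n" for k
      using that
    proof (induction k rule: less_induct)
      case (less k)
      have tk: "t j \<in> {0..T}" if "j \<le> n" for j using T that unfolding t_def by (intro grid_mem) auto
      have Ek: "E k = w (t k) + (\<Sum>j<k. h *\<^sub>R (c j *v E j))"
        unfolding E_def by (subst euler_eq) (simp add: psum_incr Wsp_0[OF w] t_def)
      have Xk: "X (t k) = w (t k) + integral {0..t k} Y"
        using eq[of "t k"] tk[OF less.prems] by (simp add: Fop_def Y_def algebra_simps)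
      have cj: "c j *v X (t j) = Y (t j)" for j by (simp add: c_def Y_def t_def)
      have "E k - X (t k) = (\<Sum>j<k. h *\<^sub>R (c j *v (E j - X (t j)))) - (integral {0..t k} Y - (\<Sum>j<k. h *\<^sub>R Y (t j)))"
        unfolding Ek Xk by (simp add: matrix_vector_mult_diff_distrib cj scaleR_diff_right sum_subtractf)
      also have "norm \<dots> \<le> (\<Sum>j<k. h * (supn T chi * e)) + real k * h * \<eta>"
      proof (rule norm_triangle_le_diff, rule add_mono)
        show "norm (\<Sum>j<k. h *\<^sub>R (c j *v (E j - X (t j)))) \<le> (\<Sum>j<k. h * (supn T chi * e))"
        proof (rule sum_norm_le)
          fix j assume "j \<in> {..<k}"
          then have j: "j < k" "j \<le> n" using less.prems by auto
          have "norm (c j *v (E j - X (t j))) \<le> norm (c j) * norm (E j - X (t j))" by (rule norm_matrix_vector_mult_le)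
          also have "\<dots> \<le> supn T chi * e"
            using norm_le_supn[OF chi tk[OF j(2)]] less.IH[OF j] supn_nonneg[OF _ chi] T
            by (intro mult_mono) (auto simp: c_def t_def)
          finally show "norm (h *\<^sub>R (c j *v (E j - X (t j)))) \<le> h * (supn T chi * e)" using h by simp
        qed
        show "norm (integral {0..t k} Y - (\<Sum>j<k. h *\<^sub>R Y (t j))) \<le> real k * h * \<eta>"
          unfolding h_def t_def
          by (rule riemann_sum_error[OF T cY _ _ less.prems]) (use elim in \<open>auto simp: less_imp_le\<close>)
      qed
      also have "\<dots> = (real k * h) * (supn T chi * e + \<eta>)" by (simp add: algebra_simps)
      also have "\<dots> \<le> T * (supn T chi * e + \<eta>)"
      proof (rule mult_right_mono)
        show "real k * h \<le> T" using tk[OF less.prems] by (simp add: t_def h_def)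
        show "0 \<le> supn T chi * e + \<eta>" using e \<eta> supn_nonneg[OF _ chi] T by simp
      qed
      also have "\<dots> = e" using T by (simp add: \<eta>_def field_simps)
      finally show ?case .
    qed
    then show ?case by (simp add: E_def h_def c_def[abs_def] t_def)
  qed
qed

section \<open>Summation by parts for the log density\<close>

lemma quadratic_form_diff:
  fixes A :: "real^'d^'d"
  shows "\<bar>(A *v x) \<bullet> x - (A *v y) \<bullet> y\<bar> \<le> norm A * norm (x - y) * (norm x + norm y)"
proof -
  have "(A *v x) \<bullet> x - (A *v y) \<bullet> y = (A *v (x - y)) \<bullet> x + (A *v y) \<bullet> (x - y)"
    by (simp add: matrix_vector_mult_diff_distrib inner_diff_left inner_diff_right)
  also have "\<bar>\<dots>\<bar> \<le> (norm A * norm (x - y)) * norm x + (norm A * norm y) * norm (x - y)"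
    by (intro order_trans[OF abs_triangle_ineq add_mono] order_trans[OF Cauchy_Schwarz_ineq2] mult_right_mono norm_matrix_vector_mult_le) auto
  finally show ?thesis by (simp add: algebra_simps)
qed

lemma symmetric_inner: "transpose A = A \<Longrightarrow> (A *v x) \<bullet> y = (A *v y) \<bullet> x" for A :: "real^'d^'d"
  by (metis dot_lmul_matrix inner_commute vector_transpose_matrix)

text \<open>The quantities <S(t_k) x_k, x_k> telescope to zero, as x_0 = 0 and S(T) = 0. Expanding
  each difference expresses the sum of <S x_k, increment> by the quadratic variation and by
  differences of S, the latter evaluated at the right node.\<close>

lemma log_density_decomposition:
  fixes chi \<sigma> S :: "real \<Rightarrow> real^'d^'d"
  assumes n: "0 < n" and chiS: "\<And>k. k \<le> n \<Longrightarrow> chi (real k * T / real n) = S (real k * T / real n) + \<sigma> (real k * T / real n)"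
    and sym: "\<And>k. k \<le> n \<Longrightarrow> transpose (S (real k * T / real n)) = S (real k * T / real n)"
    and ST: "S T = 0" and w0: "w 0 = 0"
  defines "t \<equiv> \<lambda>k. real k * T / real n" and "h \<equiv> T / real n"
  shows "log_density h (\<lambda>k. chi (real k * T / real n)) n (incr T n w)
    = ito_sum T \<sigma> n w - 1/2 * (\<Sum>k<n. (S (real k * T / real n) *v incr T n w k) \<bullet> incr T n w k)
      + 1/2 * (\<Sum>k<n. ((S (t k) - S (t (Suc k))) *v w (t (Suc k))) \<bullet> w (t (Suc k)) - h * (norm (chi (t k) *v w (t k)))\<^sup>2)"
proof -
  define x where "x = (\<lambda>k. w (t k))"
  define \<xi> where "\<xi> = incr T n w"
  have ps: "psum (incr T n w) k = x k" for k by (simp add: psum_incr[where w = w, OF w0] x_def t_def)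
  have xS: "x (Suc k) = x k + \<xi> k" for k by (simp add: x_def \<xi>_def incr_def t_def)
  define q where "q = (\<lambda>k. (S (t k) *v x k) \<bullet> x k)"
  \<comment> \<open>Symmetry of S merges the two cross terms into one with factor 2.\<close>
  have "q (Suc k) - q k = 2 * ((S (t k) *v x k) \<bullet> \<xi> k) + (S (t k) *v \<xi> k) \<bullet> \<xi> k - ((S (t k) - S (t (Suc k))) *v x (Suc k)) \<bullet> x (Suc k)"
    if "k < n" for k
  proof -
    have "(S (t k) *v \<xi> k) \<bullet> x k = (S (t k) *v x k) \<bullet> \<xi> k" using sym[of k] that by (intro symmetric_inner) (simp add: t_def)
    moreover have "q (Suc k) = (S (t k) *v x (Suc k)) \<bullet> x (Suc k) - ((S (t k) - S (t (Suc k))) *v x (Suc k)) \<bullet> x (Suc k)"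
      by (simp add: q_def bounded_bilinear.diff_left[OF bounded_bilinear_matrix_vector_mult] inner_diff_left)
    moreover have "(S (t k) *v x (Suc k)) \<bullet> x (Suc k) = (S (t k) *v x k) \<bullet> x k + (S (t k) *v x k) \<bullet> \<xi> k + (S (t k) *v \<xi> k) \<bullet> x k + (S (t k) *v \<xi> k) \<bullet> \<xi> k"
      by (simp add: xS matrix_vector_right_distrib inner_add_left inner_add_right)
    ultimately show ?thesis by (simp add: q_def)
  qed
  then have "(\<Sum>k<n. q (Suc k) - q k) = (\<Sum>k<n. 2 * ((S (t k) *v x k) \<bullet> \<xi> k) + (S (t k) *v \<xi> k) \<bullet> \<xi> k - ((S (t k) - S (t (Suc k))) *v x (Suc k)) \<bullet> x (Suc k))"
    by (intro sum.cong) auto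
  moreover have "(\<Sum>k<n. q (Suc k) - q k) = q n - q 0" by (rule sum_lessThan_telescope)
  moreover have "q n = 0" "q 0 = 0" using ST n w0 by (auto simp: q_def t_def x_def)
  ultimately have tel: "2 * (\<Sum>k<n. (S (t k) *v x k) \<bullet> \<xi> k) + (\<Sum>k<n. (S (t k) *v \<xi> k) \<bullet> \<xi> k) - (\<Sum>k<n. ((S (t k) - S (t (Suc k))) *v x (Suc k)) \<bullet> x (Suc k)) = 0"
    by (simp add: sum.distrib sum_subtractf sum_distrib_left)
  have "log_density h (\<lambda>k. chi (real k * T / real n)) n (incr T n w)
      = (\<Sum>k<n. (chi (t k) *v x k) \<bullet> \<xi> k - h / 2 * (norm (chi (t k) *v x k))\<^sup>2)"
    unfolding log_density_def ps by (simp add: \<xi>_def t_def)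
  also have "\<dots> = (\<Sum>k<n. (\<sigma> (t k) *v x k) \<bullet> \<xi> k + (S (t k) *v x k) \<bullet> \<xi> k - h / 2 * (norm (chi (t k) *v x k))\<^sup>2)"
    using chiS by (intro sum.cong refl) (simp add: t_def matrix_vector_mult_add_rdistrib inner_add_left)
  also have "\<dots> = ito_sum T \<sigma> n w + (\<Sum>k<n. (S (t k) *v x k) \<bullet> \<xi> k) - (\<Sum>k<n. h / 2 * (norm (chi (t k) *v x k))\<^sup>2)"
    by (simp add: sum.distrib sum_subtractf ito_sum_incr x_def \<xi>_def t_def)
  also have "(\<Sum>k<n. h / 2 * (norm (chi (t k) *v x k))\<^sup>2) = 1/2 * (\<Sum>k<n. h * (norm (chi (t k) *v x k))\<^sup>2)"
    by (simp add: sum_distrib_left)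
  also have "(\<Sum>k<n. (S (t k) *v x k) \<bullet> \<xi> k) = 1/2 * (\<Sum>k<n. ((S (t k) - S (t (Suc k))) *v x (Suc k)) \<bullet> x (Suc k)) - 1/2 * (\<Sum>k<n. (S (t k) *v \<xi> k) \<bullet> \<xi> k)"
    using tel by simp
  finally show ?thesis
    unfolding x_def \<xi>_def t_def sum_subtractf right_diff_distrib by linarith
qed

text \<open>Over one step S decreases by the integral of M = chi^T chi, nearly h M(t_k), and <M x,
  x> = |chi x|^2. The two terms thus cancel up to h times a quantity that is uniformly small by
  continuity of M and w.\<close>

lemma log_density_remainder_tendsto:
  fixes chi S :: "real \<Rightarrow> real^'d^'d"
  assumes T: "0 < T" and chi: "continuous_on {0..T} chi" and S: "\<And>t. t \<in> {0..T} \<Longrightarrow> S t = integral {t..T} (\<lambda>u. transpose (chi u) ** chi u)"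
    and w: "continuous_on {0..T} w"
  shows "(\<lambda>n. \<Sum>k<n. ((S (real k * T / real n) - S (real (Suc k) * T / real n)) *v w (real (Suc k) * T / real n)) \<bullet> w (real (Suc k) * T / real n)
      - T / real n * (norm (chi (real k * T / real n) *v w (real k * T / real n)))\<^sup>2) \<longlonglongrightarrow> 0"
proof (rule LIMSEQ_I)
  fix e :: real assume e: "0 < e"
  define M where "M = (\<lambda>u. transpose (chi u) ** chi u)"
  have cM: "continuous_on {0..T} M" unfolding M_def by (intro continuous_intros chi)
  define a where "a = supn T w" define b where "b = supn T M"
  have ab: "0 \<le> a" "0 \<le> b" using supn_nonneg[OF _ w] supn_nonneg[OF _ cM] T by (auto simp: a_def b_def)
  define \<eta> where "\<eta> = e / (T * (a * a + 2 * a * b + 1))"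
  have pos: "0 < T * (a * a + 2 * a * b + 1)" using T ab by (intro mult_pos_pos) (auto intro!: add_nonneg_pos)
  have \<eta>: "0 < \<eta>" using e pos by (simp add: \<eta>_def)
  from eventually_conj[OF continuous_modulus[OF cM \<eta>] eventually_conj[OF continuous_modulus[OF w \<eta>] eventually_gt_at_top[of 0]]]
  have "\<forall>\<^sub>F n in sequentially. norm ((\<Sum>k<n. ((S (real k * T / real n) - S (real (Suc k) * T / real n)) *v w (real (Suc k) * T / real n)) \<bullet> w (real (Suc k) * T / real n)
      - T / real n * (norm (chi (real k * T / real n) *v w (real k * T / real n)))\<^sup>2) - 0) < e"
  proof eventually_elim
    case (elim n)
    define h where "h = T / real n"
    define t where "t = (\<lambda>k. real k * T / real n)"
    have h: "0 < h" using elim T by (simp add: h_def)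
    have trm: "norm (((S (t k) - S (t (Suc k))) *v w (t (Suc k))) \<bullet> w (t (Suc k)) - h * (norm (chi (t k) *v w (t k)))\<^sup>2) \<le> h * (\<eta> * (a * a + 2 * a * b))"
      if k: "k < n" for k
    proof -
      have tk: "t k \<in> {0..T}" "t (Suc k) \<in> {0..T}" using T k unfolding t_def by (auto simp del: atLeastAtMost_iff of_nat_Suc intro!: grid_mem)
      have step: "t (Suc k) - t k = h" by (simp add: t_def h_def field_simps add_divide_distrib)
      have le: "t k \<le> t (Suc k)" using step h by linarith
      define x where "x = w (t k)" define y where "y = w (t (Suc k))"
      have nx: "norm x \<le> a" "norm y \<le> a" unfolding x_def y_def a_def using norm_le_supn[OF w] tk by auto
      have nM: "norm (M (t k)) \<le> b" unfolding b_def by (rule norm_le_supn[OF cM tk(1)])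
      have Mx: "(M (t k) *v x) \<bullet> x = (norm (chi (t k) *v x))\<^sup>2"
        unfolding M_def power2_norm_eq_inner
        by (metis dot_lmul_matrix inner_commute matrix_vector_mul_assoc transpose_matrix_vector)
      have cM': "continuous_on {t k..t (Suc k)} M" using tk by (intro continuous_on_subset[OF cM]) auto
      have "S (t k) = integral {t k..t (Suc k)} M + S (t (Suc k))"
        using S[OF tk(1)] S[OF tk(2)] Henstock_Kurzweil_Integration.integral_combine[of "t k" "t (Suc k)" T M] tk step h
          integrable_continuous_real[OF continuous_on_subset[OF cM, of "{t k..T}"]] by (auto simp: M_def[symmetric])
      then have "S (t k) - S (t (Suc k)) - h *\<^sub>R M (t k) = integral {t k..t (Suc k)} (\<lambda>u. M u - M (t k))"
        using le integrable_continuous_real[OF cM'] unfolding step[symmetric] by (subst integral_diff) auto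
      also have "norm \<dots> \<le> \<eta> * (t (Suc k) - t k)"
      proof (rule norm_integral_le_const)
        show "continuous_on {t k..t (Suc k)} (\<lambda>u. M u - M (t k))" by (intro continuous_intros cM')
        fix u assume "u \<in> {t k..t (Suc k)}"
        then have "u \<in> {0..T}" "\<bar>u - t k\<bar> \<le> T / real n" using tk step by (auto simp: h_def)
        then show "norm (M u - M (t k)) \<le> \<eta>" using elim tk by (simp add: less_imp_le)
      qed (use step h in auto)
      finally have SM: "norm (S (t k) - S (t (Suc k)) - h *\<^sub>R M (t k)) \<le> \<eta> * h" by (simp add: step)
      have nxy: "norm (y - x) \<le> \<eta>" unfolding x_def y_def using elim tk step by (simp add: less_imp_le h_def)
      have "((S (t k) - S (t (Suc k))) *v y) \<bullet> y - h * (norm (chi (t k) *v x))\<^sup>2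
         = ((S (t k) - S (t (Suc k)) - h *\<^sub>R M (t k)) *v y) \<bullet> y + h * ((M (t k) *v y) \<bullet> y - (M (t k) *v x) \<bullet> x)"
        unfolding Mx[symmetric]
        by (simp add: bounded_bilinear.diff_left[OF bounded_bilinear_matrix_vector_mult] inner_diff_left
            bounded_bilinear.scaleR_left[OF bounded_bilinear_matrix_vector_mult] algebra_simps)
      also have "\<bar>\<dots>\<bar> \<le> (\<eta> * h) * a * a + h * (b * \<eta> * (a + a))"
      proof (intro order_trans[OF abs_triangle_ineq add_mono])
        show "\<bar>((S (t k) - S (t (Suc k)) - h *\<^sub>R M (t k)) *v y) \<bullet> y\<bar> \<le> (\<eta> * h) * a * a"
        proof (rule order_trans[OF Cauchy_Schwarz_ineq2 mult_mono])
          show "norm ((S (t k) - S (t (Suc k)) - h *\<^sub>R M (t k)) *v y) \<le> \<eta> * h * a"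
            by (rule order_trans[OF norm_matrix_vector_mult_le mult_mono]) (use SM nx \<eta> h in auto)
        qed (use nx ab \<eta> h in auto)
        have "\<bar>(M (t k) *v y) \<bullet> y - (M (t k) *v x) \<bullet> x\<bar> \<le> b * \<eta> * (a + a)"
          by (rule order_trans[OF quadratic_form_diff]) (use nM nx nxy ab \<eta> in \<open>intro mult_mono add_mono, auto\<close>)
        then show "\<bar>h * ((M (t k) *v y) \<bullet> y - (M (t k) *v x) \<bullet> x)\<bar> \<le> h * (b * \<eta> * (a + a))" using h by (simp add: abs_mult)
      qed
      finally show ?thesis by (simp add: x_def y_def algebra_simps)
    qed
    have "norm (\<Sum>k<n. ((S (t k) - S (t (Suc k))) *v w (t (Suc k))) \<bullet> w (t (Suc k)) - h * (norm (chi (t k) *v w (t k)))\<^sup>2)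
        \<le> (\<Sum>k<n. h * (\<eta> * (a * a + 2 * a * b)))"
      by (rule sum_norm_le) (use trm in auto)
    also have "\<dots> = \<eta> * (T * (a * a + 2 * a * b))" using elim by (simp add: h_def)
    also have "\<dots> < \<eta> * (T * (a * a + 2 * a * b + 1))" using T \<eta> by (intro mult_strict_left_mono) auto
    also have "\<dots> = e"
    proof -
      have "e / c * c = e" if "0 < c" for c using that by simp
      then show ?thesis unfolding \<eta>_def using pos by blast
    qed
    finally show ?case by (simp add: t_def h_def)
  qed
  then show "\<exists>no. \<forall>n\<ge>no. norm ((\<Sum>k<n. ((S (real k * T / real n) - S (real (Suc k) * T / real n)) *v w (real (Suc k) * T / real n)) \<bullet> w (real (Suc k) * T / real n)
      - T / real n * (norm (chi (real k * T / real n) *v w (real k * T / real n)))\<^sup>2) - 0) < e"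
    by (simp only: eventually_sequentially)
qed

section \<open>Cutoffs and second moments of the discrete densities\<close>

definition path_of :: "real \<Rightarrow> nat \<Rightarrow> (nat \<Rightarrow> real^'d) \<Rightarrow> real \<Rightarrow> real^'d" where
  "path_of T n \<xi> = pwl T n (psum \<xi>)"

lemma path_of_Wsp: "path_of T n \<xi> \<in> Wsp T"
  unfolding path_of_def by (rule pwl_Wsp) (simp add: psum_def)

lemma path_of_cong: "(\<And>k. k < n \<Longrightarrow> \<xi> k = \<zeta> k) \<Longrightarrow> path_of T n \<xi> = path_of T n \<zeta>"
  unfolding path_of_def by (intro pwl_cong psum_cong) auto

lemma Cb_path_tendsto:
  assumes f: "f \<in> Cb T" and T: "0 < T" and X: "X \<in> Wsp T"
    and Y: "\<And>n. Y n \<in> Wsp T" and lim: "\<And>e. 0 < e \<Longrightarrow> \<forall>\<^sub>F n in sequentially. \<forall>t\<in>{0..T}. norm (Y n t - X t) < e"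
  shows "(\<lambda>n. f (Y n)) \<longlonglongrightarrow> f X"
proof (rule LIMSEQ_I)
  fix e :: real assume "0 < e"
  then obtain r where r: "0 < r" "\<And>v. v\<in>Wsp T \<Longrightarrow> supn T (\<lambda>t. v t - X t) < r \<Longrightarrow> \<bar>f v - f X\<bar> < e"
    using f X unfolding Cb_def by blast
  from lim[OF r(1)] have "\<forall>\<^sub>F n in sequentially. norm (f (Y n) - f X) < e"
  proof eventually_elim
    case (elim n)
    then have "supn T (\<lambda>t. Y n t - X t) < r" using T by (intro supn_less Wsp_diff_cont Y X) auto
    then show ?case using r(2)[OF Y] by simp
  qed
  then show "\<exists>no. \<forall>n\<ge>no. norm (f (Y n) - f X) < e" by (simp add: eventually_sequentially)
qed

text \<open>Equal to 1 on the ball of radius R and to 0 outside radius R + 1. It is 1-Lipschitz in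
  the sup norm, so multiplication by it preserves \<open>Cb T\<close>, and increasing in R, as
  monotone convergence requires.\<close>

definition cutoff :: "real \<Rightarrow> real \<Rightarrow> (real \<Rightarrow> real^'d) \<Rightarrow> real" where
  "cutoff T R w = max 0 (min 1 (R + 1 - supn T w))"

lemma cutoff_bounds: "0 \<le> cutoff T R w" "cutoff T R w \<le> 1" by (auto simp: cutoff_def)

lemma cutoff_support: "cutoff T R w \<noteq> 0 \<Longrightarrow> supn T w \<le> R + 1" by (auto simp: cutoff_def max_def min_def split: if_splits)

lemma supn_lipschitz:
  assumes T: "0 \<le> T" and v: "v \<in> Wsp T" and w: "w \<in> Wsp T"
  shows "\<bar>supn T v - supn T w\<bar> \<le> supn T (\<lambda>t. v t - w t)"
proof -
  have "supn T v \<le> supn T w + supn T (\<lambda>t. v t - w t)" if v: "v \<in> Wsp T" and w: "w \<in> Wsp T" for v w :: "real \<Rightarrow> real^'a"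
  proof (rule supn_le[OF T])
    fix t assume t: "t \<in> {0..T}"
    show "norm (v t) \<le> supn T w + supn T (\<lambda>t. v t - w t)"
      using norm_le_supn[OF Wsp_cont[OF w] t] norm_le_supn[OF Wsp_diff_cont[OF v w] t] norm_triangle_sub[of "v t" "w t"] by linarith
  qed
  from this[OF v w] this[OF w v] show ?thesis by (simp add: supn_minus_commute[of T w v] abs_le_iff)
qed

lemma Cb_cutoff:
  assumes T: "0 < T" and f: "f \<in> Cb T"
  shows "(\<lambda>w. f w * cutoff T R w) \<in> Cb T"
proof -
  obtain B where B: "\<And>w. w\<in>Wsp T \<Longrightarrow> \<bar>f w\<bar> \<le> B" using f unfolding Cb_def by blast
  have B0: "0 \<le> B" using order_trans[OF abs_ge_zero B[of "\<lambda>_. 0"]] by (simp add: Wsp_def)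
  have lip: "\<bar>cutoff T R v - cutoff T R w\<bar> \<le> supn T (\<lambda>t. v t - w t)" if "v \<in> Wsp T" "w \<in> Wsp T" for v w :: "real \<Rightarrow> real^'a"
    using supn_lipschitz[OF less_imp_le[OF T] that] unfolding cutoff_def by linarith
  have "\<exists>r>0. \<forall>v\<in>Wsp T. supn T (\<lambda>t. v t - w t) < r \<longrightarrow> \<bar>f v * cutoff T R v - f w * cutoff T R w\<bar> < e"
    if w: "w \<in> Wsp T" and e: "0 < e" for w e
  proof -
    obtain r where r: "0 < r" "\<And>v. v\<in>Wsp T \<Longrightarrow> supn T (\<lambda>t. v t - w t) < r \<Longrightarrow> \<bar>f v - f w\<bar> < e / 2"
      using f w e half_gt_zero[OF e] unfolding Cb_def by blast
    define r' where "r' = min r (e / (2 * (B + 1)))"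
    have r': "0 < r'" using r e B0 by (simp add: r'_def)
    show ?thesis
    proof (intro exI[of _ r'] conjI r' ballI impI)
      fix v assume v: "v \<in> Wsp T" and d: "supn T (\<lambda>t. v t - w t) < r'"
      have "f v * cutoff T R v - f w * cutoff T R w = (f v - f w) * cutoff T R v + f w * (cutoff T R v - cutoff T R w)"
        by (simp add: algebra_simps)
      then have "\<bar>f v * cutoff T R v - f w * cutoff T R w\<bar> \<le> \<bar>f v - f w\<bar> * \<bar>cutoff T R v\<bar> + \<bar>f w\<bar> * \<bar>cutoff T R v - cutoff T R w\<bar>"
        by (metis abs_mult abs_triangle_ineq)
      also have "\<dots> \<le> \<bar>f v - f w\<bar> * 1 + B * supn T (\<lambda>t. v t - w t)"
        using cutoff_bounds[of T R v] lip[OF v w] B[OF w] B0 by (intro add_mono mult_mono) auto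
      also have "\<dots> < e / 2 + e / 2"
      proof (rule add_less_le_mono)
        show "\<bar>f v - f w\<bar> * 1 < e / 2" using r(2)[OF v] d by (simp add: r'_def)
        have "B * supn T (\<lambda>t. v t - w t) \<le> B * (e / (2 * (B + 1)))" using d B0 by (intro mult_left_mono) (auto simp: r'_def)
        also have "\<dots> \<le> (B + 1) * (e / (2 * (B + 1)))" using e B0 by (intro mult_right_mono) auto
        also have "\<dots> = e / 2" using B0 by (simp add: field_simps)
        finally show "B * supn T (\<lambda>t. v t - w t) \<le> e / 2" .
      qed
      finally show "\<bar>f v * cutoff T R v - f w * cutoff T R w\<bar> < e" by simp
    qed
  qed
  moreover have "\<bar>f w * cutoff T R w\<bar> \<le> B" if "w \<in> Wsp T" for w
    using mult_mono[OF B[OF that], of "\<bar>cutoff T R w\<bar>" 1] cutoff_bounds[of T R w] B0 by (simp add: abs_mult)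
  ultimately show ?thesis unfolding Cb_def by blast
qed

text \<open>Doubling c doubles the linear part but quadruples the quadratic one; the difference is
  the sum on the right.\<close>

lemma log_density_double:
  "2 * log_density h c n \<xi> = log_density h (\<lambda>k. 2 *\<^sub>R c k) n \<xi> + h * (\<Sum>k<n. (norm (c k *v psum \<xi> k))\<^sup>2)"
proof -
  have "(2 *\<^sub>R c k) *v x = 2 *\<^sub>R (c k *v x)" for k x
    by (rule bounded_bilinear.scaleR_left[OF bounded_bilinear_matrix_vector_mult])
  then show ?thesis
    unfolding log_density_def by (simp add: sum_distrib_left sum.distrib[symmetric] power_mult_distrib algebra_simps)
qed

context brownian
begin

lemma path_of_measurable: "path_of T n \<in> measurable (PiM {..<n} (\<lambda>_. borel)) W"
proof (rule measurable_Wborel[OF T space_W sets_W path_of_Wsp])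
  fix t assume "t \<in> {0..T}"
  then show "(\<lambda>\<xi>. path_of T n \<xi> t) \<in> borel_measurable (PiM {..<n} (\<lambda>_. borel))"
    unfolding path_of_def pwl_def by (auto intro!: borel_measurable_sum borel_measurable_scaleR psum_measurable)
qed

text \<open>The discrete transform holds for independent Gaussian vectors; the law of the Brownian
  increments transports it to W, and interpolation turns test functions on paths into functions of
  increments.\<close>

lemma girsanov_grid:
  fixes g :: "(real \<Rightarrow> real^'d) \<Rightarrow> ennreal" and c :: "nat \<Rightarrow> real^'d^'d"
  assumes n: "0 < n" and g: "g \<in> borel_measurable W"
  shows "(\<integral>\<^sup>+w. g (path_of T n (euler_incr (T / real n) c n (incr T n w))) \<partial>W)
     = (\<integral>\<^sup>+w. g (path_of T n (incr T n w)) * ennreal (exp (log_density (T / real n) c n (incr T n w))) \<partial>W)"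
proof -
  define h where "h = T / real n"
  have h: "0 < h" using T n by (simp add: h_def)
  define \<xi> where "\<xi> = (\<lambda>w :: real \<Rightarrow> real^'d. restrict (incr T n w) {..<n})"
  have \<xi>m: "\<xi> \<in> measurable W (PiM {..<n} (\<lambda>_. borel))" unfolding \<xi>_def by (rule incr_restrict_measurable) simp
  have law: "PiM {..<n} (\<lambda>_. gauss h) = distr W (PiM {..<n} (\<lambda>_. borel)) \<xi>"
    using incr_distr[OF n] by (simp add: h_def \<xi>_def)
  have gm: "(\<lambda>\<zeta>. g (path_of T n \<zeta>)) \<in> borel_measurable (PiM {..<n} (\<lambda>_. borel))"
    by (rule measurable_compose[OF path_of_measurable g])
  have em: "(\<lambda>\<zeta>. g (path_of T n (euler_incr h c n \<zeta>))) \<in> borel_measurable (PiM {..<n} (\<lambda>_. borel))"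
    by (rule measurable_compose[OF euler_incr_measurable gm])
  have dm: "(\<lambda>\<zeta>. g (path_of T n \<zeta>) * ennreal (exp (log_density h c n \<zeta>))) \<in> borel_measurable (PiM {..<n} (\<lambda>_. borel))"
    using gm log_density_measurable[of h c n] by measurable
  have e1: "euler_incr h c n (\<xi> w) = euler_incr h c n (incr T n w)" for w
  proof -
    have "euler h c (\<xi> w) k = euler h c (incr T n w) k" if "k < n" for k
      using that by (intro euler_cong) (simp add: \<xi>_def)
    then show ?thesis by (auto simp: euler_incr_def \<xi>_def fun_eq_iff)
  qed
  have e2: "path_of T n (\<xi> w) = path_of T n (incr T n w)" for w by (rule path_of_cong) (simp add: \<xi>_def)
  have e3: "log_density h c n (\<xi> w) = log_density h c n (incr T n w)" for w by (rule log_density_cong) (simp add: \<xi>_def)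
  have "(\<integral>\<^sup>+w. g (path_of T n (euler_incr h c n (incr T n w))) \<partial>W) = (\<integral>\<^sup>+\<zeta>. g (path_of T n (euler_incr h c n \<zeta>)) \<partial>PiM {..<n} (\<lambda>_. gauss h))"
    unfolding law by (subst nn_integral_distr[OF \<xi>m]) (use em in \<open>simp_all add: e1\<close>)
  also have "\<dots> = (\<integral>\<^sup>+\<zeta>. g (path_of T n \<zeta>) * ennreal (exp (log_density h c n \<zeta>)) \<partial>PiM {..<n} (\<lambda>_. gauss h))"
    by (rule discrete_girsanov[OF h gm])
  also have "\<dots> = (\<integral>\<^sup>+w. g (path_of T n (incr T n w)) * ennreal (exp (log_density h c n (incr T n w))) \<partial>W)"
    unfolding law by (subst nn_integral_distr[OF \<xi>m]) (use dm in \<open>simp_all add: e2 e3\<close>)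
  finally show ?thesis unfolding h_def .
qed

lemma path_of_incr_tendsto:
  assumes f: "f \<in> Cb T" and w: "w \<in> Wsp T"
  shows "(\<lambda>n. f (path_of T n (incr T n w))) \<longlonglongrightarrow> f w"
proof (rule Cb_path_tendsto[OF f T w path_of_Wsp])
  fix e :: real assume e: "0 < e"
  then have "0 < e / 3" by simp
  from pwl_approx[OF T Wsp_cont[OF w] this]
  show "\<forall>\<^sub>F n in sequentially. \<forall>t\<in>{0..T}. norm (path_of T n (incr T n w) t - w t) < e"
    by eventually_elim (use e in \<open>auto simp: path_of_def psum_incr Wsp_0[OF w]\<close>)
qed

lemma path_of_euler_tendsto:
  fixes chi :: "real \<Rightarrow> real^'d^'d"
  assumes f: "f \<in> Cb T" and w: "w \<in> Wsp T" and chi: "continuous_on {0..T} chi" and q: "T * supn T chi < 1"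
    and X: "X \<in> Wsp T" and eq: "\<And>t. X t + Fop T chi X t = w t"
  shows "(\<lambda>n. f (path_of T n (euler_incr (T / real n) (\<lambda>k. chi (real k * T / real n)) n (incr T n w)))) \<longlonglongrightarrow> f X"
proof (rule Cb_path_tendsto[OF f T X path_of_Wsp])
  fix e :: real assume e: "0 < e"
  then have e3: "0 < e / 3" by simp
  from eventually_conj[OF pwl_approx[OF T Wsp_cont[OF X] e3] euler_converges[OF T chi q w X eq e3]]
  show "\<forall>\<^sub>F n in sequentially. \<forall>t\<in>{0..T}. norm (path_of T n (euler_incr (T / real n) (\<lambda>k. chi (real k * T / real n)) n (incr T n w)) t - X t) < e"
  proof eventually_elim
    case (elim n)
    have "path_of T n (euler_incr (T / real n) (\<lambda>k. chi (real k * T / real n)) n (incr T n w))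
        = pwl T n (euler (T / real n) (\<lambda>k. chi (real k * T / real n)) (incr T n w))"
      unfolding path_of_def by (rule pwl_cong) (simp add: psum_euler_incr)
    then show ?case using elim by auto
  qed
qed

text \<open>Where F is nonzero the interpolated path stays in the ball of radius R, which bounds the
  surplus factor of the squared density by exp(T (|chi| R)^2). What remains is the density for 2
  chi, of mean one by the transform with constant test function. The bound is independent of
  n.\<close>

lemma density_second_moment:
  fixes chi :: "real \<Rightarrow> real^'d^'d"
  assumes n: "0 < n" and chi: "continuous_on {0..T} chi" and F: "F \<in> borel_measurable W"
    and B: "\<And>w. w \<in> Wsp T \<Longrightarrow> \<bar>F w\<bar> \<le> B" and R: "\<And>w. w \<in> Wsp T \<Longrightarrow> F w \<noteq> 0 \<Longrightarrow> supn T w \<le> R" and R0: "0 \<le> R"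
  shows "(\<integral>\<^sup>+w. ennreal ((F (path_of T n (incr T n w)) * exp (log_density (T / real n) (\<lambda>k. chi (real k * T / real n)) n (incr T n w)))\<^sup>2) \<partial>W)
    \<le> ennreal (B\<^sup>2 * exp (T * (supn T chi * R)\<^sup>2))"
proof -
  define h where "h = T / real n"
  have h: "0 < h" using T n by (simp add: h_def)
  define c where "c = (\<lambda>k. chi (real k * T / real n))"
  define K where "K = B\<^sup>2 * exp (T * (supn T chi * R)\<^sup>2)"
  have K0: "0 \<le> K" by (simp add: K_def)
  have le: "(F (path_of T n \<xi>) * exp (log_density h c n \<xi>))\<^sup>2 \<le> K * exp (log_density h (\<lambda>k. 2 *\<^sub>R c k) n \<xi>)" for \<xi>
  proof (cases "F (path_of T n \<xi>) = 0")
    case True then show ?thesis using K0 by simp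
  next
    case False
    have P: "path_of T n \<xi> \<in> Wsp T" by (rule path_of_Wsp)
    have sR: "supn T (path_of T n \<xi>) \<le> R" by (rule R[OF P False])
    have "(norm (c k *v psum \<xi> k))\<^sup>2 \<le> (supn T chi * R)\<^sup>2" if "k < n" for k
    proof (rule power_mono)
      have tk: "real k * T / real n \<in> {0..T}" using that by (intro grid) simp
      \<comment> \<open>The nodes of the interpolant are the partial sums themselves, so the sup
        norm of the path controls them.\<close>
      have "psum \<xi> k = path_of T n \<xi> (real k * T / real n)" unfolding path_of_def using that by (simp add: pwl_node[OF T n])
      then have "norm (psum \<xi> k) \<le> R" using norm_le_supn[OF Wsp_cont[OF P] tk] sR by simp
      then show "norm (c k *v psum \<xi> k) \<le> supn T chi * R"
        using norm_le_supn[OF chi tk] supn_nonneg[OF _ chi] T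
        by (intro order_trans[OF norm_matrix_vector_mult_le] mult_mono) (auto simp: c_def)
    qed simp
    then have "h * (\<Sum>k<n. (norm (c k *v psum \<xi> k))\<^sup>2) \<le> h * (\<Sum>k<n. (supn T chi * R)\<^sup>2)"
      using h by (intro mult_left_mono sum_mono) auto
    also have "\<dots> = T * (supn T chi * R)\<^sup>2" using n by (simp add: h_def)
    finally have "2 * log_density h c n \<xi> \<le> log_density h (\<lambda>k. 2 *\<^sub>R c k) n \<xi> + T * (supn T chi * R)\<^sup>2"
      unfolding log_density_double by simp
    then have "(exp (log_density h c n \<xi>))\<^sup>2 \<le> exp (log_density h (\<lambda>k. 2 *\<^sub>R c k) n \<xi>) * exp (T * (supn T chi * R)\<^sup>2)"
      unfolding exp_double[symmetric] exp_add[symmetric] by simp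
    moreover have "(F (path_of T n \<xi>))\<^sup>2 \<le> B\<^sup>2" using B[OF P] by (metis abs_ge_zero power2_abs power_mono)
    ultimately have "(F (path_of T n \<xi>))\<^sup>2 * (exp (log_density h c n \<xi>))\<^sup>2 \<le> B\<^sup>2 * (exp (log_density h (\<lambda>k. 2 *\<^sub>R c k) n \<xi>) * exp (T * (supn T chi * R)\<^sup>2))"
      by (intro mult_mono) auto
    then show ?thesis by (simp add: power_mult_distrib K_def mult_ac)
  qed
  have lm: "(\<lambda>w. log_density h (\<lambda>k. 2 *\<^sub>R c k) n (incr T n w)) \<in> borel_measurable W"
  proof -
    have "(\<lambda>w. log_density h (\<lambda>k. 2 *\<^sub>R c k) n (restrict (incr T n w) {..<n})) \<in> borel_measurable W"
      by (rule measurable_compose[OF incr_restrict_measurable log_density_measurable]) simp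
    moreover have "log_density h (\<lambda>k. 2 *\<^sub>R c k) n (restrict (incr T n w) {..<n}) = log_density h (\<lambda>k. 2 *\<^sub>R c k) n (incr T n w)" for w :: "real \<Rightarrow> real^'d"
      by (rule log_density_cong) simp
    ultimately show ?thesis by simp
  qed
  have "(\<integral>\<^sup>+w. ennreal ((F (path_of T n (incr T n w)) * exp (log_density h c n (incr T n w)))\<^sup>2) \<partial>W)
      \<le> (\<integral>\<^sup>+w. ennreal K * ennreal (exp (log_density h (\<lambda>k. 2 *\<^sub>R c k) n (incr T n w))) \<partial>W)"
    using le K0 by (intro nn_integral_mono) (auto simp: ennreal_mult[symmetric] intro!: ennreal_leI)
  also have "\<dots> = ennreal K * (\<integral>\<^sup>+w. ennreal (exp (log_density h (\<lambda>k. 2 *\<^sub>R c k) n (incr T n w))) \<partial>W)"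
    by (intro nn_integral_cmult measurable_compose[OF measurable_compose[OF lm borel_measurable_exp] measurable_ennreal])
  also have "(\<integral>\<^sup>+w. ennreal (exp (log_density h (\<lambda>k. 2 *\<^sub>R c k) n (incr T n w))) \<partial>W) = 1"
    using girsanov_grid[OF n, of "\<lambda>_. 1" "\<lambda>k. 2 *\<^sub>R c k"] by (simp add: h_def emeasure_space_1)
  finally show ?thesis by (simp add: h_def c_def[abs_def] K_def)
qed

end

section \<open>The change of variables formula\<close>

lemma tendsto_L1_AE_common_subseq:
  fixes X Y :: "nat \<Rightarrow> 'a \<Rightarrow> real"
  assumes X: "\<And>n. integrable M (X n)" "(\<lambda>n. integral\<^sup>L M (\<lambda>x. \<bar>X n x\<bar>)) \<longlonglongrightarrow> 0"
    and Y: "\<And>n. integrable M (Y n)" "(\<lambda>n. integral\<^sup>L M (\<lambda>x. \<bar>Y n x\<bar>)) \<longlonglongrightarrow> 0"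
  shows "\<exists>r. strict_mono r \<and> (AE x in M. (\<lambda>n. X (r n) x) \<longlonglongrightarrow> 0 \<and> (\<lambda>n. Y (r n) x) \<longlonglongrightarrow> 0)"
proof -
  have "\<exists>r. strict_mono r \<and> (AE x in M. (\<lambda>n. \<bar>X (r n) x\<bar> + \<bar>Y (r n) x\<bar>) \<longlonglongrightarrow> 0)"
  proof (rule tendsto_L1_AE_subseq)
    show "integrable M (\<lambda>x. \<bar>X n x\<bar> + \<bar>Y n x\<bar>)" for n using X(1) Y(1) by simp
    have "(\<lambda>n. integral\<^sup>L M (\<lambda>x. \<bar>X n x\<bar>) + integral\<^sup>L M (\<lambda>x. \<bar>Y n x\<bar>)) \<longlonglongrightarrow> 0 + 0"
      by (intro tendsto_add X(2) Y(2))
    then show "(\<lambda>n. \<integral>x. norm (\<bar>X n x\<bar> + \<bar>Y n x\<bar>) \<partial>M) \<longlonglongrightarrow> 0" using X(1) Y(1) by simp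
  qed
  then obtain r where r: "strict_mono r" "AE x in M. (\<lambda>n. \<bar>X (r n) x\<bar> + \<bar>Y (r n) x\<bar>) \<longlonglongrightarrow> 0" by blast
  from r(2) have "AE x in M. (\<lambda>n. X (r n) x) \<longlonglongrightarrow> 0 \<and> (\<lambda>n. Y (r n) x) \<longlonglongrightarrow> 0"
  proof eventually_elim
    case (elim x)
    show ?case
      by (intro conjI; rule Lim_null_comparison[OF _ elim]) (auto intro!: always_eventually)
  qed
  with r(1) show ?thesis by blast
qed

text \<open>Along one subsequence the discrete densities converge almost everywhere to exp(p - c),
  while the Euler paths converge to G w. The discrete identity is passed to the limit for
  nonnegative functions with support in a ball, then for all nonnegative ones, then for all bounded
  continuous f.\<close>

theorem wiener_linear_change_of_variables:
  fixes chi \<sigma> S :: "real \<Rightarrow> real^'d^'d"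
  assumes T: "0 < T" and chi: "continuous_on {0..T} chi" and sg: "continuous_on {0..T} \<sigma>" and Sc: "continuous_on {0..T} S"
    and chiS: "\<And>t. t \<in> {0..T} \<Longrightarrow> chi t = S t + \<sigma> t"
    and S: "\<And>t. t \<in> {0..T} \<Longrightarrow> S t = integral {t..T} (\<lambda>u. transpose (chi u) ** chi u)"
    and q: "T * supn T chi < 1" and G: "cont_lin_inverse T chi G" and f: "f \<in> Cb T"
  shows "integrable (wiener T) (\<lambda>w. exp (ito_p T \<sigma> w) * f w)"
    "integral\<^sup>L (wiener T) (\<lambda>w. exp (ito_p T \<sigma> w) * f w)
      = exp (1/2 * integral {0..T} (\<lambda>t. trace (S t))) * integral\<^sup>L (wiener T) (\<lambda>w. f (G w))"
proof -
  define W :: "(real \<Rightarrow> real^'d) measure" where "W = wiener T"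
  interpret brownian T W unfolding W_def by unfold_locales (use T wiener_is_wiener in auto)
  define c where "c = 1/2 * integral {0..T} (\<lambda>t. trace (S t))"
  obtain p where p: "integrable W p" "(\<lambda>n. expectation (\<lambda>w. \<bar>ito_sum T \<sigma> n w - p w\<bar>)) \<longlonglongrightarrow> 0"
    "AE w in W. ito_p T \<sigma> w = p w" "ito_p T \<sigma> \<in> borel_measurable W"
    using ito_p_limit[OF T sg] unfolding W_def by blast
  define Q where "Q = (\<lambda>n w. \<Sum>k<n. (S (real k * T / real n) *v incr T n w k) \<bullet> incr T n w k)"
  have Q: "\<And>n. integrable W (Q n)" "(\<lambda>n. expectation (\<lambda>w. \<bar>Q n w - 2 * c\<bar>)) \<longlonglongrightarrow> 0"
    using quadratic_variation_limit[OF Sc] by (simp_all add: Q_def c_def)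
  have Ii: "integrable W (ito_sum T \<sigma> n)" for n
    by (rule expectation_abs_le_sqrt(1)[OF ito_sum_measurable ito_sum_square_integrable])
  \<comment> \<open>Ito sums and quadratic variations converge only in L1; a common subsequence
    gives almost sure convergence of both and hence of the log densities.\<close>
  obtain r where r: "strict_mono r"
    "AE w in W. (\<lambda>n. ito_sum T \<sigma> (r n) w - p w) \<longlonglongrightarrow> 0 \<and> (\<lambda>n. Q (r n) w - 2 * c) \<longlonglongrightarrow> 0"
    using tendsto_L1_AE_common_subseq[of W "\<lambda>n w. ito_sum T \<sigma> n w - p w" "\<lambda>n w. Q n w - 2 * c"] p(1,2) Q Ii by auto
  define LD where "LD = (\<lambda>n w. log_density (T / real n) (\<lambda>k. chi (real k * T / real n)) n (incr T n w))"
  have ST: "S T = 0" using S[of T] T by simp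
  have Ssym: "transpose (S t) = S t" if "t \<in> {0..T}" for t
    unfolding S[OF that] by (rule gram_integral_symmetric) (use that in \<open>auto intro: continuous_on_subset[OF chi]\<close>)
  have LDm: "LD n \<in> borel_measurable W" for n
  proof -
    have "(\<lambda>w. log_density (T / real n) (\<lambda>k. chi (real k * T / real n)) n (restrict (incr T n w) {..<n})) \<in> borel_measurable W"
      by (rule measurable_compose[OF incr_restrict_measurable log_density_measurable]) simp
    moreover have "log_density (T / real n) (\<lambda>k. chi (real k * T / real n)) n (restrict (incr T n w) {..<n}) = LD n w" for w :: "real \<Rightarrow> real^'d"
      unfolding LD_def by (rule log_density_cong) simp
    ultimately show ?thesis by simp
  qed
  have LDlim: "AE w in W. (\<lambda>n. LD (r n) w) \<longlonglongrightarrow> p w - c"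
    using r(2) AE_space
  proof eventually_elim
    case (elim w)
    then have w: "w \<in> Wsp T" by (simp add: space_W)
    define Rm where "Rm = (\<lambda>n. \<Sum>k<n. ((S (real k * T / real n) - S (real (Suc k) * T / real n)) *v w (real (Suc k) * T / real n)) \<bullet> w (real (Suc k) * T / real n)
      - T / real n * (norm (chi (real k * T / real n) *v w (real k * T / real n)))\<^sup>2)"
    have "Rm \<longlonglongrightarrow> 0" unfolding Rm_def by (rule log_density_remainder_tendsto[OF T chi S Wsp_cont[OF w]])
    from LIMSEQ_subseq_LIMSEQ[OF this r(1)] have R0: "(\<lambda>n. Rm (r n)) \<longlonglongrightarrow> 0" by (simp add: comp_def)
    have I: "(\<lambda>n. ito_sum T \<sigma> (r n) w) \<longlonglongrightarrow> p w" and QQ: "(\<lambda>n. Q (r n) w) \<longlonglongrightarrow> 2 * c"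
      using elim by (auto simp: LIM_zero_iff)
    have "(\<lambda>n. ito_sum T \<sigma> (r n) w - 1/2 * Q (r n) w + 1/2 * Rm (r n)) \<longlonglongrightarrow> p w - 1/2 * (2 * c) + 1/2 * 0"
      by (intro tendsto_add tendsto_diff tendsto_mult tendsto_const I QQ R0)
    moreover have "\<forall>\<^sub>F n in sequentially. ito_sum T \<sigma> (r n) w - 1/2 * Q (r n) w + 1/2 * Rm (r n) = LD (r n) w"
      using eventually_gt_at_top[of 0]
    proof eventually_elim
      case (elim n)
      have "0 < r n" using seq_suble[OF r(1), of n] elim by simp
      then show ?case
        unfolding LD_def Q_def Rm_def
        by (intro log_density_decomposition[symmetric]) (use chiS Ssym ST Wsp_0[OF w] grid in auto)
    qed
    ultimately show ?case by (auto dest: Lim_transform_eventually)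
  qed
  have GW: "G w \<in> Wsp T" "\<And>t. G w t + Fop T chi (G w) t = w t" if "w \<in> Wsp T" for w
    using G that unfolding cont_lin_inverse_def by (auto dest: fun_cong)
  define P :: "nat \<Rightarrow> (real \<Rightarrow> real^'d) \<Rightarrow> real \<Rightarrow> real^'d" where "P = (\<lambda>n w. path_of T n (incr T n w))"
  define E where "E = (\<lambda>n w. path_of T n (euler_incr (T / real n) (\<lambda>k. chi (real k * T / real n)) n (incr T n w)))"
  have Pm: "P n \<in> measurable W W" and Em: "E n \<in> measurable W W" for n
  proof -
    have "(\<lambda>w. path_of T n (restrict (incr T n w) {..<n})) \<in> measurable W W"
      by (rule measurable_compose[OF incr_restrict_measurable path_of_measurable]) simp
    moreover have "path_of T n (restrict (incr T n w) {..<n}) = P n w" for w :: "real \<Rightarrow> real^'d"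
      unfolding P_def by (rule path_of_cong) simp
    ultimately show "P n \<in> measurable W W" by simp
    have "(\<lambda>w. path_of T n (euler_incr (T / real n) (\<lambda>k. chi (real k * T / real n)) n (restrict (incr T n w) {..<n}))) \<in> measurable W W"
      by (rule measurable_compose[OF measurable_compose[OF incr_restrict_measurable euler_incr_measurable] path_of_measurable]) simp
    moreover have "path_of T n (euler_incr (T / real n) (\<lambda>k. chi (real k * T / real n)) n (restrict (incr T n w) {..<n})) = E n w" for w :: "real \<Rightarrow> real^'d"
      unfolding E_def
    proof (rule path_of_cong)
      fix k assume k: "k < n"
      have "euler (T / real n) (\<lambda>k. chi (real k * T / real n)) (restrict (incr T n w) {..<n}) k = euler (T / real n) (\<lambda>k. chi (real k * T / real n)) (incr T n w) k"
        using k by (intro euler_cong) simp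
      then show "euler_incr (T / real n) (\<lambda>k. chi (real k * T / real n)) n (restrict (incr T n w) {..<n}) k
        = euler_incr (T / real n) (\<lambda>k. chi (real k * T / real n)) n (incr T n w) k" using k by (simp add: euler_incr_def)
    qed
    ultimately show "E n \<in> measurable W W" by simp
  qed
  have PW: "P n w \<in> Wsp T" "E n w \<in> Wsp T" for n w by (auto simp: P_def E_def path_of_Wsp)
  note [measurable] = p(4)
  have pm [measurable]: "p \<in> borel_measurable W" using p(1) by auto
  have Cbm: "g \<in> borel_measurable W" if "g \<in> Cb T" for g by (rule Cb_measurable[OF space_W sets_W that])
  \<comment> \<open>The image side is dominated by the bound of F. Measurability of F composed with
    G is obtained as that of a pointwise limit.\<close>
  have FG_lim: "(\<lambda>n. expectation (\<lambda>w. F (E (r n) w))) \<longlonglongrightarrow> expectation (\<lambda>w. F (G w))"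
    and FGm: "(\<lambda>w. F (G w)) \<in> borel_measurable W" if F: "F \<in> Cb T" for F
  proof -
    obtain B where B: "\<And>w. w \<in> Wsp T \<Longrightarrow> \<bar>F w\<bar> \<le> B" using F unfolding Cb_def by blast
    have lim: "(\<lambda>n. F (E n w)) \<longlonglongrightarrow> F (G w)" if "w \<in> space W" for w
      unfolding E_def using that GW by (intro path_of_euler_tendsto[OF F _ chi q]) (auto simp: space_W)
    have m: "(\<lambda>w. F (E n w)) \<in> borel_measurable W" for n by (rule measurable_compose[OF Em Cbm[OF F]])
    show FGm': "(\<lambda>w. F (G w)) \<in> borel_measurable W" by (rule borel_measurable_LIMSEQ_real[OF lim m])
    show "(\<lambda>n. expectation (\<lambda>w. F (E (r n) w))) \<longlonglongrightarrow> expectation (\<lambda>w. F (G w))"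
    proof (rule integral_dominated_convergence[where w = "\<lambda>_. B"])
      show "AE w in W. (\<lambda>n. F (E (r n) w)) \<longlonglongrightarrow> F (G w)"
        using LIMSEQ_subseq_LIMSEQ[OF lim r(1)] by (intro AE_I2) (simp add: comp_def)
    qed (use m FGm' B PW in auto)
  qed
  have cut: "integrable W (\<lambda>w. F w * exp (p w - c)) \<and> expectation (\<lambda>w. F w * exp (p w - c)) = expectation (\<lambda>w. F (G w))"
    if F: "F \<in> Cb T" and F0: "\<And>w. 0 \<le> F w" and R: "\<And>w. w \<in> Wsp T \<Longrightarrow> F w \<noteq> 0 \<Longrightarrow> supn T w \<le> \<rho>" and R0: "0 \<le> \<rho>" for F \<rho>
  proof -
    obtain B where B: "\<And>w. w \<in> Wsp T \<Longrightarrow> \<bar>F w\<bar> \<le> B" using F unfolding Cb_def by blast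
    have Fm [measurable]: "F \<in> borel_measurable W" by (rule Cbm[OF F])
    have FPm: "(\<lambda>w. F (P n w)) \<in> borel_measurable W" and FEm: "(\<lambda>w. F (E n w)) \<in> borel_measurable W" for n
      using measurable_compose[OF Pm Fm] measurable_compose[OF Em Fm] by auto
    \<comment> \<open>The index is shifted so that every grid has at least one step: r (n+1) \<ge> n
      + 1 > 0.\<close>
    define Y where "Y = (\<lambda>n w. F (P (r (Suc n)) w) * exp (LD (r (Suc n)) w))"
    have rp: "0 < r (Suc n)" for n using seq_suble[OF r(1), of "Suc n"] by simp
    have Ym: "Y n \<in> borel_measurable W" for n
      unfolding Y_def by (intro borel_measurable_times FPm measurable_compose[OF LDm borel_measurable_exp])
    have Ylim: "AE w in W. (\<lambda>n. Y n w) \<longlonglongrightarrow> F w * exp (p w - c)"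
      using LDlim AE_space
    proof eventually_elim
      case (elim w)
      have "(\<lambda>n. F (P n w)) \<longlonglongrightarrow> F w" unfolding P_def using elim by (intro path_of_incr_tendsto[OF F]) (simp add: space_W)
      from LIMSEQ_subseq_LIMSEQ[OF this r(1)] have "(\<lambda>n. F (P (r n) w) * exp (LD (r n) w)) \<longlonglongrightarrow> F w * exp (p w - c)"
        using elim by (intro tendsto_mult tendsto_exp) (simp_all add: comp_def)
      from LIMSEQ_Suc[OF this] show ?case by (simp add: Y_def)
    qed
    have Y2: "(\<integral>\<^sup>+w. ennreal ((Y n w)\<^sup>2) \<partial>W) \<le> ennreal (B\<^sup>2 * exp (T * (supn T chi * \<rho>)\<^sup>2))" for n
      unfolding Y_def P_def LD_def by (rule density_second_moment[OF rp chi Fm B R R0])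
    have L: "integrable W (\<lambda>w. F w * exp (p w - c))" "(\<lambda>n. expectation (Y n)) \<longlonglongrightarrow> expectation (\<lambda>w. F w * exp (p w - c))"
      using expectation_limit_of_L2_bounded[OF Ym _ _ Ylim Y2] F0 by (auto simp: Y_def)
    have "expectation (Y n) = expectation (\<lambda>w. F (E (r (Suc n)) w))" for n
    proof -
      have "expectation (Y n) = enn2real (\<integral>\<^sup>+w. ennreal (Y n w) \<partial>W)"
        using Ym F0 by (intro integral_eq_nn_integral) (auto simp: Y_def)
      also have "(\<integral>\<^sup>+w. ennreal (Y n w) \<partial>W) = (\<integral>\<^sup>+w. ennreal (F (E (r (Suc n)) w)) \<partial>W)"
        using girsanov_grid[OF rp[of n], where g = "\<lambda>w. ennreal (F w)" and c = "\<lambda>k. chi (real k * T / real (r (Suc n)))"]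
        by (simp add: Y_def P_def E_def LD_def ennreal_mult F0)
      also have "enn2real \<dots> = expectation (\<lambda>w. F (E (r (Suc n)) w))"
        using FEm F0 by (intro integral_eq_nn_integral[symmetric]) auto
      finally show ?thesis .
    qed
    then have "(\<lambda>n. expectation (Y n)) \<longlonglongrightarrow> expectation (\<lambda>w. F (G w))"
      using LIMSEQ_Suc[OF FG_lim[OF F]] by simp
    with L show ?thesis by (auto dest: LIMSEQ_unique)
  qed
  \<comment> \<open>The radius tends to infinity. On the density side the integrands increase in R,
    and convergence of the image side supplies the finite limit that monotone convergence needs, so
    integrability comes with it.\<close>
  have nonneg: "integrable W (\<lambda>w. F w * exp (p w - c)) \<and> expectation (\<lambda>w. F w * exp (p w - c)) = expectation (\<lambda>w. F (G w))"
    if F: "F \<in> Cb T" and F0: "\<And>w. 0 \<le> F w" for F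
  proof -
    obtain B where B: "\<And>w. w \<in> Wsp T \<Longrightarrow> \<bar>F w\<bar> \<le> B" using F unfolding Cb_def by blast
    define FR where "FR = (\<lambda>R w. F w * cutoff T (real R) w)"
    have FRC: "FR R \<in> Cb T" for R unfolding FR_def by (rule Cb_cutoff[OF T F])
    have FR: "integrable W (\<lambda>w. FR R w * exp (p w - c)) \<and> expectation (\<lambda>w. FR R w * exp (p w - c)) = expectation (\<lambda>w. FR R (G w))" for R
    proof (rule cut[OF FRC])
      show "supn T w \<le> real R + 1" if "FR R w \<noteq> 0" for w using that cutoff_support[of T "real R" w] by (auto simp: FR_def)
    qed (auto simp: FR_def F0 cutoff_bounds)
    have lim: "(\<lambda>R. FR R w) \<longlonglongrightarrow> F w" for w
    proof -
      have "\<forall>\<^sub>F R in sequentially. cutoff T (real R) w = 1"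
      proof -
        obtain N where "supn T w \<le> real N" using real_arch_simple by blast
        then have "cutoff T (real R) w = 1" if "R \<ge> N" for R using that by (simp add: cutoff_def)
        then show ?thesis unfolding eventually_sequentially by blast
      qed
      then have "(\<lambda>R. cutoff T (real R) w) \<longlonglongrightarrow> 1" by (rule tendsto_eventually)
      from tendsto_mult[OF tendsto_const[of "F w"] this] show ?thesis by (simp add: FR_def)
    qed
    have mono: "mono (\<lambda>R. FR R w * exp (p w - c))" for w
      unfolding FR_def mono_def cutoff_def by (auto intro!: mult_right_mono mult_left_mono F0)
    have Gl: "(\<lambda>R. expectation (\<lambda>w. FR R (G w))) \<longlonglongrightarrow> expectation (\<lambda>w. F (G w))"
    proof (rule integral_dominated_convergence[where w = "\<lambda>_. B"])
      show "AE w in W. (\<lambda>R. FR R (G w)) \<longlonglongrightarrow> F (G w)" using lim by simp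
      show "AE w in W. norm (FR R (G w)) \<le> B" for R
      proof (rule AE_I2)
        fix w assume "w \<in> space W"
        then have "\<bar>F (G w)\<bar> \<le> B" using GW B by (simp add: space_W)
        moreover have "\<bar>F (G w)\<bar> * \<bar>cutoff T (real R) (G w)\<bar> \<le> \<bar>F (G w)\<bar> * 1"
          using cutoff_bounds[of T "real R" "G w"] by (intro mult_left_mono) auto
        ultimately show "norm (FR R (G w)) \<le> B" by (simp add: FR_def abs_mult)
      qed
    qed (use FGm[OF F] FGm[OF FRC] in auto)
    have Fm: "(\<lambda>w. F w * exp (p w - c)) \<in> borel_measurable W"
      using Cbm[OF F] by (intro borel_measurable_times measurable_compose[OF _ borel_measurable_exp] borel_measurable_diff pm) auto
    have lim': "AE w in W. (\<lambda>R. FR R w * exp (p w - c)) \<longlonglongrightarrow> F w * exp (p w - c)"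
      by (intro AE_I2 tendsto_mult lim tendsto_const)
    have i: "\<And>R. integrable W (\<lambda>w. FR R w * exp (p w - c))" and e: "(\<lambda>R. expectation (\<lambda>w. FR R w * exp (p w - c))) \<longlonglongrightarrow> expectation (\<lambda>w. F (G w))"
      using FR Gl by auto
    show ?thesis
      using integrable_monotone_convergence[OF i _ lim' e Fm] integral_monotone_convergence[OF i _ lim' e Fm] mono by auto
  qed
  obtain B where B: "\<And>w. w \<in> Wsp T \<Longrightarrow> \<bar>f w\<bar> \<le> B" using f unfolding Cb_def by blast
  have B0: "0 \<le> B" using order_trans[OF abs_ge_zero B[of "\<lambda>_. 0"]] by (simp add: Wsp_def)
  \<comment> \<open>On path space this is f + B. The maximum secures nonnegativity for arguments
    outside \<open>Wsp T\<close>, where the bound B says nothing about f.\<close>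
  define F where "F = (\<lambda>w. max 0 (f w + B))"
  have FC: "F \<in> Cb T"
  proof -
    have "\<bar>F w\<bar> \<le> 2 * B" if "w \<in> Wsp T" for w using B[OF that] B0 by (auto simp: F_def)
    moreover have "\<exists>r>0. \<forall>v\<in>Wsp T. supn T (\<lambda>t. v t - w t) < r \<longrightarrow> \<bar>F v - F w\<bar> < e" if we: "w \<in> Wsp T" "0 < e" for w e
    proof -
      obtain r where r: "0 < r" "\<And>v. v\<in>Wsp T \<Longrightarrow> supn T (\<lambda>t. v t - w t) < r \<Longrightarrow> \<bar>f v - f w\<bar> < e"
        using f we unfolding Cb_def by blast
      have "\<bar>F v - F w\<bar> \<le> \<bar>f v - f w\<bar>" for v unfolding F_def by linarith
      then show ?thesis using r by (meson le_less_trans)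
    qed
    ultimately show ?thesis unfolding Cb_def by blast
  qed
  \<comment> \<open>The constant function shows that exp(p - c) has mean one, which is what
    subtracting the added constant B requires.\<close>
  have C1: "(\<lambda>_. 1) \<in> Cb T" by (auto simp: Cb_def intro!: exI[of _ 1])
  have Fe: "integrable W (\<lambda>w. F w * exp (p w - c))" "expectation (\<lambda>w. F w * exp (p w - c)) = expectation (\<lambda>w. F (G w))"
    using nonneg[OF FC] by (auto simp: F_def)
  have 1: "integrable W (\<lambda>w. exp (p w - c))" "expectation (\<lambda>w. exp (p w - c)) = 1"
    using nonneg[OF C1] prob_space by auto
  have fF: "f w = F w - B" if "w \<in> Wsp T" for w using B[OF that] by (auto simp: F_def abs_le_iff)
  have fGi: "integrable W (\<lambda>w. F (G w))"
    using FGm[OF FC] B B0 GW by (intro integrable_const_bound[where B = "2 * B"] AE_I2) (auto simp: F_def space_W abs_le_iff)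
  have eqAE: "AE w in W. exp (ito_p T \<sigma> w) * f w = exp c * (F w * exp (p w - c)) - (exp c * B) * exp (p w - c)"
    using p(3) AE_space
  proof eventually_elim
    case (elim w)
    have "exp (ito_p T \<sigma> w) = exp c * exp (p w - c)" using elim by (simp add: exp_add[symmetric])
    moreover have "F w = f w + B" using fF[of w] elim by (simp add: space_W)
    ultimately show ?case by (simp add: algebra_simps)
  qed
  have mf: "(\<lambda>w. exp (ito_p T \<sigma> w) * f w) \<in> borel_measurable W"
    using Cbm[OF f] by (intro borel_measurable_times measurable_compose[OF p(4) borel_measurable_exp]) auto
  have i2: "integrable W (\<lambda>w. exp c * (F w * exp (p w - c)) - (exp c * B) * exp (p w - c))"
    using Fe 1 by (intro Bochner_Integration.integrable_diff integrable_mult_right) auto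
  have m2: "(\<lambda>w. exp c * (F w * exp (p w - c)) - (exp c * B) * exp (p w - c)) \<in> borel_measurable W" using i2 by auto
  have "integrable W (\<lambda>w. exp (ito_p T \<sigma> w) * f w)"
    using integrable_cong_AE[OF mf m2 eqAE] i2 by simp
  then show "integrable (wiener T) (\<lambda>w. exp (ito_p T \<sigma> w) * f w)" by (simp add: W_def)
  have "expectation (\<lambda>w. exp (ito_p T \<sigma> w) * f w) = expectation (\<lambda>w. exp c * (F w * exp (p w - c)) - (exp c * B) * exp (p w - c))"
    by (rule integral_cong_AE[OF mf m2 eqAE])
  also have "\<dots> = exp c * expectation (\<lambda>w. F w * exp (p w - c)) - (exp c * B) * expectation (\<lambda>w. exp (p w - c))"
    using Fe(1) 1(1) by (subst Bochner_Integration.integral_diff) auto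
  also have "\<dots> = exp c * (expectation (\<lambda>w. F (G w)) - B)"
    unfolding Fe(2) 1(2) by (simp add: algebra_simps)
  also have "expectation (\<lambda>w. F (G w)) - B = expectation (\<lambda>w. f (G w))"
  proof -
    have "expectation (\<lambda>w. f (G w)) = expectation (\<lambda>w. F (G w) - B)"
      using GW fF by (intro Bochner_Integration.integral_cong) (auto simp: space_W)
    then show ?thesis using fGi by (simp add: prob_space)
  qed
  finally show "integral\<^sup>L (wiener T) (\<lambda>w. exp (ito_p T \<sigma> w) * f w)
      = exp (1/2 * integral {0..T} (\<lambda>t. trace (S t))) * integral\<^sup>L (wiener T) (\<lambda>w. f (G w))"
    by (simp add: W_def c_def)
qed

section \<open>From the hypotheses of the theorem to the change of variables\<close>

lemma trace_sym_part: "trace ((1/2) *\<^sub>R (A + transpose A)) = trace (A :: real^'d^'d)"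
  by (simp add: trace_def transpose_def sum_divide_distrib[symmetric])

lemma backward_integral_C1:
  fixes chi \<sigma> :: "real \<Rightarrow> real^'d^'d"
  assumes chi: "continuous_on {0..T} chi"
    and eq: "\<And>t. t \<in> {0..T} \<Longrightarrow> chi t = \<sigma> t + integral {t..T} (\<lambda>u. transpose (chi u) ** chi u)"
  shows "C1_with T (\<lambda>t. chi t - \<sigma> t) (\<lambda>t. - (transpose (chi t) ** chi t))"
  unfolding C1_with_def
proof (intro conjI ballI)
  have cM: "continuous_on {0..T} (\<lambda>u. transpose (chi u) ** chi u)" by (intro continuous_intros chi)
  then show "continuous_on {0..T} (\<lambda>t. - (transpose (chi t) ** chi t))" by (rule continuous_on_minus)
  fix t assume t: "t \<in> {0..T}"
  show "((\<lambda>t. chi t - \<sigma> t) has_vector_derivative - (transpose (chi t) ** chi t)) (at t within {0..T})"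
    by (rule has_vector_derivative_transform[OF t _ has_vector_derivative_integral_left[OF cM t]])
      (use eq in simp)
qed

theorem mainTheorem10:
  fixes T \<epsilon> \<delta> :: real
    and d_type :: "'d::finite itself"
  defines "d \<equiv> real CARD('d)"
  assumes T: "T > 0" and eps: "\<epsilon> > 0" and del: "\<delta> > 0"
    and c1: "2 * \<epsilon> * T * sqrt d * (1 + T * sqrt d * (1 + \<epsilon>)) * exp (T * (sqrt d + 2 * \<epsilon> + \<epsilon>^2)) < 1"
    and c2: "\<epsilon> * T * (1 + T * sqrt d * K0 TYPE('d) * (1 + \<epsilon>) * exp (T * (sqrt d + 2 * \<epsilon> + \<epsilon>^2))) < 1"
    and c3: "\<delta> * T * max (2 * sqrt d) (K0 TYPE('d)) * (1 + T * (sqrt d + \<delta>) * exp (T * (sqrt d + \<delta>))) < 1"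
  shows
  \<comment> \<open>(i)\<close>
  "(\<forall>\<sigma> :: real \<Rightarrow> real^'d^'d. continuous_on {0..T} \<sigma> \<and> supn T \<sigma> < \<epsilon> \<longrightarrow>
     (\<exists>S S'. C1_with T S S' \<and>
        (\<forall>t\<in>{0..T}. S' t = - (S t ** S t) - transpose (\<sigma> t) ** S t - S t ** \<sigma> t
                              - transpose (\<sigma> t) ** \<sigma> t) \<and>
        S T = 0 \<and>
        (let chi = (\<lambda>t. S t + \<sigma> t) in
           T * supn T chi < 1 \<and>
           (\<forall>t\<in>{0..T}. \<sigma> t = chi t - integral {t..T} (\<lambda>u. transpose (chi u) ** chi u)) \<and>
           (\<exists>G. cont_lin_inverse T chi G \<and>
              (\<forall>f\<in>Cb T.
                 integrable (wiener T) (\<lambda>w. exp (ito_p T \<sigma> w) * f w) \<and>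
                 integral\<^sup>L (wiener T) (\<lambda>w. exp (ito_p T \<sigma> w) * f w)
                 = exp ((1/2) * integral {0..T} (\<lambda>t. trace (S t)))
                   * integral\<^sup>L (wiener T) (\<lambda>w. f (G w))))))) \<and>
  \<comment> \<open>(ii)\<close>
  (\<forall>(\<sigma> :: real \<Rightarrow> real^'d^'d) \<sigma>'. C1_with T \<sigma> \<sigma>' \<and>
     norm (\<sigma> T) + supn T \<sigma>' + 2 * supn T (\<lambda>t. (1/2) *\<^sub>R (\<sigma> t - transpose (\<sigma> t))) < \<delta> \<longrightarrow>
     (let \<sigma>A = (\<lambda>t. (1/2) *\<^sub>R (\<sigma> t - transpose (\<sigma> t)));
          \<sigma>S = (\<lambda>t. (1/2) *\<^sub>R (\<sigma> t + transpose (\<sigma> t)));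
          isSol = (\<lambda>A A1 A2. C1_with T A A1 \<and> C1_with T A1 A2 \<and>
                    (\<forall>t\<in>{0..T}. A2 t - 2 *\<^sub>R (\<sigma>A t ** A1 t) - \<sigma>' t ** A t = 0) \<and>
                    A T = mat 1 \<and> A1 T = \<sigma> T)
      in (\<exists>A A1 A2. isSol A A1 A2) \<and>
         (\<forall>A A1 A2. isSol A A1 A2 \<longrightarrow>
            (\<forall>t\<in>{0..T}. det (A t) \<noteq> 0) \<and>
            (let chi = (\<lambda>t. A1 t ** matrix_inv (A t)) in
               T * supn T chi < 1 \<and>
               (\<forall>t\<in>{0..T}. \<sigma> t = chi t - integral {t..T} (\<lambda>u. transpose (chi u) ** chi u)) \<and>
               (\<exists>G. cont_lin_inverse T chi G \<and>
                  (\<forall>f\<in>Cb T.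
                     integrable (wiener T) (\<lambda>w. exp (ito_p T \<sigma> w) * f w) \<and>
                     integral\<^sup>L (wiener T) (\<lambda>w. exp (ito_p T \<sigma> w) * f w)
                     = exp (- (1/2) * integral {0..T} (\<lambda>t. trace (\<sigma>S t))) / sqrt (det (A 0))
                       * integral\<^sup>L (wiener T) (\<lambda>w. f (G w))))))))"
proof (intro conjI allI impI)
  define r where "r = sqrt d"
  have r1: "1 \<le> r" using zero_less_card_finite[where 'a='d] by (simp add: r_def d_def Suc_leI)
  fix \<sigma> :: "real \<Rightarrow> real^'d^'d" assume a: "continuous_on {0..T} \<sigma> \<and> supn T \<sigma> < \<epsilon>"
  have s0: "0 \<le> supn T \<sigma>" using a T by (intro supn_nonneg) auto
  \<comment> \<open>The remaining factors in the first condition, sqrt d, the braces and the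
    exponential, are all at least 1.\<close>
  have "2 * supn T \<sigma> * T < 1"
  proof -
    have "2 * supn T \<sigma> * T \<le> 2 * \<epsilon> * T" using a T by (intro mult_right_mono) auto
    also have "\<dots> = (2 * \<epsilon> * T) * 1 * 1" by simp
    also have "\<dots> \<le> (2 * \<epsilon> * T * r) * (1 + T * r * (1 + \<epsilon>)) * exp (T * (r + 2 * \<epsilon> + \<epsilon>^2))"
    proof (rule mult_mono[OF mult_mono])
      show "2 * \<epsilon> * T \<le> 2 * \<epsilon> * T * r" using mult_left_mono[OF r1, of "2 * \<epsilon> * T"] eps T by simp
    qed (use eps T r1 in auto)
    finally show ?thesis using c1 by (simp add: r_def)
  qed
  then obtain chi where chi: "continuous_on {0..T} chi" "T * supn T chi < 1"
     "\<And>t. t\<in>{0..T} \<Longrightarrow> chi t = \<sigma> t + integral {t..T} (\<lambda>u. transpose (chi u) ** chi u)"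
    using riccati_exists[OF T] a by blast
  define S where "S = (\<lambda>t. chi t - \<sigma> t)"
  define S' where "S' = (\<lambda>t. - (transpose (chi t) ** chi t))"
  have C1: "C1_with T S S'" unfolding S_def S'_def by (rule backward_integral_C1[OF chi(1,3)])
  have Seq: "S t = integral {t..T} (\<lambda>u. transpose (chi u) ** chi u)" if "t \<in> {0..T}" for t
    using chi(3)[OF that] by (simp add: S_def)
  have Ssym: "transpose (S t) = S t" if "t \<in> {0..T}" for t
    unfolding Seq[OF that] by (rule gram_integral_symmetric) (use that in \<open>auto intro: continuous_on_subset[OF chi(1)]\<close>)
  have chiS: "(\<lambda>t. S t + \<sigma> t) = chi" by (simp add: S_def)
  \<comment> \<open>Expand -chi^T chi with chi = S + \<sigma> and S symmetric.\<close>
  have ric: "S' t = - (S t ** S t) - transpose (\<sigma> t) ** S t - S t ** \<sigma> t - transpose (\<sigma> t) ** \<sigma> t" if "t \<in> {0..T}" for t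
  proof -
    have "chi t = S t + \<sigma> t" by (simp add: S_def)
    then show ?thesis
      by (simp add: S'_def transpose_add Ssym[OF that] bounded_bilinear.add_left[OF bounded_bilinear_matrix_mult]
          bounded_bilinear.add_right[OF bounded_bilinear_matrix_mult])
  qed
  obtain G where G: "cont_lin_inverse T chi G" using cont_lin_inverse_exists[OF T chi(1,2)] by blast
  have main: "integrable (wiener T) (\<lambda>w. exp (ito_p T \<sigma> w) * f w)"
    "integral\<^sup>L (wiener T) (\<lambda>w. exp (ito_p T \<sigma> w) * f w) = exp (1/2 * integral {0..T} (\<lambda>t. trace (S t))) * integral\<^sup>L (wiener T) (\<lambda>w. f (G w))"
    if "f \<in> Cb T" for f
    using wiener_linear_change_of_variables[OF T chi(1) _ C1_with_continuous[OF C1] _ Seq chi(2) G that] a by (auto simp: S_def)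
  show "\<exists>S S'. C1_with T S S' \<and>
        (\<forall>t\<in>{0..T}. S' t = - (S t ** S t) - transpose (\<sigma> t) ** S t - S t ** \<sigma> t - transpose (\<sigma> t) ** \<sigma> t) \<and>
        S T = 0 \<and>
        (let chi = (\<lambda>t. S t + \<sigma> t) in
           T * supn T chi < 1 \<and>
           (\<forall>t\<in>{0..T}. \<sigma> t = chi t - integral {t..T} (\<lambda>u. transpose (chi u) ** chi u)) \<and>
           (\<exists>G. cont_lin_inverse T chi G \<and>
              (\<forall>f\<in>Cb T.
                 integrable (wiener T) (\<lambda>w. exp (ito_p T \<sigma> w) * f w) \<and>
                 integral\<^sup>L (wiener T) (\<lambda>w. exp (ito_p T \<sigma> w) * f w)
                 = exp ((1/2) * integral {0..T} (\<lambda>t. trace (S t)))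
                   * integral\<^sup>L (wiener T) (\<lambda>w. f (G w)))))"
  proof (rule exI[of _ S], rule exI[of _ S'], unfold Let_def chiS, intro conjI ballI)
    show "S T = 0" using Seq[of T] T by simp
    show "\<exists>G. cont_lin_inverse T chi G \<and> (\<forall>f\<in>Cb T.
                 integrable (wiener T) (\<lambda>w. exp (ito_p T \<sigma> w) * f w) \<and>
                 integral\<^sup>L (wiener T) (\<lambda>w. exp (ito_p T \<sigma> w) * f w)
                 = exp ((1/2) * integral {0..T} (\<lambda>t. trace (S t))) * integral\<^sup>L (wiener T) (\<lambda>w. f (G w)))"
      using G main by (intro exI[of _ G]) auto
    show "\<sigma> t = chi t - integral {t..T} (\<lambda>u. transpose (chi u) ** chi u)" if "t \<in> {0..T}" for t using chi(3)[OF that] by simp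
  qed (use C1 ric chi(2) in auto)
next
  define r where "r = sqrt d"
  have r1: "1 \<le> r" using zero_less_card_finite[where 'a='d] by (simp add: r_def d_def Suc_leI)
  fix \<sigma> \<sigma>' :: "real \<Rightarrow> real^'d^'d"
  assume a: "C1_with T \<sigma> \<sigma>' \<and> norm (\<sigma> T) + supn T \<sigma>' + 2 * supn T (\<lambda>t. (1/2) *\<^sub>R (\<sigma> t - transpose (\<sigma> t))) < \<delta>"
  then have sg: "C1_with T \<sigma> \<sigma>'" and small: "norm (\<sigma> T) + supn T \<sigma>' + 2 * supn T (\<lambda>t. (1/2) *\<^sub>R (\<sigma> t - transpose (\<sigma> t))) < \<delta>" by auto
  have cs: "continuous_on {0..T} \<sigma>" by (rule C1_with_continuous[OF sg])
  have cs': "continuous_on {0..T} \<sigma>'" using sg by (simp add: C1_with_def)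
  \<comment> \<open>The maximum in the condition on \<delta> dominates 2 sqrt d.\<close>
  have cond: "\<delta> * T * (2 * sqrt (real CARD('d))) *
      (1 + T * (sqrt (real CARD('d)) + \<delta>) * exp (T * (sqrt (real CARD('d)) + \<delta>))) < 1"
  proof -
    have "\<delta> * T * (2 * r) * (1 + T * (r + \<delta>) * exp (T * (r + \<delta>)))
        \<le> \<delta> * T * max (2 * r) (K0 TYPE('d)) * (1 + T * (r + \<delta>) * exp (T * (r + \<delta>)))"
      using del T r1 by (intro mult_right_mono mult_left_mono) auto
    then show ?thesis using c3 by (simp add: r_def d_def)
  qed
  define \<sigma>A where "\<sigma>A = (\<lambda>t. (1/2) *\<^sub>R (\<sigma> t - transpose (\<sigma> t)))"
  define \<sigma>S where "\<sigma>S = (\<lambda>t. (1/2) *\<^sub>R (\<sigma> t + transpose (\<sigma> t)))"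
  define isSol where "isSol = (\<lambda>A A1 A2. C1_with T A A1 \<and> C1_with T A1 A2 \<and>
                    (\<forall>t\<in>{0..T}. A2 t - 2 *\<^sub>R (\<sigma>A t ** A1 t) - \<sigma>' t ** A t = 0) \<and>
                    A T = mat 1 \<and> A1 T = \<sigma> T)"
  have ex: "\<exists>A A1 A2. isSol A A1 A2"
  proof -
    have "continuous_on {0..T} (\<lambda>t. 2 *\<^sub>R \<sigma>A t)" unfolding \<sigma>A_def by (intro continuous_intros cs)
    from second_order_linear_ode_exists[OF T this cs', of "mat 1" "\<sigma> T"]
    obtain A B C where "C1_with T A B" "C1_with T B C" "\<forall>t\<in>{0..T}. C t = (2 *\<^sub>R \<sigma>A t) ** B t + \<sigma>' t ** A t" "A T = mat 1" "B T = \<sigma> T"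
      by blast
    then have "isSol A B C"
      unfolding isSol_def by (simp add: bounded_bilinear.scaleR_left[OF bounded_bilinear_matrix_mult])
    then show ?thesis by blast
  qed
  have all: "(\<forall>t\<in>{0..T}. det (A t) \<noteq> 0) \<and>
            (let chi = (\<lambda>t. A1 t ** matrix_inv (A t)) in
               T * supn T chi < 1 \<and>
               (\<forall>t\<in>{0..T}. \<sigma> t = chi t - integral {t..T} (\<lambda>u. transpose (chi u) ** chi u)) \<and>
               (\<exists>G. cont_lin_inverse T chi G \<and>
                  (\<forall>f\<in>Cb T.
                     integrable (wiener T) (\<lambda>w. exp (ito_p T \<sigma> w) * f w) \<and>
                     integral\<^sup>L (wiener T) (\<lambda>w. exp (ito_p T \<sigma> w) * f w)
                     = exp (- (1/2) * integral {0..T} (\<lambda>t. trace (\<sigma>S t))) / sqrt (det (A 0))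
                       * integral\<^sup>L (wiener T) (\<lambda>w. f (G w)))))"
    if sol: "isSol A A1 A2" for A A1 A2
  proof -
    have sol': "C1_with T A A1" "C1_with T A1 A2" "A T = mat 1" "A1 T = \<sigma> T"
      using sol unfolding isSol_def by auto
    have sol2: "A2 t = 2 *\<^sub>R (((1/2) *\<^sub>R (\<sigma> t - transpose (\<sigma> t))) ** A1 t) + \<sigma>' t ** A t" if "t \<in> {0..T}" for t
      using sol that unfolding isSol_def \<sigma>A_def by (auto simp: algebra_simps)
    define chi where "chi = (\<lambda>t. A1 t ** matrix_inv (A t))"
    have J: "\<forall>t\<in>{0..T}. det (A t) \<noteq> 0" "continuous_on {0..T} chi" "T * supn T chi < 1"
      "\<forall>t\<in>{0..T}. \<sigma> t = chi t - integral {t..T} (\<lambda>u. transpose (chi u) ** chi u)"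
      "det (A 0) = exp (- integral {0..T} (\<lambda>t. trace (chi t)))"
      unfolding chi_def using jacobi_equation_chi[OF T sg small cond sol'(1,2) sol2 sol'(3,4)] by blast+
    define S where "S = (\<lambda>t. chi t - \<sigma> t)"
    have Seq: "S t = integral {t..T} (\<lambda>u. transpose (chi u) ** chi u)" if "t \<in> {0..T}" for t
      unfolding S_def by (subst bspec[OF J(4) that]) simp
    have Sc: "continuous_on {0..T} S" unfolding S_def by (intro continuous_intros J(2) cs)
    obtain G where G: "cont_lin_inverse T chi G" using cont_lin_inverse_exists[OF T J(2,3)] by blast
    \<comment> \<open>Traces see only symmetric parts, so tr S = tr chi - tr \<sigma>_S; by
      Liouville's formula exp of half the integral of tr chi is 1 / sqrt(det A(0)).\<close>
    have const: "exp (1/2 * integral {0..T} (\<lambda>t. trace (S t))) = exp (- (1/2) * integral {0..T} (\<lambda>t. trace (\<sigma>S t))) / sqrt (det (A 0))"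
    proof -
      have "integral {0..T} (\<lambda>t. trace (S t)) = integral {0..T} (\<lambda>t. trace (chi t) - trace (\<sigma>S t))"
        unfolding S_def \<sigma>S_def trace_sym_part by (simp add: trace_sub)
      also have "\<dots> = integral {0..T} (\<lambda>t. trace (chi t)) - integral {0..T} (\<lambda>t. trace (\<sigma>S t))"
        unfolding \<sigma>S_def by (intro integral_diff integrable_continuous_real continuous_intros J(2) cs)
      finally have I: "integral {0..T} (\<lambda>t. trace (S t)) = integral {0..T} (\<lambda>t. trace (chi t)) - integral {0..T} (\<lambda>t. trace (\<sigma>S t))" .
      have "sqrt (det (A 0)) = exp (- (1/2) * integral {0..T} (\<lambda>t. trace (chi t)))"
        unfolding J(5) by (rule real_sqrt_unique) (simp_all add: exp_double[symmetric])
      then show ?thesis unfolding I by (simp add: exp_diff[symmetric] algebra_simps diff_divide_distrib)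
    qed
    have main: "integrable (wiener T) (\<lambda>w. exp (ito_p T \<sigma> w) * f w)"
      "integral\<^sup>L (wiener T) (\<lambda>w. exp (ito_p T \<sigma> w) * f w)
        = exp (- (1/2) * integral {0..T} (\<lambda>t. trace (\<sigma>S t))) / sqrt (det (A 0)) * integral\<^sup>L (wiener T) (\<lambda>w. f (G w))"
      if "f \<in> Cb T" for f
      using wiener_linear_change_of_variables[OF T J(2) cs Sc _ Seq J(3) G that] unfolding const[symmetric] by (auto simp: S_def)
    show ?thesis
      unfolding Let_def chi_def[symmetric] using J(1,3,4) G main by blast
  qed
  show "let \<sigma>A = (\<lambda>t. (1/2) *\<^sub>R (\<sigma> t - transpose (\<sigma> t)));
          \<sigma>S = (\<lambda>t. (1/2) *\<^sub>R (\<sigma> t + transpose (\<sigma> t)));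
          isSol = (\<lambda>A A1 A2. C1_with T A A1 \<and> C1_with T A1 A2 \<and>
                    (\<forall>t\<in>{0..T}. A2 t - 2 *\<^sub>R (\<sigma>A t ** A1 t) - \<sigma>' t ** A t = 0) \<and>
                    A T = mat 1 \<and> A1 T = \<sigma> T)
      in (\<exists>A A1 A2. isSol A A1 A2) \<and>
         (\<forall>A A1 A2. isSol A A1 A2 \<longrightarrow>
            (\<forall>t\<in>{0..T}. det (A t) \<noteq> 0) \<and>
            (let chi = (\<lambda>t. A1 t ** matrix_inv (A t)) in
               T * supn T chi < 1 \<and>
               (\<forall>t\<in>{0..T}. \<sigma> t = chi t - integral {t..T} (\<lambda>u. transpose (chi u) ** chi u)) \<and>
               (\<exists>G. cont_lin_inverse T chi G \<and>
                  (\<forall>f\<in>Cb T.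
                     integrable (wiener T) (\<lambda>w. exp (ito_p T \<sigma> w) * f w) \<and>
                     integral\<^sup>L (wiener T) (\<lambda>w. exp (ito_p T \<sigma> w) * f w)
                     = exp (- (1/2) * integral {0..T} (\<lambda>t. trace (\<sigma>S t))) / sqrt (det (A 0))
                       * integral\<^sup>L (wiener T) (\<lambda>w. f (G w))))))"
    unfolding Let_def
    by (rule conjI[OF ex[unfolded isSol_def \<sigma>A_def]], intro allI impI,
        rule all[unfolded Let_def isSol_def \<sigma>A_def \<sigma>S_def])
qed

end
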